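(* Let $k\ge0$ and let $f:\mathbb R_+^n\to\mathbb C$ be measurable and bounded, and continuous at a point $\xi\in\mathbb R_+^n$. Then $$f(\xi)=\lim_{\nu\to\infty,\ \nu\in\mathbb N}\frac{(-1)^{n\nu}}{\Gamma_n(\nu+\mu_0+1)}\,\Delta\Bigl(\frac\nu\xi\Bigr)^{\nu+\mu_0+1}\bigl(\Delta(T)^\nu(\mathcal Lf)\bigr)\Bigl(\frac\nu\xi\Bigr).$$
   Context: Notation: $\langle z,w\rangle=\sum z_iw_i$; $\mathbb R_+=(0,\infty)$; $\nu/\xi=(\nu/\xi_1,\dots,\nu/\xi_n)$; $s_{ij}$ transposition of coordinates $i,j$. Dunkl operators of type $A_{n-1}$ with multiplicity $k$: $T_\xi f(z)=\partial_\xi f(z)+k\sum_{i<j}(\xi_i-\xi_j)\frac{f(z)-f(s_{ij}z)}{z_i-z_j}$, acting on holomorphic functions on $\mathcal S_n$-invariant open subsets of $\mathbb C^n$ ($\partial_\xi$ the complex directional derivative); $T_j=T_{e_j}$, and $\Delta(T)=T_1T_2\cdots T_n$ (the $T_j$ commute). Dunkl kernel $E(\lambda,z)$: unique holomorphic function on $\mathbb C^n\times\mathbb C^n$ with $T_\xi E(\lambda,\cdot)=\langle\lambda,\xi\rangle E(\lambda,\cdot)$ for all $\xi\in\mathbb R^n$, $E(\lambda,0)=1$. $\omega(x)=\prod_{i<j}|x_i-x_j|^{2k}$, $\Delta(z)=\prod z_j$, $\mu_0=k(n-1)$, $\Gamma_n(\mu)=d_n(k)\prod_{j=1}^n\Gamma(\mu-k(j-1))$,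 $d_n(k)=\prod_{j=1}^n\Gamma(1+jk)/\Gamma(1+k)$. The Dunkl–Laplace transform of $f$ is $\mathcal Lf(z)=\int_{\mathbb R_+^n}f(x)E(-z,x)\omega(x)\,dx$, which for bounded measurable $f$ exists and is holomorphic on $\{z\in\mathbb C^n:\mathrm{Re}\,z>0\}$. *)

theory Defs
  imports "HOL-Analysis.Analysis"
begin

definition cvec :: "real^'n \<Rightarrow> complex^'n" where
  "cvec x = (\<chi> i. complex_of_real (x $ i))"

definition swap_coord :: "'n \<Rightarrow> 'n \<Rightarrow> 'a^'n \<Rightarrow> 'a^'n" where
  "swap_coord i j z = (\<chi> l. z $ (Transposition.transpose i j l))"

text \<open>Holomorphy on an open subset of a finite-dimensional complex vector space:
  (real) Frechet differentiability with a complex-linear derivative.\<close>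
definition holo_vec :: "'a set \<Rightarrow> ('a::real_normed_vector \<Rightarrow> complex) \<Rightarrow> (complex \<Rightarrow> 'a \<Rightarrow> 'a) \<Rightarrow> bool" where
  "holo_vec S f cmul \<longleftrightarrow> open S \<and> (\<forall>z\<in>S. \<exists>D. (f has_derivative D) (at z) \<and> (\<forall>c v. D (cmul c v) = c * D v))"

definition dir_deriv :: "real^'n \<Rightarrow> (complex^'n \<Rightarrow> complex) \<Rightarrow> complex^'n \<Rightarrow> complex" where
  "dir_deriv xi f z = deriv (\<lambda>t::complex. f (z + t *s cvec xi)) 0"

text \<open>The divided difference (f(z) - f(s_ij z))/(z_i - z_j), extended by continuity
  to the hyperplane z_i = z_j (where it is understood by holomorphic extension).\<close>
definition div_diff :: "'n \<Rightarrow> 'n \<Rightarrow> (complex^'n \<Rightarrow> complex) \<Rightarrow> complex^'n \<Rightarrow> complex" where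
  "div_diff i j f z =
     (let q = (\<lambda>w. (f w - f (swap_coord i j w)) / (w $ i - w $ j)) in
      if z $ i \<noteq> z $ j then q z else Lim (at z within {w. w $ i \<noteq> w $ j}) q)"

definition dunkl_op :: "real \<Rightarrow> real^('n::{finite,linorder}) \<Rightarrow> (complex^('n::{finite,linorder}) \<Rightarrow> complex) \<Rightarrow> complex^('n::{finite,linorder}) \<Rightarrow> complex" where
  "dunkl_op k xi f z = dir_deriv xi f z
     + complex_of_real k * (\<Sum>(i,j)\<in>{(i,j). i < j}. complex_of_real (xi $ i - xi $ j) * div_diff i j f z)"

definition dunkl_Delta :: "real \<Rightarrow> ((complex^('n::{finite,linorder})) \<Rightarrow> complex) \<Rightarrow> complex^('n::{finite,linorder}) \<Rightarrow> complex" where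
  "dunkl_Delta k f = foldr (\<lambda>j g. dunkl_op k (axis j 1) g) (sorted_list_of_set (UNIV :: 'n set)) f"

definition cinner :: "complex^'n \<Rightarrow> real^'n \<Rightarrow> complex" where
  "cinner lam xi = (\<Sum>i\<in>UNIV. lam $ i * complex_of_real (xi $ i))"

definition dunkl_kernel :: "real \<Rightarrow> complex^('n::{finite,linorder}) \<Rightarrow> complex^('n::{finite,linorder}) \<Rightarrow> complex" where
  "dunkl_kernel k = (THE E.
      holo_vec UNIV (\<lambda>p. E (fst p) (snd p)) (\<lambda>c p. (c *s fst p, c *s snd p))
    \<and> (\<forall>lam xi z. dunkl_op k xi (E lam) z = cinner lam xi * E lam z)
    \<and> (\<forall>lam. E lam 0 = 1))"

text \<open>|t|^a with the convention 0^0 = 1 (so that omega = 1 when k = 0).\<close>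
definition rpow0 :: "real \<Rightarrow> real \<Rightarrow> real" where
  "rpow0 t a = (if t = 0 \<and> a = 0 then 1 else \<bar>t\<bar> powr a)"

definition weight :: "real \<Rightarrow> real^('n::{finite,linorder}) \<Rightarrow> real" where
  "weight k x = (\<Prod>(i,j)\<in>{(i,j). i < j}. rpow0 (x $ i - x $ j) (2 * k))"

definition Rpos :: "(real^'n) set" where
  "Rpos = {x. \<forall>i. 0 < x $ i}"

definition dunkl_laplace :: "real \<Rightarrow> (real^('n::{finite,linorder}) \<Rightarrow> complex) \<Rightarrow> complex^('n::{finite,linorder}) \<Rightarrow> complex" where
  "dunkl_laplace k f z =
     (LINT x : Rpos | lebesgue. f x * dunkl_kernel k (- z) (cvec x) * complex_of_real (weight k x))"

definition dprod :: "real^'n \<Rightarrow> real" where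
  "dprod x = (\<Prod>i\<in>UNIV. x $ i)"

definition mu0 :: "real \<Rightarrow> 'n::finite itself \<Rightarrow> real" where
  "mu0 k _ = k * (real CARD('n) - 1)"

definition d_const :: "nat \<Rightarrow> real \<Rightarrow> real" where
  "d_const n k = (\<Prod>j=1..n. Gamma (1 + real j * k) / Gamma (1 + k))"

definition Gamma_n :: "nat \<Rightarrow> real \<Rightarrow> real \<Rightarrow> real" where
  "Gamma_n n k mu = d_const n k * (\<Prod>j=1..n. Gamma (mu - k * (real j - 1)))"

end

theory Submission
  imports Defs "HOL-Complex_Analysis.Cauchy_Integral_Formula"
begin

text \<open>
  Applying \<open>\<Delta>(T)\<^sup>\<nu>\<close> to the transform multiplies the integrand by \<open>(-1)\<^sup>n\<^sup>\<nu> \<Delta>(x)\<^sup>\<nu>\<close>, so the expression in the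
  theorem is the integral of \<open>f\<close> against the positive density \<open>\<Delta>(x)\<^sup>\<nu> E(-z, x) \<omega>(x)\<close> at \<open>z = \<nu>/\<xi>\<close>, suitably
  normalized. Integrating by parts against the Dunkl equations of the kernel gives the first two moments
  of this density in closed form. The first moments determine the logarithmic derivative of the total
  mass in \<open>z\<close>, which reduces the normalization to \<open>z = (1,\<dots>,1)\<close>, where \<open>E(-z, x) = e\<^sup>-\<^sup>\<Sigma>\<^sup>x\<close> and the mass is
  the Laguerre form of Selberg's integral; the latter follows from Aomoto's recursion and from integrating
  out the smallest coordinate. By the second moments the variance about \<open>\<xi>\<close> tends to \<open>0\<close>, and
  Chebyshev's inequality yields the limit.

  The kernel is constructed as the sum of its homogeneous components, each obtained from the previous
  one by inverting the operator \<open>m + k \<Sum>(1 - s\<^sub>i\<^sub>j)\<close> on orbits, which is invertible for \<open>k \<ge> 0\<close>.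
\<close>

subsection \<open>The homogeneous components of the Dunkl kernel\<close>

text \<open>One device carries the theory of the kernel: on a finite set stable under the
  reflections, \<open>c + \<kappa> * sum (1 - s)\<close> with \<open>c > 0\<close>,
  \<open>\<kappa> \<ge> 0\<close> obeys maximum and minimum principles. Uniqueness, growth bound,
  positivity and Dunkl equations of the components are all instances. Contracting the Dunkl
  equations with \<open>\<xi> = z\<close> clears the denominators and leaves one Euler-type equation
  per spectral parameter, which already determines the kernel.

  Positivity is needed only for \<open>x\<close> in the orthant. Adding a multiple of
  \<open>(1,...,1)\<close> to the spectral parameter changes the kernel by an exponential factor, so
  that parameter may be taken nonnegative, where every component is nonnegative.

  The quotients in the Dunkl operator are undefined on the hyperplanes, hence identities are proved
  at regular points and extended by continuity. For small positive \<open>k\<close> the weight is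
  not differentiable there, hence the regularized weight in the integration by parts. Aomoto's
  recursion moves the exponent by integers only, while removing a coordinate creates the exponent
  \<open>2 * k\<close>; log-convexity bridges the gap.\<close>

definition act :: "('n \<Rightarrow> 'n) \<Rightarrow> 'a^'n \<Rightarrow> 'a^'n" where
  "act w z = (\<chi> l. z $ (w l))"

definition cdot :: "complex^'n \<Rightarrow> complex^'n \<Rightarrow> complex" where
  "cdot l z = (\<Sum>i\<in>UNIV. l $ i * z $ i)"

lemma act_nth [simp]: "act w z $ i = z $ (w i)"
  by (simp add: act_def)

lemma act_act: "act v (act w z) = act (w \<circ> v) z"
  by (simp add: vec_eq_iff)

lemma act_id [simp]: "act id z = z"
  by (simp add: vec_eq_iff)

lemma swap_coord_act: "swap_coord i j = act (Transposition.transpose i j)"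
  by (simp add: fun_eq_iff swap_coord_def act_def)

lemma swap_coord_nth [simp]: "swap_coord i j z $ l = z $ (Transposition.transpose i j l)"
  by (simp add: swap_coord_def)

lemma swap_coord_swap_coord [simp]: "swap_coord i j (swap_coord i j z) = z"
  by (simp add: vec_eq_iff)

lemma swap_coord_same [simp]: "swap_coord i i z = z"
  by (simp add: vec_eq_iff)

lemma swap_coord_commute: "swap_coord i j = swap_coord j i"
  by (simp add: fun_eq_iff swap_coord_def transpose_commute)

lemma swap_coord_add: "swap_coord i j (x + y) = swap_coord i j x + swap_coord i j y"
  by (simp add: vec_eq_iff)

lemma swap_coord_smult: "swap_coord i j (c *s x) = c *s swap_coord i j x"
  by (simp add: vec_eq_iff)

lemma cdot_swap: "cdot (swap_coord i j l) z = cdot l (swap_coord i j z)"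
  unfolding cdot_def
  by (rule sum.reindex_bij_witness[where i="Transposition.transpose i j" and j="Transposition.transpose i j"]) auto

lemma cdot_commute: "cdot l z = cdot z l"
  by (simp add: cdot_def mult.commute)

text \<open>At a point where \<open>norm f\<close> is maximal, solving the equation for
  \<open>f\<close> gives \<open>(c + \<kappa> * |A|) M \<le> B + \<kappa> * |A| M\<close>, and the
  \<kappa> terms cancel. The bound does not depend on \<kappa>, and \<open>B = 0\<close> makes it a
  uniqueness statement.\<close>

lemma orbit_max_principle:
  fixes f g :: "'o \<Rightarrow> 'b::real_normed_vector"
  assumes "finite Om" "finite A" "\<And>a o'. a \<in> A \<Longrightarrow> o' \<in> Om \<Longrightarrow> \<sigma> a o' \<in> Om"
    and c: "c > 0" and \<kappa>: "\<kappa> \<ge> 0"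
    and eq: "\<And>o'. o' \<in> Om \<Longrightarrow> c *\<^sub>R f o' + \<kappa> *\<^sub>R (\<Sum>a\<in>A. f o' - f (\<sigma> a o')) = g o'"
    and B: "\<And>o'. o' \<in> Om \<Longrightarrow> norm (g o') \<le> B"
    and x: "x \<in> Om"
  shows "norm (f x) \<le> B / c"
proof -
  define M where "M = Max ((\<lambda>o'. norm (f o')) ` Om)"
  have fin: "finite ((\<lambda>o'. norm (f o')) ` Om)" using assms(1) by simp
  have le: "norm (f o') \<le> M" if "o' \<in> Om" for o'
    unfolding M_def using that fin by (intro Max_ge) auto
  obtain y where y: "y \<in> Om" "norm (f y) = M"
    using Max_in[OF fin] x unfolding M_def by fastforce
  have "g y = (c + \<kappa> * card A) *\<^sub>R f y - \<kappa> *\<^sub>R (\<Sum>a\<in>A. f (\<sigma> a y))"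
    unfolding eq[OF y(1), symmetric]
    by (simp add: sum_subtractf scaleR_add_left scaleR_diff_right sum_constant_scaleR)
  then have e: "(c + \<kappa> * card A) *\<^sub>R f y = g y + \<kappa> *\<^sub>R (\<Sum>a\<in>A. f (\<sigma> a y))"
    by simp
  have "(c + \<kappa> * card A) * M = norm ((c + \<kappa> * card A) *\<^sub>R f y)"
    using c \<kappa> y by simp
  also have "\<dots> \<le> B + \<kappa> * (\<Sum>a\<in>A. M)"
    unfolding e using \<kappa> B[OF y(1)] sum_norm_le[of A "\<lambda>a. f (\<sigma> a y)" "\<lambda>_. M"] le[OF assms(3)] y(1)
    by (intro norm_triangle_mono) (auto intro!: mult_left_mono)
  finally have "c * M \<le> B" by (simp add: algebra_simps)
  then show ?thesis using le[OF x] c by (simp add: field_simps) (metis mult_left_mono order_trans le[OF x] less_imp_le mult.commute)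
qed

text \<open>At a minimum every difference is nonpositive, so \<open>c * M\<close> is at least the
  source term there.\<close>

lemma orbit_min_principle:
  fixes f g :: "'o \<Rightarrow> real"
  assumes "finite Om" "finite A" "\<And>a o'. a \<in> A \<Longrightarrow> o' \<in> Om \<Longrightarrow> \<sigma> a o' \<in> Om"
    and c: "c > 0" and \<kappa>: "\<kappa> \<ge> 0"
    and eq: "\<And>o'. o' \<in> Om \<Longrightarrow> c * f o' + \<kappa> * (\<Sum>a\<in>A. f o' - f (\<sigma> a o')) = g o'"
    and g: "\<And>o'. o' \<in> Om \<Longrightarrow> 0 \<le> g o'"
    and x: "x \<in> Om"
  shows "0 \<le> f x"
proof -
  define M where "M = Min (f ` Om)"
  have fin: "finite (f ` Om)" using assms(1) by simp
  have le: "M \<le> f o'" if "o' \<in> Om" for o'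
    unfolding M_def using that fin by (intro Min_le) auto
  obtain y where y: "y \<in> Om" "f y = M"
    using Min_in[OF fin] x unfolding M_def by fastforce
  have "(\<Sum>a\<in>A. f y - f (\<sigma> a y)) \<le> 0"
    using y le assms(3) by (intro sum_nonpos) auto
  then have "\<kappa> * (\<Sum>a\<in>A. f y - f (\<sigma> a y)) \<le> 0"
    using \<kappa> by (simp add: mult_nonneg_nonpos)
  with eq[OF y(1)] g[OF y(1)] have "0 \<le> c * M" using y by simp
  then show ?thesis using c le[OF x] by (simp add: zero_le_mult_iff)
qed

section \<open>The resolvent of the reflection sum\<close>

abbreviation swapp :: "'n \<times> 'n \<Rightarrow> 'a^'n \<Rightarrow> 'a^'n" where
  "swapp a \<equiv> swap_coord (fst a) (snd a)"

text \<open>The functions \<open>r\<close> live on the finite type of all self-maps and so form a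
  finite-dimensional space, on which the maximum principle with zero source gives injectivity, hence
  surjectivity. The factor \<open>k/2\<close> compensates for ordered pairs: each transposition
  occurs twice and the diagonal contributes nothing.\<close>

lemma resolvent_exists:
  fixes c k :: real
  assumes "c > 0" "k \<ge> 0"
  shows "\<exists>r :: ('n::finite \<Rightarrow> 'n) \<Rightarrow> real. \<forall>w.
    c * r w + (k/2) * (\<Sum>a\<in>UNIV. r w - r (Transposition.transpose (fst a) (snd a) \<circ> w)) = (if w = id then 1 else 0)"
proof -
  define A :: "real^('n \<Rightarrow> 'n) \<Rightarrow> real^('n \<Rightarrow> 'n)" where
    "A r = (\<chi> w. c * r $ w + (k/2) * (\<Sum>a\<in>UNIV. r $ w - r $ (Transposition.transpose (fst a) (snd a) \<circ> w)))" for r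
  have lin: "linear A"
    unfolding A_def
    by (rule linearI) (simp_all add: vec_eq_iff algebra_simps sum.distrib sum_subtractf sum_distrib_left)
  have "inj A"
  proof (subst linear_injective_0[OF lin], intro allI impI)
    fix r assume r: "A r = 0"
    have "norm (r $ w) \<le> 0 / c" for w
    proof (rule orbit_max_principle[where Om=UNIV and A=UNIV and f="\<lambda>w. r $ w" and g="\<lambda>_. 0" and \<kappa>="k/2"
        and \<sigma>="\<lambda>a w. Transposition.transpose (fst a) (snd a) \<circ> w"])
      fix w :: "'n \<Rightarrow> 'n"
      have "A r $ w = 0" using r by simp
      then show "c *\<^sub>R (r $ w) + (k / 2) *\<^sub>R (\<Sum>a\<in>UNIV. r $ w - r $ (Transposition.transpose (fst a) (snd a) \<circ> w)) = 0"
        by (simp add: A_def)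
    qed (use assms in auto)
    then show "r = 0" by (simp add: vec_eq_iff)
  qed
  then have "surj A" using linear_injective_imp_surjective[OF lin] by simp
  then obtain r where "A r = (\<chi> w. if w = id then 1 else 0)" by (metis surjD)
  then have "\<forall>w. A r $ w = (if w = id then 1 else 0)" by simp
  then show ?thesis unfolding A_def by (intro exI[of _ "\<lambda>w. r $ w"]) simp
qed

definition resolvent :: "real \<Rightarrow> real \<Rightarrow> ('n::finite \<Rightarrow> 'n) \<Rightarrow> real" where
  "resolvent k c = (SOME r. \<forall>w.
    c * r w + (k/2) * (\<Sum>a\<in>UNIV. r w - r (Transposition.transpose (fst a) (snd a) \<circ> w)) = (if w = id then 1 else 0))"

lemma resolvent:
  assumes "c > 0" "k \<ge> 0"
  shows "c * resolvent k c w + (k/2) * (\<Sum>a\<in>UNIV. resolvent k c w - resolvent k c (Transposition.transpose (fst a) (snd a) \<circ> w))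
    = (if w = id then 1 else 0)"
  using someI_ex[OF resolvent_exists[OF assms]] unfolding resolvent_def by blast

text \<open>Convolution with the fundamental solution \<open>resolvent\<close>: a swap of the
  argument moves to the coefficient by reindexing the sum over \<open>w\<close>, since a
  transposition is its own inverse.\<close>

lemma resolvent_solves:
  fixes g :: "complex^'n::finite \<Rightarrow> complex"
  assumes "c > 0" "k \<ge> 0"
  defines "f \<equiv> \<lambda>z. \<Sum>w\<in>UNIV. complex_of_real (resolvent k c w) * g (act w z)"
  shows "c * f z + complex_of_real (k/2) * (\<Sum>a\<in>UNIV. f z - f (swapp a z)) = g z"
proof -
  let ?r = "\<lambda>w. complex_of_real (resolvent k c w)"
  let ?t = "\<lambda>a. Transposition.transpose (fst a) (snd a)"
  have "f (swapp a z) = (\<Sum>w\<in>UNIV. ?r (?t a \<circ> w) * g (act w z))" for a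
    unfolding f_def
    by (rule sum.reindex_bij_witness[where i="\<lambda>w. ?t a \<circ> w" and j="\<lambda>w. ?t a \<circ> w"])
      (auto simp: swap_coord_act act_act o_assoc)
  then have "c * f z + complex_of_real (k/2) * (\<Sum>a\<in>UNIV. f z - f (swapp a z)) =
    c * (\<Sum>w\<in>UNIV. ?r w * g (act w z)) + complex_of_real (k/2) * (\<Sum>a\<in>UNIV. (\<Sum>w\<in>UNIV. ?r w * g (act w z)) - (\<Sum>w\<in>UNIV. ?r (?t a \<circ> w) * g (act w z)))"
    by (simp add: f_def)
  also have "\<dots> = c * (\<Sum>w\<in>UNIV. ?r w * g (act w z)) + complex_of_real (k/2) * (\<Sum>a\<in>UNIV. (\<Sum>w\<in>UNIV. (?r w - ?r (?t a \<circ> w)) * g (act w z)))"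
    by (simp add: sum_subtractf algebra_simps)
  also have "\<dots> = c * (\<Sum>w\<in>UNIV. ?r w * g (act w z)) + complex_of_real (k/2) * (\<Sum>w\<in>UNIV. (\<Sum>a\<in>UNIV. (?r w - ?r (?t a \<circ> w)) * g (act w z)))"
    by (subst sum.swap) simp
  also have "\<dots> = (\<Sum>w\<in>UNIV. (c * ?r w + complex_of_real (k/2) * (\<Sum>a\<in>UNIV. ?r w - ?r (?t a \<circ> w))) * g (act w z))"
    by (simp add: sum_distrib_left sum_distrib_right sum.distrib algebra_simps)
  also have "\<dots> = (\<Sum>w\<in>UNIV. complex_of_real (if w = id then 1 else 0) * g (act w z))"
  proof -
    have "c * ?r w + complex_of_real (k/2) * (\<Sum>a\<in>UNIV. ?r w - ?r (?t a \<circ> w)) = complex_of_real (if w = id then 1 else 0)" for w :: "'n \<Rightarrow> 'n"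
      by (subst resolvent[OF assms(1,2), symmetric]) simp
    then show ?thesis by (simp only:)
  qed
  also have "\<dots> = (\<Sum>w\<in>(UNIV::('n \<Rightarrow> 'n) set). if w = id then g z else 0)"
    by (intro sum.cong) auto
  also have "\<dots> = g z" by simp
  finally show ?thesis .
qed

text \<open>The degree \<open>m\<close> component of the kernel; for \<open>k = 0\<close> it is
  \<open>cdot l z ^ m / fact m\<close>. The recursion is the degree \<open>m + 1\<close> part of the
  Euler equation, solved by the resolvent. As a finite sum over \<open>w\<close> it is visibly
  polynomial in both vector arguments.\<close>

primrec dhom :: "real \<Rightarrow> nat \<Rightarrow> complex^'n::finite \<Rightarrow> complex^'n \<Rightarrow> complex" where
  "dhom k 0 l z = 1"
| "dhom k (Suc m) l z = (\<Sum>w\<in>UNIV. complex_of_real (resolvent k (real (Suc m)) w) * (cdot l (act w z) * dhom k m l (act w z)))"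

lemma dhom_rec:
  assumes "k \<ge> 0"
  shows "real (Suc m) * dhom k (Suc m) l z + complex_of_real (k/2) * (\<Sum>a\<in>UNIV. dhom k (Suc m) l z - dhom k (Suc m) l (swapp a z))
    = cdot l z * dhom k m l z"
  using resolvent_solves[of "real (Suc m)" k "\<lambda>z. cdot l z * dhom k m l z" z] assms by simp

section \<open>Uniqueness, bounds and symmetries of the components\<close>

definition orbit :: "'a^'n \<Rightarrow> ('a^'n) set" where
  "orbit z = {act p z | p. bij p}"

lemma finite_orbit [simp]: "finite (orbit (z :: 'a^'n::finite))"
  unfolding orbit_def by (simp add: setcompr_eq_image)

lemma orbit_self [simp]: "z \<in> orbit z"
  unfolding orbit_def by (auto intro!: exI[of _ id])

lemma orbit_swap: "y \<in> orbit z \<Longrightarrow> swap_coord i j y \<in> orbit z"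
proof -
  assume "y \<in> orbit z"
  then obtain p where "y = act p z" "bij p" by (auto simp: orbit_def)
  then have "swap_coord i j y = act (p \<circ> Transposition.transpose i j) z" "bij (p \<circ> Transposition.transpose i j)"
    by (simp_all add: swap_coord_act act_act bij_comp)
  then show ?thesis unfolding orbit_def by blast
qed

lemma orbit_sum:
  fixes f :: "'a \<Rightarrow> 'b::comm_monoid_add"
  assumes "y \<in> orbit (z :: 'a^'n::finite)"
  shows "(\<Sum>i\<in>UNIV. f (y $ i)) = (\<Sum>i\<in>UNIV. f (z $ i))"
proof -
  from assms obtain p where p: "y = act p z" "bij p" by (auto simp: orbit_def)
  show ?thesis unfolding p act_nth
    by (rule sum.reindex_bij_betw[OF p(2), of "\<lambda>i. f (z $ i)"])
qed

text \<open>The equation couples only the values on one orbit, so no regularity of \<open>h\<close>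
  enters: the difference of two solutions has source zero and the maximum principle applies orbit by
  orbit.\<close>

lemma dhom_unique:
  fixes h :: "complex^'n::finite \<Rightarrow> complex"
  assumes "k \<ge> 0"
    and "\<And>z. real (Suc m) * h z + complex_of_real (k/2) * (\<Sum>a\<in>UNIV. h z - h (swapp a z)) = cdot l z * dhom k m l z"
  shows "h z = dhom k (Suc m) l z"
proof -
  let ?d = "\<lambda>z. h z - dhom k (Suc m) l z"
  have "norm (?d z) \<le> 0 / real (Suc m)"
  proof (rule orbit_max_principle[where Om="orbit z" and A=UNIV and g="\<lambda>_. 0" and \<kappa>="k/2" and \<sigma>=swapp])
    fix y
    show "real (Suc m) *\<^sub>R ?d y + (k / 2) *\<^sub>R (\<Sum>a\<in>UNIV. ?d y - ?d (swapp a y)) = 0"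
    proof -
      have "real (Suc m) *\<^sub>R ?d y + (k / 2) *\<^sub>R (\<Sum>a\<in>UNIV. ?d y - ?d (swapp a y)) =
        (real (Suc m) * h y + complex_of_real (k/2) * (\<Sum>a\<in>UNIV. h y - h (swapp a y))) -
        (real (Suc m) * dhom k (Suc m) l y + complex_of_real (k/2) * (\<Sum>a\<in>UNIV. dhom k (Suc m) l y - dhom k (Suc m) l (swapp a y)))"
        by (simp add: scaleR_conv_of_real sum_subtractf algebra_simps sum.distrib del: dhom.simps)
      then show ?thesis by (simp only: assms(2) dhom_rec[OF assms(1)] diff_self)
    qed
  qed (use assms orbit_swap in auto)
  then show ?thesis by simp
qed

text \<open>Each step of the recursion multiplies by at most \<open>L * sum |z_i|\<close>, which is
  constant on orbits, and the maximum principle divides by \<open>m + 1\<close>. The reflections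
  cost nothing, and the exponential series majorizes the kernel uniformly in
  \<open>k\<close>.\<close>

lemma dhom_bound:
  fixes l z :: "complex^'n::finite"
  assumes "k \<ge> 0" and L: "\<And>i. norm (l $ i) \<le> L"
  shows "norm (dhom k m l z) \<le> (L * (\<Sum>i\<in>UNIV. norm (z $ i))) ^ m / fact m"
proof (induction m arbitrary: z)
  case (Suc m)
  let ?X = "\<lambda>z::complex^'n. \<Sum>i\<in>UNIV. norm (z $ i)"
  have L0: "0 \<le> L" using L norm_ge_zero order_trans by blast
  have "norm (dhom k (Suc m) l z) \<le> ((L * ?X z) * ((L * ?X z) ^ m / fact m)) / real (Suc m)"
  proof (rule orbit_max_principle[where Om="orbit z" and A=UNIV and g="\<lambda>z. cdot l z * dhom k m l z" and \<kappa>="k/2" and \<sigma>=swapp])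
    fix y
    show "real (Suc m) *\<^sub>R dhom k (Suc m) l y + (k / 2) *\<^sub>R (\<Sum>a\<in>UNIV. dhom k (Suc m) l y - dhom k (Suc m) l (swapp a y)) =
         cdot l y * dhom k m l y"
      using dhom_rec[OF assms(1), of m l y] by (simp add: scaleR_conv_of_real del: dhom.simps)
    assume y: "y \<in> orbit z"
    have X: "?X y = ?X z" using orbit_sum[OF y] .
    have "norm (cdot l y) \<le> (\<Sum>i\<in>UNIV. L * norm (y $ i))"
      unfolding cdot_def by (intro sum_norm_le) (auto simp: norm_mult intro!: mult_right_mono L)
    also have "\<dots> = L * ?X z" using X by (simp add: sum_distrib_left[symmetric])
    finally have "norm (cdot l y) \<le> L * ?X z" .
    moreover have "norm (dhom k m l y) \<le> (L * ?X z) ^ m / fact m" using Suc.IH[of y] X by simp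
    ultimately show "norm (cdot l y * dhom k m l y) \<le> (L * ?X z) * ((L * ?X z) ^ m / fact m)"
      unfolding norm_mult using L0 by (intro mult_mono) (auto intro!: mult_nonneg_nonneg sum_nonneg)
  qed (use assms orbit_swap in auto)
  then show ?case by (simp add: mult_ac del: dhom.simps)
qed simp

lemma sum_swap_reindex:
  fixes F :: "'n::finite \<times> 'n \<Rightarrow> 'b::comm_monoid_add"
  shows "(\<Sum>a\<in>UNIV. F a) = (\<Sum>a\<in>UNIV. F (Transposition.transpose i j (fst a), Transposition.transpose i j (snd a)))"
  by (rule sum.reindex_bij_witness[where i="\<lambda>a. (Transposition.transpose i j (fst a), Transposition.transpose i j (snd a))"
      and j="\<lambda>a. (Transposition.transpose i j (fst a), Transposition.transpose i j (snd a))"]) auto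

lemma swap_coord_conj:
  "swap_coord i j (swap_coord (Transposition.transpose i j a) (Transposition.transpose i j b) z) = swap_coord a b (swap_coord i j z)"
proof -
  have "Transposition.transpose (Transposition.transpose i j a) (Transposition.transpose i j b) (Transposition.transpose i j l)
    = Transposition.transpose i j (Transposition.transpose a b l)" for l
    by (metis transpose_apply_first transpose_apply_other transpose_apply_second transpose_involutory)
  then show ?thesis by (simp add: vec_eq_iff)
qed

text \<open>Swapping both arguments yields another solution of the recursion, because conjugation by
  a transposition permutes the pairs in the reflection sum.\<close>

lemma dhom_equivariant:
  assumes "k \<ge> 0"
  shows "dhom k m (swap_coord i j l) (swap_coord i j z) = dhom k m l z"
proof (induction m arbitrary: z)
  case (Suc m)
  show ?case
  proof (rule dhom_unique[OF assms])
    fix z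
    let ?h = "\<lambda>z. dhom k (Suc m) (swap_coord i j l) (swap_coord i j z)"
    have "(\<Sum>a\<in>UNIV. ?h z - ?h (swapp a z)) = (\<Sum>a\<in>UNIV. ?h z - dhom k (Suc m) (swap_coord i j l) (swapp a (swap_coord i j z)))"
      by (subst sum_swap_reindex[of _ i j]) (simp only: fst_conv snd_conv swap_coord_conj)
    then show "real (Suc m) * ?h z + complex_of_real (k/2) * (\<Sum>a\<in>UNIV. ?h z - ?h (swapp a z)) = cdot l z * dhom k m l z"
      using dhom_rec[OF assms, of m "swap_coord i j l" "swap_coord i j z"]
      by (simp only: cdot_swap swap_coord_swap_coord Suc.IH)
  qed
qed simp

text \<open>By equivariance a swap in one argument equals the same swap in the other, so the
  function with exchanged arguments solves the same recursion and uniqueness applies.\<close>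

lemma dhom_symmetric:
  assumes "k \<ge> 0"
  shows "dhom k m l z = dhom k m z l"
proof (induction m arbitrary: l z)
  case (Suc m)
  have "dhom k (Suc m) z l = dhom k (Suc m) l z"
  proof (rule dhom_unique[OF assms])
    fix z
    have "dhom k (Suc m) (swapp a z) l = dhom k (Suc m) z (swapp a l)" for a
      using dhom_equivariant[OF assms, of "Suc m" "fst a" "snd a" z "swapp a l"] by (simp del: dhom.simps)
    then show "real (Suc m) * dhom k (Suc m) z l + complex_of_real (k/2) * (\<Sum>a\<in>UNIV. dhom k (Suc m) z l - dhom k (Suc m) (swapp a z) l)
        = cdot l z * dhom k m l z"
      using dhom_rec[OF assms, of m z l] by (simp only: cdot_commute[of l z] Suc.IH[of l z])
  qed
  then show ?case by simp
qed simp

lemma act_smult: "act w (c *s z) = c *s act w z"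
  by (simp add: vec_eq_iff)

lemma cdot_smult_right: "cdot l (c *s z) = c * cdot l z"
  by (simp add: cdot_def sum_distrib_left mult_ac)

lemma cdot_smult_left: "cdot (c *s l) z = c * cdot l z"
  by (simp add: cdot_def sum_distrib_left mult_ac)

lemma dhom_smult_right: "dhom k m l (c *s z) = c ^ m * dhom k m l z"
  by (induction m arbitrary: z) (simp_all add: act_smult cdot_smult_right sum_distrib_left mult_ac)

lemma dhom_smult_left: "dhom k m (c *s l) z = c ^ m * dhom k m l z"
  by (induction m arbitrary: z) (simp_all add: cdot_smult_left sum_distrib_left mult_ac)

text \<open>The imaginary part solves the equation with source zero; the real part solves it with a
  nonnegative source, to which the minimum principle applies.\<close>

lemma dhom_nonneg:
  fixes l z :: "real^'n::finite"
  assumes "k \<ge> 0" "\<And>i. 0 \<le> l $ i" "\<And>i. 0 \<le> z $ i"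
  shows "dhom k m (cvec l) (cvec z) \<in> \<real> \<and> 0 \<le> Re (dhom k m (cvec l) (cvec z))"
  using assms(3)
proof (induction m arbitrary: z)
  case (Suc m)
  let ?f = "\<lambda>z. dhom k (Suc m) (cvec l) (cvec z)"
  have cv: "swap_coord i j (cvec y) = cvec (swap_coord i j y)" for i j and y :: "real^'n"
    by (simp add: vec_eq_iff cvec_def)
  have cd: "cdot (cvec l) (cvec y) = complex_of_real (\<Sum>i\<in>UNIV. l $ i * y $ i)" for y
    by (simp add: cdot_def cvec_def)
  have pos: "0 \<le> y $ i" if "y \<in> orbit z" for y i
    using that Suc.prems by (auto simp: orbit_def)
  have eq: "real (Suc m) * ?f y + complex_of_real (k/2) * (\<Sum>a\<in>UNIV. ?f y - ?f (swapp a y))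
    = complex_of_real (\<Sum>i\<in>UNIV. l $ i * y $ i) * dhom k m (cvec l) (cvec y)" for y
    using dhom_rec[OF assms(1), of m "cvec l" "cvec y"] by (simp only: cv cd)
  have IH: "dhom k m (cvec l) (cvec y) = complex_of_real (Re (dhom k m (cvec l) (cvec y)))"
     "0 \<le> Re (dhom k m (cvec l) (cvec y))" if "y \<in> orbit z" for y
    using Suc.IH[of y] pos[OF that] by (auto elim!: Reals_cases)
  have "norm (Im (?f z)) \<le> 0 / real (Suc m)"
  proof (rule orbit_max_principle[where Om="orbit z" and A=UNIV and g="\<lambda>_. 0" and \<kappa>="k/2" and \<sigma>=swapp])
    fix y assume y: "y \<in> orbit z"
    have "Im (real (Suc m) * ?f y + complex_of_real (k/2) * (\<Sum>a\<in>UNIV. ?f y - ?f (swapp a y))) = 0"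
      unfolding eq by (subst IH(1)[OF y]) (simp only: of_real_mult [symmetric] Im_complex_of_real)
    then show "real (Suc m) *\<^sub>R Im (?f y) + (k / 2) *\<^sub>R (\<Sum>a\<in>UNIV. Im (?f y) - Im (?f (swapp a y))) = 0"
      by (simp only: plus_complex.sel Im_complex_of_real Re_complex_of_real times_complex.sel Im_sum minus_complex.sel) 
         (simp del: dhom.simps)
  qed (use assms(1) orbit_swap in auto)
  moreover have "0 \<le> Re (?f z)"
  proof (rule orbit_min_principle[where Om="orbit z" and A=UNIV and f="\<lambda>z. Re (?f z)" and c="real (Suc m)"
        and g="\<lambda>y. (\<Sum>i\<in>UNIV. l $ i * y $ i) * Re (dhom k m (cvec l) (cvec y))" and \<kappa>="k/2" and \<sigma>=swapp])
    fix y assume y: "y \<in> orbit z"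
    have "Re (real (Suc m) * ?f y + complex_of_real (k/2) * (\<Sum>a\<in>UNIV. ?f y - ?f (swapp a y)))
       = (\<Sum>i\<in>UNIV. l $ i * y $ i) * Re (dhom k m (cvec l) (cvec y))"
      unfolding eq by (simp only: times_complex.sel) simp
    then show "real (Suc m) * Re (?f y) + (k / 2) * (\<Sum>a\<in>UNIV. Re (?f y) - Re (?f (swapp a y)))
       = (\<Sum>i\<in>UNIV. l $ i * y $ i) * Re (dhom k m (cvec l) (cvec y))"
      by (simp only: plus_complex.sel Im_complex_of_real Re_complex_of_real times_complex.sel Re_sum minus_complex.sel)
    show "0 \<le> (\<Sum>i\<in>UNIV. l $ i * y $ i) * Re (dhom k m (cvec l) (cvec y))"
      using IH(2)[OF y] assms(2) pos[OF y] by (intro mult_nonneg_nonneg sum_nonneg) auto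
  qed (use assms(1) orbit_swap in auto)
  ultimately show ?case by (simp add: complex_is_Real_iff del: dhom.simps)
qed simp

subsection \<open>Dunkl operators on functions that are holomorphic along lines\<close>

definition pd :: "(complex^'n \<Rightarrow> complex) \<Rightarrow> complex^'n \<Rightarrow> complex^'n \<Rightarrow> complex" where
  "pd f z v = deriv (\<lambda>t. f (z + t *s v)) 0"

text \<open>By Osgood's lemma this is holomorphy.\<close>
definition nice :: "(complex^'n) set \<Rightarrow> (complex^'n \<Rightarrow> complex) \<Rightarrow> bool" where
  "nice D F \<longleftrightarrow> continuous_on D F \<and> (\<forall>z\<in>D. \<forall>v. (\<lambda>t. F (z + t *s v)) field_differentiable (at 0))"

definition regular :: "'a^'n \<Rightarrow> bool" where
  "regular z \<longleftrightarrow> (\<forall>i j. i \<noteq> j \<longrightarrow> z $ i \<noteq> z $ j)"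

section \<open>Cauchy estimates on complex lines\<close>

lemma norm_vec_smult: "norm (c *s (v :: complex^'n)) = norm c * norm v"
  by (simp add: norm_vec_def norm_mult L2_set_right_distrib)

lemma norm_swap_coord [simp]: "norm (swap_coord i j (v :: ('a::real_normed_vector)^'n)) = norm v"
proof -
  have "(\<Sum>l\<in>UNIV. (norm (v $ Transposition.transpose i j l))\<^sup>2) = (\<Sum>l\<in>UNIV. (norm (v $ l))\<^sup>2)"
    by (rule sum.reindex_bij_witness[where i="Transposition.transpose i j" and j="Transposition.transpose i j"]) auto
  then show ?thesis by (simp add: norm_vec_def L2_set_def)
qed

lemma swap_coord_diff: "swap_coord i j (x - y) = swap_coord i j x - swap_coord i j (y :: ('a::ab_group_add)^'n)"
  by (simp add: vec_eq_iff)

lemma dist_swap_coord [simp]: "dist (swap_coord i j x) (swap_coord i j (y :: ('a::real_normed_vector)^'n)) = dist x y"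
  by (simp add: dist_norm swap_coord_diff[symmetric])

lemma continuous_on_swap_coord [continuous_intros]:
  "continuous_on S f \<Longrightarrow> continuous_on S (\<lambda>x. swap_coord i j (f x :: ('a::real_normed_vector)^'n))"
  by (subst swap_coord_def) (intro continuous_intros)

lemma tendsto_smult_line:
  fixes z v :: "complex^'n"
  shows "((\<lambda>t. z + t *s v) \<longlongrightarrow> z + a *s v) (at a within S)"
  by (rule vec_tendstoI) (auto intro!: tendsto_eq_intros)

lemma continuous_on_line [continuous_intros]:
  fixes z v :: "complex^'n"
  shows "continuous_on S (\<lambda>t. z + t *s v)"
  unfolding continuous_on_def using tendsto_smult_line by blast

lemma nice_deriv:
  assumes "nice D F" "z + t *s v \<in> D"
  shows "((\<lambda>t. F (z + t *s v)) has_field_derivative pd F (z + t *s v) v) (at t)"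
proof -
  have "((\<lambda>s. F ((z + t *s v) + s *s v)) has_field_derivative pd F (z + t *s v) v) (at 0)"
    unfolding pd_def using assms unfolding nice_def by (meson field_differentiable_derivI)
  then have "((\<lambda>s. F ((z + t *s v) + s *s v)) has_field_derivative pd F (z + t *s v) v) (at (t + (- t)))"
    by simp
  then have "((\<lambda>s. F ((z + t *s v) + (s + - t) *s v)) has_field_derivative pd F (z + t *s v) v) (at t)"
    by (subst (asm) DERIV_shift)
  moreover have "(z + t *s v) + (s + - t) *s v = z + s *s v" for s
    by (simp add: vec_eq_iff algebra_simps)
  ultimately show ?thesis by simp
qed

lemma nice_deriv0:
  assumes "nice D F" "z \<in> D"
  shows "((\<lambda>t. F (z + t *s v)) has_field_derivative pd F z v) (at 0)"
  using nice_deriv[of D F z 0 v] assms by simp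

lemma nice_holomorphic:
  assumes "nice D F" "\<And>t. t \<in> S \<Longrightarrow> z + t *s v \<in> D"
  shows "(\<lambda>t. F (z + t *s v)) holomorphic_on S"
  unfolding holomorphic_on_def field_differentiable_def
  using nice_deriv[OF assms(1)] assms(2) has_field_derivative_at_within by blast

lemma pd_bound:
  assumes "nice D F" and r: "r > 0" and D: "\<And>t. norm t \<le> r \<Longrightarrow> z + t *s v \<in> D"
    and B: "\<And>t. norm t \<le> r \<Longrightarrow> norm (F (z + t *s v)) \<le> B"
  shows "norm (pd F z v) \<le> B / r"
proof -
  have h: "(\<lambda>t. F (z + t *s v)) holomorphic_on (cball 0 r)"
    by (rule nice_holomorphic[OF assms(1)]) (use D in auto)
  have "norm ((deriv ^^ 1) (\<lambda>t. F (z + t *s v)) 0) \<le> fact 1 * B / r ^ 1"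
    by (rule Cauchy_inequality)
      (use h r B in \<open>auto intro: holomorphic_on_subset holomorphic_on_imp_continuous_on\<close>)
  then show ?thesis by (simp add: pd_def)
qed

text \<open>A \<open>nice\<close> function is known to be differentiable along single lines only.
  Continuity comes from Cauchy's estimate for the difference of \<open>F\<close> on two parallel
  discs, which is uniformly small because \<open>F\<close> is uniformly continuous on a compact
  ball.\<close>

lemma pd_continuous:
  assumes "nice D F" "open D"
  shows "continuous_on D (\<lambda>z. pd F z v)"
proof (subst continuous_on_iff, intro ballI allI impI)
  fix z and e :: real assume z: "z \<in> D" and e: "e > 0"
  obtain \<rho> where \<rho>: "\<rho> > 0" "cball z \<rho> \<subseteq> D" using assms(2) z open_contains_cball by blast
  \<comment> \<open>A disc of radius \<open>r\<close> in direction \<open>v\<close> reaches at most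
    \<open>\<rho> / 2\<close> from its centre; the added \<open>1\<close> covers
    \<open>v = 0\<close>.\<close>
  define r where "r = \<rho> / (2 * (1 + norm v))"
  have nv: "1 + norm v > 0" by (simp add: add_pos_nonneg)
  have r: "r > 0" using \<rho> nv by (simp add: r_def)
  have rv: "t * norm v \<le> \<rho> / 2" if "t \<le> r" for t
  proof -
    have "t * norm v \<le> r * norm v" using that by (intro mult_right_mono) auto
    also have "\<dots> \<le> r * (1 + norm v)" using r by (simp add: distrib_left)
    also have "\<dots> = \<rho> / 2" using nv unfolding r_def by (simp add: field_simps)
    finally show ?thesis .
  qed
  have inD: "w + t *s v \<in> cball z \<rho>" if "dist w z < \<rho> / 2" "norm t \<le> r" for w t
  proof -
    have "dist z (w + t *s v) = norm ((z - w) - t *s v)" by (simp add: dist_norm algebra_simps)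
    also have "\<dots> \<le> norm (z - w) + norm (t *s v)" by (rule norm_triangle_ineq4)
    also have "\<dots> \<le> \<rho> / 2 + \<rho> / 2"
      using that rv[of "norm t"] by (intro add_mono) (auto simp: norm_vec_smult dist_norm norm_minus_commute)
    finally show ?thesis by simp
  qed
  have "uniformly_continuous_on (cball z \<rho>) F"
    using assms(1) \<rho>(2) by (intro compact_uniformly_continuous) (auto simp: nice_def intro: continuous_on_subset)
  moreover have "e * r / 2 > 0" using e r by simp
  ultimately obtain d where d: "d > 0" "\<And>x y. x \<in> cball z \<rho> \<Longrightarrow> y \<in> cball z \<rho> \<Longrightarrow> dist y x < d \<Longrightarrow> dist (F y) (F x) < e * r / 2"
    unfolding uniformly_continuous_on_def by metis
  show "\<exists>d>0. \<forall>w\<in>D. dist w z < d \<longrightarrow> dist (pd F w v) (pd F z v) < e"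
  proof (intro exI[of _ "min d (\<rho>/2)"] conjI ballI impI)
    show "min d (\<rho>/2) > 0" using d \<rho> by simp
    fix w assume w: "w \<in> D" "dist w z < min d (\<rho>/2)"
    define \<phi> where "\<phi> = (\<lambda>t. F (w + t *s v) - F (z + t *s v))"
    have hol: "\<phi> holomorphic_on cball 0 r" unfolding \<phi>_def
      by (intro holomorphic_intros nice_holomorphic[OF assms(1)] subsetD[OF \<rho>(2)] inD) (use w \<rho> in auto)
    have der: "deriv \<phi> 0 = pd F w v - pd F z v"
      unfolding \<phi>_def by (intro DERIV_imp_deriv DERIV_diff nice_deriv0[OF assms(1)] w z)
    have "norm ((deriv ^^ 1) \<phi> 0) \<le> fact 1 * (e * r / 2) / r ^ 1"
    proof (rule Cauchy_inequality)
      fix t :: complex assume "norm (0 - t) = r"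
      then have t: "norm t \<le> r" by simp
      show "norm (\<phi> t) \<le> e * r / 2"
        using d(2)[OF inD[OF _ t, of z] inD[OF _ t, of w]] w \<rho> by (auto simp: \<phi>_def dist_norm less_imp_le)
    qed (use hol r in \<open>auto intro: holomorphic_on_subset holomorphic_on_imp_continuous_on\<close>)
    then show "dist (pd F w v) (pd F z v) < e" using e r by (simp add: der dist_norm)
  qed
qed

text \<open>\<open>w\<close> and its mirror image differ by \<open>w $ i - w $ j\<close> times
  \<open>axis i 1 - axis j 1\<close>, so the quotient is a mean of the derivative in that direction
  over the segment between them. The swap is an isometry fixing \<open>z\<close>, hence the segment
  stays in the ball.\<close>

lemma divided_difference_limit:
  fixes z :: "complex^'n"
  assumes "nice D F" "open D" "z \<in> D" "z $ i = z $ j" "i \<noteq> j" "e > 0"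
  obtains d where "d > 0" "ball z d \<subseteq> D"
    "\<And>w. w \<in> ball z d \<Longrightarrow> w $ i \<noteq> w $ j \<Longrightarrow>
      norm ((F w - F (swap_coord i j w)) / (w $ i - w $ j) - pd F z (axis i 1 - axis j 1)) \<le> e"
    "\<And>w. w \<in> ball z d \<Longrightarrow> norm (pd F w (axis i 1 - axis j 1) - pd F z (axis i 1 - axis j 1)) \<le> e"
proof -
  let ?v = "axis i 1 - axis j 1 :: complex^'n"
  obtain d1 where d1: "d1 > 0" "ball z d1 \<subseteq> D" using assms openE by blast
  obtain d2 where d2: "d2 > 0" "\<And>w. w \<in> D \<Longrightarrow> dist w z < d2 \<Longrightarrow> dist (pd F w ?v) (pd F z ?v) < e"
    using pd_continuous[OF assms(1,2), of ?v] assms(3,6) unfolding continuous_on_iff by metis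
  define d where "d = min d1 d2"
  have d: "d > 0" "ball z d \<subseteq> D" using d1 d2 by (auto simp: d_def)
  have b: "norm (pd F w ?v - pd F z ?v) \<le> e" if "w \<in> ball z d" for w
    using d2(2)[of w] that subsetD[OF d(2) that] by (auto simp: d_def dist_norm norm_minus_commute intro: less_imp_le)
  have "norm ((F w - F (swap_coord i j w)) / (w $ i - w $ j) - pd F z ?v) \<le> e"
    if w: "w \<in> ball z d" "w $ i \<noteq> w $ j" for w
  proof -
    define u where "u = swap_coord i j w"
    define \<tau> where "\<tau> = w $ i - w $ j"
    have wu: "w = u + \<tau> *s ?v"
      using assms(5) by (auto simp: vec_eq_iff u_def \<tau>_def axis_def Transposition.transpose_def)
    have "swap_coord i j z = z" using assms(4) by (auto simp: vec_eq_iff Transposition.transpose_def)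
    then have "dist z u = dist z w" unfolding u_def by (metis dist_swap_coord)
    then have u: "u \<in> ball z d" using w by simp
    have seg: "u + t *s ?v \<in> ball z d" if "t \<in> closed_segment 0 \<tau>" for t
    proof -
      obtain s where s: "0 \<le> s" "s \<le> 1" "t = s *\<^sub>R \<tau>" using \<open>t \<in> closed_segment 0 \<tau>\<close> by (auto simp: closed_segment_def)
      have "u + t *s ?v = (1 - s) *\<^sub>R u + s *\<^sub>R w"
        unfolding wu s(3) by (simp add: vec_eq_iff) (simp add: scaleR_conv_of_real algebra_simps)
      moreover have "(1 - s) *\<^sub>R u + s *\<^sub>R w \<in> ball z d"
        using convexD[OF convex_ball u w(1), of "1 - s" s] s by simp
      ultimately show ?thesis by simp
    qed
    \<comment> \<open>Subtracting the linear term turns the mean value inequality into closeness to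
      the derivative at \<open>z\<close>.\<close>
    let ?\<psi> = "\<lambda>t. F (u + t *s ?v) - t * pd F z ?v"
    have "norm (?\<psi> \<tau> - ?\<psi> 0) \<le> e * norm (\<tau> - 0)"
    proof (rule field_differentiable_bound[where S="closed_segment 0 \<tau>" and f'="\<lambda>t. pd F (u + t *s ?v) ?v - pd F z ?v"])
      fix t assume t: "t \<in> closed_segment 0 \<tau>"
      show "(?\<psi> has_field_derivative pd F (u + t *s ?v) ?v - pd F z ?v) (at t within closed_segment 0 \<tau>)"
      proof (rule has_field_derivative_at_within, rule DERIV_diff)
        show "((\<lambda>t. F (u + t *s ?v)) has_field_derivative pd F (u + t *s ?v) ?v) (at t)"
          by (rule nice_deriv[OF assms(1)]) (use seg[OF t] d(2) in blast)
        show "((\<lambda>t. t * pd F z ?v) has_field_derivative pd F z ?v) (at t)"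
          by (auto intro!: derivative_eq_intros)
      qed
      show "norm (pd F (u + t *s ?v) ?v - pd F z ?v) \<le> e" using b[OF seg[OF t]] .
    qed auto
    then have "norm ((F w - F u) - \<tau> * pd F z ?v) \<le> e * norm \<tau>"
      unfolding wu[symmetric] by (simp add: diff_diff_eq add.commute)
    moreover have "\<tau> \<noteq> 0" using w by (simp add: \<tau>_def)
    moreover have "(F w - F u) / \<tau> - pd F z ?v = ((F w - F u) - \<tau> * pd F z ?v) / \<tau>"
      using \<open>\<tau> \<noteq> 0\<close> by (simp add: field_simps)
    ultimately show ?thesis unfolding u_def[symmetric] \<tau>_def[symmetric]
      by (simp add: norm_divide divide_le_eq)
  qed
  with b d show ?thesis using that by blast
qed

lemma regular_sequence:
  fixes z :: "complex^'n::{finite,linorder}"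
  obtains X where "X \<longlonglongrightarrow> z" "\<forall>\<^sub>F n in sequentially. regular (X n)"
proof -
  \<comment> \<open>The rank of the index serves as a vector with pairwise distinct entries; adding
    small multiples of it separates equal coordinates and eventually keeps distinct ones
    distinct.\<close>
  define u :: "(complex, 'n) vec" where "u = (\<chi> i. of_nat (card {..<i}))"
  have u: "u $ i \<noteq> u $ j" if "i \<noteq> j" for i j
  proof -
    have "card {..<i} \<noteq> card {..<j}"
    proof (cases "i < j")
      case True then have "{..<i} \<subset> {..<j}" by auto
      then show ?thesis using psubset_card_mono[of "{..<j}" "{..<i}"] by simp
    next
      case False then have "{..<j} \<subset> {..<i}" using that by auto
      then show ?thesis using psubset_card_mono[of "{..<i}" "{..<j}"] by simp
    qed
    then show ?thesis by (simp add: u_def)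
  qed
  define X where "X n = z + inverse (of_nat (Suc n)) *s u" for n
  have lim: "X \<longlonglongrightarrow> z"
    unfolding X_def
  proof (rule vec_tendstoI)
    fix i
    have "(\<lambda>n. z $ i + inverse (of_nat (Suc n)) * u $ i) \<longlonglongrightarrow> z $ i + 0 * u $ i"
      by (intro tendsto_intros LIMSEQ_Suc[OF lim_inverse_n])
    then show "(\<lambda>n. (z + inverse (of_nat (Suc n)) *s u) $ i) \<longlonglongrightarrow> z $ i" by simp
  qed
  have "\<forall>\<^sub>F n in sequentially. \<forall>a. fst a \<noteq> snd a \<longrightarrow> X n $ fst a \<noteq> X n $ snd a"
  proof (rule eventually_all_finite)
    fix a :: "'n \<times> 'n"
    show "\<forall>\<^sub>F n in sequentially. fst a \<noteq> snd a \<longrightarrow> X n $ fst a \<noteq> X n $ snd a"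
    proof (cases "z $ fst a = z $ snd a")
      case True
      then show ?thesis using u by (auto simp: X_def simp del: of_nat_Suc)
    next
      case False
      have "(\<lambda>n. X n $ fst a - X n $ snd a) \<longlonglongrightarrow> z $ fst a - z $ snd a"
        by (intro tendsto_intros lim)
      then have "\<forall>\<^sub>F n in sequentially. X n $ fst a - X n $ snd a \<noteq> 0"
        using False by (intro tendsto_imp_eventually_ne) auto
      then show ?thesis by (rule eventually_mono) auto
    qed
  qed
  then have "\<forall>\<^sub>F n in sequentially. regular (X n)"
    by (rule eventually_mono) (auto simp: regular_def)
  with lim show ?thesis using that by blast
qed

text \<open>Regular points are dense by \<open>regular_sequence\<close>, which lets identities with
  quotients be checked off the hyperplanes only.\<close>

lemma continuous_eq_on_regular:
  fixes A B :: "complex^'n::{finite,linorder} \<Rightarrow> complex"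
  assumes "open D" "continuous_on D A" "continuous_on D B"
    and eq: "\<And>z. z \<in> D \<Longrightarrow> regular z \<Longrightarrow> A z = B z" and z: "z \<in> D"
  shows "A z = B z"
proof -
  obtain X where X: "X \<longlonglongrightarrow> z" "\<forall>\<^sub>F n in sequentially. regular (X n)" using regular_sequence by blast
  have "isCont A z" "isCont B z" using assms(1-3) z by (simp_all add: continuous_on_eq_continuous_at)
  then have lim: "(\<lambda>n. A (X n)) \<longlonglongrightarrow> A z" "(\<lambda>n. B (X n)) \<longlonglongrightarrow> B z"
    by (simp_all add: isCont_tendsto_compose[OF _ X(1)])
  have "\<forall>\<^sub>F n in sequentially. X n \<in> D"
    by (rule topological_tendstoD[OF X(1) assms(1) z])
  then have "\<forall>\<^sub>F n in sequentially. A (X n) = B (X n)"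
    using X(2) by eventually_elim (use eq in auto)
  then have "(\<lambda>n. B (X n)) \<longlonglongrightarrow> A z" using lim(1) by (simp add: tendsto_cong)
  then show ?thesis by (rule LIMSEQ_unique[OF _ lim(2)])
qed

lemma div_diff_hyperplane:
  fixes z :: "complex^'n::{finite,linorder}"
  assumes "nice D F" "open D" "z \<in> D" "z $ i = z $ j" "i \<noteq> j"
  shows "div_diff i j F z = pd F z (axis i 1 - axis j 1)"
proof -
  let ?S = "{w::(complex, 'n) vec. w $ i \<noteq> w $ j}"
  have "((\<lambda>w. (F w - F (swap_coord i j w)) / (w $ i - w $ j)) \<longlongrightarrow> pd F z (axis i 1 - axis j 1)) (at z within ?S)"
  proof (subst Lim_within, intro allI impI)
    fix e :: real assume "e > 0"
    then have e2: "e / 2 > 0" by simp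
    obtain d where d: "d > 0" "ball z d \<subseteq> D"
      "\<And>w. w \<in> ball z d \<Longrightarrow> w $ i \<noteq> w $ j \<Longrightarrow>
      norm ((F w - F (swap_coord i j w)) / (w $ i - w $ j) - pd F z (axis i 1 - axis j 1)) \<le> e / 2"
      by (rule divided_difference_limit[OF assms e2]) blast
    show "\<exists>d>0. \<forall>x\<in>?S. 0 < dist x z \<and> dist x z < d \<longrightarrow>
             dist ((F x - F (swap_coord i j x)) / (x $ i - x $ j)) (pd F z (axis i 1 - axis j 1)) < e"
    proof (intro exI[of _ d] conjI ballI impI)
      fix x assume x: "x \<in> ?S" "0 < dist x z \<and> dist x z < d"
      then have "norm ((F x - F (swap_coord i j x)) / (x $ i - x $ j) - pd F z (axis i 1 - axis j 1)) \<le> e / 2"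
        by (intro d(3)) (auto simp: dist_commute)
      then show "dist ((F x - F (swap_coord i j x)) / (x $ i - x $ j)) (pd F z (axis i 1 - axis j 1)) < e"
        using \<open>e > 0\<close> by (simp only: dist_norm)
    qed (rule d(1))
  qed
  \<comment> \<open>\<open>Lim\<close> has the expected value only along a nontrivial filter; points
    off the hyperplane do accumulate at \<open>z\<close>.\<close>
  moreover have "\<not> trivial_limit (at z within ?S)"
  proof -
    obtain X where X: "X \<longlonglongrightarrow> z" "\<forall>\<^sub>F n in sequentially. regular (X n)" using regular_sequence by blast
    show ?thesis unfolding trivial_limit_within islimpt_sequential not_not
    proof -
      obtain N where N: "\<And>n. n \<ge> N \<Longrightarrow> regular (X n)" using X(2) by (auto simp: eventually_sequentially)
      have "X (n + N) \<in> ?S - {z}" for n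
      proof -
        have "X (n + N) $ i \<noteq> X (n + N) $ j" using N[of "n + N"] assms(5) unfolding regular_def by simp
        then show ?thesis using assms(4) by auto
      qed
      moreover have "(\<lambda>n. X (n + N)) \<longlonglongrightarrow> z" using X(1) by (rule LIMSEQ_ignore_initial_segment)
      ultimately show "\<exists>f. (\<forall>n. f n \<in> ?S - {z}) \<and> f \<longlonglongrightarrow> z"
        by (intro exI[of _ "\<lambda>n. X (n + N)"] conjI allI)
    qed
  qed
  ultimately have "Lim (at z within ?S) (\<lambda>w. (F w - F (swap_coord i j w)) / (w $ i - w $ j)) = pd F z (axis i 1 - axis j 1)"
    by (intro tendsto_Lim)
  then show ?thesis using assms(4) by (simp add: div_diff_def)
qed

lemma div_diff_continuous:
  fixes D :: "(complex^'n::{finite,linorder}) set"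
  assumes "nice D F" "open D" and sw: "\<And>z. z \<in> D \<Longrightarrow> swap_coord i j z \<in> D" and "i \<noteq> j"
  shows "continuous_on D (div_diff i j F)"
proof (rule continuous_at_imp_continuous_on, rule ballI)
  fix z assume z: "z \<in> D"
  show "isCont (div_diff i j F) z"
  proof (cases "z $ i = z $ j")
    case True
    show ?thesis
    proof (subst continuous_at, intro tendstoI)
      fix e :: real assume "e > 0"
      then have e2: "e / 2 > 0" by simp
      obtain d where d: "d > 0" "ball z d \<subseteq> D"
        "\<And>w. w \<in> ball z d \<Longrightarrow> w $ i \<noteq> w $ j \<Longrightarrow>
        norm ((F w - F (swap_coord i j w)) / (w $ i - w $ j) - pd F z (axis i 1 - axis j 1)) \<le> e / 2"
        "\<And>w. w \<in> ball z d \<Longrightarrow> norm (pd F w (axis i 1 - axis j 1) - pd F z (axis i 1 - axis j 1)) \<le> e / 2"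
        by (rule divided_difference_limit[OF assms(1,2) z True assms(4) e2]) blast
      have "dist (div_diff i j F w) (div_diff i j F z) < e" if w: "w \<in> ball z d" for w
      proof (cases "w $ i = w $ j")
        case T: True
        have "div_diff i j F w = pd F w (axis i 1 - axis j 1)"
          using div_diff_hyperplane[OF assms(1,2) _ T assms(4)] w d(2) by blast
        then show ?thesis using d(4)[OF w] \<open>e > 0\<close> div_diff_hyperplane[OF assms(1,2) z True assms(4)]
          by (simp add: dist_norm)
      next
        case False
        then show ?thesis using d(3)[OF w False] \<open>e > 0\<close> div_diff_hyperplane[OF assms(1,2) z True assms(4)]
          by (simp add: dist_norm div_diff_def)
      qed
      then show "\<forall>\<^sub>F w in at z. dist (div_diff i j F w) (div_diff i j F z) < e"
        by (intro eventually_mono[OF eventually_at_ball[OF d(1), of z UNIV]]) simp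
    qed
  next
    case False
    let ?U = "D \<inter> {w. w $ i \<noteq> w $ j}"
    have "open {w::(complex, 'n) vec. w $ i \<noteq> w $ j}"
      by (intro open_Collect_neq continuous_intros)
    then have U: "open ?U" using assms(2) by auto
    have c: "continuous_on D F" using assms(1) by (simp add: nice_def)
    have c2: "continuous_on D (\<lambda>w. F (swap_coord i j w))"
      by (rule continuous_on_compose2[OF c]) (use sw in \<open>auto intro!: continuous_intros\<close>)
    have "continuous_on ?U (\<lambda>w. (F w - F (swap_coord i j w)) / (w $ i - w $ j))"
      by (intro continuous_intros continuous_on_subset[OF c] continuous_on_subset[OF c2]) auto
    then have "continuous_on ?U (div_diff i j F)"
      by (rule continuous_on_eq) (auto simp: div_diff_def)
    then show ?thesis using U z False by (simp add: continuous_on_eq_continuous_at)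
  qed
qed

lemma dunkl_op_continuous:
  fixes D :: "(complex^'n::{finite,linorder}) set"
  assumes "nice D F" "open D" and "\<And>i j z. z \<in> D \<Longrightarrow> swap_coord i j z \<in> D"
  shows "continuous_on D (dunkl_op k xi F)"
proof -
  have 1: "continuous_on D (dir_deriv xi F)"
    using pd_continuous[OF assms(1,2), of "cvec xi"] by (simp add: pd_def dir_deriv_def[abs_def])
  have 2: "continuous_on D (\<lambda>z. div_diff i j F z)" if "i < j" for i j
    using div_diff_continuous[OF assms(1,2,3), of i j] that by auto
  show ?thesis unfolding dunkl_op_def[abs_def]
    by (intro continuous_on_add continuous_on_mult continuous_on_const continuous_on_sum 1)
       (auto intro!: continuous_on_mult continuous_on_const 2)
qed

text \<open>The Dunkl operator off the reflection hyperplanes, as a sum over all ordered pairs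
  (the diagonal terms vanish since \<open>x / 0 = 0\<close>).\<close>
definition Tr :: "real \<Rightarrow> complex^'n::finite \<Rightarrow> (complex^'n \<Rightarrow> complex) \<Rightarrow> complex^'n \<Rightarrow> complex" where
  "Tr k xi f z = pd f z xi + complex_of_real (k/2) * (\<Sum>a\<in>UNIV.
     (xi $ fst a - xi $ snd a) * ((f z - f (swapp a z)) / (z $ fst a - z $ snd a)))"

lemma sum_ordered_pairs:
  fixes F :: "'n::{finite,linorder} \<Rightarrow> 'n \<Rightarrow> complex"
  assumes "\<And>i j. F i j = F j i" "\<And>i. F i i = 0"
  shows "(\<Sum>a\<in>UNIV. F (fst a) (snd a)) = 2 * (\<Sum>(i,j)\<in>{(i,j). i < j}. F i j)"
proof -
  have "(UNIV :: ('n \<times> 'n) set) = {(i,j). i < j} \<union> {(i,j). j < i} \<union> {(i,j). i = j}" by auto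
  then have "(\<Sum>a\<in>UNIV. F (fst a) (snd a)) = (\<Sum>a\<in>{(i,j). i < j} \<union> {(i,j). j < i} \<union> {(i,j). i = j}. F (fst a) (snd a))" by simp
  also have "\<dots> = (\<Sum>a\<in>{(i,j). i < j}. F (fst a) (snd a)) + (\<Sum>a\<in>{(i,j). j < i}. F (fst a) (snd a)) + (\<Sum>a\<in>{(i,j). i = j}. F (fst a) (snd a))"
    by (subst sum.union_disjoint; (subst sum.union_disjoint)?) auto
  also have "(\<Sum>a\<in>{(i,j). i = j}. F (fst a) (snd a)) = 0" using assms(2) by (intro sum.neutral) auto
  also have "(\<Sum>a\<in>{(i,j). j < i}. F (fst a) (snd a)) = (\<Sum>a\<in>{(i,j). i < j}. F (fst a) (snd a))"
    by (rule sum.reindex_bij_witness[where i="\<lambda>(i,j). (j,i)" and j="\<lambda>(i,j). (j,i)"]) (auto simp: assms(1))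
  finally show ?thesis by (simp add: case_prod_unfold)
qed

lemma dunkl_op_regular:
  assumes "regular z"
  shows "dunkl_op k xi f z = Tr k (cvec xi) f z"
proof -
  have "(\<Sum>a\<in>UNIV. (cvec xi $ fst a - cvec xi $ snd a) * ((f z - f (swapp a z)) / (z $ fst a - z $ snd a)))
    = 2 * (\<Sum>(i,j)\<in>{(i,j). i < j}. (cvec xi $ i - cvec xi $ j) * ((f z - f (swap_coord i j z)) / (z $ i - z $ j)))"
  proof (rule sum_ordered_pairs)
    fix i j
    have "(f z - f (swap_coord j i z)) / (z $ j - z $ i) = - ((f z - f (swap_coord i j z)) / (z $ i - z $ j))"
      by (metis minus_diff_eq minus_divide_right swap_coord_commute)
    then show "(cvec xi $ i - cvec xi $ j) * ((f z - f (swap_coord i j z)) / (z $ i - z $ j)) =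
      (cvec xi $ j - cvec xi $ i) * ((f z - f (swap_coord j i z)) / (z $ j - z $ i))"
      using minus_mult_minus[of "cvec xi $ i - cvec xi $ j" "(f z - f (swap_coord i j z)) / (z $ i - z $ j)"]
      by (simp only: minus_diff_eq)
  qed auto
  also have "(\<Sum>(i,j)\<in>{(i,j). i < j}. (cvec xi $ i - cvec xi $ j) * ((f z - f (swap_coord i j z)) / (z $ i - z $ j)))
    = (\<Sum>(i,j)\<in>{(i,j). i < j}. complex_of_real (xi $ i - xi $ j) * div_diff i j f z)"
    using assms by (intro sum.cong) (auto simp: div_diff_def regular_def cvec_def)
  finally show ?thesis by (simp add: dunkl_op_def Tr_def dir_deriv_def pd_def)
qed

text \<open>This is how formulas for \<open>dunkl_op\<close> are reduced to \<open>Tr\<close>: on a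
  hyperplane \<open>Tr\<close> drops the divided difference whereas \<open>dunkl_op\<close> keeps
  its limit, so the two are compared at regular points and the rest follows by continuity.\<close>

lemma dunkl_op_eqI:
  fixes D :: "(complex^'n::{finite,linorder}) set"
  assumes "nice D F" "open D" and "\<And>i j z. z \<in> D \<Longrightarrow> swap_coord i j z \<in> D"
    and "continuous_on D G" and "\<And>z. z \<in> D \<Longrightarrow> regular z \<Longrightarrow> Tr k (cvec xi) F z = G z" and "z \<in> D"
  shows "dunkl_op k xi F z = G z"
  by (rule continuous_eq_on_regular[OF assms(2) dunkl_op_continuous[OF assms(1,2,3)] assms(4)])
     (simp_all add: dunkl_op_regular assms(3,5,6))

subsection \<open>The Dunkl kernel as a power series\<close>

definition cmul2 :: "complex \<Rightarrow> (complex^'n) \<times> (complex^'n) \<Rightarrow> (complex^'n) \<times> (complex^'n)" where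
  "cmul2 c p = (c *s fst p, c *s snd p)"

definition cderiv :: "((complex^'n) \<times> (complex^'n) \<Rightarrow> complex) \<Rightarrow> (complex^'n) \<times> (complex^'n) \<Rightarrow> ((complex^'n) \<times> (complex^'n) \<Rightarrow> complex) \<Rightarrow> bool" where
  "cderiv F p D \<longleftrightarrow> (F has_derivative D) (at p) \<and> (\<forall>c v. D (cmul2 c v) = c * D v)"

lemma bounded_linear_smult_left: "bounded_linear (\<lambda>s. s *s (v :: complex^'n))"
  by (rule linear_conv_bounded_linear[THEN iffD1], rule linearI)
     (simp_all add: vec_eq_iff algebra_simps)

lemma bounded_linear_cmul2: "bounded_linear (\<lambda>s. cmul2 s u)"
  unfolding cmul2_def by (intro bounded_linear_Pair bounded_linear_smult_left)

lemma norm_cmul2: "norm (cmul2 c p) = norm c * norm p"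
proof -
  have "(norm c * norm (fst p))\<^sup>2 + (norm c * norm (snd p))\<^sup>2 = (norm c)\<^sup>2 * ((norm (fst p))\<^sup>2 + (norm (snd p))\<^sup>2)"
    by (simp add: power_mult_distrib algebra_simps)
  then show ?thesis by (simp add: cmul2_def norm_prod_def norm_vec_smult real_sqrt_mult)
qed

lemma cderiv_const: "cderiv (\<lambda>p. c) p (\<lambda>h. 0)"
  by (simp add: cderiv_def)

lemma cderiv_mult:
  "cderiv F p D \<Longrightarrow> cderiv G p D' \<Longrightarrow> cderiv (\<lambda>p. F p * G p) p (\<lambda>h. F p * D' h + D h * G p)"
  by (auto simp: cderiv_def algebra_simps intro!: derivative_eq_intros)

lemma cderiv_sum:
  "(\<And>i. i \<in> I \<Longrightarrow> cderiv (F i) p (D i)) \<Longrightarrow> cderiv (\<lambda>p. \<Sum>i\<in>I. F i p) p (\<lambda>h. \<Sum>i\<in>I. D i h)"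
  by (auto simp: cderiv_def sum_distrib_left intro!: has_derivative_sum)

lemma cderiv_fst: "cderiv (\<lambda>p. fst p $ i) p (\<lambda>h. fst h $ i)"
  unfolding cderiv_def cmul2_def
  by (auto intro!: bounded_linear.has_derivative[OF bounded_linear_compose[OF bounded_linear_vec_nth bounded_linear_fst]] derivative_eq_intros)

lemma cderiv_snd: "cderiv (\<lambda>p. snd p $ i) p (\<lambda>h. snd h $ i)"
  unfolding cderiv_def cmul2_def
  by (auto intro!: bounded_linear.has_derivative[OF bounded_linear_compose[OF bounded_linear_vec_nth bounded_linear_snd]] derivative_eq_intros)

definition cdiff :: "((complex^'n) \<times> (complex^'n) \<Rightarrow> complex) \<Rightarrow> (complex^'n) \<times> (complex^'n) \<Rightarrow> bool" where
  "cdiff F p \<longleftrightarrow> (\<exists>D. cderiv F p D)"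

lemma cdiffI: "cderiv F p D \<Longrightarrow> cdiff F p"
  by (auto simp: cdiff_def)

lemma cdiff_mult: "cdiff F p \<Longrightarrow> cdiff G p \<Longrightarrow> cdiff (\<lambda>p. F p * G p) p"
  unfolding cdiff_def by (elim exE, rule exI, rule cderiv_mult)

lemma cdiff_sum: "(\<And>i. i \<in> I \<Longrightarrow> cdiff (F i) p) \<Longrightarrow> cdiff (\<lambda>p. \<Sum>i\<in>I. F i p) p"
proof (rule cdiffI, rule cderiv_sum)
  fix i assume "\<And>i. i \<in> I \<Longrightarrow> cdiff (F i) p" "i \<in> I"
  then have "\<exists>D. cderiv (F i) p D" by (simp add: cdiff_def)
  then show "cderiv (F i) p (SOME D. cderiv (F i) p D)" by (rule someI_ex)
qed

text \<open>The reindexing \<open>act w\<close> is there for the induction, since the recursion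
  evaluates the previous component at \<open>act w z\<close>.\<close>

lemma cdiff_dhom_act: "cdiff (\<lambda>p. dhom k m (fst p) (act w (snd p))) p"
proof (induction m arbitrary: w)
  case 0
  show ?case unfolding dhom.simps by (rule cdiffI, rule cderiv_const)
next
  case (Suc m)
  show ?case unfolding dhom.simps act_act cdot_def act_nth
    by (intro cdiff_sum cdiff_mult Suc.IH cdiffI[OF cderiv_const] cdiffI[OF cderiv_fst] cdiffI[OF cderiv_snd])
qed

definition dD :: "real \<Rightarrow> nat \<Rightarrow> (complex^'n) \<times> (complex^'n) \<Rightarrow> ((complex^'n) \<times> (complex^'n) \<Rightarrow> complex)" where
  "dD k m p = (SOME D. cderiv (\<lambda>p. dhom k m (fst p) (snd p)) p D)"

lemma cderiv_dhom: "cderiv (\<lambda>p. dhom k m (fst p) (snd p)) p (dD k m p)"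
  using someI_ex[OF cdiff_dhom_act[of k m id p, unfolded cdiff_def]] unfolding dD_def by simp

lemma cderiv_line:
  assumes "cderiv F (p + cmul2 t u) D"
  shows "((\<lambda>s. F (p + cmul2 s u)) has_field_derivative D u) (at t)"
proof -
  have "((\<lambda>s. p + cmul2 s u) has_derivative (\<lambda>s. cmul2 s u)) (at t)"
    using has_derivative_add[OF has_derivative_const bounded_linear.has_derivative[OF bounded_linear_cmul2 has_derivative_ident]]
    by simp
  moreover have "(F has_derivative D) (at (p + cmul2 t u))" using assms by (simp add: cderiv_def)
  ultimately have "(F \<circ> (\<lambda>s. p + cmul2 s u) has_derivative D \<circ> (\<lambda>s. cmul2 s u)) (at t)"
    by (rule diff_chain_at)
  moreover have "D \<circ> (\<lambda>s. cmul2 s u) = (*) (D u)"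
  proof
    show "(D \<circ> (\<lambda>s. cmul2 s u)) x = D u * x" for x
      using assms unfolding cderiv_def by (metis comp_apply mult.commute)
  qed
  ultimately show ?thesis by (simp add: has_field_derivative_def o_def)
qed

text \<open>Cauchy's estimate on the unit disc in direction \<open>h / norm h\<close>: a bound on
  the values alone controls the derivative, which makes the derivative series of the kernel
  summable.\<close>

lemma cderiv_bound:
  assumes D: "\<And>q. cderiv F q (D q)" and B: "\<And>q. norm q \<le> norm p + 1 \<Longrightarrow> norm (F q) \<le> B"
  shows "norm (D p h) \<le> B * norm h"
proof (cases "h = 0")
  case True
  have "linear (D p)" using D[of p] unfolding cderiv_def by (auto intro: has_derivative_linear)
  then show ?thesis using True by (simp add: linear_0)
next
  case False
  have lin: "linear (D p)" using D[of p] unfolding cderiv_def by (auto intro: has_derivative_linear)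
  define u where "u = (1 / norm h) *\<^sub>R h"
  have nu: "norm u = 1" using False by (simp add: u_def)
  have hu: "h = norm h *\<^sub>R u" using False by (simp add: u_def)
  let ?\<phi> = "\<lambda>s. F (p + cmul2 s u)"
  have hol: "?\<phi> holomorphic_on S" for S
    unfolding holomorphic_on_def field_differentiable_def
    by (intro ballI, rule exI, rule has_field_derivative_at_within, rule cderiv_line, rule D)
  have "p + cmul2 0 u = p" by (simp add: cmul2_def prod_eq_iff)
  then have "deriv ?\<phi> 0 = D p u" using DERIV_imp_deriv[OF cderiv_line[of F p 0 u "D p"]] D by simp
  moreover have "norm ((deriv ^^ 1) ?\<phi> 0) \<le> fact 1 * B / 1 ^ 1"
  proof (rule Cauchy_inequality)
    fix x :: complex assume "norm (0 - x) = 1"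
    then have "norm (p + cmul2 x u) \<le> norm p + 1"
      using norm_triangle_ineq[of p "cmul2 x u"] nu by (simp add: norm_cmul2)
    then show "norm (F (p + cmul2 x u)) \<le> B" by (rule B)
  qed (use hol in \<open>auto intro: holomorphic_on_imp_continuous_on\<close>)
  ultimately have "norm (D p u) \<le> B" by simp
  moreover have "D p h = norm h *\<^sub>R D p u" by (subst hu) (simp add: linear_scale[OF lin])
  ultimately show ?thesis by (simp add: mult.commute[of B] mult_left_mono)
qed

lemma dhom_bound_norm:
  fixes p :: "(complex^'n::finite) \<times> (complex^'n)" and R :: real
  assumes "k \<ge> 0" "norm p \<le> R"
  shows "norm (dhom k m (fst p) (snd p)) \<le> (R * (CARD('n) * R)) ^ m / fact m"
proof -
  have R: "0 \<le> R" using assms(2) norm_ge_zero order_trans by blast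
  have f: "norm (fst p $ i) \<le> R" for i
    using Finite_Cartesian_Product.norm_nth_le[of "fst p" i] norm_fst_le[of "fst p" "snd p"] assms(2) by simp
  have s: "norm (snd p $ i) \<le> R" for i
    using Finite_Cartesian_Product.norm_nth_le[of "snd p" i] norm_snd_le[of "snd p" "fst p"] assms(2) by simp
  have "(\<Sum>i\<in>UNIV. norm (snd p $ i)) \<le> CARD('n) * R"
    using sum_bounded_above[of UNIV "\<lambda>i. norm (snd p $ i)" R] s by simp
  then have "(R * (\<Sum>i\<in>UNIV. norm (snd p $ i))) ^ m / fact m \<le> (R * (CARD('n) * R)) ^ m / fact m"
    using R by (intro divide_right_mono power_mono mult_left_mono mult_nonneg_nonneg sum_nonneg) auto
  with dhom_bound[OF assms(1), of "fst p" R m "snd p", OF f] show ?thesis by linarith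
qed

definition dker :: "real \<Rightarrow> complex^'n::finite \<Rightarrow> complex^'n \<Rightarrow> complex" where
  "dker k l z = (\<Sum>m. dhom k m l z)"

lemma summable_exp_real: "summable (\<lambda>m. (x::real) ^ m / fact m)"
  using summable_exp_generic[of x] by (simp add: divide_inverse mult.commute)

lemma summable_dhom:
  assumes "k \<ge> 0"
  shows "summable (\<lambda>m. norm (dhom k m l z))"
proof (rule summable_comparison_test'[where N=0, OF summable_exp_real])
  show "norm (norm (dhom k m l z)) \<le> (norm (l, z) * (CARD('a) * norm (l, z))) ^ m / fact m" for m
    using dhom_bound_norm[OF assms, of "(l,z)" "norm (l,z)" m] by simp
qed

lemma dhom_sums:
  assumes "k \<ge> 0"
  shows "(\<lambda>m. dhom k m l z) sums dker k l z"
  unfolding dker_def by (rule summable_sums[OF summable_norm_cancel[OF summable_dhom[OF assms]]])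

lemma dker_bound:
  fixes l z :: "complex^'n::finite"
  assumes "k \<ge> 0" "\<And>i. norm (l $ i) \<le> L"
  shows "norm (dker k l z) \<le> exp (L * (\<Sum>i\<in>UNIV. norm (z $ i)))"
proof -
  let ?x = "L * (\<Sum>i\<in>UNIV. norm (z $ i))"
  have "norm (dker k l z) \<le> (\<Sum>m. norm (dhom k m l z))"
    unfolding dker_def by (rule summable_norm[OF summable_dhom[OF assms(1)]])
  also have "\<dots> \<le> (\<Sum>m. ?x ^ m / fact m)"
    by (intro suminf_le dhom_bound assms summable_dhom summable_exp_real)
  also have "\<dots> = exp ?x" by (simp add: exp_def divide_inverse mult.commute)
  finally show ?thesis .
qed

lemma dD_bound:
  fixes p :: "(complex^'n::finite) \<times> (complex^'n)" and R :: real
  assumes "k \<ge> 0" "norm p \<le> R"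
  shows "norm (dD k m p h) \<le> ((R + 1) * (CARD('n) * (R + 1))) ^ m / fact m * norm h"
  by (rule cderiv_bound[where F="\<lambda>p. dhom k m (fst p) (snd p)" and D="\<lambda>q. dD k m q", OF cderiv_dhom])
     (rule dhom_bound_norm[OF assms(1)], use assms(2) in linarith)

lemma summable_dD:
  assumes "k \<ge> 0"
  shows "summable (\<lambda>m. dD k m p h)"
proof (rule summable_comparison_test'[where N=0])
  show "norm (dD k m p h) \<le> ((norm p + 1) * (CARD('a) * (norm p + 1))) ^ m / fact m * norm h" for m
    using dD_bound[OF assms, of p "norm p" m h] by simp
qed (intro summable_mult2 summable_exp_real)

text \<open>Termwise differentiation. On the ball of radius \<open>norm p + 1\<close> the
  derivatives are dominated by an exponential series, so their partial sums converge uniformly in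
  operator norm.\<close>

lemma cderiv_dker:
  fixes p :: "(complex^'n::finite) \<times> (complex^'n)"
  assumes "k \<ge> 0"
  shows "cderiv (\<lambda>p. dker k (fst p) (snd p)) p (\<lambda>h. \<Sum>m. dD k m p h)"
  unfolding cderiv_def
proof (intro conjI allI)
  fix c v
  have "dD k m p (cmul2 c v) = c * dD k m p v" for m
    using cderiv_dhom[of k m p] unfolding cderiv_def by blast
  then show "(\<Sum>m. dD k m p (cmul2 c v)) = c * (\<Sum>m. dD k m p v)"
    using suminf_mult[OF summable_dD[OF assms, of p v], of c] by simp
next
  define R where "R = norm p + 1"
  define a where "a m = ((R + 1) * (CARD('n) * (R + 1))) ^ m / fact m" for m :: nat
  have a: "summable a" unfolding a_def by (rule summable_exp_real)
  have bnd: "norm (dD k m x h) \<le> a m * norm h" if "x \<in> ball 0 R" for m h and x :: "(complex^'n) \<times> (complex^'n)"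
    unfolding a_def using dD_bound[OF assms, of x R m h] that by simp
  have "\<exists>g. \<forall>x\<in>ball (0 :: (complex^'n) \<times> (complex^'n)) R. (\<lambda>m. dhom k m (fst x) (snd x)) sums (g x) \<and> (g has_derivative (\<lambda>h. \<Sum>m. dD k m x h)) (at x within ball 0 R)"
  proof (rule has_derivative_series[where f'="\<lambda>m x. dD k m x" and x=p])
    show "((\<lambda>x. dhom k n (fst x) (snd x)) has_derivative dD k n x) (at x within ball 0 R)" for n x
      using cderiv_dhom[of k n x] by (auto simp: cderiv_def intro: has_derivative_at_withinI)
    fix e :: real assume e: "e > 0"
    obtain N where N: "\<And>n. n \<ge> N \<Longrightarrow> norm (\<Sum>i. a (i + n)) < e"
      using suminf_exist_split[OF e a] by blast
    show "\<forall>\<^sub>F n in sequentially. \<forall>x\<in>ball (0 :: (complex^'n) \<times> (complex^'n)) R. \<forall>h. norm (sum (\<lambda>i. dD k i x h) {..<n} - (\<Sum>m. dD k m x h)) \<le> e * norm h"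
      unfolding eventually_sequentially
    proof (intro exI[of _ N] allI impI ballI)
      fix n and x h :: "(complex^'n) \<times> (complex^'n)" assume n: "N \<le> n" and x: "x \<in> ball 0 R"
      have sn: "summable (\<lambda>i. dD k (i + n) x h)"
        by (rule summable_ignore_initial_segment[OF summable_dD[OF assms]])
      have san: "summable (\<lambda>i. a (i + n) * norm h)"
        using a by (intro summable_mult2) (simp add: summable_iff_shift)
      have "(\<Sum>m. dD k m x h) = (\<Sum>i. dD k (i + n) x h) + sum (\<lambda>i. dD k i x h) {..<n}"
        by (rule suminf_split_initial_segment[OF summable_dD[OF assms]])
      then have "norm (sum (\<lambda>i. dD k i x h) {..<n} - (\<Sum>m. dD k m x h)) = norm (\<Sum>i. dD k (i + n) x h)"
        by (simp add: norm_minus_commute)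
      also have "\<dots> \<le> (\<Sum>i. a (i + n) * norm h)"
        by (rule norm_suminf_le[OF bnd[OF x] san])
      also have "\<dots> = (\<Sum>i. a (i + n)) * norm h"
        using a by (intro suminf_mult2[symmetric]) (simp add: summable_iff_shift)
      also have "\<dots> \<le> e * norm h" using N[OF n] by (intro mult_right_mono) auto
      finally show "norm (sum (\<lambda>i. dD k i x h) {..<n} - (\<Sum>m. dD k m x h)) \<le> e * norm h" .
    qed
  next
    show "p \<in> ball 0 R" by (simp add: R_def)
    show "(\<lambda>m. dhom k m (fst p) (snd p)) sums dker k (fst p) (snd p)" by (rule dhom_sums[OF assms])
  qed simp
  then obtain g where g0: "\<forall>x\<in>ball (0 :: (complex^'n) \<times> (complex^'n)) R. (\<lambda>m. dhom k m (fst x) (snd x)) sums (g x) \<and> (g has_derivative (\<lambda>h. \<Sum>m. dD k m x h)) (at x within ball 0 R)"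
    by (rule exE)
  note g = g0[rule_format, THEN conjunct1] g0[rule_format, THEN conjunct2]
  have p: "p \<in> ball 0 R" by (simp add: R_def)
  have eq: "g x = dker k (fst x) (snd x)" if "x \<in> ball 0 R" for x
    using sums_unique2[OF g(1)[OF that] dhom_sums[OF assms]] .
  have "(g has_derivative (\<lambda>h. \<Sum>m. dD k m p h)) (at p)"
    using g(2)[OF p] at_within_open[OF p] by simp
  then show "((\<lambda>p. dker k (fst p) (snd p)) has_derivative (\<lambda>h. \<Sum>m. dD k m p h)) (at p)"
    by (rule has_derivative_transform_within_open[OF _ open_ball p eq])
qed

lemma cderiv_pd:
  assumes "cderiv F (l, z) D"
  shows "((\<lambda>t. F (l, z + t *s v)) has_field_derivative D (0, v)) (at 0)" "pd (\<lambda>z. F (l, z)) z v = D (0, v)"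
proof -
  have e: "(l, z) + cmul2 s (0, v) = (l, z + s *s v)" for s by (simp add: cmul2_def)
  show d: "((\<lambda>t. F (l, z + t *s v)) has_field_derivative D (0, v)) (at 0)"
    using cderiv_line[of F "(l,z)" 0 "(0,v)" D] assms unfolding e by simp
  then show "pd (\<lambda>z. F (l, z)) z v = D (0, v)" unfolding pd_def by (rule DERIV_imp_deriv)
qed

lemma cderiv_nice:
  assumes "\<And>z. cderiv F (l, z) (D z)"
  shows "nice UNIV (\<lambda>z. F (l, z))"
  unfolding nice_def
proof (intro conjI ballI allI)
  have "((\<lambda>z. F (l, z)) has_derivative (\<lambda>v. D z (0, v))) (at z)" for z
  proof -
    have "((\<lambda>z. (l, z)) has_derivative (\<lambda>v. (0, v))) (at z)" by (auto intro!: derivative_eq_intros)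
    moreover have "(F has_derivative D z) (at (l, z))" using assms by (simp add: cderiv_def)
    ultimately have "(F \<circ> (\<lambda>z. (l, z)) has_derivative D z \<circ> (\<lambda>v. (0, v))) (at z)" by (rule diff_chain_at)
    then show ?thesis by (simp add: o_def)
  qed
  then show "continuous_on UNIV (\<lambda>z. F (l, z))"
    by (intro continuous_at_imp_continuous_on ballI has_derivative_continuous)
  show "(\<lambda>t. F (l, z + t *s v)) field_differentiable at 0" for z v
    using cderiv_pd(1)[OF assms] by (auto simp: field_differentiable_def)
qed

lemma nice_dhom: "nice UNIV (dhom k m l)"
  using cderiv_nice[of "\<lambda>p. dhom k m (fst p) (snd p)" l "\<lambda>z. dD k m (l,z)", OF cderiv_dhom] by simp

lemma nice_dker: "k \<ge> 0 \<Longrightarrow> nice UNIV (dker k l)"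
  using cderiv_nice[of "\<lambda>p. dker k (fst p) (snd p)" l "\<lambda>z h. \<Sum>m. dD k m (l,z) h", OF cderiv_dker] by simp

lemma pd_dker_sums:
  assumes "k \<ge> 0"
  shows "(\<lambda>m. pd (dhom k m l) z v) sums pd (dker k l) z v"
proof -
  have "pd (dhom k m l) z v = dD k m (l,z) (0,v)" for m
    using cderiv_pd(2)[OF cderiv_dhom[of k m "(l,z)"], of v] by simp
  moreover have "pd (dker k l) z v = (\<Sum>m. dD k m (l,z) (0,v))"
    using cderiv_pd(2)[OF cderiv_dker[OF assms, of "(l,z)"], of v] by simp
  ultimately show ?thesis using summable_sums[OF summable_dD[OF assms, of "(l,z)" "(0,v)"]] by simp
qed

section \<open>Calculus of directional derivatives and of \<open>Tr\<close>\<close>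

lemma pd_eqI: "((\<lambda>t. f (z + t *s v)) has_field_derivative D) (at 0) \<Longrightarrow> pd f z v = D"
  unfolding pd_def by (rule DERIV_imp_deriv)

lemma nice_deriv_UNIV: "nice UNIV f \<Longrightarrow> ((\<lambda>t. f (z + t *s v)) has_field_derivative pd f z v) (at 0)"
  by (rule nice_deriv0) auto

lemma niceI:
  assumes "continuous_on UNIV f" "\<And>z v. ((\<lambda>t. f (z + t *s v)) has_field_derivative D z v) (at 0)"
  shows "nice UNIV f"
  unfolding nice_def field_differentiable_def by (intro conjI ballI allI assms(1)) (rule exI, rule assms(2))

lemma nice_continuous: "nice D f \<Longrightarrow> continuous_on D f"
  by (simp add: nice_def)

lemma nice_const: "nice UNIV (\<lambda>z. c)"
  by (rule niceI[where D="\<lambda>_ _. 0"]) auto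

lemma nice_diff: "nice UNIV f \<Longrightarrow> nice UNIV g \<Longrightarrow> nice UNIV (\<lambda>z. f z - g z)"
proof (rule niceI)
  assume f: "nice UNIV f" and g: "nice UNIV g"
  show "continuous_on UNIV (\<lambda>z. f z - g z)" by (intro continuous_intros nice_continuous f g)
  show "((\<lambda>t. f (z + t *s v) - g (z + t *s v)) has_field_derivative
    pd f z v - pd g z v) (at 0)" for z v
    by (rule DERIV_diff[OF nice_deriv_UNIV[OF f] nice_deriv_UNIV[OF g]])
qed

lemma nice_mult: "nice UNIV f \<Longrightarrow> nice UNIV g \<Longrightarrow> nice UNIV (\<lambda>z. f z * g z)"
proof (rule niceI)
  assume f: "nice UNIV f" and g: "nice UNIV g"
  show "continuous_on UNIV (\<lambda>z. f z * g z)" by (intro continuous_intros nice_continuous f g)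
  show "((\<lambda>t. f (z + t *s v) * g (z + t *s v)) has_field_derivative
    pd f z v * g (z + 0 *s v) + pd g z v * f (z + 0 *s v)) (at 0)" for z v
    by (rule DERIV_mult[OF nice_deriv_UNIV[OF f] nice_deriv_UNIV[OF g]])
qed

lemma nice_sum: "(\<And>i. i \<in> I \<Longrightarrow> nice UNIV (f i)) \<Longrightarrow> nice UNIV (\<lambda>z. \<Sum>i\<in>I. f i z)"
proof (rule niceI)
  assume f: "\<And>i. i \<in> I \<Longrightarrow> nice UNIV (f i)"
  show "continuous_on UNIV (\<lambda>z. \<Sum>i\<in>I. f i z)" by (intro continuous_intros nice_continuous f)
  show "((\<lambda>t. \<Sum>i\<in>I. f i (z + t *s v)) has_field_derivative (\<Sum>i\<in>I. pd (f i) z v)) (at 0)" for z v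
    by (rule DERIV_sum[OF nice_deriv_UNIV[OF f]])
qed

lemma nice_swap: "nice UNIV f \<Longrightarrow> nice UNIV (\<lambda>z. f (swap_coord i j z))"
proof (rule niceI[where D="\<lambda>z v. pd f (swap_coord i j z) (swap_coord i j v)"])
  assume f: "nice UNIV f"
  show "continuous_on UNIV (\<lambda>z. f (swap_coord i j z))"
    by (rule continuous_on_compose2[OF nice_continuous[OF f]]) (auto intro!: continuous_intros)
  show "((\<lambda>t. f (swap_coord i j (z + t *s v))) has_field_derivative pd f (swap_coord i j z) (swap_coord i j v)) (at 0)" for z v
    using nice_deriv_UNIV[OF f] by (simp add: swap_coord_add swap_coord_smult)
qed

lemma cdot_line: "cdot l (z + t *s v) = cdot l z + t * cdot l v"
  by (simp add: cdot_def sum.distrib sum_distrib_left algebra_simps)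

lemma continuous_on_cdot [continuous_intros]: "continuous_on S (cdot l)"
  unfolding cdot_def[abs_def] by (intro continuous_intros)

lemma nice_cdot: "nice UNIV (cdot l)"
  by (rule niceI[where D="\<lambda>z v. cdot l v"])
    (auto simp: cdot_line intro!: continuous_intros derivative_eq_intros)

lemma pd_cdot: "pd (cdot l) z v = cdot l v"
  by (rule pd_eqI) (auto simp: cdot_line intro!: derivative_eq_intros)

lemma pd_add: "nice UNIV f \<Longrightarrow> nice UNIV g \<Longrightarrow> pd (\<lambda>z. f z + g z) z v = pd f z v + pd g z v"
  by (rule pd_eqI, rule DERIV_add) (auto intro: nice_deriv_UNIV)

lemma pd_diff: "nice UNIV f \<Longrightarrow> nice UNIV g \<Longrightarrow> pd (\<lambda>z. f z - g z) z v = pd f z v - pd g z v"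
  by (rule pd_eqI, rule DERIV_diff) (auto intro: nice_deriv_UNIV)

lemma pd_mult: "nice UNIV f \<Longrightarrow> nice UNIV g \<Longrightarrow> pd (\<lambda>z. f z * g z) z v = pd f z v * g z + pd g z v * f z"
  by (rule pd_eqI, rule DERIV_cong, rule DERIV_mult) (auto intro: nice_deriv_UNIV)

lemma pd_const: "pd (\<lambda>z. c) z v = 0"
  by (rule pd_eqI) auto

lemma Tr_const: "Tr k xi (\<lambda>z. c) z = 0"
  by (simp add: Tr_def pd_const)

lemma Tr_add: "nice UNIV f \<Longrightarrow> nice UNIV g \<Longrightarrow> Tr k xi (\<lambda>z. f z + g z) z = Tr k xi f z + Tr k xi g z"
  by (simp add: Tr_def pd_add sum.distrib algebra_simps add_divide_distrib diff_divide_distrib sum_subtractf)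

lemma Tr_diff: "nice UNIV f \<Longrightarrow> nice UNIV g \<Longrightarrow> Tr k xi (\<lambda>z. f z - g z) z = Tr k xi f z - Tr k xi g z"
  by (simp add: Tr_def pd_diff sum.distrib algebra_simps add_divide_distrib diff_divide_distrib sum_subtractf)

lemma Tr_cmult: "nice UNIV f \<Longrightarrow> Tr k xi (\<lambda>z. c * f z) z = c * Tr k xi f z"
proof -
  assume f: "nice UNIV f"
  have "pd (\<lambda>z. c * f z) z xi = c * pd f z xi"
    by (simp add: pd_mult[OF nice_const f] pd_const mult.commute)
  moreover have "(\<Sum>a\<in>UNIV. (xi $ fst a - xi $ snd a) * ((c * f z - c * f (swapp a z)) / (z $ fst a - z $ snd a)))
    = c * (\<Sum>a\<in>UNIV. (xi $ fst a - xi $ snd a) * ((f z - f (swapp a z)) / (z $ fst a - z $ snd a)))"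
    unfolding sum_distrib_left by (intro sum.cong refl) (simp add: right_diff_distrib[symmetric])
  ultimately show ?thesis unfolding Tr_def by (simp add: algebra_simps)
qed

lemma Tr_sum:
  assumes "finite I" "\<And>i. i \<in> I \<Longrightarrow> nice UNIV (f i)"
  shows "Tr k xi (\<lambda>z. \<Sum>i\<in>I. f i z) z = (\<Sum>i\<in>I. Tr k xi (f i) z)"
  using assms by (induction I) (simp_all add: Tr_const Tr_add nice_sum)

text \<open>Conjugating the operator with a swap replaces the direction by its swap, since
  conjugation permutes the terms of the reflection sum.\<close>

lemma Tr_swap:
  "Tr k xi (\<lambda>z. f (swap_coord i j z)) z = Tr k (swap_coord i j xi) f (swap_coord i j z)"
proof -
  have "pd (\<lambda>z. f (swap_coord i j z)) z xi = pd f (swap_coord i j z) (swap_coord i j xi)"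
    by (simp add: pd_def swap_coord_add swap_coord_smult)
  then show ?thesis unfolding Tr_def
    by (subst sum_swap_reindex[of _ i j]) (simp add: swap_coord_conj)
qed

lemma cdot_swap_diff: "cdot l z - cdot l (swap_coord i j z) = (l $ i - l $ j) * (z $ i - z $ j)"
proof (cases "i = j")
  case False
  have "cdot l z - cdot l (swap_coord i j z) = (\<Sum>a\<in>UNIV. l $ a * (z $ a - z $ Transposition.transpose i j a))"
    by (simp add: cdot_def sum_subtractf algebra_simps)
  also have "\<dots> = (\<Sum>a\<in>{i,j}. l $ a * (z $ a - z $ Transposition.transpose i j a))"
    by (rule sum.mono_neutral_right) (auto simp: Transposition.transpose_def)
  also have "\<dots> = (l $ i - l $ j) * (z $ i - z $ j)"
    using False by (simp add: algebra_simps)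
  finally show ?thesis .
qed simp

text \<open>Leibniz rule with a defect. A reflection changes \<open>cdot l z\<close> by
  \<open>(l_i - l_j) (z_i - z_j)\<close>, so its divided difference is constant, and multiplied by
  \<open>\<xi>_i - \<xi>_j\<close> it is again a difference of \<open>cdot l\<close>, now between
  the direction and its swap.\<close>

lemma Tr_cdot_mult:
  assumes "nice UNIV h" "regular z"
  shows "Tr k xi (\<lambda>z. cdot l z * h z) z = cdot l xi * h z + cdot l z * Tr k xi h z
    + complex_of_real (k/2) * (\<Sum>a\<in>UNIV. (cdot l xi - cdot l (swapp a xi)) * h (swapp a z))"
proof -
  have "(xi $ fst a - xi $ snd a) * ((cdot l z * h z - cdot l (swapp a z) * h (swapp a z)) / (z $ fst a - z $ snd a))
     = cdot l z * ((xi $ fst a - xi $ snd a) * ((h z - h (swapp a z)) / (z $ fst a - z $ snd a)))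
      + (cdot l xi - cdot l (swapp a xi)) * h (swapp a z)" for a
  proof (cases "fst a = snd a")
    case False
    then have ne: "z $ fst a - z $ snd a \<noteq> 0" using assms(2) by (simp add: regular_def)
    have "cdot l (swapp a z) = cdot l z - (l $ fst a - l $ snd a) * (z $ fst a - z $ snd a)"
      using cdot_swap_diff[of l z "fst a" "snd a"] by (simp add: algebra_simps)
    then have "cdot l z * h z - cdot l (swapp a z) * h (swapp a z) =
      cdot l z * (h z - h (swapp a z)) + (l $ fst a - l $ snd a) * (z $ fst a - z $ snd a) * h (swapp a z)"
      by (simp only:) (simp add: algebra_simps)
    then show ?thesis using ne unfolding cdot_swap_diff by (simp add: add_divide_distrib distrib_left mult_ac)
  qed simp
  then have "(\<Sum>a\<in>UNIV. (xi $ fst a - xi $ snd a) * ((cdot l z * h z - cdot l (swapp a z) * h (swapp a z)) / (z $ fst a - z $ snd a)))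
     = cdot l z * (\<Sum>a\<in>UNIV. (xi $ fst a - xi $ snd a) * ((h z - h (swapp a z)) / (z $ fst a - z $ snd a)))
      + (\<Sum>a\<in>UNIV. (cdot l xi - cdot l (swapp a xi)) * h (swapp a z))"
    by (simp only: sum.distrib sum_distrib_left)
  then show ?thesis unfolding Tr_def
    by (simp only: pd_mult[OF nice_cdot assms(1)] pd_cdot) (simp add: algebra_simps)
qed

lemma regular_act: "regular z \<Longrightarrow> bij p \<Longrightarrow> regular (act p z)"
  unfolding regular_def by (simp add: bij_def inj_eq)

lemma regular_swap: "regular z \<Longrightarrow> regular (swap_coord i j z)"
  unfolding swap_coord_act by (rule regular_act) auto

text \<open>Apply \<open>Tr\<close> to the recursion of degree \<open>m + 1\<close>. The defect
  \<open>G\<close> between \<open>Tr k xi f z\<close> and \<open>cdot l xi * h z\<close> then solves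
  the reflection equation with source zero, the swaps acting on \<open>xi\<close> and
  \<open>z\<close> together, and vanishes by the maximum principle. The hypothesis \<open>IH\<close>
  is the claim for degree \<open>m\<close> multiplied by \<open>cdot l z\<close>, with the previous
  component eliminated through the recursion; in this form it also makes sense for
  \<open>m = 0\<close>.\<close>

lemma Tr_dhom_step:
  fixes l :: "complex^'n::finite"
  assumes k: "k \<ge> 0"
    and IH: "\<And>xi z. regular z \<Longrightarrow> cdot l z * Tr k xi (dhom k m l) z =
      cdot l xi * (of_nat m * dhom k m l z + complex_of_real (k/2) * (\<Sum>a\<in>UNIV. dhom k m l z - dhom k m l (swapp a z)))"
    and z: "regular z"
  shows "Tr k xi (dhom k (Suc m) l) z = cdot l xi * dhom k m l z"
proof -
  define f where "f = dhom k (Suc m) l"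
  define h where "h = dhom k m l"
  define K where "K = complex_of_real (k/2)"
  define c :: complex where "c = of_nat m + 1"
  define G where "G xi z = Tr k xi f z - cdot l xi * h z" for xi z
  have nf: "nice UNIV f" and nh: "nice UNIV h" unfolding f_def h_def by (rule nice_dhom)+
  have rec: "(\<lambda>z. c * f z + K * (\<Sum>a\<in>UNIV. f z - f (swapp a z))) = (\<lambda>z. cdot l z * h z)"
  proof
    show "c * f z + K * (\<Sum>a\<in>UNIV. f z - f (swapp a z)) = cdot l z * h z" for z
      using dhom_rec[OF k, of m l z] unfolding f_def h_def K_def c_def
      by (simp only: of_real_of_nat_eq of_nat_Suc of_real_add of_real_1 add.commute[of 1])
  qed
  have key: "c * G xi z + K * (\<Sum>a\<in>UNIV. G xi z - G (swapp a xi) (swapp a z)) = 0" if z: "regular z" for xi z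
  proof -
    let ?S = "\<Sum>a\<in>UNIV. Tr k xi f z - Tr k (swapp a xi) f (swapp a z)"
    let ?H = "\<Sum>a\<in>UNIV. h z - h (swapp a z)"
    let ?L = "\<Sum>a\<in>UNIV. (cdot l xi - cdot l (swapp a xi)) * h (swapp a z)"
    have "Tr k xi (\<lambda>z. c * f z + K * (\<Sum>a\<in>UNIV. f z - f (swapp a z))) z = c * Tr k xi f z + K * ?S"
      by (subst Tr_add, (intro nice_mult nice_const nice_sum nice_diff nice_swap nf)+,
          subst Tr_cmult[OF nf], subst Tr_cmult, (intro nice_sum nice_diff nice_swap nf)+,
          subst Tr_sum, simp, (intro nice_diff nice_swap nf)+)
         (simp add: Tr_diff nf nice_swap Tr_swap)
    then have "c * Tr k xi f z + K * ?S = cdot l xi * h z + cdot l z * Tr k xi h z + K * ?L"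
      unfolding rec Tr_cdot_mult[OF nh z] by (simp add: K_def)
    also have "cdot l z * Tr k xi h z = cdot l xi * (of_nat m * h z + K * ?H)"
      using IH[OF z, of xi] by (simp add: h_def K_def)
    finally have 1: "c * Tr k xi f z + K * ?S = cdot l xi * h z + cdot l xi * (of_nat m * h z + K * ?H) + K * ?L" .
    have 2: "(\<Sum>a\<in>UNIV. G xi z - G (swapp a xi) (swapp a z)) = ?S - (cdot l xi * ?H + ?L)"
      unfolding G_def by (simp only: sum_distrib_left sum.distrib[symmetric] sum_subtractf[symmetric])
        (rule sum.cong, simp, simp add: algebra_simps)
    have "c * G xi z + K * (\<Sum>a\<in>UNIV. G xi z - G (swapp a xi) (swapp a z)) =
      (c * Tr k xi f z + K * ?S) - c * (cdot l xi * h z) - K * (cdot l xi * ?H + ?L)"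
      unfolding 2 by (simp only: G_def right_diff_distrib) simp
    also have "\<dots> = 0" by (subst 1) (simp only: c_def distrib_left distrib_right, simp add: mult_ac)
    finally show ?thesis .
  qed
  \<comment> \<open>Direction and point are moved by one common permutation, so this finite set is
    stable under simultaneous swaps.\<close>
  let ?Om = "(\<lambda>p. (act p xi, act p z)) ` {p. bij p}"
  have "norm ((\<lambda>q. G (fst q) (snd q)) (xi, z)) \<le> 0 / real (Suc m)"
  proof (rule orbit_max_principle[where Om="?Om" and A=UNIV and g="\<lambda>_. 0" and \<kappa>="k/2"
      and \<sigma>="\<lambda>a q. (swapp a (fst q), swapp a (snd q))"])
    show "(swapp a (fst q), swapp a (snd q)) \<in> ?Om" if "q \<in> ?Om" for a q
    proof -
      from that obtain p where p: "bij p" "q = (act p xi, act p z)" by auto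
      show ?thesis
        by (rule image_eqI[where x="p \<circ> Transposition.transpose (fst a) (snd a)"])
          (use p in \<open>auto simp: swap_coord_act act_act intro!: bij_comp\<close>)
    qed
    show "real (Suc m) *\<^sub>R G (fst q) (snd q) + (k / 2) *\<^sub>R (\<Sum>a\<in>UNIV. G (fst q) (snd q) -
       G (fst (swapp a (fst q), swapp a (snd q))) (snd (swapp a (fst q), swapp a (snd q)))) = 0"
      if "q \<in> ?Om" for q
    proof -
      have "regular (snd q)" using that z regular_act by auto
      from key[OF this, of "fst q"] show ?thesis
        by (simp add: scaleR_conv_of_real K_def c_def add.commute)
    qed
    show "(xi, z) \<in> ?Om" by (rule image_eqI[where x=id]) auto
  qed (use k in auto)
  then show ?thesis by (simp add: G_def f_def h_def del: dhom.simps)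
qed

lemma Tr_dhom:
  assumes k: "k \<ge> 0" and z: "regular z"
  shows "Tr k xi (dhom k (Suc m) l) z = cdot l xi * dhom k m l z"
  using z
proof (induction m arbitrary: xi z)
  case 0
  have "dhom k 0 l = (\<lambda>_. 1)" by (simp add: fun_eq_iff)
  then show ?case by (intro Tr_dhom_step[OF k _ 0]) (simp add: Tr_const)
next
  case (Suc m)
  show ?case
  proof (rule Tr_dhom_step[OF k _ Suc.prems])
    fix xi z :: "complex^'a" assume z: "regular z"
    show "cdot l z * Tr k xi (dhom k (Suc m) l) z =
      cdot l xi * (of_nat (Suc m) * dhom k (Suc m) l z + complex_of_real (k/2) * (\<Sum>a\<in>UNIV. dhom k (Suc m) l z - dhom k (Suc m) l (swapp a z)))"
      using dhom_rec[OF k, of m l z] Suc.IH[OF z, of xi]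
      by (simp only: of_real_of_nat_eq mult.left_commute)
  qed
qed

text \<open>At a regular point \<open>Tr\<close> is a finite combination of values and one
  directional derivative, so it may be applied term by term; lowering the degree by one reproduces
  the series.\<close>

lemma Tr_dker:
  fixes l :: "complex^'n::finite"
  assumes k: "k \<ge> 0" and z: "regular z"
  shows "Tr k xi (dker k l) z = cdot l xi * dker k l z"
proof -
  have "(\<lambda>m. Tr k xi (dhom k m l) z) sums Tr k xi (dker k l) z"
    unfolding Tr_def
    by (intro sums_add sums_mult sums_sum sums_divide sums_diff pd_dker_sums[OF k] dhom_sums[OF k])
  moreover have "(\<lambda>m. Tr k xi (dhom k (Suc m) l) z) sums (cdot l xi * dker k l z)"
    unfolding Tr_dhom[OF k z] by (intro sums_mult dhom_sums[OF k])
  then have "(\<lambda>m. Tr k xi (dhom k m l) z) sums (cdot l xi * dker k l z + Tr k xi (dhom k 0 l) z)"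
    by (rule sums_Suc)
  moreover have "Tr k xi (dhom k 0 l) z = 0"
  proof -
    have "dhom k 0 l = (\<lambda>_. 1)" by (simp add: fun_eq_iff)
    then show ?thesis by (simp add: Tr_const)
  qed
  ultimately show ?thesis using sums_unique2 by fastforce
qed

lemma cdot_cvec: "cdot l (cvec xi) = cinner l xi"
  by (simp add: cdot_def cvec_def cinner_def)

lemma dunkl_op_dker:
  assumes "k \<ge> 0"
  shows "dunkl_op k xi (dker k l) z = cinner l xi * dker k l z"
proof (rule dunkl_op_eqI[where D=UNIV])
  show "nice UNIV (dker k l)" by (rule nice_dker[OF assms])
  then show "continuous_on UNIV (\<lambda>z. cinner l xi * dker k l z)"
    by (intro continuous_intros nice_continuous)
  show "Tr k (cvec xi) (dker k l) z = cinner l xi * dker k l z" if "regular z" for z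
    using Tr_dker[OF assms that, of "cvec xi" l] by (simp add: cdot_cvec)
qed auto

section \<open>Uniqueness through the Euler equation\<close>

lemma pd_smult:
  assumes "nice UNIV f"
  shows "pd f z (c *s v) = c * pd f z v"
proof -
  have "((\<lambda>t. f (z + t *s v)) has_field_derivative pd f z v) (at (c * 0))"
    using nice_deriv_UNIV[OF assms, of z v] by simp
  from DERIV_chain2[OF this DERIV_cmult_Id]
  have "((\<lambda>t. f (z + (c * t) *s v)) has_field_derivative pd f z v * c) (at 0)" .
  moreover have "(c * t) *s v = t *s (c *s v)" for t by (simp add: vec_eq_iff)
  ultimately show ?thesis by (intro pd_eqI) (simp add: mult.commute)
qed

text \<open>The energy \<open>\<Sum>\<^sub>p |f(t p z)|\<^sup>2\<close> along a ray satisfies a Gronwall inequality, since the reflection part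
  of the operator is dissipative for \<open>k \<ge> 0\<close>.\<close>
lemma euler_equation_unique:
  fixes f :: "complex^'n::{finite,linorder} \<Rightarrow> complex"
  assumes k: "k \<ge> 0" and nf: "nice UNIV f" and f0: "f 0 = 0"
    and eu: "\<And>z. regular z \<Longrightarrow> pd f z z + complex_of_real (k/2) * (\<Sum>a\<in>UNIV. f z - f (swapp a z)) = cdot l z * f z"
  shows "f z = 0"
proof -
  have reg: "f z = 0" if z: "regular z" for z
  proof -
    \<comment> \<open>The rays through all permuted copies of \<open>z\<close> are treated together,
      because the reflection terms couple them.\<close>
    define P :: "('n \<Rightarrow> 'n) set" where "P = {p. bij p}"
    have finP: "finite P" by simp
    define \<phi> where "\<phi> p t = f (complex_of_real t *s act p z)" for p t
    define \<phi>' where "\<phi>' p t = pd f (complex_of_real t *s act p z) (act p z)" for p t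
    define C where "C = (\<Sum>p\<in>P. norm (cdot l (act p z)))"
    define u where "u t = (\<Sum>p\<in>P. (Re (\<phi> p t))\<^sup>2 + (Im (\<phi> p t))\<^sup>2)" for t
    define u' where "u' t = (\<Sum>p\<in>P. 2 * Re (cnj (\<phi> p t) * \<phi>' p t))" for t
    have u_norm: "u t = (\<Sum>p\<in>P. (norm (\<phi> p t))\<^sup>2)" for t
      unfolding u_def by (simp add: cmod_power2)
    have d\<phi>: "(\<phi> p has_vector_derivative \<phi>' p t) (at t)" for p t
    proof -
      have "((\<lambda>s. f (0 + s *s act p z)) has_field_derivative pd f (0 + complex_of_real t *s act p z) (act p z)) (at (complex_of_real t))"
        by (rule nice_deriv[OF nf]) simp
      then have "((\<lambda>s. f (s *s act p z)) has_field_derivative \<phi>' p t) (at (complex_of_real t))"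
        by (simp add: \<phi>'_def)
      then have "((\<lambda>s. f (s *s act p z)) \<circ> complex_of_real has_vector_derivative \<phi>' p t) (at t)"
        using field_vector_diff_chain_at[OF has_vector_derivative_of_real[OF DERIV_ident]] by fastforce
      then show ?thesis by (simp add: o_def \<phi>_def[abs_def])
    qed
    have dRe: "((\<lambda>t. Re (\<phi> p t)) has_real_derivative Re (\<phi>' p t)) (at t)"
      and dIm: "((\<lambda>t. Im (\<phi> p t)) has_real_derivative Im (\<phi>' p t)) (at t)" for p t
      using has_vector_derivative_real_field bounded_linear.has_vector_derivative[OF bounded_linear_Re d\<phi>]
        bounded_linear.has_vector_derivative[OF bounded_linear_Im d\<phi>]
      by (simp_all add: has_real_derivative_iff_has_vector_derivative)
    have du: "(u has_real_derivative u' t) (at t)" for t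
      unfolding u_def u'_def
      by (rule DERIV_sum, rule DERIV_cong[OF DERIV_add[OF DERIV_power[OF dRe] DERIV_power[OF dIm]]])
         (simp add: algebra_simps)
    have ineq: "u' t \<le> 2 * C * u t" if t: "t > 0" for t
    proof -
      have eq: "t * \<phi>' p t = t * cdot l (act p z) * \<phi> p t - complex_of_real (k/2) * (\<Sum>a\<in>UNIV. \<phi> p t - \<phi> (p \<circ> Transposition.transpose (fst a) (snd a)) t)"
        if "p \<in> P" for p
      proof -
        let ?y = "complex_of_real t *s act p z"
        have "regular (act p z)" using z that regular_act by (auto simp: P_def)
        then have "regular ?y" using t by (simp add: regular_def)
        from eu[OF this] have "pd f ?y ?y + complex_of_real (k/2) * (\<Sum>a\<in>UNIV. f ?y - f (swapp a ?y)) = cdot l ?y * f ?y" .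
        moreover have "pd f ?y ?y = t * \<phi>' p t" by (simp only: pd_smult[OF nf] \<phi>'_def)
        moreover have "swapp a ?y = complex_of_real t *s act (p \<circ> Transposition.transpose (fst a) (snd a)) z" for a
          by (simp add: swap_coord_act act_act act_smult)
        ultimately show ?thesis by (simp add: \<phi>_def cdot_smult_right algebra_simps)
      qed
      have R: "Re (cnj x * (t * y)) = t * Re (cnj x * y)" for x y :: complex by (simp add: algebra_simps)
      have tq: "t * Re (cnj (\<phi> p t) * \<phi>' p t) = t * Re (cdot l (act p z)) * (norm (\<phi> p t))\<^sup>2
          - (k/2) * (\<Sum>a\<in>UNIV. (norm (\<phi> p t))\<^sup>2 - Re (cnj (\<phi> p t) * \<phi> (p \<circ> Transposition.transpose (fst a) (snd a)) t))"
        if "p \<in> P" for p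
      proof -
        have "t * Re (cnj (\<phi> p t) * \<phi>' p t) = Re (cnj (\<phi> p t) * (t * \<phi>' p t))" by (simp only: R)
        also have "\<dots> = Re (cnj (\<phi> p t) * (t * cdot l (act p z) * \<phi> p t) - complex_of_real (k/2) * (\<Sum>a\<in>UNIV. cnj (\<phi> p t) * \<phi> p t - cnj (\<phi> p t) * \<phi> (p \<circ> Transposition.transpose (fst a) (snd a)) t))"
          unfolding eq[OF that] by (simp only: right_diff_distrib sum_distrib_left mult.left_commute)
        also have "cnj (\<phi> p t) * \<phi> p t = complex_of_real ((norm (\<phi> p t))\<^sup>2)"
          by (simp only: complex_norm_square mult.commute)
        also have "cnj (\<phi> p t) * (t * cdot l (act p z) * \<phi> p t) = complex_of_real (t * (norm (\<phi> p t))\<^sup>2) * cdot l (act p z)"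
          by (simp only: of_real_mult complex_norm_square mult_ac)
        finally show ?thesis by (simp only: minus_complex.sel Re_complex_of_real times_complex.sel Im_complex_of_real Re_sum) (simp add: mult_ac)
      qed
      have "t * u' t = (\<Sum>p\<in>P. 2 * (t * Re (cdot l (act p z)) * (norm (\<phi> p t))\<^sup>2)
          - k * (\<Sum>a\<in>UNIV. (norm (\<phi> p t))\<^sup>2 - Re (cnj (\<phi> p t) * \<phi> (p \<circ> Transposition.transpose (fst a) (snd a)) t)))"
        unfolding u'_def
        by (subst sum_distrib_left, intro sum.cong refl, subst mult.left_commute, subst tq, assumption)
           (simp add: right_diff_distrib)
      also have "\<dots> = (\<Sum>p\<in>P. 2 * (t * Re (cdot l (act p z)) * (norm (\<phi> p t))\<^sup>2))
          - k * (\<Sum>a\<in>UNIV. \<Sum>p\<in>P. (norm (\<phi> p t))\<^sup>2 - Re (cnj (\<phi> p t) * \<phi> (p \<circ> Transposition.transpose (fst a) (snd a)) t))"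
        by (subst sum.swap) (simp only: sum_subtractf sum_distrib_left[symmetric])
      also have "\<dots> \<le> 2 * t * C * u t - k * 0"
      proof (intro diff_mono mult_left_mono k)
        have C: "Re (cdot l (act p z)) \<le> C" if "p \<in> P" for p
        proof -
          have "Re (cdot l (act p z)) \<le> norm (cdot l (act p z))" by (rule complex_Re_le_cmod)
          also have "\<dots> \<le> C" unfolding C_def by (rule member_le_sum[OF that]) (use finP in auto)
          finally show ?thesis .
        qed
        have "(\<Sum>p\<in>P. 2 * (t * Re (cdot l (act p z)) * (norm (\<phi> p t))\<^sup>2)) \<le> (\<Sum>p\<in>P. 2 * (t * C * (norm (\<phi> p t))\<^sup>2))"
          using t C by (intro sum_mono mult_left_mono mult_right_mono) auto
        also have "\<dots> = 2 * t * C * u t" by (simp add: u_norm sum_distrib_left mult_ac)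
        finally show "(\<Sum>p\<in>P. 2 * (t * Re (cdot l (act p z)) * (norm (\<phi> p t))\<^sup>2)) \<le> 2 * t * C * u t" .
        \<comment> \<open>Each reflection maps the family of rays to itself, and
          \<open>2 * Re (cnj x * y)\<close> is at most the sum of the two squared norms; hence the
          reflection part can only lower the energy.\<close>
        show "0 \<le> (\<Sum>a\<in>UNIV. \<Sum>p\<in>P. (norm (\<phi> p t))\<^sup>2 - Re (cnj (\<phi> p t) * \<phi> (p \<circ> Transposition.transpose (fst a) (snd a)) t))"
        proof (rule sum_nonneg)
        fix a :: "'n \<times> 'n"
        let ?\<tau> = "Transposition.transpose (fst a) (snd a)"
        have re: "(\<Sum>p\<in>P. (norm (\<phi> (p \<circ> ?\<tau>) t))\<^sup>2) = (\<Sum>p\<in>P. (norm (\<phi> p t))\<^sup>2)"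
          by (rule sum.reindex_bij_witness[where i="\<lambda>p. p \<circ> ?\<tau>" and j="\<lambda>p. p \<circ> ?\<tau>"])
            (auto simp: P_def o_assoc[symmetric] intro: bij_comp)
        have le: "2 * Re (cnj x * y) \<le> (norm x)\<^sup>2 + (norm y)\<^sup>2" for x y
        proof -
          have "0 \<le> (Re x - Re y)\<^sup>2 + (Im x - Im y)\<^sup>2" by simp
          then show ?thesis unfolding cmod_power2 by (simp add: power2_eq_square algebra_simps)
        qed
        have "2 * (\<Sum>p\<in>P. Re (cnj (\<phi> p t) * \<phi> (p \<circ> ?\<tau>) t)) \<le> (\<Sum>p\<in>P. (norm (\<phi> p t))\<^sup>2 + (norm (\<phi> (p \<circ> ?\<tau>) t))\<^sup>2)"
          unfolding sum_distrib_left by (intro sum_mono le)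
        then show "0 \<le> (\<Sum>p\<in>P. (norm (\<phi> p t))\<^sup>2 - Re (cnj (\<phi> p t) * \<phi> (p \<circ> ?\<tau>) t))"
          by (simp add: sum.distrib re sum_subtractf)
        qed
      qed
      finally have "t * u' t \<le> t * (2 * C * u t)" by (simp add: mult_ac)
      then show ?thesis using t by simp
    qed
    \<comment> \<open>Integrating factor: \<open>v\<close> does not increase on the unit interval
      and starts at \<open>0\<close> because \<open>f 0 = 0\<close>, so the nonnegative energy
      \<open>u\<close> vanishes at \<open>1\<close>.\<close>
    define v where "v t = u t * exp (- 2 * C * t)" for t
    have dv: "(v has_real_derivative (u' t - 2 * C * u t) * exp (- 2 * C * t)) (at t)" for t
      unfolding v_def by (auto intro!: derivative_eq_intros du simp: algebra_simps)
    have "v 1 \<le> v 0"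
    proof (rule DERIV_nonpos_imp_decreasing_open[where f=v and a=0 and b=1])
      show "\<exists>y. (v has_real_derivative y) (at x) \<and> y \<le> 0" if "0 < x" "x < 1" for x
        using dv[of x] ineq[OF that(1)] by (intro exI conjI) (auto simp: mult_nonpos_nonneg)
      show "continuous_on {0..1} v"
        by (intro continuous_at_imp_continuous_on ballI DERIV_isCont[OF dv])
    qed simp
    moreover have "v 0 = 0" by (simp add: v_def u_norm \<phi>_def f0)
    ultimately have "u 1 \<le> 0" by (simp add: v_def mult_le_0_iff)
    moreover have "(norm (\<phi> id 1))\<^sup>2 \<le> u 1"
    proof -
      have "id \<in> P" by (simp only: P_def mem_Collect_eq bij_id)
      then show ?thesis unfolding u_norm by (rule member_le_sum) (use finP in auto)
    qed
    ultimately have "(norm (\<phi> id 1))\<^sup>2 \<le> 0" by (rule order_trans[rotated])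
    then show ?thesis by (simp add: \<phi>_def)
  qed
  show ?thesis
    by (rule continuous_eq_on_regular[where D=UNIV and B="\<lambda>_. 0"]) (use reg nice_continuous[OF nf] in auto)
qed

text \<open>Contract the Dunkl equations in the coordinate directions with \<open>z\<close>. The
  coefficient of each reflection quotient becomes \<open>z_i - z_j\<close> and cancels the
  denominator. Complex linearity of \<open>D\<close> assembles the coordinate derivatives into the
  derivative in the complex direction \<open>z\<close>.\<close>

lemma euler_from_dunkl:
  fixes F :: "(complex^'n::{finite,linorder}) \<times> (complex^'n::{finite,linorder}) \<Rightarrow> complex"
  assumes D: "cderiv F (l, z) D" and z: "regular z"
    and T: "\<And>xi. Tr k (cvec xi) (\<lambda>z. F (l, z)) z = cinner l xi * F (l, z)"
  shows "pd (\<lambda>z. F (l, z)) z z + complex_of_real (k/2) * (\<Sum>a\<in>UNIV. F (l, z) - F (l, swapp a z)) = cdot l z * F (l, z)"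
proof -
  let ?f = "\<lambda>z. F (l, z)"
  have lin: "linear D" using D unfolding cderiv_def by (auto intro: has_derivative_linear)
  have sc: "D (0, c *s v) = c * D (0, v)" for c v
    using D unfolding cderiv_def cmul2_def by (metis fst_conv snd_conv vector_smult_rzero)
  have ax: "cvec (axis i 1) = axis i (1::complex)" for i :: 'n
    by (simp add: vec_eq_iff cvec_def axis_def)
  have zz: "(\<Sum>i\<in>UNIV. z $ i *s axis i 1) = z" by (simp add: basis_expansion)
  have "D (0, z) = (\<Sum>i\<in>UNIV. z $ i * D (0, axis i 1))"
  proof -
    have "linear (\<lambda>v. D (0, v))"
    proof (rule linearI)
      show "D (0, x + y) = D (0, x) + D (0, y)" for x y
        using linear_add[OF lin, of "(0,x)" "(0,y)"] by simp
      show "D (0, r *\<^sub>R x) = r *\<^sub>R D (0, x)" for r x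
        using linear_scale[OF lin, of r "(0,x)"] by simp
    qed
    from linear_sum[OF this, of "\<lambda>i. z $ i *s axis i 1" UNIV] show ?thesis unfolding zz sc .
  qed
  then have 1: "pd ?f z z = (\<Sum>i\<in>UNIV. z $ i * pd ?f z (axis i 1))"
    using cderiv_pd(2)[OF D] by simp
  have ai: "(\<Sum>i\<in>UNIV. z $ i * (axis i 1 $ m)) = z $ m" for m
    by (simp add: axis_def if_distrib cong: if_cong)
  have 2: "F (l, z) - F (l, swapp a z) = (\<Sum>i\<in>UNIV. z $ i * ((axis i 1 $ fst a - axis i 1 $ snd a) * ((?f z - ?f (swapp a z)) / (z $ fst a - z $ snd a))))" for a
  proof -
    have "(\<Sum>i\<in>UNIV. z $ i * ((axis i 1 $ fst a - axis i 1 $ snd a) * ((?f z - ?f (swapp a z)) / (z $ fst a - z $ snd a))))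
     = ((\<Sum>i\<in>UNIV. z $ i * (axis i 1 $ fst a)) - (\<Sum>i\<in>UNIV. z $ i * (axis i 1 $ snd a))) * ((?f z - ?f (swapp a z)) / (z $ fst a - z $ snd a))"
      by (simp only: sum_subtractf[symmetric] sum_distrib_right) (simp only: right_diff_distrib left_diff_distrib mult.assoc)
    also have "\<dots> = ?f z - ?f (swapp a z)"
      unfolding ai using z by (cases "fst a = snd a") (auto simp: regular_def)
    finally show ?thesis by simp
  qed
  have "pd ?f z z + complex_of_real (k/2) * (\<Sum>a\<in>UNIV. F (l, z) - F (l, swapp a z)) = (\<Sum>i\<in>UNIV. z $ i * Tr k (axis i 1) ?f z)"
  proof -
    have "(\<Sum>a\<in>UNIV. F (l, z) - F (l, swapp a z)) = (\<Sum>a\<in>UNIV. \<Sum>i\<in>UNIV. z $ i * ((axis i 1 $ fst a - axis i 1 $ snd a) * ((?f z - ?f (swapp a z)) / (z $ fst a - z $ snd a))))"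
      by (rule sum.cong[OF refl 2])
    also have "\<dots> = (\<Sum>i\<in>UNIV. z $ i * (\<Sum>a\<in>UNIV. (axis i 1 $ fst a - axis i 1 $ snd a) * ((?f z - ?f (swapp a z)) / (z $ fst a - z $ snd a))))"
      by (subst sum.swap) (simp only: sum_distrib_left)
    finally have s2: "(\<Sum>a\<in>UNIV. F (l, z) - F (l, swapp a z)) = (\<Sum>i\<in>UNIV. z $ i * (\<Sum>a\<in>UNIV. (axis i 1 $ fst a - axis i 1 $ snd a) * ((?f z - ?f (swapp a z)) / (z $ fst a - z $ snd a))))" .
    define Q where "Q i = (\<Sum>a\<in>UNIV. (axis i 1 $ fst a - axis i 1 $ snd a) * ((?f z - ?f (swapp a z)) / (z $ fst a - z $ snd a)))" for i
    show ?thesis unfolding s2 Tr_def 1 Q_def[symmetric]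
      by (simp add: distrib_left sum.distrib sum_distrib_left mult_ac)
  qed
  also have "\<dots> = (\<Sum>i\<in>UNIV. z $ i * (cinner l (axis i 1) * F (l, z)))"
    using T unfolding ax[symmetric] by simp
  also have "\<dots> = (\<Sum>i\<in>UNIV. z $ i * cinner l (axis i 1)) * F (l, z)"
    by (simp add: sum_distrib_right mult.assoc)
  also have "(\<Sum>i\<in>UNIV. z $ i * cinner l (axis i 1)) = cdot l z"
    unfolding cdot_cvec[symmetric] ax by (simp add: cdot_def axis_def if_distrib cong: if_cong) (simp add: mult.commute)
  finally show ?thesis .
qed

lemma dker_0_right: "dker k l 0 = 1"
proof -
  have "dhom k m l 0 = 0 ^ m" for m
    using dhom_smult_right[of k m l 0 0] by (cases m) simp_all
  then show ?thesis unfolding dker_def by (simp add: suminf_geometric)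
qed

lemma holo_vec_cderiv:
  "holo_vec UNIV F (\<lambda>c p. (c *s fst p, c *s snd p)) \<longleftrightarrow> (\<forall>p. \<exists>D. cderiv F p D)"
  by (simp add: holo_vec_def cderiv_def cmul2_def)

lemma euler_dker:
  fixes z :: "complex^'n::{finite,linorder}"
  assumes k: "k \<ge> 0" and z: "regular z"
  shows "pd (dker k l) z z + complex_of_real (k/2) * (\<Sum>a\<in>UNIV. dker k l z - dker k l (swapp a z)) = cdot l z * dker k l z"
  using euler_from_dunkl[OF cderiv_dker[OF k] z, of k l] Tr_dker[OF k z, of _ l] by (simp add: cdot_cvec)

text \<open>For each fixed \<open>l\<close> the difference of two solutions satisfies the Euler
  equation and vanishes at the origin.\<close>

theorem dunkl_kernel_eqI:
  assumes k: "k \<ge> 0"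
    and hol: "\<And>p. \<exists>D. cderiv (\<lambda>p. E (fst p) (snd p)) p D"
    and T: "\<And>xi z. dunkl_op k xi (E l) z = cinner l xi * E l z"
    and 0: "E l 0 = 1"
  shows "E l z = dker k l z"
proof -
  let ?F = "\<lambda>p. E (fst p) (snd p)" and ?G = "\<lambda>p. dker k (fst p) (snd p)"
  define DE where "DE p = (SOME D. cderiv ?F p D)" for p
  have DE: "cderiv ?F p (DE p)" for p unfolding DE_def by (rule someI_ex[OF hol])
  have nE: "nice UNIV (E l)" using cderiv_nice[of ?F l "\<lambda>z. DE (l, z)", OF DE] by simp
  have nK: "nice UNIV (dker k l)" by (rule nice_dker[OF k])
  have e1: "pd (E l) z z + complex_of_real (k/2) * (\<Sum>a\<in>UNIV. E l z - E l (swapp a z)) = cdot l z * E l z" if "regular z" for z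
  proof -
    have "Tr k (cvec xi) (E l) z = cinner l xi * E l z" for xi
      using T[of xi z] by (simp add: dunkl_op_regular[OF that])
    then show ?thesis using euler_from_dunkl[OF DE that, of k l] by simp
  qed
  note e2 = euler_dker[OF k, of _ l]
  have "E l z - dker k l z = 0"
  proof (rule euler_equation_unique[OF k nice_diff[OF nE nK]])
    show "E l 0 - dker k l 0 = 0" by (simp add: 0 dker_0_right)
    fix z :: "(complex, 'a) vec" assume z: "regular z"
    have "(\<Sum>a\<in>UNIV. (E l z - dker k l z) - (E l (swapp a z) - dker k l (swapp a z))) =
      (\<Sum>a\<in>UNIV. E l z - E l (swapp a z)) - (\<Sum>a\<in>UNIV. dker k l z - dker k l (swapp a z))"
      by (simp only: sum_subtractf[symmetric]) (simp add: algebra_simps)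
    then have "pd (\<lambda>z. E l z - dker k l z) z z + complex_of_real (k/2) * (\<Sum>a\<in>UNIV. (E l z - dker k l z) - (E l (swapp a z) - dker k l (swapp a z)))
      = cdot l z * E l z - cdot l z * dker k l z"
      unfolding pd_diff[OF nE nK] e1[OF z, symmetric] e2[OF z, symmetric] by (simp only: right_diff_distrib) simp
    then show "pd (\<lambda>z. E l z - dker k l z) z z + complex_of_real (k/2) * (\<Sum>a\<in>UNIV. (E l z - dker k l z) - (E l (swapp a z) - dker k l (swapp a z)))
      = cdot l z * (E l z - dker k l z)" by (simp only: right_diff_distrib)
  qed
  then show ?thesis by simp
qed

theorem dunkl_kernel_eq:
  assumes "k \<ge> 0"
  shows "dunkl_kernel k = dker k"
  unfolding dunkl_kernel_def
proof (rule the_equality, intro conjI allI)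
  show "holo_vec UNIV (\<lambda>p. dker k (fst p) (snd p)) (\<lambda>c p. (c *s fst p, c *s snd p))"
    unfolding holo_vec_cderiv using cderiv_dker[OF assms] by auto
next
  fix E :: "complex^('a::{finite,linorder}) \<Rightarrow> complex^('a::{finite,linorder}) \<Rightarrow> complex"
  assume E: "holo_vec UNIV (\<lambda>p. E (fst p) (snd p)) (\<lambda>c p. (c *s fst p, c *s snd p)) \<and>
    (\<forall>lam xi z. dunkl_op k xi (E lam) z = cinner lam xi * E lam z) \<and> (\<forall>lam. E lam 0 = 1)"
  have hol: "\<exists>D. cderiv (\<lambda>p. E (fst p) (snd p)) p D" for p
    by (rule spec[OF conjunct1[OF E, unfolded holo_vec_cderiv]])
  show "E = dker k"
    by (intro ext dunkl_kernel_eqI[OF assms hol]) (use E in auto)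
qed (simp_all add: dunkl_op_dker assms dker_0_right)

section \<open>Symmetries, shift, decay and positivity of the kernel\<close>

lemma dker_symmetric: "k \<ge> 0 \<Longrightarrow> dker k l z = dker k z l"
  unfolding dker_def by (simp add: dhom_symmetric[of k _ l z])

lemma dker_swap: "k \<ge> 0 \<Longrightarrow> dker k (swap_coord i j l) (swap_coord i j z) = dker k l z"
  unfolding dker_def by (simp add: dhom_equivariant)

text \<open>A sign in either argument becomes \<open>(-1) ^ m\<close> in degree \<open>m\<close>.
  Moving \<open>z\<close> into the second argument turns the integrand of the transform into an
  eigenfunction of the operators acting on \<open>z\<close>.\<close>

lemma dker_neg_symmetric:
  assumes "k \<ge> 0"
  shows "dker k (- z) x = dker k (- x) z"
proof -
  have "dker k (- z) x = dker k z (- x)"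
    unfolding dker_def vector_sneg_minus1 dhom_smult_left dhom_smult_right ..
  then show ?thesis using dker_symmetric[OF assms] by metis
qed

lemma dker_0_left:
  assumes "k \<ge> 0" shows "dker k 0 z = 1"
  using dker_symmetric[OF assms] dker_0_right by metis

definition cvx :: "complex \<Rightarrow> complex^'n" where
  "cvx a = (\<chi> i. a)"

lemma cdot_cvx: "cdot (cvx a) z = a * (\<Sum>i\<in>UNIV. z $ i)"
  by (simp add: cdot_def cvx_def sum_distrib_left)

lemma cdot_cvx_swap: "cdot (cvx a) (swap_coord i j z) = cdot (cvx a) z"
  unfolding cdot_swap[symmetric] by (simp add: cvx_def swap_coord_def)

lemma cdot_add_left: "cdot (l + l') z = cdot l z + cdot l' z"
  by (simp add: cdot_def sum.distrib algebra_simps)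

lemma exp_cdot_deriv: "((\<lambda>t. exp (cdot b (z + t *s v))) has_field_derivative exp (cdot b z) * cdot b v) (at 0)"
  unfolding cdot_line by (auto intro!: derivative_eq_intros)

lemma nice_exp_cdot: "nice UNIV (\<lambda>z. exp (cdot b z))"
  by (rule niceI[OF _ exp_cdot_deriv]) (intro continuous_intros)

text \<open>The exponential is invariant under swaps, so it passes through the reflection terms and
  merely adds \<open>cdot (cvx a) z\<close> to the multiplier in the Euler equation; both sides are
  \<open>1\<close> at the origin.\<close>

lemma dker_shift:
  fixes l z :: "complex^'n::{finite,linorder}"
  assumes k: "k \<ge> 0"
  shows "dker k (l + cvx a) z = exp (a * (\<Sum>i\<in>UNIV. z $ i)) * dker k l z"
proof -
  let ?e = "\<lambda>z. exp (cdot (cvx a) z)"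
  let ?g = "\<lambda>z. ?e z * dker k l z"
  have ng: "nice UNIV ?g" by (intro nice_mult nice_exp_cdot nice_dker k)
  have pe: "pd ?e z v = ?e z * cdot (cvx a) v" for z v :: "(complex, 'n) vec"
    by (rule pd_eqI[OF exp_cdot_deriv])
  have "dker k (l + cvx a) z - ?g z = 0"
  proof (rule euler_equation_unique[OF k nice_diff[OF nice_dker[OF k] ng], where l="l + cvx a"])
    show "dker k (l + cvx a) 0 - ?g 0 = 0" by (simp add: dker_0_right cdot_def)
    fix z :: "(complex, 'n) vec" assume z: "regular z"
    have "pd ?g z z + complex_of_real (k/2) * (\<Sum>b\<in>UNIV. ?g z - ?g (swapp b z)) =
       cdot (cvx a) z * ?g z + ?e z * (pd (dker k l) z z + complex_of_real (k/2) * (\<Sum>b\<in>UNIV. dker k l z - dker k l (swapp b z)))"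
      unfolding pd_mult[OF nice_exp_cdot nice_dker[OF k]] pe cdot_cvx_swap right_diff_distrib[symmetric] sum_distrib_left[symmetric]
      by (simp add: algebra_simps)
    also have "\<dots> = cdot (l + cvx a) z * ?g z"
      unfolding euler_dker[OF k z] cdot_add_left by (simp add: algebra_simps)
    finally have g: "pd ?g z z + complex_of_real (k/2) * (\<Sum>b\<in>UNIV. ?g z - ?g (swapp b z)) = cdot (l + cvx a) z * ?g z" .
    let ?h = "dker k (l + cvx a)"
    have "(\<Sum>b\<in>UNIV. (?h z - ?g z) - (?h (swapp b z) - ?g (swapp b z))) = (\<Sum>b\<in>UNIV. ?h z - ?h (swapp b z)) - (\<Sum>b\<in>UNIV. ?g z - ?g (swapp b z))"
      by (simp only: sum_subtractf[symmetric]) (simp add: algebra_simps)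
    then have "pd (\<lambda>z. ?h z - ?g z) z z + complex_of_real (k/2) * (\<Sum>b\<in>UNIV. (?h z - ?g z) - (?h (swapp b z) - ?g (swapp b z)))
      = (pd ?h z z + complex_of_real (k/2) * (\<Sum>b\<in>UNIV. ?h z - ?h (swapp b z))) - (pd ?g z z + complex_of_real (k/2) * (\<Sum>b\<in>UNIV. ?g z - ?g (swapp b z)))"
      unfolding pd_diff[OF nice_dker[OF k] ng] by (simp only: right_diff_distrib) simp
    then show "pd (\<lambda>z. ?h z - ?g z) z z + complex_of_real (k/2) * (\<Sum>b\<in>UNIV. (?h z - ?g z) - (?h (swapp b z) - ?g (swapp b z)))
      = cdot (l + cvx a) z * (?h z - ?g z)"
      unfolding g euler_dker[OF k z] right_diff_distrib .
  qed
  then show ?thesis by (simp add: cdot_cvx)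
qed

text \<open>Shifting by a large constant \<open>R\<close> moves the spectral parameter \<open>-z\<close> into the disc of radius \<open>R - \<epsilon>\<close>,
  which turns the trivial bound of the kernel into exponential decay.\<close>
lemma dker_decay:
  fixes z x :: "complex^'n::{finite,linorder}"
  assumes k: "k \<ge> 0" and e: "\<epsilon> > 0" and re: "\<And>i. Re (z $ i) \<ge> 2 * \<epsilon>" and M: "\<And>i. norm (z $ i) \<le> M"
  defines "R \<equiv> M\<^sup>2 / (2 * \<epsilon>) + \<epsilon>"
  shows "norm (dker k (- z) x) \<le> exp (- R * (\<Sum>i\<in>UNIV. Re (x $ i)) + (R - \<epsilon>) * (\<Sum>i\<in>UNIV. norm (x $ i)))"
proof -
  have e': "- z = (cvx (complex_of_real R) - z) + cvx (- complex_of_real R)" by (simp add: vec_eq_iff cvx_def)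
  have "norm ((cvx (complex_of_real R) - z) $ i) \<le> R - \<epsilon>" for i
  proof -
    let ?w = "z $ i"
    have "(norm (complex_of_real R - ?w))\<^sup>2 = R\<^sup>2 - 2 * R * Re ?w + (norm ?w)\<^sup>2"
      unfolding cmod_power2 by (simp add: power2_eq_square algebra_simps)
    also have "\<dots> \<le> R\<^sup>2 - 2 * R * (2 * \<epsilon>) + M\<^sup>2"
      using re[of i] M[of i] e norm_ge_zero[of ?w] unfolding R_def
      by (intro add_mono diff_mono mult_left_mono power_mono) (auto intro!: add_nonneg_nonneg)
    \<comment> \<open>By the choice of \<open>R\<close>,
      \<open>M\<^sup>2 = 2 * \<epsilon> * (R - \<epsilon>)\<close>.\<close>
    also have "\<dots> = (R - \<epsilon>)\<^sup>2 - 3 * \<epsilon>\<^sup>2"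
      using e unfolding R_def by (simp add: power2_eq_square field_simps)
    also have "\<dots> \<le> (R - \<epsilon>)\<^sup>2" by simp
    finally show ?thesis using e
      by (auto simp: cvx_def R_def intro!: power2_le_imp_le)
  qed
  from dker_bound[OF k this, of x]
  have b: "norm (dker k (cvx (complex_of_real R) - z) x) \<le> exp ((R - \<epsilon>) * (\<Sum>i\<in>UNIV. norm (x $ i)))" .
  have "norm (dker k (- z) x) = exp (- R * (\<Sum>i\<in>UNIV. Re (x $ i))) * norm (dker k (cvx (complex_of_real R) - z) x)"
    unfolding e' dker_shift[OF k] by (simp add: norm_mult)
  also have "\<dots> \<le> exp (- R * (\<Sum>i\<in>UNIV. Re (x $ i))) * exp ((R - \<epsilon>) * (\<Sum>i\<in>UNIV. norm (x $ i)))"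
    by (intro mult_left_mono b) auto
  finally show ?thesis by (simp only: exp_add)
qed

text \<open>For \<open>x\<close> in the closed orthant both sums in \<open>dker_decay\<close> equal
  the sum of the coordinates, and \<open>R\<close> cancels.\<close>

lemma dker_decay_real:
  fixes z :: "complex^'n::{finite,linorder}"
  assumes "k \<ge> 0" "\<epsilon> > 0" "\<And>i. Re (z $ i) \<ge> 2 * \<epsilon>" and "\<And>i. 0 \<le> x $ i"
  shows "norm (dker k (- z) (cvec x)) \<le> exp (- \<epsilon> * (\<Sum>i\<in>UNIV. x $ i))"
proof -
  have "norm (z $ i) \<le> norm z" for i by (rule Finite_Cartesian_Product.norm_nth_le)
  from dker_decay[OF assms(1,2,3) this, of "cvec x"] show ?thesis using assms(4)
    by (simp add: cvec_def algebra_simps)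
qed

text \<open>Shifting \<open>l\<close> by its norm makes all entries nonnegative; the components are
  then nonnegative, and the shift costs only a positive exponential factor. That \<open>l\<close>
  may have any sign matters, because the transform uses the parameter \<open>- z\<close>.\<close>

lemma dker_nonneg:
  fixes l x :: "real^'n::{finite,linorder}"
  assumes k: "k \<ge> 0" and x: "\<And>i. 0 \<le> x $ i"
  shows "dker k (cvec l) (cvec x) = complex_of_real (Re (dker k (cvec l) (cvec x)))" "0 \<le> Re (dker k (cvec l) (cvec x))"
proof -
  define a where "a = norm l"
  define l' where "l' = (\<chi> i. l $ i + a)"
  have l': "0 \<le> l' $ i" for i
    using component_le_norm_cart[of l i] by (simp add: l'_def a_def)
  note * = dhom_nonneg[OF k l' x]
  have s: "(\<lambda>m. dhom k m (cvec l') (cvec x)) sums dker k (cvec l') (cvec x)" by (rule dhom_sums[OF k])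
  have "0 \<le> Re (dker k (cvec l') (cvec x))"
    by (rule sums_le[OF _ sums_zero sums_Re[OF s]]) (use * in auto)
  moreover have "Im (dker k (cvec l') (cvec x)) = 0"
  proof -
    have "(\<lambda>m. Im (dhom k m (cvec l') (cvec x))) sums Im (dker k (cvec l') (cvec x))" by (rule sums_Im[OF s])
    moreover have "(\<lambda>m. Im (dhom k m (cvec l') (cvec x))) = (\<lambda>m. 0)" using * by (auto simp: complex_is_Real_iff)
    ultimately show ?thesis using sums_unique2[OF _ sums_zero] by metis
  qed
  ultimately obtain r where r: "r \<ge> 0" "dker k (cvec l') (cvec x) = complex_of_real r"
    by (metis complex_eq_iff Re_complex_of_real Im_complex_of_real)
  have "cvec l = cvec l' + cvx (- complex_of_real a)"
    by (simp add: vec_eq_iff cvec_def cvx_def l'_def)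
  then have "dker k (cvec l) (cvec x) = exp (- complex_of_real a * (\<Sum>i\<in>UNIV. cvec x $ i)) * complex_of_real r"
    using dker_shift[OF k, of "cvec l'" "- complex_of_real a" "cvec x"] r by simp
  also have "\<dots> = complex_of_real (exp (- a * (\<Sum>i\<in>UNIV. x $ i)) * r)"
    by (simp add: cvec_def exp_of_real[symmetric])
  finally show "dker k (cvec l) (cvec x) = complex_of_real (Re (dker k (cvec l) (cvec x)))" "0 \<le> Re (dker k (cvec l) (cvec x))"
    using r(1) by auto
qed

lemma dker_constant:
  fixes x :: "real^'n::{finite,linorder}"
  assumes "k \<ge> 0"
  shows "dker k (- cvx 1) (cvec x) = complex_of_real (exp (- (\<Sum>i\<in>UNIV. x $ i)))"
proof -
  have "- cvx 1 = (0 :: (complex, 'n) vec) + cvx (-1)" by (simp add: cvx_def vec_eq_iff)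
  then show ?thesis by (simp only: dker_shift[OF assms] dker_0_left[OF assms])
     (simp add: cvec_def exp_of_real[symmetric])
qed

subsection \<open>The Dunkl-Laplace transform\<close>

definition sx :: "real^'n \<Rightarrow> real" where
  "sx x = (\<Sum>i\<in>UNIV. x $ i)"

lemma sx_nonneg: "x \<in> Rpos \<Longrightarrow> 0 \<le> sx x"
  unfolding sx_def Rpos_def by (intro sum_nonneg) (auto intro: less_imp_le)

lemma nth_le_sx: "x \<in> Rpos \<Longrightarrow> x $ i \<le> sx x"
  unfolding sx_def Rpos_def by (rule member_le_sum) (auto intro: less_imp_le)

lemma Rpos_nth: "x \<in> Rpos \<Longrightarrow> 0 < x $ i"
  by (simp add: Rpos_def)

lemma borel_measurable_sx [measurable]: "sx \<in> borel_measurable borel"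
  unfolding sx_def[abs_def] by measurable

lemma open_Rpos: "open (Rpos :: (real^'n) set)"
proof -
  have *: "Rpos = (\<Inter>i. {x::real^'n. 0 < x $ i})" by (auto simp: Rpos_def)
  show ?thesis unfolding * by (intro open_INT ballI open_Collect_less continuous_intros) auto
qed

lemma Rpos_measurable [measurable]: "Rpos \<in> sets borel"
  by (rule borel_open[OF open_Rpos])

section \<open>Integrability on the positive orthant\<close>

lemma nn_integral_exp_Ioi:
  assumes "\<epsilon> > 0"
  shows "(\<integral>\<^sup>+t. ennreal (exp (- \<epsilon> * t)) * indicator {0..} t \<partial>lborel) = ennreal (1 / \<epsilon>)"
proof -
  have "(\<integral>\<^sup>+t. ennreal (exp (- \<epsilon> * t)) * indicator {0..} t \<partial>lborel) = ennreal (0 - (- (1 / \<epsilon>) * exp (- \<epsilon> * 0)))"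
  proof (rule nn_integral_FTC_atLeast)
    show "((\<lambda>t. - (1 / \<epsilon>) * exp (- \<epsilon> * t)) \<longlongrightarrow> 0) at_top"
    proof -
      have "filterlim (\<lambda>t. - \<epsilon> * t) at_bot at_top"
        by (rule filterlim_tendsto_neg_mult_at_bot[OF tendsto_const _ filterlim_ident]) (use assms in simp)
      then have "((\<lambda>t. exp (- \<epsilon> * t)) \<longlongrightarrow> 0) at_top"
        by (rule filterlim_compose[OF exp_at_bot])
      then show ?thesis using tendsto_mult_right_zero by blast
    qed
    show "((\<lambda>t. - (1 / \<epsilon>) * exp (- \<epsilon> * t)) has_real_derivative exp (- \<epsilon> * x)) (at x)" for x
      using assms by (auto intro!: derivative_eq_intros)
  qed auto
  then show ?thesis by simp
qed

lemma AE_lborel_coord_ne: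
  "AE x in (lborel :: (real^'n) measure). x $ i \<noteq> c"
proof -
  have "negligible {x::real^'n. x $ i = c}"
  proof -
    have "axis i 1 \<in> (Basis :: (real^'n) set)" by (auto simp: Basis_vec_def)
    from negligible_standard_hyperplane[OF this, of c] show ?thesis by (simp add: inner_axis)
  qed
  then have "{x::real^'n. x $ i = c} \<in> null_sets lborel"
    by (subst null_sets_completion_iff[symmetric]) (auto simp: negligible_iff_null_sets intro!: borel_closed closed_Collect_eq continuous_intros)
  then show ?thesis by (rule AE_I') auto
qed

lemma prod_Basis_axis: "(\<Prod>b\<in>(Basis :: (real^'n) set). F b) = (\<Prod>i\<in>UNIV. F (axis i (1::real)))"
proof -
  have *: "(Basis :: (real^'n) set) = (\<lambda>i. axis i 1) ` UNIV" by (auto simp: Basis_vec_def)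
  show ?thesis unfolding * by (subst prod.reindex) (auto simp: inj_on_def axis_eq_axis)
qed

lemma nn_integral_exp_Rpos:
  assumes "\<epsilon> > 0"
  shows "(\<integral>\<^sup>+x. ennreal (exp (- \<epsilon> * sx x)) * indicator Rpos x \<partial>(lborel :: (real^'n) measure)) = ennreal ((1 / \<epsilon>) ^ CARD('n))"
proof -
  have "(\<integral>\<^sup>+x. ennreal (exp (- \<epsilon> * sx x)) * indicator Rpos x \<partial>(lborel :: (real^'n) measure))
     = (\<integral>\<^sup>+x. (\<Prod>b\<in>Basis. (\<lambda>t. ennreal (exp (- \<epsilon> * t)) * indicator {0..} t) (x \<bullet> b)) \<partial>(lborel :: (real^'n) measure))"
  proof (rule nn_integral_cong_AE)
    \<comment> \<open>The product of closed half-lines differs from \<open>Rpos\<close> only on the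
      coordinate hyperplanes, a null set.\<close>
    have "AE x in (lborel :: (real^'n) measure). \<forall>i. x $ i \<noteq> 0"
      by (simp add: AE_all_countable AE_lborel_coord_ne)
    then show "AE x in (lborel :: (real^'n) measure). ennreal (exp (- \<epsilon> * sx x)) * indicator Rpos x
        = (\<Prod>b\<in>Basis. (\<lambda>t. ennreal (exp (- \<epsilon> * t)) * indicator {0..} t) (x \<bullet> b))"
    proof eventually_elim
      case (elim x)
      have "(\<Prod>b\<in>Basis. (\<lambda>t. ennreal (exp (- \<epsilon> * t)) * indicator {0..} t) (x \<bullet> b)) =
         (\<Prod>i\<in>UNIV. ennreal (exp (- \<epsilon> * x $ i)) * indicator {0..} (x $ i))"
        by (simp add: prod_Basis_axis inner_axis)
      also have "\<dots> = (\<Prod>i\<in>UNIV. ennreal (exp (- \<epsilon> * x $ i))) * (\<Prod>i\<in>UNIV. indicator {0..} (x $ i))"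
        by (rule prod.distrib)
      also have "(\<Prod>i\<in>UNIV. ennreal (exp (- \<epsilon> * x $ i))) = ennreal (exp (- \<epsilon> * sx x))"
        by (simp add: prod_ennreal exp_sum[symmetric] sx_def sum_distrib_left sum_negf)
      also have "(\<Prod>i\<in>UNIV. indicator {0..} (x $ i)) = (indicator Rpos x :: ennreal)"
      proof (cases "x \<in> Rpos")
        case True
        then show ?thesis by (simp add: Rpos_def less_imp_le)
      next
        case False
        then obtain i where "x $ i < 0" using elim by (auto simp: Rpos_def) (metis linorder_neqE_linordered_idom)
        then have "indicator {0..} (x $ i) = (0::ennreal)" by (simp add: indicator_def)
        then have "(\<Prod>i\<in>UNIV. indicator {0..} (x $ i)) = (0::ennreal)" by (intro prod_zero) auto
        then show ?thesis using False by simp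
      qed
      finally show ?case by simp
    qed
  qed
  also have "\<dots> = (\<Prod>b\<in>(Basis :: (real^'n) set). \<integral>\<^sup>+t. ennreal (exp (- \<epsilon> * t)) * indicator {0..} t \<partial>lborel)"
    by (rule nn_integral_lborel_prod) auto
  also have "\<dots> = ennreal ((1 / \<epsilon>) ^ CARD('n))"
    using assms unfolding nn_integral_exp_Ioi[OF assms] by (simp add: prod_constant ennreal_power)
  finally show ?thesis .
qed

lemma integrable_exp_Rpos:
  assumes "\<epsilon> > 0"
  shows "integrable lborel (\<lambda>x::real^'n. indicator Rpos x * exp (- \<epsilon> * sx x))"
proof (rule integrableI_bounded)
  have "(\<integral>\<^sup>+x. ennreal (norm (indicator Rpos x * exp (- \<epsilon> * sx x))) \<partial>(lborel :: (real^'n) measure))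
    = (\<integral>\<^sup>+x. ennreal (exp (- \<epsilon> * sx x)) * indicator Rpos x \<partial>(lborel :: (real^'n) measure))"
    by (rule nn_integral_cong) (simp add: indicator_def)
  also have "\<dots> < \<infinity>" unfolding nn_integral_exp_Rpos[OF assms] by simp
  finally show "(\<integral>\<^sup>+x. ennreal (norm (indicator Rpos x * exp (- \<epsilon> * sx x))) \<partial>(lborel :: (real^'n) measure)) < \<infinity>" .
qed measurable

lemma integrable_exp_Rpos_lebesgue:
  assumes "\<epsilon> > 0"
  shows "integrable lebesgue (\<lambda>x::real^'n. indicator Rpos x * exp (- \<epsilon> * sx x))"
  using integrable_exp_Rpos[OF assms] by (subst integrable_completion) auto

text \<open>Growth below every exponential. Polynomials, the weight and bounded functions qualify,
  the class is closed under products, and exponential decay of any rate, however small, absorbs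
  it.\<close>

definition subexp :: "(real^'n \<Rightarrow> 'b::real_normed_vector) \<Rightarrow> bool" where
  "subexp g \<longleftrightarrow> (\<forall>\<eta>>0. \<exists>C\<ge>0. \<forall>x\<in>Rpos. norm (g x) \<le> C * exp (\<eta> * sx x))"

lemma subexpD:
  assumes "subexp g" "\<eta> > 0"
  obtains C where "C \<ge> 0" "\<And>x. x \<in> Rpos \<Longrightarrow> norm (g x) \<le> C * exp (\<eta> * sx x)"
  using assms unfolding subexp_def by blast

lemma subexp_mult:
  fixes f g :: "real^'n \<Rightarrow> 'b::real_normed_algebra"
  assumes "subexp f" "subexp g" shows "subexp (\<lambda>x. f x * g x)"
  unfolding subexp_def
proof (intro allI impI)
  fix \<eta> :: real assume "\<eta> > 0"
  then have h: "\<eta> / 2 > 0" by simp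
  obtain C where C: "C \<ge> 0" "\<And>x. x \<in> Rpos \<Longrightarrow> norm (f x) \<le> C * exp (\<eta> / 2 * sx x)" by (rule subexpD[OF assms(1) h]) blast
  obtain C' where C': "C' \<ge> 0" "\<And>x. x \<in> Rpos \<Longrightarrow> norm (g x) \<le> C' * exp (\<eta> / 2 * sx x)" by (rule subexpD[OF assms(2) h]) blast
  show "\<exists>C\<ge>0. \<forall>x\<in>Rpos. norm (f x * g x) \<le> C * exp (\<eta> * sx x)"
  proof (intro exI[of _ "C * C'"] conjI ballI)
    fix x :: "real^'n" assume x: "x \<in> Rpos"
    have "norm (f x * g x) \<le> norm (f x) * norm (g x)" by (rule norm_mult_ineq)
    also have "\<dots> \<le> (C * exp (\<eta> / 2 * sx x)) * (C' * exp (\<eta> / 2 * sx x))"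
      using C C' x by (intro mult_mono) auto
    also have "\<dots> = C * C' * (exp (\<eta> / 2 * sx x) * exp (\<eta> / 2 * sx x))" by (simp add: mult_ac)
    also have "exp (\<eta> / 2 * sx x) * exp (\<eta> / 2 * sx x) = exp (\<eta> * sx x)" by (simp add: exp_add[symmetric])
    finally show "norm (f x * g x) \<le> C * C' * exp (\<eta> * sx x)" .
  qed (use C C' in simp)
qed

lemma subexp_mono:
  assumes "subexp g" "\<And>x. x \<in> Rpos \<Longrightarrow> norm (f x) \<le> norm (g x)"
  shows "subexp f"
  using assms unfolding subexp_def by (meson order_trans)

lemma subexp_bounded:
  fixes f :: "real^'n \<Rightarrow> 'b::real_normed_vector"
  assumes "\<And>x. x \<in> Rpos \<Longrightarrow> norm (f x) \<le> B"
  shows "subexp f"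
  unfolding subexp_def
proof (intro allI impI exI[of _ "\<bar>B\<bar>"] conjI ballI)
  fix \<eta> :: real and x :: "real^'n" assume "\<eta> > 0" "x \<in> Rpos"
  then have "1 \<le> exp (\<eta> * sx x)" using sx_nonneg[of x] by simp
  then have "\<bar>B\<bar> * 1 \<le> \<bar>B\<bar> * exp (\<eta> * sx x)" by (intro mult_left_mono) auto
  then show "norm (f x) \<le> \<bar>B\<bar> * exp (\<eta> * sx x)" using assms[OF \<open>x \<in> Rpos\<close>] by linarith
qed simp

lemma subexp_powr:
  assumes "a \<ge> 0"
  shows "subexp (\<lambda>x::real^'n. (1 + sx x) powr a)"
  unfolding subexp_def
proof (intro allI impI)
  fix \<eta> :: real assume \<eta>: "\<eta> > 0"
  \<comment> \<open>Applying \<open>ln u \<le> u - 1\<close> to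
    \<open>u = (1 + sx x) * \<delta>\<close> bounds the logarithm by a line of slope \<delta>; the
    denominator \<open>a + 1\<close> gives \<open>a * \<delta> \<le> \<eta>\<close> also for
    \<open>a = 0\<close>.\<close>
  define \<delta> where "\<delta> = \<eta> / (a + 1)"
  have \<delta>: "\<delta> > 0" "a * \<delta> \<le> \<eta>" using \<eta> assms by (auto simp: \<delta>_def field_simps)
  show "\<exists>C\<ge>0. \<forall>x\<in>Rpos. norm ((1 + sx (x::real^'n)) powr a) \<le> C * exp (\<eta> * sx x)"
  proof (intro exI[of _ "exp (a * (\<delta> - 1 - ln \<delta>))"] conjI ballI)
    fix x :: "real^'n" assume "x \<in> Rpos"
    then have s: "sx x \<ge> 0" by (rule sx_nonneg)
    have "ln ((1 + sx x) * \<delta>) \<le> (1 + sx x) * \<delta> - 1" by (rule ln_le_minus_one, rule mult_pos_pos) (use s \<delta> in auto)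
    moreover have "ln ((1 + sx x) * \<delta>) = ln (1 + sx x) + ln \<delta>" using s \<delta> by (simp add: ln_mult)
    ultimately have "ln (1 + sx x) \<le> (\<delta> - 1 - ln \<delta>) + \<delta> * sx x" by (simp add: algebra_simps)
    then have "a * ln (1 + sx x) \<le> a * ((\<delta> - 1 - ln \<delta>) + \<delta> * sx x)" using assms by (intro mult_left_mono)
    also have "\<dots> = a * (\<delta> - 1 - ln \<delta>) + (a * \<delta>) * sx x" by (simp add: algebra_simps)
    also have "\<dots> \<le> a * (\<delta> - 1 - ln \<delta>) + \<eta> * sx x" using \<delta> s by (intro add_left_mono mult_right_mono) auto
    finally have "exp (a * ln (1 + sx x)) \<le> exp (a * (\<delta> - 1 - ln \<delta>)) * exp (\<eta> * sx x)" by (simp add: exp_add[symmetric])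
    then show "norm ((1 + sx x) powr a) \<le> exp (a * (\<delta> - 1 - ln \<delta>)) * exp (\<eta> * sx x)"
      using s by (simp add: powr_def)
  qed simp
qed

lemma subexp_prod:
  fixes f :: "'i \<Rightarrow> real^'n \<Rightarrow> 'b::{real_normed_algebra_1,comm_monoid_mult}"
  assumes "finite I" "\<And>i. i \<in> I \<Longrightarrow> subexp (f i)"
  shows "subexp (\<lambda>x. \<Prod>i\<in>I. f i x)"
  using assms
proof (induction I)
  case empty
  show ?case by (rule subexp_bounded[where B=1]) simp
next
  case (insert i I)
  then show ?case by (simp add: subexp_mult)
qed

lemma subexp_nth: "subexp (\<lambda>x::real^'n. x $ i)"
proof (rule subexp_mono[OF subexp_powr[of 1]])
  show "norm (x $ i) \<le> norm ((1 + sx x) powr 1)" if "x \<in> Rpos" for x :: "real^'n"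
    using nth_le_sx[OF that, of i] Rpos_nth[OF that, of i] sx_nonneg[OF that] by simp
qed simp

lemma abs_diff_le_sx: "x \<in> Rpos \<Longrightarrow> \<bar>x $ i - x $ j\<bar> \<le> sx x"
  using nth_le_sx[of x i] nth_le_sx[of x j] Rpos_nth[of x i] Rpos_nth[of x j] by (auto simp: abs_le_iff)

lemma subexp_rpow0:
  assumes "a \<ge> 0"
  shows "subexp (\<lambda>x::real^'n. rpow0 (x $ i - x $ j) a)"
proof (rule subexp_mono[OF subexp_powr[OF assms]])
  fix x :: "real^'n" assume x: "x \<in> Rpos"
  have "\<bar>x $ i - x $ j\<bar> powr a \<le> (1 + sx x) powr a"
    using abs_diff_le_sx[OF x, of i j] assms by (intro powr_mono2) auto
  then show "norm (rpow0 (x $ i - x $ j) a) \<le> norm ((1 + sx x) powr a)"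
    using sx_nonneg[OF x] by (auto simp: rpow0_def)
qed

lemma subexp_weight:
  assumes "k \<ge> 0"
  shows "subexp (weight k :: real^'n::{finite,linorder} \<Rightarrow> real)"
  unfolding weight_def[abs_def] case_prod_unfold by (intro subexp_prod subexp_rpow0) (use assms in auto)

lemma borel_measurable_rpow0 [measurable]:
  "f \<in> borel_measurable M \<Longrightarrow> (\<lambda>x. rpow0 (f x) a) \<in> borel_measurable M"
  unfolding rpow0_def by (cases "a = 0"; simp; measurable)

lemma borel_measurable_weight [measurable]:
  "weight k \<in> borel_measurable (borel :: (real^'n::{finite,linorder}) measure)"
  unfolding weight_def[abs_def] case_prod_unfold by measurable

lemma continuous_on_cvec: "continuous_on S cvec"
  unfolding cvec_def[abs_def] by (intro continuous_intros)

lemma borel_measurable_dker [measurable]: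
  assumes "k \<ge> 0"
  shows "(\<lambda>x::real^'n. dker k l (cvec x)) \<in> borel_measurable borel"
  by (rule borel_measurable_continuous_onI, rule continuous_on_compose2[OF nice_continuous[OF nice_dker[OF assms]] continuous_on_cvec]) auto

lemma lebesgue_measurableI: "f \<in> borel_measurable borel \<Longrightarrow> f \<in> borel_measurable lebesgue"
  by (rule measurable_completion) simp

text \<open>For a holomorphic parameter a dominating function for the values is enough: Cauchy's
  estimate on discs of radius \<open>r/3\<close> bounds the derivatives, hence the difference
  quotients, by \<open>3 / r * B x\<close>. The derivative is measurable as a limit of
  quotients.\<close>

lemma has_field_derivative_integral:
  fixes \<phi> :: "complex \<Rightarrow> 'a \<Rightarrow> complex"
  assumes r: "r > 0"
    and hol: "\<And>x. (\<lambda>t. \<phi> t x) holomorphic_on ball 0 r"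
    and meas: "\<And>t. t \<in> ball 0 r \<Longrightarrow> \<phi> t \<in> borel_measurable M"
    and bnd: "\<And>t x. t \<in> ball 0 r \<Longrightarrow> norm (\<phi> t x) \<le> B x"
    and B: "integrable M B"
  shows "((\<lambda>t. \<integral>x. \<phi> t x \<partial>M) has_field_derivative (\<integral>x. deriv (\<lambda>t. \<phi> t x) 0 \<partial>M)) (at 0)"
    and "(\<lambda>x. deriv (\<lambda>t. \<phi> t x) 0) \<in> borel_measurable M"
    and "\<And>x. norm (deriv (\<lambda>t. \<phi> t x) 0) \<le> 3 / r * B x"
proof -
  have der: "((\<lambda>t. \<phi> t x) has_field_derivative deriv (\<lambda>t. \<phi> t x) t) (at t)" if "t \<in> ball 0 r" for t x
    using holomorphic_derivI[OF hol open_ball that] .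
  have dbnd: "norm (deriv (\<lambda>t. \<phi> t x) t) \<le> 3 / r * B x" if t: "t \<in> cball 0 (r/3)" for t x
  proof -
    have sub: "cball t (r/3) \<subseteq> ball 0 r"
    proof
      fix s assume "s \<in> cball t (r/3)"
      then have "norm s \<le> norm t + r/3" using norm_triangle_ineq[of t "s - t"] by (simp add: dist_norm norm_minus_commute)
      then show "s \<in> ball 0 r" using t r by simp
    qed
    have "norm ((deriv ^^ 1) (\<lambda>t. \<phi> t x) t) \<le> fact 1 * B x / (r/3) ^ 1"
    proof (rule Cauchy_inequality)
      show "(\<lambda>t. \<phi> t x) holomorphic_on ball t (r/3)"
        by (rule holomorphic_on_subset[OF hol]) (use sub in auto)
      show "continuous_on (cball t (r/3)) (\<lambda>t. \<phi> t x)"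
        by (rule holomorphic_on_imp_continuous_on, rule holomorphic_on_subset[OF hol sub])
      fix s assume "norm (t - s) = r/3"
      then have "s \<in> cball t (r/3)" by (simp add: dist_norm)
      then show "norm (\<phi> s x) \<le> B x" by (intro bnd subsetD[OF sub])
    qed (use r in simp)
    then show ?thesis by (simp add: mult.commute)
  qed
  show "\<And>x. norm (deriv (\<lambda>t. \<phi> t x) 0) \<le> 3 / r * B x" by (rule dbnd) (use r in simp)
  have quot: "norm ((\<phi> t x - \<phi> 0 x) / t) \<le> 3 / r * B x" if t: "t \<in> cball 0 (r/3)" for t x
  proof -
    have "norm (\<phi> t x - \<phi> 0 x) \<le> 3 / r * B x * norm (t - 0)"
    proof (rule field_differentiable_bound[where S="cball 0 (r/3)" and f'="\<lambda>t. deriv (\<lambda>t. \<phi> t x) t"])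
      fix s :: complex assume s: "s \<in> cball 0 (r/3)"
      then have "s \<in> ball 0 r" using r by simp
      then show "((\<lambda>t. \<phi> t x) has_field_derivative deriv (\<lambda>t. \<phi> t x) s) (at s within cball 0 (r/3))"
        by (rule has_field_derivative_at_within[OF der])
      show "norm (deriv (\<lambda>t. \<phi> t x) s) \<le> 3 / r * B x" using dbnd[OF s] .
    qed (use t r in auto)
    moreover have "0 \<le> 3 / r * B x" by (rule order_trans[OF norm_ge_zero dbnd[of 0 x]]) (use r in simp)
    ultimately show ?thesis by (cases "t = 0") (auto simp: norm_divide divide_le_eq)
  qed
  have int: "integrable M (\<phi> t)" if "t \<in> ball 0 r" for t
  proof (rule Bochner_Integration.integrable_bound[OF B meas[OF that]])
    show "AE x in M. norm (\<phi> t x) \<le> norm (B x)"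
      unfolding real_norm_def by (rule AE_I2, rule order_trans[OF bnd[OF that] abs_ge_self])
  qed
  have lim: "(\<lambda>n. (\<phi> (S n) x - \<phi> 0 x) / S n) \<longlonglongrightarrow> deriv (\<lambda>t. \<phi> t x) 0"
    if S: "S \<longlonglongrightarrow> 0" "\<And>n. S n \<noteq> 0" for S x
  proof -
    have "((\<lambda>t. (\<phi> t x - \<phi> 0 x) / (t - 0)) \<longlongrightarrow> deriv (\<lambda>t. \<phi> t x) 0) (at 0)"
    proof -
      have "0 \<in> ball (0::complex) r" using r by simp
      from der[OF this, of x] show ?thesis unfolding has_field_derivative_iff .
    qed
    then have "((\<lambda>n. (\<phi> (S n) x - \<phi> 0 x) / (S n - 0)) \<longlongrightarrow> deriv (\<lambda>t. \<phi> t x) 0) sequentially"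
      by (rule filterlim_compose) (simp add: filterlim_at S)
    then show ?thesis by simp
  qed
  define S0 where "S0 n = complex_of_real (r / 3 / real (Suc n))" for n
  have S0: "S0 \<longlonglongrightarrow> 0" "S0 n \<noteq> 0" "S0 n \<in> cball 0 (r/3)" "S0 n \<in> ball 0 r" for n
  proof -
    have "(\<lambda>n. complex_of_real (r / 3 * inverse (real (Suc n)))) \<longlonglongrightarrow> complex_of_real (r / 3 * 0)"
      by (intro tendsto_intros LIMSEQ_inverse_real_of_nat)
    moreover have "S0 = (\<lambda>n. complex_of_real (r / 3 * inverse (real (Suc n))))"
      by (rule ext) (simp only: S0_def divide_inverse)
    ultimately show "S0 \<longlonglongrightarrow> 0" by (simp only: mult_zero_right of_real_0)
    show "S0 n \<noteq> 0" using r by (simp add: S0_def del: of_nat_Suc)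
    have "r / 3 / real (Suc n) \<le> r / 3 / 1" using r by (intro divide_left_mono) auto
    then show "S0 n \<in> cball 0 (r/3)" using r by (simp add: S0_def norm_divide del: of_nat_Suc)
    then show "S0 n \<in> ball 0 r" using r by simp
  qed
  show dm: "(\<lambda>x. deriv (\<lambda>t. \<phi> t x) 0) \<in> borel_measurable M"
  proof (rule borel_measurable_LIMSEQ_metric[where f="\<lambda>n x. (\<phi> (S0 n) x - \<phi> 0 x) / S0 n"])
    show "(\<lambda>x. (\<phi> (S0 n) x - \<phi> 0 x) / S0 n) \<in> borel_measurable M" for n
      by (rule borel_measurable_divide, rule borel_measurable_diff) (use meas[OF S0(4)[of n]] meas[of 0] r in simp_all)
    show "(\<lambda>n. (\<phi> (S0 n) x - \<phi> 0 x) / S0 n) \<longlonglongrightarrow> deriv (\<lambda>t. \<phi> t x) 0" for x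
      using lim[OF S0(1,2)] .
  qed
  show "((\<lambda>t. \<integral>x. \<phi> t x \<partial>M) has_field_derivative (\<integral>x. deriv (\<lambda>t. \<phi> t x) 0 \<partial>M)) (at 0)"
    unfolding has_field_derivative_iff LIMSEQ_SEQ_conv[symmetric]
  proof (intro allI impI)
    fix S :: "nat \<Rightarrow> complex" assume S: "(\<forall>n. S n \<noteq> 0) \<and> S \<longlonglongrightarrow> 0"
    have "\<forall>\<^sub>F n in sequentially. S n \<in> ball 0 (r/3)"
      by (rule topological_tendstoD[OF conjunct2[OF S]]) (use r in auto)
    then obtain N where N: "\<And>n. n \<ge> N \<Longrightarrow> S n \<in> ball 0 (r/3)" by (auto simp: eventually_sequentially)
    have NB: "S (n + N) \<in> cball 0 (r/3)" "S (n + N) \<in> ball 0 r" for n using N[of "n + N"] r by auto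
    have "(\<lambda>n. \<integral>x. (\<phi> (S (n + N)) x - \<phi> 0 x) / S (n + N) \<partial>M) \<longlonglongrightarrow> (\<integral>x. deriv (\<lambda>t. \<phi> t x) 0 \<partial>M)"
    proof (rule integral_dominated_convergence[where w="\<lambda>x. 3 / r * B x"])
      show "(\<lambda>x. (\<phi> (S (n + N)) x - \<phi> 0 x) / S (n + N)) \<in> borel_measurable M" for n
        by (rule borel_measurable_divide, rule borel_measurable_diff) (use meas[OF NB(2)[of n]] meas[of 0] r in simp_all)
      show "AE x in M. (\<lambda>n. (\<phi> (S (n + N)) x - \<phi> 0 x) / S (n + N)) \<longlonglongrightarrow> deriv (\<lambda>t. \<phi> t x) 0"
      proof (rule AE_I2)
        fix x
        have "(\<lambda>n. S (n + N)) \<longlonglongrightarrow> 0" by (rule LIMSEQ_ignore_initial_segment[OF conjunct2[OF S]])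
        then show "(\<lambda>n. (\<phi> (S (n + N)) x - \<phi> 0 x) / S (n + N)) \<longlonglongrightarrow> deriv (\<lambda>t. \<phi> t x) 0"
          by (rule lim[where S="\<lambda>n. S (n + N)"]) (use S in simp)
      qed
      show "AE x in M. norm ((\<phi> (S (n + N)) x - \<phi> 0 x) / S (n + N)) \<le> 3 / r * B x" for n
        by (rule AE_I2, rule quot, rule NB)
    qed (use dm B in auto)
    moreover have "(\<integral>x. (\<phi> (S (n + N)) x - \<phi> 0 x) / S (n + N) \<partial>M) = ((\<integral>x. \<phi> (S (n + N)) x \<partial>M) - (\<integral>x. \<phi> 0 x \<partial>M)) / (S (n + N) - 0)" for n
    proof -
      have "integrable M (\<phi> 0)" by (rule int) (use r in simp)
      then show ?thesis by (simp add: int[OF NB(2)[of n]])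
    qed
    ultimately have "(\<lambda>n. ((\<integral>x. \<phi> (S (n + N)) x \<partial>M) - (\<integral>x. \<phi> 0 x \<partial>M)) / (S (n + N) - 0)) \<longlonglongrightarrow> (\<integral>x. deriv (\<lambda>t. \<phi> t x) 0 \<partial>M)"
      by (simp only:)
    then show "(\<lambda>n. ((\<integral>x. \<phi> (S n) x \<partial>M) - (\<integral>x. \<phi> 0 x \<partial>M)) / (S n - 0)) \<longlonglongrightarrow> (\<integral>x. deriv (\<lambda>t. \<phi> t x) 0 \<partial>M)"
      by (rule LIMSEQ_offset)
  qed
qed

section \<open>The transform and its Dunkl operators on the right half-space\<close>

definition Dpos :: "(complex^'n) set" where
  "Dpos = {z. \<forall>i. 0 < Re (z $ i)}"

definition Dge :: "real \<Rightarrow> (complex^'n) set" where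
  "Dge e = {z. \<forall>i. e < Re (z $ i)}"

lemma open_Dge: "open (Dge e :: (complex^'n) set)"
proof -
  have *: "Dge e = (\<Inter>i. {z::complex^'n. e < Re (z $ i)})" by (auto simp: Dge_def)
  show ?thesis unfolding * by (intro open_INT ballI open_Collect_less continuous_intros) auto
qed

lemma Dpos_Dge: "Dpos = Dge 0"
  by (simp add: Dpos_def Dge_def)

lemma open_Dpos: "open (Dpos :: (complex^'n) set)"
  unfolding Dpos_Dge by (rule open_Dge)

lemma Dpos_swap: "z \<in> Dpos \<Longrightarrow> swap_coord i j z \<in> Dpos"
  by (simp add: Dpos_def)

lemma Dpos_in_Dge:
  fixes z :: "complex^'n"
  assumes "z \<in> Dpos" obtains \<epsilon> where "\<epsilon> > 0" "z \<in> Dge (2 * \<epsilon>)"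
proof -
  define m where "m = Min (range (\<lambda>i. Re (z $ i)))"
  have "m \<in> range (\<lambda>i. Re (z $ i))" unfolding m_def by (rule Min_in) auto
  then have m: "m > 0" using assms by (auto simp: Dpos_def)
  have "m \<le> Re (z $ i)" for i unfolding m_def by (rule Min_le) auto
  then have "m / 2 < Re (z $ i)" for i using m by (smt (verit) field_sum_of_halves)
  then show ?thesis using that[of "m / 4"] m by (simp add: Dge_def)
qed

text \<open>The integrand of the Dunkl-Laplace transform, with \<open>z\<close> moved to the second argument of the kernel.\<close>
definition LW :: "real \<Rightarrow> (real^'n::{finite,linorder} \<Rightarrow> complex) \<Rightarrow> complex^'n::{finite,linorder} \<Rightarrow> real^'n::{finite,linorder} \<Rightarrow> complex" where
  "LW k g z x = indicator Rpos x *\<^sub>R (g x * dker k (- cvec x) z * complex_of_real (weight k x))"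

lemma dunkl_laplace_LW:
  assumes "k \<ge> 0"
  shows "dunkl_laplace k g z = (\<integral>x. LW k g z x \<partial>lebesgue)"
  unfolding dunkl_laplace_def LW_def dunkl_kernel_eq[OF assms] set_lebesgue_integral_def
  by (simp only: dker_neg_symmetric[OF assms])

lemma LW_measurable:
  assumes k: "k \<ge> 0" and g: "set_borel_measurable lebesgue Rpos g"
  shows "LW k g z \<in> borel_measurable lebesgue"
proof -
  have "LW k g z = (\<lambda>x. (indicator Rpos x *\<^sub>R g x) * (dker k (- z) (cvec x) * complex_of_real (weight k x)))"
    by (simp add: LW_def fun_eq_iff dker_neg_symmetric[OF k, of z])
  moreover have "(\<lambda>x. dker k (- z) (cvec x) * complex_of_real (weight k x)) \<in> borel_measurable lebesgue"
    using k by (intro lebesgue_measurableI) measurable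
  ultimately show ?thesis using borel_measurable_times[OF g[unfolded set_borel_measurable_def]] by simp
qed

text \<open>The kernel decays at rate \<epsilon>, and half of that is spent on the growth of
  \<open>g\<close> and the weight. One constant \<open>C\<close> serves all \<open>z\<close> in
  \<open>Dge (2 * \<epsilon>)\<close>, as domination in the parameter requires.\<close>

lemma LW_bound:
  assumes k: "k \<ge> 0" and g: "subexp g" and e: "\<epsilon> > 0"
  obtains C where "C \<ge> 0" "\<And>z x. z \<in> Dge (2 * \<epsilon>) \<Longrightarrow> norm (LW k g z x) \<le> C * (indicator Rpos x * exp (- (\<epsilon> / 2) * sx x))"
proof -
  have "subexp (\<lambda>x. g x * complex_of_real (weight k x))"
    by (rule subexp_mult[OF g subexp_mono[OF subexp_weight[OF k]]]) simp
  moreover have "\<epsilon> / 2 > 0" using e by simp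
  ultimately obtain C where C: "C \<ge> 0" "\<And>x. x \<in> Rpos \<Longrightarrow> norm (g x * complex_of_real (weight k x)) \<le> C * exp (\<epsilon> / 2 * sx x)"
    by (rule subexpD) blast
  have "norm (LW k g z x) \<le> C * (indicator Rpos x * exp (- (\<epsilon> / 2) * sx x))" if z: "z \<in> Dge (2 * \<epsilon>)" for z x
  proof (cases "x \<in> Rpos")
    case True
    have "norm (dker k (- z) (cvec x)) \<le> exp (- \<epsilon> * (\<Sum>i\<in>UNIV. x $ i))"
      by (rule dker_decay_real[OF k e]) (use z True in \<open>auto simp: Dge_def Rpos_def intro: less_imp_le\<close>)
    then have "norm (dker k (- z) (cvec x)) \<le> exp (- \<epsilon> * sx x)" by (simp add: sx_def)
    moreover have "norm (LW k g z x) = norm (g x * complex_of_real (weight k x)) * norm (dker k (- z) (cvec x))"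
      using True by (simp add: LW_def norm_mult dker_neg_symmetric[OF k, of z])
    ultimately have "norm (LW k g z x) \<le> (C * exp (\<epsilon> / 2 * sx x)) * exp (- \<epsilon> * sx x)"
      using C True by (auto intro!: mult_mono)
    also have "\<dots> = C * exp (- (\<epsilon> / 2) * sx x)" by (simp add: exp_add[symmetric] algebra_simps)
    finally show ?thesis using True by simp
  qed (simp add: LW_def)
  with C show ?thesis using that by blast
qed

lemma LW_integrable:
  assumes "k \<ge> 0" "set_borel_measurable lebesgue Rpos g" "subexp g" "z \<in> Dpos"
  shows "integrable lebesgue (LW k g z)"
proof -
  obtain \<epsilon> where e: "\<epsilon> > 0" "z \<in> Dge (2 * \<epsilon>)" by (rule Dpos_in_Dge[OF assms(4)])
  obtain C where C: "C \<ge> 0" "\<And>z x. z \<in> Dge (2 * \<epsilon>) \<Longrightarrow> norm (LW k g z x) \<le> C * (indicator Rpos x * exp (- (\<epsilon> / 2) * sx x))"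
    by (rule LW_bound[OF assms(1,3) e(1)]) blast
  have h: "\<epsilon> / 2 > 0" using e by simp
  show ?thesis
    by (rule Bochner_Integration.integrable_bound[OF integrable_mult_right[OF integrable_exp_Rpos_lebesgue[OF h], of C] LW_measurable[OF assms(1,2)]])
      (rule AE_I2, use order_trans[OF C(2)[OF e(2)] abs_ge_self] in simp)
qed

lemma LW_deriv:
  assumes k: "k \<ge> 0" and g: "set_borel_measurable lebesgue Rpos g" "subexp g" and z: "z \<in> Dpos"
  shows "((\<lambda>t. \<integral>x. LW k g (z + t *s v) x \<partial>lebesgue) has_field_derivative
      (\<integral>x. indicator Rpos x *\<^sub>R (g x * pd (dker k (- cvec x)) z v * complex_of_real (weight k x)) \<partial>lebesgue)) (at 0)"
    and "integrable lebesgue (\<lambda>x. indicator Rpos x *\<^sub>R (g x * pd (dker k (- cvec x)) z v * complex_of_real (weight k x)))"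
proof -
  obtain \<epsilon> where e: "\<epsilon> > 0" "z \<in> Dge (2 * \<epsilon>)" by (rule Dpos_in_Dge[OF z])
  obtain C where C: "C \<ge> 0" "\<And>z x. z \<in> Dge (2 * \<epsilon>) \<Longrightarrow> norm (LW k g z x) \<le> C * (indicator Rpos x * exp (- (\<epsilon> / 2) * sx x))"
    by (rule LW_bound[OF k g(2) e(1)]) blast
  have h: "\<epsilon> / 2 > 0" using e by simp
  have "open ((\<lambda>t. z + t *s v) -` Dge (2 * \<epsilon>))"
    by (rule open_vimage[OF open_Dge continuous_on_line])
  moreover have "0 \<in> (\<lambda>t. z + t *s v) -` Dge (2 * \<epsilon>)" using e by simp
  ultimately obtain r where r: "r > 0" "ball 0 r \<subseteq> (\<lambda>t. z + t *s v) -` Dge (2 * \<epsilon>)" by (rule openE)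
  let ?B = "\<lambda>x. C * (indicator Rpos x * exp (- (\<epsilon> / 2) * sx x))"
  have B: "integrable lebesgue ?B" by (rule integrable_mult_right[OF integrable_exp_Rpos_lebesgue[OF h]])
  have hol: "(\<lambda>t. LW k g (z + t *s v) x) holomorphic_on ball 0 r" for x
    unfolding LW_def scaleR_conv_of_real
    by (intro holomorphic_intros nice_holomorphic[OF nice_dker[OF k]]) auto
  have d: "deriv (\<lambda>t. LW k g (z + t *s v) x) 0 = indicator Rpos x *\<^sub>R (g x * pd (dker k (- cvec x)) z v * complex_of_real (weight k x))" for x
  proof (rule DERIV_imp_deriv)
    show "((\<lambda>t. LW k g (z + t *s v) x) has_field_derivative indicator Rpos x *\<^sub>R (g x * pd (dker k (- cvec x)) z v * complex_of_real (weight k x))) (at 0)"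
      unfolding LW_def scaleR_conv_of_real
      by (intro DERIV_cmult DERIV_cmult_right nice_deriv_UNIV nice_dker k)
  qed
  note * = has_field_derivative_integral[where \<phi>="\<lambda>t x. LW k g (z + t *s v) x" and M=lebesgue and B="?B", OF r(1) hol LW_measurable[OF k g(1)] _ B, unfolded d]
  have bnd: "norm (LW k g (z + t *s v) x) \<le> ?B x" if "t \<in> ball 0 r" for t x
    using C(2) subsetD[OF r(2) that] by simp
  show "((\<lambda>t. \<integral>x. LW k g (z + t *s v) x \<partial>lebesgue) has_field_derivative
      (\<integral>x. indicator Rpos x *\<^sub>R (g x * pd (dker k (- cvec x)) z v * complex_of_real (weight k x)) \<partial>lebesgue)) (at 0)"
    by (rule *(1)[OF bnd])
  show "integrable lebesgue (\<lambda>x. indicator Rpos x *\<^sub>R (g x * pd (dker k (- cvec x)) z v * complex_of_real (weight k x)))"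
  proof (rule Bochner_Integration.integrable_bound[OF integrable_mult_right[OF B, of "3 / r"]])
    show "(\<lambda>x. indicator Rpos x *\<^sub>R (g x * pd (dker k (- cvec x)) z v * complex_of_real (weight k x))) \<in> borel_measurable lebesgue"
      by (rule *(2)[OF bnd])
    have "norm (indicator Rpos x *\<^sub>R (g x * pd (dker k (- cvec x)) z v * complex_of_real (weight k x))) \<le> 3 / r * ?B x" for x
      by (rule *(3)[OF bnd])
    then show "AE x in lebesgue. norm (indicator Rpos x *\<^sub>R (g x * pd (dker k (- cvec x)) z v * complex_of_real (weight k x))) \<le> norm (3 / r * ?B x)"
      unfolding real_norm_def by (intro AE_I2 order_trans[OF _ abs_ge_self])
  qed
qed

text \<open>Dominated convergence needs a majorant uniform in \<open>z\<close>, so continuity is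
  shown on each \<open>Dge (2 * \<epsilon>)\<close>; these open sets cover
  \<open>Dpos\<close>.\<close>

lemma laplace_nice:
  assumes k: "k \<ge> 0" and g: "set_borel_measurable lebesgue Rpos g" "subexp g"
  shows "nice Dpos (dunkl_laplace k g)"
proof -
  have eq: "dunkl_laplace k g = (\<lambda>z. \<integral>x. LW k g z x \<partial>lebesgue)"
    by (simp add: fun_eq_iff dunkl_laplace_LW[OF k])
  have cont: "continuous_on (Dge (2 * \<epsilon>)) (\<lambda>z. \<integral>x. LW k g z x \<partial>lebesgue)" if e: "\<epsilon> > 0" for \<epsilon>
    unfolding continuous_on_sequentially o_def
  proof (intro allI ballI impI)
    fix X and a :: "complex^'a::{finite,linorder}" assume a: "a \<in> Dge (2 * \<epsilon>)" and X: "(\<forall>n. X n \<in> Dge (2 * \<epsilon>)) \<and> X \<longlonglongrightarrow> a"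
    obtain C where C: "C \<ge> 0" "\<And>z x. z \<in> Dge (2 * \<epsilon>) \<Longrightarrow> norm (LW k g z x) \<le> C * (indicator Rpos x * exp (- (\<epsilon> / 2) * sx x))"
      by (rule LW_bound[OF k g(2) e]) blast
    have h: "\<epsilon> / 2 > 0" using e by simp
    show "(\<lambda>n. \<integral>x. LW k g (X n) x \<partial>lebesgue) \<longlonglongrightarrow> (\<integral>x. LW k g a x \<partial>lebesgue)"
    proof (rule integral_dominated_convergence[OF LW_measurable[OF k g(1)] LW_measurable[OF k g(1)] integrable_mult_right[OF integrable_exp_Rpos_lebesgue[OF h], of C]])
      show "AE x in lebesgue. (\<lambda>n. LW k g (X n) x) \<longlonglongrightarrow> LW k g a x"
      proof (rule AE_I2)
        fix x
        have "isCont (dker k (- cvec x)) a"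
          using nice_continuous[OF nice_dker[OF k, of "- cvec x"]] by (simp add: continuous_on_eq_continuous_at)
        then have "(\<lambda>n. dker k (- cvec x) (X n)) \<longlonglongrightarrow> dker k (- cvec x) a"
          by (rule isCont_tendsto_compose[OF _ conjunct2[OF X]])
        then show "(\<lambda>n. LW k g (X n) x) \<longlonglongrightarrow> LW k g a x"
          unfolding LW_def by (intro tendsto_scaleR tendsto_mult tendsto_const)
      qed
      show "AE x in lebesgue. norm (LW k g (X n) x) \<le> C * (indicator Rpos x * exp (- (\<epsilon> / 2) * sx x))" for n
        by (rule AE_I2, rule C(2)) (use X in simp)
    qed
  qed
  show ?thesis unfolding nice_def eq
  proof (intro conjI ballI allI)
    show "continuous_on Dpos (\<lambda>z. \<integral>x. LW k g z x \<partial>lebesgue)"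
    proof (rule continuous_at_imp_continuous_on, rule ballI)
      fix z :: "complex^'a::{finite,linorder}" assume "z \<in> Dpos"
      then obtain \<epsilon> where e: "\<epsilon> > 0" "z \<in> Dge (2 * \<epsilon>)" by (rule Dpos_in_Dge)
      show "isCont (\<lambda>z. \<integral>x. LW k g z x \<partial>lebesgue) z"
        by (rule continuous_on_eq_continuous_at[OF open_Dge, THEN iffD1, rule_format, OF cont[OF e(1)] e(2)])
    qed
    show "(\<lambda>t. \<integral>x. LW k g (z + t *s v) x \<partial>lebesgue) field_differentiable at 0" if "z \<in> Dpos" for z v
      using LW_deriv(1)[OF k g that] unfolding field_differentiable_def by (rule exI)
  qed
qed

text \<open>All pieces of \<open>Tr\<close> in the variable \<open>z\<close> pass under the
  integral, where \<open>dker k (- cvec x)\<close> is an eigenfunction with eigenvalue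
  \<open>- (\<xi> \<bullet> x)\<close>.\<close>

lemma Tr_laplace:
  fixes \<xi> :: "real^'n::{finite,linorder}"
  assumes k: "k \<ge> 0" and g: "set_borel_measurable lebesgue Rpos g" "subexp g" and z: "z \<in> Dpos" "regular z"
  shows "Tr k (cvec \<xi>) (dunkl_laplace k g) z = dunkl_laplace k (\<lambda>x. - complex_of_real (\<xi> \<bullet> x) * g x) z"
proof -
  let ?P = "\<lambda>x. indicator Rpos x *\<^sub>R (g x * pd (dker k (- cvec x)) z (cvec \<xi>) * complex_of_real (weight k x))"
  let ?c = "\<lambda>a. (cvec \<xi> $ fst a - cvec \<xi> $ snd a)"
  let ?y = "\<lambda>a. z $ fst a - z $ snd a"
  have I: "integrable lebesgue (LW k g z)" by (rule LW_integrable[OF k g z(1)])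
  have Is: "integrable lebesgue (LW k g (swapp a z))" for a by (rule LW_integrable[OF k g Dpos_swap[OF z(1)]])
  have "pd (dunkl_laplace k g) z (cvec \<xi>) = (\<integral>x. ?P x \<partial>lebesgue)"
    by (rule pd_eqI) (simp only: dunkl_laplace_LW[OF k] LW_deriv(1)[OF k g z(1)])
  then have "Tr k (cvec \<xi>) (dunkl_laplace k g) z = (\<integral>x. ?P x \<partial>lebesgue) + complex_of_real (k/2) * (\<Sum>a\<in>UNIV. ?c a * (((\<integral>x. LW k g z x \<partial>lebesgue) - (\<integral>x. LW k g (swapp a z) x \<partial>lebesgue)) / ?y a))"
    unfolding Tr_def dunkl_laplace_LW[OF k] by simp
  also have "\<dots> = (\<integral>x. ?P x + complex_of_real (k/2) * (\<Sum>a\<in>UNIV. ?c a * ((LW k g z x - LW k g (swapp a z) x) / ?y a)) \<partial>lebesgue)"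
    using I Is LW_deriv(2)[OF k g z(1)] by simp
  also have "\<dots> = (\<integral>x. LW k (\<lambda>x. - complex_of_real (\<xi> \<bullet> x) * g x) z x \<partial>lebesgue)"
  proof (rule Bochner_Integration.integral_cong[OF refl])
    fix x :: "(real, 'n) vec"
    let ?h = "dker k (- cvec x)"
    let ?G = "indicator Rpos x *\<^sub>R (g x * complex_of_real (weight k x))"
    have L: "LW k g y x = ?G * ?h y" for y by (simp add: LW_def)
    have "(\<Sum>a\<in>UNIV. ?c a * ((LW k g z x - LW k g (swapp a z) x) / ?y a)) = ?G * (\<Sum>a\<in>UNIV. ?c a * ((?h z - ?h (swapp a z)) / ?y a))"
      unfolding L right_diff_distrib[symmetric] by (simp only: times_divide_eq_right[symmetric] mult.left_commute[of "?c _"] sum_distrib_left)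
    then have "?P x + complex_of_real (k/2) * (\<Sum>a\<in>UNIV. ?c a * ((LW k g z x - LW k g (swapp a z) x) / ?y a)) = ?G * Tr k (cvec \<xi>) ?h z"
      unfolding Tr_def distrib_left by (simp add: mult_ac)
    also have "Tr k (cvec \<xi>) ?h z = - complex_of_real (\<xi> \<bullet> x) * ?h z"
      unfolding Tr_dker[OF k z(2)] by (simp add: cdot_def cvec_def inner_vec_def sum_negf mult.commute)
    finally show "?P x + complex_of_real (k/2) * (\<Sum>a\<in>UNIV. ?c a * ((LW k g z x - LW k g (swapp a z) x) / ?y a)) = LW k (\<lambda>x. - complex_of_real (\<xi> \<bullet> x) * g x) z x"
      by (simp add: LW_def mult_ac)
  qed
  finally show ?thesis by (simp only: dunkl_laplace_LW[OF k])
qed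

lemma set_borel_measurable_mult_cont:
  assumes "set_borel_measurable lebesgue Rpos g" "h \<in> borel_measurable borel"
  shows "set_borel_measurable lebesgue Rpos (\<lambda>x. (h x :: complex) * g x)"
proof -
  have "(\<lambda>x. h x * (indicator Rpos x *\<^sub>R g x)) \<in> borel_measurable lebesgue"
    using assms lebesgue_measurableI[OF assms(2)] unfolding set_borel_measurable_def by (intro borel_measurable_times)
  then show ?thesis unfolding set_borel_measurable_def by (simp add: mult_scaleR_right)
qed

lemma subexp_of_real: "subexp f \<Longrightarrow> subexp (\<lambda>x. complex_of_real (f x))"
  by (rule subexp_mono) auto

lemma subexp_uminus: "subexp f \<Longrightarrow> subexp (\<lambda>x. - f x)"
  by (rule subexp_mono) auto

lemma dunkl_op_laplace_axis:
  assumes k: "k \<ge> 0" and g: "set_borel_measurable lebesgue Rpos g" "subexp g"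
  shows "z \<in> Dpos \<Longrightarrow> dunkl_op k (axis j 1) (dunkl_laplace k g) z = dunkl_laplace k (\<lambda>x. - complex_of_real (x $ j) * g x) z"
    and "set_borel_measurable lebesgue Rpos (\<lambda>x. - complex_of_real (x $ j) * g x)"
    and "subexp (\<lambda>x. - complex_of_real (x $ j) * g x)"
proof -
  show m: "set_borel_measurable lebesgue Rpos (\<lambda>x. - complex_of_real (x $ j) * g x)"
    by (rule set_borel_measurable_mult_cont[OF g(1)]) measurable
  show s: "subexp (\<lambda>x. - complex_of_real (x $ j) * g x)"
    by (intro subexp_mult subexp_uminus subexp_of_real subexp_nth g)
  show "dunkl_op k (axis j 1) (dunkl_laplace k g) z = dunkl_laplace k (\<lambda>x. - complex_of_real (x $ j) * g x) z" if z: "z \<in> Dpos"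
  proof (rule dunkl_op_eqI[OF laplace_nice[OF k g] open_Dpos Dpos_swap nice_continuous[OF laplace_nice[OF k m s]] _ z])
    fix z :: "(complex, 'a) vec" assume "z \<in> Dpos" "regular z"
    from Tr_laplace[OF k g this, of "axis j 1"]
    show "Tr k (cvec (axis j 1)) (dunkl_laplace k g) z = dunkl_laplace k (\<lambda>x. - complex_of_real (x $ j) * g x) z"
      by (simp add: inner_axis')
  qed
qed

text \<open>The iterated operators on the transform are identified on \<open>Dpos\<close> only.
  Locality on an invariant open set, including the \<open>Lim\<close> inside
  \<open>div_diff\<close>, lets the next operator be applied there.\<close>

lemma dunkl_op_cong:
  fixes f h :: "complex^'n::{finite,linorder} \<Rightarrow> complex"
  assumes D: "open D" "\<And>i j z. z \<in> D \<Longrightarrow> swap_coord i j z \<in> D" and eq: "\<And>z. z \<in> D \<Longrightarrow> f z = h z" and z: "z \<in> D"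
  shows "dunkl_op k xi f z = dunkl_op k xi h z"
proof -
  have "dir_deriv xi f z = dir_deriv xi h z"
    unfolding dir_deriv_def
  proof (rule deriv_cong_ev[OF _ refl])
    have "open ((\<lambda>t. z + t *s cvec xi) -` D)" by (rule open_vimage[OF D(1) continuous_on_line])
    moreover have "0 \<in> (\<lambda>t. z + t *s cvec xi) -` D" using z by simp
    ultimately have "\<forall>\<^sub>F t in nhds 0. t \<in> (\<lambda>t. z + t *s cvec xi) -` D" by (rule eventually_nhds_in_open)
    then show "\<forall>\<^sub>F t in nhds 0. f (z + t *s cvec xi) = h (z + t *s cvec xi)"
      by (rule eventually_mono) (simp add: eq)
  qed
  moreover have "div_diff i j f z = div_diff i j h z" for i j
  proof -
    let ?S = "{w::(complex,'n) vec. w $ i \<noteq> w $ j}"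
    have "\<forall>\<^sub>F w in at z within ?S. w \<in> D"
      unfolding eventually_at_filter by (rule eventually_mono[OF eventually_nhds_in_open[OF D(1) z]]) simp
    then have ev: "\<forall>\<^sub>F w in at z within ?S. (f w - f (swap_coord i j w)) / (w $ i - w $ j) = (h w - h (swap_coord i j w)) / (w $ i - w $ j)"
      by (rule eventually_mono) (simp add: eq D(2))
    have "Lim (at z within ?S) (\<lambda>w. (f w - f (swap_coord i j w)) / (w $ i - w $ j)) = Lim (at z within ?S) (\<lambda>w. (h w - h (swap_coord i j w)) / (w $ i - w $ j))"
      by (simp only: t2_space_class.Lim_def tendsto_cong[OF ev])
    then show ?thesis using eq[OF z] eq[OF D(2)[OF z]] by (simp add: div_diff_def)
  qed
  ultimately show ?thesis by (simp add: dunkl_op_def)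
qed

text \<open>Measurability and growth of the new integrand are carried along because the next
  application requires them.\<close>

lemma foldr_dunkl_laplace:
  assumes k: "k \<ge> 0" and g: "set_borel_measurable lebesgue Rpos g" "subexp g"
    and h: "\<And>z. z \<in> Dpos \<Longrightarrow> h z = dunkl_laplace k g z"
  shows "(\<forall>z\<in>Dpos. foldr (\<lambda>j g. dunkl_op k (axis j 1) g) js h z =
      dunkl_laplace k (\<lambda>x. prod_list (map (\<lambda>j. - complex_of_real (x $ j)) js) * g x) z)
    \<and> set_borel_measurable lebesgue Rpos (\<lambda>x. prod_list (map (\<lambda>j. - complex_of_real (x $ j)) js) * g x)
    \<and> subexp (\<lambda>x. prod_list (map (\<lambda>j. - complex_of_real (x $ j)) js) * g x)"
proof (induction js)
  case Nil
  then show ?case using g h by simp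
next
  case (Cons j js)
  let ?G = "\<lambda>x. prod_list (map (\<lambda>j. - complex_of_real (x $ j)) js) * g x"
  have m: "set_borel_measurable lebesgue Rpos ?G" and s: "subexp ?G"
    and e: "\<And>z. z \<in> Dpos \<Longrightarrow> foldr (\<lambda>j g. dunkl_op k (axis j 1) g) js h z = dunkl_laplace k ?G z"
    using conjunct1[OF Cons] conjunct2[OF Cons] by simp_all
  have "foldr (\<lambda>j g. dunkl_op k (axis j 1) g) (j # js) h z = dunkl_laplace k (\<lambda>x. - complex_of_real (x $ j) * ?G x) z" if z: "z \<in> Dpos" for z
    using dunkl_op_cong[OF open_Dpos Dpos_swap e z, where k=k and xi="axis j 1"] dunkl_op_laplace_axis(1)[OF k m s z] by simp
  then show ?case using dunkl_op_laplace_axis(2,3)[OF k m s, of j] by (simp add: mult.assoc)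
qed

lemma prod_list_coords:
  fixes x :: "real^'n::{finite,linorder}"
  shows "prod_list (map (\<lambda>j. - complex_of_real (x $ j)) (sorted_list_of_set (UNIV :: 'n set))) = (-1) ^ CARD('n) * complex_of_real (dprod x)"
proof -
  have "prod_list (map (\<lambda>j. - complex_of_real (x $ j)) (sorted_list_of_set (UNIV :: 'n set))) = (\<Prod>j\<in>UNIV. - complex_of_real (x $ j))"
    using prod.distinct_set_conv_list[of "sorted_list_of_set (UNIV :: 'n set)" "\<lambda>j. - complex_of_real (x $ j)"] by simp
  then show ?thesis by (simp add: dprod_def prod_uminus)
qed

lemma dunkl_Delta_power_laplace:
  fixes f :: "real^'n::{finite,linorder} \<Rightarrow> complex"
  assumes k: "k \<ge> 0" and f: "set_borel_measurable lebesgue Rpos f" "subexp f"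
  shows "(\<forall>z\<in>Dpos. (dunkl_Delta k ^^ \<nu>) (dunkl_laplace k f) z =
      dunkl_laplace k (\<lambda>x. ((-1) ^ CARD('n) * complex_of_real (dprod x)) ^ \<nu> * f x) z)
    \<and> set_borel_measurable lebesgue Rpos (\<lambda>x. ((-1) ^ CARD('n) * complex_of_real (dprod x)) ^ \<nu> * f x)
    \<and> subexp (\<lambda>x. ((-1) ^ CARD('n) * complex_of_real (dprod x)) ^ \<nu> * f x)"
proof (induction \<nu>)
  case 0
  then show ?case using f by simp
next
  case (Suc \<nu>)
  let ?G = "\<lambda>x. ((-1) ^ CARD('n) * complex_of_real (dprod x)) ^ \<nu> * f x"
  from foldr_dunkl_laplace[OF k, of ?G "(dunkl_Delta k ^^ \<nu>) (dunkl_laplace k f)" "sorted_list_of_set UNIV"] Suc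
  show ?case by (simp add: dunkl_Delta_def[of k "(dunkl_Delta k ^^ \<nu>) (dunkl_laplace k f)"] prod_list_coords mult.assoc)
qed

subsection \<open>Integration by parts for the Dunkl weight\<close>

text \<open>Borel functions with exponential decay at an unspecified positive rate. Products with
  measurable \<open>subexp\<close> functions stay in this class, which keeps the integrals below
  absolutely convergent.\<close>

definition good :: "(real^'n \<Rightarrow> real) \<Rightarrow> bool" where
  "good h \<longleftrightarrow> h \<in> borel_measurable borel \<and> (\<exists>C \<epsilon>. 0 \<le> C \<and> 0 < \<epsilon> \<and> (\<forall>x\<in>Rpos. \<bar>h x\<bar> \<le> C * exp (- \<epsilon> * sx x)))"

definition rint :: "(real^'n \<Rightarrow> real) \<Rightarrow> real" where
  "rint h = (\<integral>x. indicator Rpos x * h x \<partial>lborel)"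

lemma goodI:
  assumes "h \<in> borel_measurable borel" "0 \<le> C" "0 < \<epsilon>" "\<And>x. x \<in> Rpos \<Longrightarrow> \<bar>h x\<bar> \<le> C * exp (- \<epsilon> * sx x)"
  shows "good h"
  using assms unfolding good_def by auto

lemma goodE:
  assumes "good h"
  obtains C \<epsilon> where "h \<in> borel_measurable borel" "0 \<le> C" "0 < \<epsilon>" "\<And>x. x \<in> Rpos \<Longrightarrow> \<bar>h x\<bar> \<le> C * exp (- \<epsilon> * sx x)"
proof -
  from assms obtain C \<epsilon> where "h \<in> borel_measurable borel" "0 \<le> C" "0 < \<epsilon>" "\<forall>x\<in>Rpos. \<bar>h x\<bar> \<le> C * exp (- \<epsilon> * sx x)"
    unfolding good_def by (elim conjE exE)
  then show ?thesis by (intro that[of C \<epsilon>]) auto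
qed

lemma good_measurable: "good h \<Longrightarrow> h \<in> borel_measurable borel"
  by (simp add: good_def)

lemma good_integrable:
  assumes "good h"
  shows "integrable lborel (\<lambda>x. indicator Rpos x * h x)"
proof -
  obtain C \<epsilon> where h: "h \<in> borel_measurable borel" "0 \<le> C" "0 < \<epsilon>" "\<And>x. x \<in> Rpos \<Longrightarrow> \<bar>h x\<bar> \<le> C * exp (- \<epsilon> * sx x)"
    by (rule goodE[OF assms]) blast
  show ?thesis
  proof (rule Bochner_Integration.integrable_bound[OF integrable_mult_right[OF integrable_exp_Rpos[OF h(3)], of C]])
    show "(\<lambda>x. indicator Rpos x * h x) \<in> borel_measurable lborel" using h(1) by measurable
    show "AE x in lborel. norm (indicator Rpos x * h x) \<le> norm (C * (indicator Rpos x * exp (- \<epsilon> * sx x)))"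
    proof (rule AE_I2)
      fix x :: "real^'a"
      show "norm (indicator Rpos x * h x) \<le> norm (C * (indicator Rpos x * exp (- \<epsilon> * sx x)))"
        using h(2) h(4)[of x] by (cases "x \<in> Rpos") (auto simp: abs_mult)
    qed
  qed
qed

lemma good_mono:
  assumes "good g" "h \<in> borel_measurable borel" "\<And>x. x \<in> Rpos \<Longrightarrow> \<bar>h x\<bar> \<le> \<bar>g x\<bar>"
  shows "good h"
proof -
  obtain C \<epsilon> where g: "g \<in> borel_measurable borel" "0 \<le> C" "0 < \<epsilon>" "\<And>x. x \<in> Rpos \<Longrightarrow> \<bar>g x\<bar> \<le> C * exp (- \<epsilon> * sx x)"
    by (rule goodE[OF assms(1)]) blast
  show ?thesis by (rule goodI[OF assms(2) g(2,3)]) (rule order_trans[OF assms(3) g(4)])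
qed

lemma good_mult_subexp:
  assumes "good h" "subexp g" "g \<in> borel_measurable borel"
  shows "good (\<lambda>x. h x * g x)"
proof -
  obtain C \<epsilon> where h: "h \<in> borel_measurable borel" "0 \<le> C" "0 < \<epsilon>" "\<And>x. x \<in> Rpos \<Longrightarrow> \<bar>h x\<bar> \<le> C * exp (- \<epsilon> * sx x)"
    by (rule goodE[OF assms(1)]) blast
  have "\<epsilon> / 2 > 0" using h by simp
  then obtain C' where C': "C' \<ge> 0" "\<And>x. x \<in> Rpos \<Longrightarrow> norm (g x) \<le> C' * exp (\<epsilon> / 2 * sx x)"
    by (rule subexpD[OF assms(2)]) blast
  show ?thesis
  proof (rule goodI[of _ "C * C'" "\<epsilon> / 2"])
    fix x :: "real^'a" assume x: "x \<in> Rpos"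
    have "\<bar>h x * g x\<bar> \<le> (C * exp (- \<epsilon> * sx x)) * (C' * exp (\<epsilon> / 2 * sx x))"
      unfolding abs_mult using h(2,4) C' x by (intro mult_mono) auto
    also have "\<dots> = C * C' * (exp (- \<epsilon> * sx x) * exp (\<epsilon> / 2 * sx x))" by (simp add: mult_ac)
    also have "exp (- \<epsilon> * sx x) * exp (\<epsilon> / 2 * sx x) = exp (- (\<epsilon> / 2) * sx x)"
      unfolding exp_add[symmetric] by (simp add: field_simps)
    finally show "\<bar>h x * g x\<bar> \<le> C * C' * exp (- (\<epsilon> / 2) * sx x)" .
  qed (use h C' assms in \<open>auto intro: borel_measurable_times\<close>)
qed

lemma good_add:
  assumes "good f" "good g" shows "good (\<lambda>x. f x + g x)"
proof -
  obtain C \<epsilon> where f: "f \<in> borel_measurable borel" "0 \<le> C" "0 < \<epsilon>" "\<And>x. x \<in> Rpos \<Longrightarrow> \<bar>f x\<bar> \<le> C * exp (- \<epsilon> * sx x)"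
    by (rule goodE[OF assms(1)]) blast
  obtain C' \<epsilon>' where g: "g \<in> borel_measurable borel" "0 \<le> C'" "0 < \<epsilon>'" "\<And>x. x \<in> Rpos \<Longrightarrow> \<bar>g x\<bar> \<le> C' * exp (- \<epsilon>' * sx x)"
    by (rule goodE[OF assms(2)]) blast
  show ?thesis
  proof (rule goodI[of _ "C + C'" "min \<epsilon> \<epsilon>'"])
    fix x :: "real^'a" assume x: "x \<in> Rpos"
    have "C * exp (- \<epsilon> * sx x) \<le> C * exp (- min \<epsilon> \<epsilon>' * sx x)" "C' * exp (- \<epsilon>' * sx x) \<le> C' * exp (- min \<epsilon> \<epsilon>' * sx x)"
      using sx_nonneg[OF x] f(2) g(2) by (auto intro!: mult_left_mono mult_right_mono)
    then show "\<bar>f x + g x\<bar> \<le> (C + C') * exp (- min \<epsilon> \<epsilon>' * sx x)"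
      using f(4)[OF x] g(4)[OF x] by (simp add: distrib_right)
  qed (use f g in auto)
qed

lemma subexp_const: "subexp (\<lambda>x. c)"
  by (rule subexp_bounded[of _ "norm c"]) simp

lemma good_cmult: "good f \<Longrightarrow> good (\<lambda>x. c * f x)"
  using good_mult_subexp[OF _ subexp_const, of f c] by (simp add: mult.commute)

lemma good_diff: "good f \<Longrightarrow> good g \<Longrightarrow> good (\<lambda>x. f x - g x)"
  using good_add[of f "\<lambda>x. - 1 * g x"] good_cmult[of g "-1"] by simp

lemma good_0: "good (\<lambda>x. 0)"
  by (rule goodI[of _ 0 1]) auto

lemma good_sum: "finite I \<Longrightarrow> (\<And>i. i \<in> I \<Longrightarrow> good (f i)) \<Longrightarrow> good (\<lambda>x. \<Sum>i\<in>I. f i x)"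
  by (induction I rule: finite_induct) (auto intro: good_0 good_add)

lemma rint_add: "good f \<Longrightarrow> good g \<Longrightarrow> rint (\<lambda>x. f x + g x) = rint f + rint g"
  unfolding rint_def distrib_left by (rule Bochner_Integration.integral_add) (auto intro: good_integrable)

lemma rint_diff: "good f \<Longrightarrow> good g \<Longrightarrow> rint (\<lambda>x. f x - g x) = rint f - rint g"
  unfolding rint_def right_diff_distrib by (rule Bochner_Integration.integral_diff) (auto intro: good_integrable)

lemma rint_cmult: "rint (\<lambda>x. c * f x) = c * rint f"
  unfolding rint_def mult.left_commute[of _ c] by simp

lemma rint_0: "rint (\<lambda>x. 0) = 0"
  by (simp add: rint_def)

lemma rint_sum: "finite I \<Longrightarrow> (\<And>i. i \<in> I \<Longrightarrow> good (f i)) \<Longrightarrow> rint (\<lambda>x. \<Sum>i\<in>I. f i x) = (\<Sum>i\<in>I. rint (f i))"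
  by (induction I rule: finite_induct) (simp_all add: rint_0 rint_add good_sum)

lemma AE_regular: "AE x in (lborel :: (real^'n) measure). regular x"
proof -
  have "AE x in (lborel :: (real^'n) measure). x $ i \<noteq> x $ j" if "i \<noteq> j" for i j
  proof -
    have ne: "(axis i 1 - axis j 1 :: real^'n) \<noteq> 0"
    proof
      assume "(axis i 1 - axis j 1 :: real^'n) = 0"
      then have "(axis i 1 - axis j 1 :: real^'n) $ i = 0" by simp
      then show False using that by (simp add: axis_def)
    qed
    have "negligible {x::real^'n. (axis i 1 - axis j 1) \<bullet> x = 0}"
      by (rule negligible_hyperplane) (use ne in simp)
    moreover have "{x::real^'n. (axis i 1 - axis j 1) \<bullet> x = 0} = {x. x $ i = x $ j}"
      by (simp add: inner_diff_left inner_axis')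
    ultimately have "negligible {x::real^'n. x $ i = x $ j}" by simp
    then have "{x::real^'n. x $ i = x $ j} \<in> null_sets lborel"
      by (subst null_sets_completion_iff[symmetric]) (auto simp: negligible_iff_null_sets intro!: borel_closed closed_Collect_eq continuous_intros)
    then show ?thesis by (rule AE_I') auto
  qed
  then have "AE x in (lborel :: (real^'n) measure). i \<noteq> j \<longrightarrow> x $ i \<noteq> x $ j" for i j by (cases "i = j") auto
  then have "AE x in (lborel :: (real^'n) measure). \<forall>i j. i \<noteq> j \<longrightarrow> x $ i \<noteq> x $ j"
    by (simp add: AE_all_countable)
  then show ?thesis unfolding regular_def .
qed

lemma rint_cong_regular:
  assumes "\<And>x. x \<in> Rpos \<Longrightarrow> regular x \<Longrightarrow> f x = g x" "f \<in> borel_measurable borel" "g \<in> borel_measurable borel"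
  shows "rint f = rint g"
  unfolding rint_def
proof (rule integral_cong_AE)
  show "AE x in lborel. indicator Rpos x * f x = indicator Rpos x * g x"
    using AE_regular by eventually_elim (auto simp: indicator_def assms(1))
qed (use assms(2,3) in measurable)

lemma rint_dominated:
  assumes f: "f \<in> borel_measurable borel" and s: "\<And>m. s m \<in> borel_measurable borel" and B: "good B"
    and lim: "\<And>x. x \<in> Rpos \<Longrightarrow> regular x \<Longrightarrow> (\<lambda>m. s m x) \<longlonglongrightarrow> f x"
    and bnd: "\<And>m x. x \<in> Rpos \<Longrightarrow> regular x \<Longrightarrow> \<bar>s m x\<bar> \<le> B x"
  shows "(\<lambda>m. rint (s m)) \<longlonglongrightarrow> rint f"
  unfolding rint_def
proof (rule integral_dominated_convergence[OF _ _ good_integrable[OF B]])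
  show "AE x in lborel. (\<lambda>m. indicator Rpos x * s m x) \<longlonglongrightarrow> indicator Rpos x * f x"
    using AE_regular by eventually_elim (auto simp: indicator_def lim)
  show "AE x in lborel. norm (indicator Rpos x * s m x) \<le> indicator Rpos x * B x" for m
    using AE_regular by eventually_elim (auto simp: indicator_def bnd)
qed (use f s in measurable)

section \<open>Coordinate swaps and dilations\<close>

lemma swap_coord_measurable [measurable]: "swap_coord i j \<in> borel_measurable (borel :: (real^'n) measure)"
  by (rule borel_measurable_continuous_onI) (intro continuous_intros)

lemma lborel_swap: "distr lborel borel (swap_coord i j) = (lborel :: (real^'n) measure)"
proof (rule lborel_eqI[symmetric])
  fix l u :: "real^'n" assume lu: "\<And>b. b \<in> Basis \<Longrightarrow> l \<bullet> b \<le> u \<bullet> b"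
  have pre: "swap_coord i j -` box l u = box (swap_coord i j l) (swap_coord i j u)"
  proof -
    have "swap_coord i j x \<in> box l u \<longleftrightarrow> x \<in> box (swap_coord i j l) (swap_coord i j u)" for x
      unfolding mem_box_cart swap_coord_nth by (metis transpose_involutory)
    then show ?thesis by blast
  qed
  have lu': "\<And>b. b \<in> Basis \<Longrightarrow> swap_coord i j l \<bullet> b \<le> swap_coord i j u \<bullet> b"
  proof -
    have "l $ a \<le> u $ a" for a using lu[of "axis a 1"] by (simp add: inner_axis axis_in_Basis_iff)
    then show "swap_coord i j l \<bullet> b \<le> swap_coord i j u \<bullet> b" if "b \<in> Basis" for b
      using that by (auto simp: Basis_vec_def inner_axis)
  qed
  have "emeasure (distr lborel borel (swap_coord i j)) (box l u) = emeasure lborel (box (swap_coord i j l) (swap_coord i j u))"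
    by (subst emeasure_distr) (auto simp: pre)
  also have "\<dots> = ennreal (\<Prod>b\<in>Basis. (swap_coord i j u - swap_coord i j l) \<bullet> b)"
    using lu' by (simp add: emeasure_lborel_box)
  also have "(\<Prod>b\<in>Basis. (swap_coord i j u - swap_coord i j l) \<bullet> b) = (\<Prod>b\<in>Basis. (u - l) \<bullet> b)"
    unfolding prod_Basis_axis
    by (rule prod.reindex_bij_witness[where i="Transposition.transpose i j" and j="Transposition.transpose i j"]) (auto simp: inner_axis)
  finally show "emeasure (distr lborel borel (swap_coord i j)) (box l u) = ennreal (\<Prod>b\<in>Basis. (u - l) \<bullet> b)" .
qed simp

lemma Rpos_swap_iff [simp]: "swap_coord i j x \<in> Rpos \<longleftrightarrow> x \<in> Rpos"
  unfolding Rpos_def by simp (metis transpose_involutory)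

lemma sx_swap [simp]: "sx (swap_coord i j x) = sx x"
  unfolding sx_def swap_coord_nth
  by (rule sum.reindex_bij_witness[where i="Transposition.transpose i j" and j="Transposition.transpose i j"]) auto

lemma rint_swap:
  assumes "f \<in> borel_measurable borel"
  shows "rint (\<lambda>x. f (swap_coord i j x)) = rint f"
proof -
  have "rint f = (\<integral>x. indicator Rpos x * f x \<partial>distr lborel borel (swap_coord i j))"
    unfolding rint_def lborel_swap ..
  also have "\<dots> = (\<integral>x. indicator Rpos (swap_coord i j x) * f (swap_coord i j x) \<partial>lborel)"
    by (rule integral_distr) (use assms in measurable)
  also have "\<dots> = rint (\<lambda>x. f (swap_coord i j x))"
    unfolding rint_def by (simp add: indicator_def)
  finally show ?thesis by simp
qed

lemma good_swap:
  assumes "good f" shows "good (\<lambda>x. f (swap_coord i j x))"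
proof -
  obtain C \<epsilon> where f: "f \<in> borel_measurable borel" "0 \<le> C" "0 < \<epsilon>" "\<And>x. x \<in> Rpos \<Longrightarrow> \<bar>f x\<bar> \<le> C * exp (- \<epsilon> * sx x)"
    by (rule goodE[OF assms]) blast
  show ?thesis
  proof (rule goodI[OF _ f(2,3)])
    show "(\<lambda>x. f (swap_coord i j x)) \<in> borel_measurable borel" using f(1) by measurable
    show "\<bar>f (swap_coord i j x)\<bar> \<le> C * exp (- \<epsilon> * sx x)" if "x \<in> Rpos" for x
      using f(4)[of "swap_coord i j x"] that by simp
  qed
qed

definition dil :: "'n \<Rightarrow> real \<Rightarrow> real^'n \<Rightarrow> real^'n" where
  "dil j s x = (\<chi> i. if i = j then s * x $ i else x $ i)"

lemma dil_eq: "dil j s x = x + ((s - 1) * x $ j) *\<^sub>R axis j 1"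
  by (auto simp: dil_def vec_eq_iff axis_def algebra_simps)

lemma dil_measurable [measurable]: "dil j s \<in> borel_measurable borel"
  unfolding dil_eq[abs_def] by measurable

lemma rint_dil:
  assumes "f \<in> borel_measurable borel" "s > 0"
  shows "rint f = s * rint (\<lambda>x. f (dil j s x))"
proof -
  define c where "c b = (if b = axis j 1 then s else 1)" for b :: "real^'a"
  have T: "(0 + (\<Sum>b\<in>Basis. (c b * (x \<bullet> b)) *\<^sub>R b)) = dil j s x" for x
  proof -
    have *: "(Basis :: (real^'a) set) = (\<lambda>i. axis i 1) ` UNIV" by (auto simp: Basis_vec_def)
    have "(\<Sum>b\<in>Basis. (c b * (x \<bullet> b)) *\<^sub>R b) = (\<Sum>i\<in>UNIV. (c (axis i 1) * (x \<bullet> axis i 1)) *\<^sub>R axis i (1::real))"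
      unfolding * by (subst sum.reindex) (auto simp: inj_on_def axis_eq_axis)
    moreover have "(\<Sum>i\<in>UNIV. d i *\<^sub>R axis i (1::real)) = (\<chi> i. d i)" for d :: "'a \<Rightarrow> real"
      by (simp add: vec_eq_iff axis_def if_distrib cong: if_cong)
    moreover have "c (axis i 1) * (x \<bullet> axis i 1) = (if i = j then s * x $ i else x $ i)" for i
      by (simp add: c_def axis_eq_axis inner_axis)
    ultimately show ?thesis by (simp add: dil_def)
  qed
  have P: "(\<Prod>b\<in>(Basis::(real^'a) set). \<bar>c b\<bar>) = s"
    using assms(2) by (simp add: prod_Basis_axis c_def axis_eq_axis if_distrib cong: if_cong)
  have L: "(lborel :: (real^'a) measure) = density (distr lborel borel (dil j s)) (\<lambda>_. ennreal s)"
    using lborel_affine_euclidean[of c 0] assms(2) unfolding T P by (simp add: c_def)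
  have "rint f = (\<integral>x. indicator Rpos x * f x \<partial>density (distr lborel borel (dil j s)) (\<lambda>_. ennreal s))"
    unfolding rint_def L[symmetric] ..
  also have "\<dots> = (\<integral>x. s *\<^sub>R (indicator Rpos x * f x) \<partial>distr lborel borel (dil j s))"
    by (rule integral_density) (use assms in auto)
  also have "\<dots> = (\<integral>x. s *\<^sub>R (indicator Rpos (dil j s x) * f (dil j s x)) \<partial>lborel)"
    by (rule integral_distr) (use assms in measurable)
  also have "\<dots> = s * rint (\<lambda>x. f (dil j s x))"
  proof -
    have "dil j s x \<in> Rpos \<longleftrightarrow> x \<in> Rpos" for x
      using assms(2) by (auto simp: Rpos_def dil_def zero_less_mult_iff)
    then show ?thesis by (simp add: rint_def indicator_def)
  qed
  finally show ?thesis .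
qed

lemma sx_dil: "sx (dil j s x) = sx x + (s - 1) * x $ j"
proof -
  have "sx (dil j s x) = (\<Sum>i\<in>UNIV. x $ i + (if i = j then (s - 1) * x $ j else 0))"
    unfolding sx_def by (rule sum.cong) (auto simp: dil_def algebra_simps)
  then show ?thesis by (simp add: sx_def sum.distrib)
qed

lemma dil_Rpos: "x \<in> Rpos \<Longrightarrow> s \<ge> 1 \<Longrightarrow> dil j s x \<in> Rpos"
  by (auto simp: Rpos_def dil_def intro: mult_pos_pos)

lemma exp_sx_dil_le:
  assumes "x \<in> Rpos" "s \<ge> 1" "\<epsilon> > 0" "C \<ge> 0"
  shows "C * exp (- \<epsilon> * sx (dil j s x)) \<le> C * exp (- \<epsilon> * sx x)"
proof -
  have "0 \<le> (s - 1) * x $ j" using assms Rpos_nth[OF assms(1), of j] by simp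
  then show ?thesis using assms by (intro mult_left_mono) (auto simp: sx_dil)
qed

lemma good_dil:
  assumes "good f" "s \<ge> 1"
  shows "good (\<lambda>x. f (dil j s x))"
proof -
  obtain C \<epsilon> where f: "f \<in> borel_measurable borel" "0 \<le> C" "0 < \<epsilon>" "\<And>x. x \<in> Rpos \<Longrightarrow> \<bar>f x\<bar> \<le> C * exp (- \<epsilon> * sx x)"
    by (rule goodE[OF assms(1)]) blast
  show ?thesis
  proof (rule goodI[OF _ f(2,3)])
    show "(\<lambda>x. f (dil j s x)) \<in> borel_measurable borel" using f(1) by measurable
    show "\<bar>f (dil j s x)\<bar> \<le> C * exp (- \<epsilon> * sx x)" if "x \<in> Rpos" for x
      by (rule order_trans[OF f(4)[OF dil_Rpos[OF that assms(2)]] exp_sx_dil_le[OF that assms(2) f(3,2)]])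
  qed
qed

text \<open>The integral of \<open>\<partial>\<^sub>j(x\<^sub>j H)\<close> vanishes; differentiating along the dilations of one coordinate avoids boundary terms.\<close>
lemma dilation_ibp:
  fixes H H' :: "real^'n \<Rightarrow> real"
  assumes H: "good H" and K: "good (\<lambda>x. H x + x $ j * H' x)"
    and der: "\<And>x. x \<in> Rpos \<Longrightarrow> ((\<lambda>t. H (x + t *\<^sub>R axis j 1)) has_real_derivative H' x) (at 0)"
  shows "rint (\<lambda>x. H x + x $ j * H' x) = 0"
proof -
  define K where "K x = H x + x $ j * H' x" for x
  have gK: "good K" using K unfolding K_def[abs_def] .
  obtain C \<epsilon> where C: "K \<in> borel_measurable borel" "0 \<le> C" "0 < \<epsilon>" "\<And>x. x \<in> Rpos \<Longrightarrow> \<bar>K x\<bar> \<le> C * exp (- \<epsilon> * sx x)"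
    by (rule goodE[OF gK]) blast
  define B where "B x = C * exp (- \<epsilon> * sx x)" for x :: "real^'n"
  have gB: "good B"
  proof (rule goodI[OF _ C(2,3)])
    show "B \<in> borel_measurable borel" unfolding B_def[abs_def] by measurable
  qed (use C(2) in \<open>simp add: B_def\<close>)
  define \<sigma> where "\<sigma> m = 1 + inverse (real (Suc m))" for m
  have \<sigma>: "\<sigma> m > 1" for m unfolding \<sigma>_def by simp
  \<comment> \<open>By the change of variables \<open>rint_dil\<close> the integral of
    \<open>q x s\<close> over \<open>x\<close> does not depend on \<open>s\<close>, while its
    derivative in \<open>s\<close> is \<open>K (dil j s x)\<close>. The difference quotients at
    \<open>s = 1\<close> thus have integral zero and tend to \<open>K\<close>.\<close>
  define q where "q x s = s * H (dil j s x)" for x s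
  have dq: "(q x has_real_derivative K (dil j s x)) (at s)" if x: "x \<in> Rpos" and s: "s \<ge> 1" for x s
  proof -
    define y where "y = dil j s x"
    have y: "y \<in> Rpos" unfolding y_def by (rule dil_Rpos[OF x s])
    have e: "dil j r x = y + ((r - s) * x $ j) *\<^sub>R axis j 1" for r
      unfolding y_def dil_eq by (simp add: algebra_simps)
    have d0: "((\<lambda>t. H (y + t *\<^sub>R axis j 1)) has_real_derivative H' y) (at ((s - s) * x $ j))"
      using der[OF y] by simp
    have d1: "((\<lambda>r. (r - s) * x $ j) has_real_derivative x $ j) (at s)"
      by (auto intro!: derivative_eq_intros)
    have "((\<lambda>r. H (y + ((r - s) * x $ j) *\<^sub>R axis j 1)) has_real_derivative H' y * x $ j) (at s)"
      by (rule DERIV_chain2[OF d0 d1])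
    then have "((\<lambda>r. H (dil j r x)) has_real_derivative H' y * x $ j) (at s)" unfolding e[symmetric] .
    from DERIV_mult[OF DERIV_ident this]
    have "(q x has_real_derivative 1 * H (dil j s x) + (H' y * x $ j) * s) (at s)" unfolding q_def[abs_def] .
    moreover have "1 * H (dil j s x) + (H' y * x $ j) * s = K (dil j s x)"
      unfolding K_def y_def by (simp add: dil_def algebra_simps)
    ultimately show ?thesis by simp
  qed
  define Q where "Q m x = (q x (\<sigma> m) - q x 1) / (\<sigma> m - 1)" for m x
  have Hm: "H \<in> borel_measurable borel" by (rule good_measurable[OF H])
  have Qm: "Q m \<in> borel_measurable borel" for m
    unfolding Q_def[abs_def] q_def using Hm by measurable
  have "rint (Q m) = 0" for m
  proof -
    have "rint (Q m) = rint (\<lambda>x. (1 / (\<sigma> m - 1)) * (\<sigma> m * H (dil j (\<sigma> m) x) - H x))"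
      unfolding Q_def q_def by (simp add: dil_eq)
    also have "\<dots> = (1 / (\<sigma> m - 1)) * (\<sigma> m * rint (\<lambda>x. H (dil j (\<sigma> m) x)) - rint H)"
      using \<sigma>[of m] by (subst rint_cmult, subst rint_diff) (auto intro!: good_cmult good_dil H simp: rint_cmult)
    also have "\<dots> = 0" using rint_dil[OF Hm, of "\<sigma> m" j] \<sigma>[of m] by simp
    finally show ?thesis .
  qed
  moreover have "(\<lambda>m. rint (Q m)) \<longlonglongrightarrow> rint K"
  proof (rule rint_dominated[OF C(1) Qm gB])
    fix x :: "real^'n" assume x: "x \<in> Rpos"
    have "(q x has_real_derivative K x) (at 1)" using dq[OF x, of 1] by (simp add: dil_eq)
    then have l: "((\<lambda>s. (q x s - q x 1) / (s - 1)) \<longlongrightarrow> K x) (at 1)" unfolding has_field_derivative_iff .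
    have "\<sigma> \<longlonglongrightarrow> 1"
    proof -
      have "(\<lambda>m. 1 + inverse (real (Suc m))) \<longlonglongrightarrow> 1 + 0"
        by (intro tendsto_add tendsto_const LIMSEQ_inverse_real_of_nat)
      then show ?thesis unfolding \<sigma>_def[abs_def] by simp
    qed
    moreover have "\<forall>m. \<sigma> m \<noteq> 1" using \<sigma> by (metis less_irrefl)
    ultimately have "filterlim \<sigma> (at 1) sequentially" by (simp add: filterlim_at)
    from filterlim_compose[OF l this] show "(\<lambda>m. Q m x) \<longlonglongrightarrow> K x" unfolding Q_def .
    show "\<bar>Q m x\<bar> \<le> B x" for m
    proof -
      \<comment> \<open>The mean value theorem evaluates the quotient at a stretched point;
        stretching a coordinate only increases \<open>sx\<close>, so the bound of \<open>K\<close>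
        there is below its value at \<open>x\<close>.\<close>
      have "\<exists>z>1. z < \<sigma> m \<and> q x (\<sigma> m) - q x 1 = (\<sigma> m - 1) * K (dil j z x)"
        using MVT2[of 1 "\<sigma> m" "q x" "\<lambda>s. K (dil j s x)", OF \<sigma> dq[OF x]] by auto
      then obtain z where z: "z > 1" "q x (\<sigma> m) - q x 1 = (\<sigma> m - 1) * K (dil j z x)" by auto
      then have "Q m x = K (dil j z x)" using \<sigma>[of m] by (simp add: Q_def)
      also have "\<bar>\<dots>\<bar> \<le> C * exp (- \<epsilon> * sx (dil j z x))" by (rule C(4)[OF dil_Rpos[OF x]]) (use z in simp)
      also have "\<dots> \<le> B x" unfolding B_def by (rule exp_sx_dil_le[OF x _ C(3,2)]) (use z in simp)
      finally show ?thesis .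
    qed
  qed
  ultimately have "rint K = 0" by (simp add: LIMSEQ_const_iff)
  then show ?thesis unfolding K_def[abs_def] .
qed

text \<open>Ordered pairs, so each unordered pair counts twice; with the exponent \<open>k/2\<close>
  on squares in \<open>wS\<close> this produces \<open>|x_i - x_j| ^ (2 * k)\<close> at
  \<open>\<delta> = 0\<close>.\<close>

definition prs :: "'n set \<Rightarrow> ('n \<times> 'n) set" where
  "prs S = {a. fst a \<in> S \<and> snd a \<in> S \<and> fst a \<noteq> snd a}"

text \<open>For \<open>\<delta> > 0\<close> this is a smooth regularization of the weight.\<close>
definition wS :: "'n set \<Rightarrow> real \<Rightarrow> real \<Rightarrow> real^'n \<Rightarrow> real" where
  "wS S k \<delta> x = (\<Prod>a\<in>prs S. ((x $ fst a - x $ snd a)\<^sup>2 + \<delta>) powr (k/2))"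

lemma wS_measurable [measurable]: "wS S k \<delta> \<in> borel_measurable borel"
  unfolding wS_def[abs_def] by measurable

lemma wS_nonneg: "0 \<le> wS S k \<delta> x"
  unfolding wS_def by (intro prod_nonneg) auto

lemma wS_mono:
  assumes "k \<ge> 0" "0 \<le> \<delta>" "\<delta> \<le> 1"
  shows "wS S k \<delta> x \<le> wS S k 1 x"
  unfolding wS_def using assms by (intro prod_mono conjI powr_mono2) auto

lemma subexp_wS:
  assumes k: "k \<ge> 0" and \<delta>: "0 \<le> \<delta>" "\<delta> \<le> 1"
  shows "subexp (wS S k \<delta> :: real^'n \<Rightarrow> real)"
proof -
  have "subexp (wS S k 1 :: real^'n \<Rightarrow> real)"
    unfolding wS_def[abs_def]
  proof (intro subexp_prod)
    fix a :: "'n \<times> 'n"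
    show "subexp (\<lambda>x::real^'n. ((x $ fst a - x $ snd a)\<^sup>2 + 1) powr (k/2))"
    proof (rule subexp_mono[OF subexp_powr[OF k]])
      fix x :: "real^'n" assume x: "x \<in> Rpos"
      let ?d = "x $ fst a - x $ snd a"
      have s: "\<bar>?d\<bar> \<le> sx x" "0 \<le> sx x" using abs_diff_le_sx[OF x] sx_nonneg[OF x] by auto
      have "?d\<^sup>2 \<le> (sx x)\<^sup>2" using s by (simp add: abs_le_square_iff[symmetric])
      then have "?d\<^sup>2 + 1 \<le> (1 + sx x)\<^sup>2" using s by (simp add: power2_eq_square algebra_simps)
      then have "(?d\<^sup>2 + 1) powr (k/2) \<le> ((1 + sx x)\<^sup>2) powr (k/2)" using k by (intro powr_mono2) auto
      also have "((1 + sx x)\<^sup>2) powr (k/2) = (1 + sx x) powr k"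
        using s by (simp add: powr_powr powr_numeral[symmetric] del: powr_numeral)
      finally show "norm ((?d\<^sup>2 + 1) powr (k/2)) \<le> norm ((1 + sx x) powr k)" by simp
    qed
  qed simp
  then show ?thesis
    by (rule subexp_mono) (use wS_mono[OF k \<delta>, of S] wS_nonneg[of S k] in auto)
qed

lemma wS_swap:
  assumes "i \<in> S" "j \<in> S"
  shows "wS S k \<delta> (swap_coord i j x) = wS S k \<delta> x"
  unfolding wS_def swap_coord_nth
proof (rule prod.reindex_bij_witness[where
      i="\<lambda>a. (Transposition.transpose i j (fst a), Transposition.transpose i j (snd a))" and
      j="\<lambda>a. (Transposition.transpose i j (fst a), Transposition.transpose i j (snd a))"])
  have t: "Transposition.transpose i j l \<in> S" if "l \<in> S" for l
    using that assms by (auto simp: Transposition.transpose_def)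
  have ne: "Transposition.transpose i j a = Transposition.transpose i j b \<longleftrightarrow> a = b" for a b
    by (metis transpose_involutory)
  show "(Transposition.transpose i j (fst a), Transposition.transpose i j (snd a)) \<in> prs S" if "a \<in> prs S" for a
    using that t ne by (auto simp: prs_def)
  show "(Transposition.transpose i j (fst b), Transposition.transpose i j (snd b)) \<in> prs S" if "b \<in> prs S" for b
    using that t ne by (auto simp: prs_def)
qed auto

lemma wS_tendsto:
  assumes "regular x" "\<delta> \<longlonglongrightarrow> 0"
  shows "(\<lambda>m. wS S k (\<delta> m) x) \<longlonglongrightarrow> wS S k 0 x"
  unfolding wS_def
proof (intro tendsto_prod)
  fix a assume "a \<in> prs S"
  then have "(x $ fst a - x $ snd a)\<^sup>2 + 0 \<noteq> 0" using assms(1) by (auto simp: prs_def regular_def)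
  then show "(\<lambda>m. ((x $ fst a - x $ snd a)\<^sup>2 + \<delta> m) powr (k / 2)) \<longlonglongrightarrow> ((x $ fst a - x $ snd a)\<^sup>2 + 0) powr (k / 2)"
    by (intro tendsto_powr tendsto_add tendsto_const assms(2))
qed

text \<open>By antisymmetry the pairs \<open>(j, l)\<close> and \<open>(l, j)\<close> contribute
  alike.\<close>

lemma sum_prs_split:
  fixes c :: "'n::finite \<Rightarrow> 'n \<Rightarrow> real"
  assumes "j \<in> S" and anti: "\<And>a b. c a b = - c b a"
  shows "(\<Sum>a\<in>prs S. c (fst a) (snd a) * ((if fst a = j then 1 else 0) - (if snd a = j then 1 else 0))) = 2 * (\<Sum>l\<in>S-{j}. c j l)"
proof -
  have "(\<Sum>a\<in>prs S. c (fst a) (snd a) * ((if fst a = j then 1 else 0) - (if snd a = j then 1 else 0)))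
    = (\<Sum>a\<in>prs S. if fst a = j then c (fst a) (snd a) else 0) - (\<Sum>a\<in>prs S. if snd a = j then c (fst a) (snd a) else 0)"
    unfolding sum_subtractf[symmetric] by (rule sum.cong) auto
  also have "(\<Sum>a\<in>prs S. if fst a = j then c (fst a) (snd a) else 0) = (\<Sum>a\<in>Pair j ` (S - {j}). c (fst a) (snd a))"
    unfolding sum.If_cases[OF finite] using assms(1) by (simp, intro sum.cong) (auto simp: prs_def)
  also have "(\<Sum>a\<in>Pair j ` (S - {j}). c (fst a) (snd a)) = (\<Sum>l\<in>S-{j}. c j l)"
    by (subst sum.reindex) (auto simp: inj_on_def)
  also have "(\<Sum>a\<in>prs S. if snd a = j then c (fst a) (snd a) else 0) = (\<Sum>a\<in>(\<lambda>l. (l, j)) ` (S - {j}). c (fst a) (snd a))"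
    unfolding sum.If_cases[OF finite] using assms(1) by (simp, intro sum.cong) (auto simp: prs_def)
  also have "(\<Sum>a\<in>(\<lambda>l. (l, j)) ` (S - {j}). c (fst a) (snd a)) = (\<Sum>l\<in>S-{j}. c l j)"
    by (subst sum.reindex) (auto simp: inj_on_def)
  also have "(\<Sum>l\<in>S-{j}. c l j) = - (\<Sum>l\<in>S-{j}. c j l)"
    unfolding sum_negf[symmetric] by (rule sum.cong[OF refl anti])
  finally show ?thesis by simp
qed

lemma wS_exp:
  assumes "\<delta> > 0"
  shows "wS S k \<delta> x = exp (\<Sum>a\<in>prs S. (k/2) * ln ((x $ fst a - x $ snd a)\<^sup>2 + \<delta>))"
proof -
  have "(x $ fst a - x $ snd a)\<^sup>2 + \<delta> \<noteq> 0" for a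
    using assms by (metis add_nonneg_pos less_irrefl zero_le_power2)
  then show ?thesis unfolding wS_def by (simp add: exp_sum powr_def)
qed

text \<open>Logarithmic differentiation; the two orders of each pair containing \<open>j\<close>
  give equal terms, which turns \<open>k\<close> into \<open>2 * k\<close>.\<close>

lemma wS_deriv:
  fixes x :: "real^'n"
  assumes \<delta>: "\<delta> > 0" and j: "j \<in> S"
  shows "((\<lambda>t. wS S k \<delta> (x + t *\<^sub>R axis j 1)) has_real_derivative
    wS S k \<delta> x * (\<Sum>l\<in>S-{j}. 2 * k * ((x $ j - x $ l) / ((x $ j - x $ l)\<^sup>2 + \<delta>)))) (at 0)"
proof -
  have pos: "0 < d\<^sup>2 + \<delta>" for d :: real using \<delta> by (simp add: add_nonneg_pos)
  let ?v = "\<lambda>a. (if fst a = j then 1 else 0) - (if snd a = j then 1 else 0) :: real"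
  have comp: "(x + t *\<^sub>R axis j 1) $ fst a - (x + t *\<^sub>R axis j 1) $ snd a = x $ fst a - x $ snd a + t * ?v a" for t and a :: "'n \<times> 'n"
    by (simp add: axis_def algebra_simps)
  let ?c = "\<lambda>a b. (x $ a - x $ b) / ((x $ a - x $ b)\<^sup>2 + \<delta>)"
  have "((\<lambda>t. (k/2) * ln ((x $ fst a - x $ snd a + t * ?v a)\<^sup>2 + \<delta>)) has_real_derivative k * (?c (fst a) (snd a) * ?v a)) (at 0)" for a
    using pos[of "x $ fst a - x $ snd a"] by (auto intro!: derivative_eq_intros simp: field_simps)
  then have "((\<lambda>t. \<Sum>a\<in>prs S. (k/2) * ln ((x $ fst a - x $ snd a + t * ?v a)\<^sup>2 + \<delta>)) has_real_derivative (\<Sum>a\<in>prs S. k * (?c (fst a) (snd a) * ?v a))) (at 0)"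
    by (rule DERIV_sum)
  from DERIV_fun_exp[OF this]
  have "((\<lambda>t. wS S k \<delta> (x + t *\<^sub>R axis j 1)) has_real_derivative wS S k \<delta> x * (\<Sum>a\<in>prs S. k * (?c (fst a) (snd a) * ?v a))) (at 0)"
    unfolding wS_exp[OF \<delta>] comp by simp
  moreover have "(\<Sum>a\<in>prs S. k * (?c (fst a) (snd a) * ?v a)) = k * (2 * (\<Sum>l\<in>S-{j}. ?c j l))"
    unfolding sum_distrib_left[symmetric]
    by (subst sum_prs_split[OF j, of ?c]) (simp_all add: power2_commute minus_divide_left)
  moreover have "k * (2 * (\<Sum>l\<in>S-{j}. ?c j l)) = (\<Sum>l\<in>S-{j}. 2 * k * ?c j l)"
    by (simp only: sum_distrib_left mult_ac)
  ultimately show ?thesis by (simp only:)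
qed

lemma subexp_diff_nth: "subexp (\<lambda>x::real^'n. x $ i - x $ j)"
proof (rule subexp_mono[OF subexp_powr[of 1]])
  show "norm (x $ i - x $ j) \<le> norm ((1 + sx x) powr 1)" if "x \<in> Rpos" for x :: "real^'n"
    using abs_diff_le_sx[OF that, of i j] sx_nonneg[OF that] by simp
qed simp

text \<open>This is the vanishing of \<open>\<integral> T\<^sub>j U \<omega>\<close> for \<open>U = x\<^sub>j G\<close>. With the regularized weight no singular integrals occur:
  symmetrization in \<open>j, l\<close> produces the divided difference \<open>Q\<^sub>l\<close> of \<open>U\<close> times a factor in \<open>[0, 1]\<close>.\<close>
lemma dunkl_ibp:
  fixes G G' :: "real^'n \<Rightarrow> real"
  assumes k: "k \<ge> 0" and j: "j \<in> S" and G: "good G" and G': "good (\<lambda>x. x $ j * G' x)"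
    and der: "\<And>x. x \<in> Rpos \<Longrightarrow> ((\<lambda>t. G (x + t *\<^sub>R axis j 1)) has_real_derivative G' x) (at 0)"
    and Q: "\<And>l. l \<in> S - {j} \<Longrightarrow> good (Q l)"
    and Qeq: "\<And>l x. l \<in> S - {j} \<Longrightarrow> x \<in> Rpos \<Longrightarrow> regular x \<Longrightarrow> Q l x * (x $ j - x $ l) = x $ j * G x - x $ l * G (swap_coord j l x)"
  shows "rint (\<lambda>x. (G x + x $ j * G' x + k * (\<Sum>l\<in>S-{j}. Q l x)) * wS S k 0 x) = 0"
proof -
  define d where "d l x = x $ j - x $ l" for l and x :: "real^'n"
  \<comment> \<open>For each \<delta> in the half-open unit interval the integral of
    \<open>\<Phi> \<delta>\<close> is shown to vanish; as \<delta> tends to zero the damping factor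
    tends to \<open>1\<close> at regular points, which gives the claim.\<close>
  define \<Phi> where "\<Phi> \<delta> x = (G x + x $ j * G' x + k * (\<Sum>l\<in>S-{j}. Q l x * ((d l x)\<^sup>2 / ((d l x)\<^sup>2 + \<delta>)))) * wS S k \<delta> x" for \<delta> x
  have Gm: "G \<in> borel_measurable borel" "(\<lambda>x. x $ j * G' x) \<in> borel_measurable borel"
    using good_measurable G G' by blast+
  have Qm: "Q l \<in> borel_measurable borel" if "l \<in> S - {j}" for l by (rule good_measurable[OF Q[OF that]])
  have dm: "d l \<in> borel_measurable borel" for l unfolding d_def[abs_def] by measurable
  have gG: "good (\<lambda>x. G x + x $ j * G' x)" by (rule good_add[OF G G'])
  have zero: "rint (\<Phi> \<delta>) = 0" if \<delta>: "0 < \<delta>" "\<delta> \<le> 1" for \<delta>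
  proof -
    have pos: "0 < (d l x)\<^sup>2 + \<delta>" for l x using \<delta> by (simp add: add_nonneg_pos)
    have sw: "subexp (wS S k \<delta> :: real^'n \<Rightarrow> real)" using k \<delta> by (intro subexp_wS) auto
    \<comment> \<open>Apart from the factor \<open>2 * k\<close>, this is the contribution of the
      pair \<open>j\<close>, \<open>l\<close> to the derivative of the weight; it is
      \<open>good\<close> because \<delta> keeps the denominator away from zero.\<close>
    define A where "A l x = x $ j * G x * (d l x / ((d l x)\<^sup>2 + \<delta>)) * wS S k \<delta> x" for l x
    have sq: "subexp (\<lambda>x. 1 / ((d l x)\<^sup>2 + \<delta>))" for l
    proof (rule subexp_bounded[of _ "1 / \<delta>"])
      show "norm (1 / ((d l x)\<^sup>2 + \<delta>)) \<le> 1 / \<delta>" for x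
        using \<delta> pos[of l x] by (simp add: frac_le)
    qed
    have gA: "good (A l)" for l
    proof -
      have "subexp (\<lambda>x. x $ j * (d l x) * (1 / ((d l x)\<^sup>2 + \<delta>)) * wS S k \<delta> x)"
        by (intro subexp_mult subexp_nth sq sw) (unfold d_def, rule subexp_diff_nth)
      moreover have "(\<lambda>x. x $ j * (d l x) * (1 / ((d l x)\<^sup>2 + \<delta>)) * wS S k \<delta> x) \<in> borel_measurable borel"
        using dm by measurable
      ultimately have "good (\<lambda>x. G x * (x $ j * (d l x) * (1 / ((d l x)\<^sup>2 + \<delta>)) * wS S k \<delta> x))"
        by (rule good_mult_subexp[OF G])
      then show ?thesis unfolding A_def[abs_def] by (simp add: mult_ac)
    qed
    define H where "H x = G x * wS S k \<delta> x" for x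
    define H' where "H' x = G' x * wS S k \<delta> x + G x * (wS S k \<delta> x * (\<Sum>l\<in>S-{j}. 2 * k * (d l x / ((d l x)\<^sup>2 + \<delta>))))" for x
    have eqK: "H x + x $ j * H' x = (G x + x $ j * G' x) * wS S k \<delta> x + 2 * k * (\<Sum>l\<in>S-{j}. A l x)" for x
      unfolding H_def H'_def A_def by (simp add: sum_distrib_left algebra_simps)
    have g1: "good (\<lambda>x. (G x + x $ j * G' x) * wS S k \<delta> x)" by (rule good_mult_subexp[OF gG sw]) simp
    have gS: "good (\<lambda>x. \<Sum>l\<in>S-{j}. A l x)" by (intro good_sum gA) simp
    have "rint (\<lambda>x. H x + x $ j * H' x) = 0"
    proof (rule dilation_ibp)
      show "good H" unfolding H_def[abs_def] by (rule good_mult_subexp[OF G sw]) simp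
      show "good (\<lambda>x. H x + x $ j * H' x)" unfolding eqK by (intro good_add g1 good_cmult gS)
      fix x :: "real^'n" assume x: "x \<in> Rpos"
      from DERIV_mult[OF der[OF x] wS_deriv[OF \<delta>(1) j, of k x]]
      show "((\<lambda>t. H (x + t *\<^sub>R axis j 1)) has_real_derivative H' x) (at 0)"
        unfolding H_def H'_def d_def by (simp add: algebra_simps)
    qed
    then have e1: "rint (\<lambda>x. (G x + x $ j * G' x) * wS S k \<delta> x) + 2 * k * (\<Sum>l\<in>S-{j}. rint (A l)) = 0"
      unfolding eqK by (simp add: rint_add g1 good_cmult gS rint_cmult rint_sum gA)
    let ?QL = "\<lambda>l x. Q l x * ((d l x)\<^sup>2 / ((d l x)\<^sup>2 + \<delta>)) * wS S k \<delta> x"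
    have gQL: "good (?QL l)" if l: "l \<in> S - {j}" for l
    proof (rule good_mono[OF good_mult_subexp[OF Q[OF l] sw wS_measurable]])
      show "?QL l \<in> borel_measurable borel" using Qm[OF l] dm by measurable
      show "\<bar>?QL l x\<bar> \<le> \<bar>Q l x * wS S k \<delta> x\<bar>" for x
      proof -
        have "0 \<le> (d l x)\<^sup>2 / ((d l x)\<^sup>2 + \<delta>)" "(d l x)\<^sup>2 / ((d l x)\<^sup>2 + \<delta>) \<le> 1"
          using pos[of l x] \<delta> by (auto simp: divide_le_eq)
        then have "\<bar>Q l x\<bar> * ((d l x)\<^sup>2 / ((d l x)\<^sup>2 + \<delta>)) * wS S k \<delta> x \<le> \<bar>Q l x\<bar> * 1 * wS S k \<delta> x"
          by (intro mult_right_mono mult_left_mono wS_nonneg) auto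
        then show ?thesis using wS_nonneg[of S k \<delta> x] by (simp add: abs_mult abs_of_pos[OF pos])
      qed
    qed
    \<comment> \<open>The swap of \<open>j\<close> and \<open>l\<close> flips the sign of
      \<open>d l\<close> and fixes the weight, so adding the swapped copy of \<open>A l\<close>
      replaces \<open>x $ j * G x\<close> by the difference \<open>Q l x * d l x\<close>.\<close>
    have e2: "2 * rint (A l) = rint (?QL l)" if l: "l \<in> S - {j}" for l
    proof -
      have "2 * rint (A l) = rint (\<lambda>x. A l x + A l (swap_coord j l x))"
        by (subst rint_add[OF gA good_swap[OF gA]], subst rint_swap[OF good_measurable[OF gA]]) simp
      also have "\<dots> = rint (?QL l)"
      proof (rule rint_cong_regular)
        show "(\<lambda>x. A l x + A l (swap_coord j l x)) \<in> borel_measurable borel"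
          by (rule good_measurable[OF good_add[OF gA good_swap[OF gA]]])
        show "?QL l \<in> borel_measurable borel" by (rule good_measurable[OF gQL[OF l]])
        fix x :: "real^'n" assume x: "x \<in> Rpos" "regular x"
        have ds: "d l (swap_coord j l x) = - d l x" by (simp add: d_def)
        have "A l x + A l (swap_coord j l x) = (x $ j * G x - x $ l * G (swap_coord j l x)) * (d l x / ((d l x)\<^sup>2 + \<delta>)) * wS S k \<delta> x"
          unfolding A_def ds using wS_swap[OF j, of l k \<delta> x] l by (simp add: algebra_simps)
        also have "\<dots> = ?QL l x" unfolding Qeq[OF l x, symmetric] d_def[symmetric] by (simp add: power2_eq_square mult_ac)
        finally show "A l x + A l (swap_coord j l x) = ?QL l x" .
      qed
      finally show ?thesis .
    qed
    have "rint (\<Phi> \<delta>) = rint (\<lambda>x. (G x + x $ j * G' x) * wS S k \<delta> x + k * (\<Sum>l\<in>S-{j}. ?QL l x))"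
      unfolding \<Phi>_def by (simp add: distrib_right sum_distrib_right mult.assoc)
    also have "\<dots> = rint (\<lambda>x. (G x + x $ j * G' x) * wS S k \<delta> x) + k * (\<Sum>l\<in>S-{j}. rint (?QL l))"
    proof -
      have gs: "good (\<lambda>x. \<Sum>l\<in>S-{j}. ?QL l x)" by (rule good_sum[OF _ gQL]) simp
      have rs: "rint (\<lambda>x. \<Sum>l\<in>S-{j}. ?QL l x) = (\<Sum>l\<in>S-{j}. rint (?QL l))" by (rule rint_sum[OF _ gQL]) simp
      show ?thesis unfolding rint_add[OF g1 good_cmult[OF gs]] rint_cmult rs ..
    qed
    also have "\<dots> = rint (\<lambda>x. (G x + x $ j * G' x) * wS S k \<delta> x) + 2 * k * (\<Sum>l\<in>S-{j}. rint (A l))"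
    proof -
      have "(\<Sum>l\<in>S-{j}. rint (?QL l)) = (\<Sum>l\<in>S-{j}. 2 * rint (A l))" by (rule sum.cong[OF refl e2[symmetric]])
      also have "\<dots> = 2 * (\<Sum>l\<in>S-{j}. rint (A l))" by (rule sum_distrib_left[symmetric])
      finally show ?thesis by (simp only: mult.assoc mult.left_commute)
    qed
    finally show ?thesis using e1 by simp
  qed
  \<comment> \<open>Passage to the limit along a sequence in the unit interval, dominated by the
    weight regularized with \<open>1\<close>.\<close>
  define \<delta> where "\<delta> m = inverse (real (Suc m))" for m
  have \<delta>: "0 < \<delta> m" "\<delta> m \<le> 1" for m
  proof -
    show "0 < \<delta> m" by (simp add: \<delta>_def)
    show "\<delta> m \<le> 1" unfolding \<delta>_def by (rule inverse_le_1_iff[THEN iffD2]) simp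
  qed
  have \<delta>0: "\<delta> \<longlonglongrightarrow> 0" unfolding \<delta>_def[abs_def] by (rule LIMSEQ_inverse_real_of_nat)
  define B where "B x = (\<bar>G x + x $ j * G' x\<bar> + k * (\<Sum>l\<in>S-{j}. \<bar>Q l x\<bar>)) * wS S k 1 x" for x
  have gabs: "good (\<lambda>x. \<bar>f x\<bar>)" if "good f" for f :: "real^'n \<Rightarrow> real"
    by (rule good_mono[OF that]) (use good_measurable[OF that] in auto)
  have s1: "subexp (wS S k 1 :: real^'n \<Rightarrow> real)" using k by (intro subexp_wS) auto
  have gB: "good B"
    unfolding B_def[abs_def] using s1
    by (intro good_mult_subexp[OF good_add[OF gabs[OF gG] good_cmult[OF good_sum]]]) (auto intro!: gabs Q)
  have \<Phi>m: "\<Phi> \<delta> \<in> borel_measurable borel" for \<delta>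
    unfolding \<Phi>_def[abs_def] using Gm Qm dm by measurable
  have eq0: "\<Phi> 0 x = (G x + x $ j * G' x + k * (\<Sum>l\<in>S-{j}. Q l x)) * wS S k 0 x" if "regular x" for x
  proof -
    have "(\<Sum>l\<in>S-{j}. Q l x * ((d l x)\<^sup>2 / ((d l x)\<^sup>2 + 0))) = (\<Sum>l\<in>S-{j}. Q l x)"
    proof (rule sum.cong[OF refl])
      fix l assume "l \<in> S - {j}"
      then have "d l x \<noteq> 0" using that by (auto simp: regular_def d_def)
      then show "Q l x * ((d l x)\<^sup>2 / ((d l x)\<^sup>2 + 0)) = Q l x" by simp
    qed
    then show ?thesis unfolding \<Phi>_def by simp
  qed
  have "(\<lambda>m. rint (\<Phi> (\<delta> m))) \<longlonglongrightarrow> rint (\<Phi> 0)"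
  proof (rule rint_dominated[OF \<Phi>m \<Phi>m gB])
    fix x :: "real^'n" assume x: "x \<in> Rpos" "regular x"
    show "(\<lambda>m. \<Phi> (\<delta> m) x) \<longlonglongrightarrow> \<Phi> 0 x"
      unfolding \<Phi>_def
    proof (intro tendsto_mult tendsto_add tendsto_const tendsto_sum tendsto_divide \<delta>0 wS_tendsto[OF x(2) \<delta>0])
      fix l assume "l \<in> S - {j}"
      then show "(d l x)\<^sup>2 + 0 \<noteq> 0" using x(2) by (auto simp: regular_def d_def)
    qed
    fix m
    have r: "0 \<le> (d l x)\<^sup>2 / ((d l x)\<^sup>2 + \<delta> m)" "(d l x)\<^sup>2 / ((d l x)\<^sup>2 + \<delta> m) \<le> 1" for l
      using \<delta>[of m] by (auto simp: divide_le_eq add_nonneg_pos)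
    have "\<bar>\<Sum>l\<in>S-{j}. Q l x * ((d l x)\<^sup>2 / ((d l x)\<^sup>2 + \<delta> m))\<bar> \<le> (\<Sum>l\<in>S-{j}. \<bar>Q l x\<bar>)"
    proof (rule order_trans[OF sum_abs], rule sum_mono)
      fix l
      have "\<bar>Q l x\<bar> * ((d l x)\<^sup>2 / ((d l x)\<^sup>2 + \<delta> m)) \<le> \<bar>Q l x\<bar> * 1" by (rule mult_left_mono[OF r(2)]) simp
      then show "\<bar>Q l x * ((d l x)\<^sup>2 / ((d l x)\<^sup>2 + \<delta> m))\<bar> \<le> \<bar>Q l x\<bar>" using r(1)[of l] by (simp only: abs_mult abs_of_nonneg mult_1_right)
    qed
    then have "k * \<bar>\<Sum>l\<in>S-{j}. Q l x * ((d l x)\<^sup>2 / ((d l x)\<^sup>2 + \<delta> m))\<bar> \<le> k * (\<Sum>l\<in>S-{j}. \<bar>Q l x\<bar>)"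
      by (rule mult_left_mono[OF _ k])
    then have "\<bar>G x + x $ j * G' x + k * (\<Sum>l\<in>S-{j}. Q l x * ((d l x)\<^sup>2 / ((d l x)\<^sup>2 + \<delta> m)))\<bar>
      \<le> \<bar>G x + x $ j * G' x\<bar> + k * (\<Sum>l\<in>S-{j}. \<bar>Q l x\<bar>)"
      using k by (intro order_trans[OF abs_triangle_ineq] add_left_mono) (simp add: abs_mult)
    moreover have "\<bar>wS S k (\<delta> m) x\<bar> \<le> wS S k 1 x"
      using wS_mono[OF k less_imp_le[OF \<delta>(1)[of m]] \<delta>(2)[of m], of S x] wS_nonneg[of S k "\<delta> m" x] by simp
    ultimately show "\<bar>\<Phi> (\<delta> m) x\<bar> \<le> B x"
      unfolding \<Phi>_def B_def abs_mult by (intro mult_mono) (auto intro: order_trans[OF abs_ge_zero])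
  qed
  then have "rint (\<Phi> 0) = 0" using zero[OF \<delta>] by (simp add: LIMSEQ_const_iff)
  moreover have "rint (\<Phi> 0) = rint (\<lambda>x. (G x + x $ j * G' x + k * (\<Sum>l\<in>S-{j}. Q l x)) * wS S k 0 x)"
    by (rule rint_cong_regular[OF eq0 \<Phi>m]) (use Gm Qm in measurable)
  ultimately show ?thesis by simp
qed

subsection \<open>The Laguerre form of Selberg's integral\<close>

text \<open>The variables outside \<open>S\<close> are decoupled and contribute the factor \<open>\<integral> e\<^sup>-\<^sup>t dt = 1\<close> each,
  so that the induction over the number of variables stays in one space.\<close>
definition eS :: "'n set \<Rightarrow> 'n set \<Rightarrow> real \<Rightarrow> real^'n \<Rightarrow> real" where
  "eS T S a x = (\<Prod>i\<in>T. x $ i) * (\<Prod>i\<in>S. x $ i powr a) * exp (- sx x)"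

text \<open>The Laguerre-Selberg integral in \<open>card S\<close> variables with exponent
  \<open>a\<close> and interaction \<open>|x_i - x_j| ^ (2 * k)\<close>.\<close>

definition cS :: "'n::finite set \<Rightarrow> real \<Rightarrow> real \<Rightarrow> real" where
  "cS S k a = rint (\<lambda>x. eS {} S a x * wS S k 0 x)"

lemma good_exp: "good (\<lambda>x. exp (- sx x))"
  by (rule goodI[of _ 1 1]) auto

lemma eS_measurable [measurable]: "eS T S a \<in> borel_measurable borel"
  unfolding eS_def[abs_def] by measurable

lemma subexp_nth_powr:
  assumes "a \<ge> 0" shows "subexp (\<lambda>x::real^'n. x $ i powr a)"
proof (rule subexp_mono[OF subexp_powr[OF assms]])
  fix x :: "real^'n" assume x: "x \<in> Rpos"
  have "x $ i powr a \<le> (1 + sx x) powr a"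
    using nth_le_sx[OF x, of i] Rpos_nth[OF x, of i] assms by (intro powr_mono2) auto
  then show "norm (x $ i powr a) \<le> norm ((1 + sx x) powr a)" by simp
qed

lemma good_eS:
  assumes "a \<ge> 0" shows "good (eS T S a :: real^'n \<Rightarrow> real)"
proof -
  have "good (\<lambda>x::real^'n. exp (- sx x) * ((\<Prod>i\<in>T. x $ i) * (\<Prod>i\<in>S. x $ i powr a)))"
    by (intro good_mult_subexp good_exp subexp_mult subexp_prod subexp_nth subexp_nth_powr assms) auto
  then show ?thesis unfolding eS_def[abs_def] by (simp add: mult_ac)
qed

lemma good_eS_wS:
  assumes "a \<ge> 0" "k \<ge> 0" shows "good (\<lambda>x. eS T S a x * wS S' k 0 x)"
  by (intro good_mult_subexp good_eS subexp_wS assms) auto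

lemma prod_swap:
  assumes "i \<in> T" "j \<in> T"
  shows "(\<Prod>l\<in>T. F (swap_coord i j x $ l)) = (\<Prod>l\<in>T. F (x $ l))"
  unfolding swap_coord_nth
  by (rule prod.reindex_bij_witness[where i="Transposition.transpose i j" and j="Transposition.transpose i j"])
     (use assms in \<open>auto simp: Transposition.transpose_def\<close>)

lemma eS_deriv:
  fixes x :: "real^'n"
  assumes x: "x \<in> Rpos" and j: "j \<in> S" "j \<notin> T"
  shows "((\<lambda>t. eS T S a (x + t *\<^sub>R axis j 1)) has_real_derivative eS T S a x * (a / x $ j - 1)) (at 0)"
proof -
  have xj: "x $ j > 0" by (rule Rpos_nth[OF x])
  have nth: "(x + t *\<^sub>R axis j 1) $ i = (if i = j then x $ j + t else x $ i)" for t i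
    by (simp add: axis_def)
  have T: "(\<Prod>i\<in>T. (x + t *\<^sub>R axis j 1) $ i) = (\<Prod>i\<in>T. x $ i)" for t
    unfolding nth by (rule prod.cong) (use j in auto)
  have S: "(\<Prod>i\<in>S. (x + t *\<^sub>R axis j 1) $ i powr a) = (x $ j + t) powr a * (\<Prod>i\<in>S-{j}. x $ i powr a)" for t
    unfolding prod.remove[OF finite j(1)] nth by (rule arg_cong2[of _ _ _ _ "(*)"]) (auto intro!: prod.cong)
  have X: "sx (x + t *\<^sub>R axis j 1) = sx x + t" for t
  proof -
    have "sx (x + t *\<^sub>R axis j 1) = (\<Sum>i\<in>UNIV. x $ i + (if i = j then t else 0))"
      unfolding sx_def nth by (rule sum.cong) auto
    then show ?thesis by (simp add: sx_def sum.distrib)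
  qed
  have eq: "eS T S a (x + t *\<^sub>R axis j 1) = ((\<Prod>i\<in>T. x $ i) * (\<Prod>i\<in>S-{j}. x $ i powr a)) * ((x $ j + t) powr a * exp (- (sx x + t)))" for t
    unfolding eS_def T S X by (simp add: mult_ac)
  have "((\<lambda>t. (x $ j + t) powr a * exp (- (sx x + t))) has_real_derivative
      (x $ j powr a * exp (- sx x)) * (a / x $ j - 1)) (at 0)"
    using xj by (auto intro!: derivative_eq_intros simp: powr_diff algebra_simps)
  from DERIV_cmult[OF this, of "(\<Prod>i\<in>T. x $ i) * (\<Prod>i\<in>S-{j}. x $ i powr a)"]
  show ?thesis unfolding eq using eq[of 0] by (simp add: mult_ac)
qed

text \<open>Integration by parts in \<open>x_j\<close> with \<open>G = eS (T - {j}) S a\<close>. For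
  \<open>l\<close> in \<open>T\<close> the function \<open>x_j * G\<close> is symmetric in
  \<open>j\<close>, \<open>l\<close>, so these pairs contribute nothing; for \<open>l\<close> in
  \<open>S - T\<close> already \<open>G\<close> is symmetric and the divided difference of
  \<open>x_j * G\<close> is \<open>G\<close>. Hence \<open>k\<close> survives
  \<open>card (S - T)\<close> times.\<close>

lemma aomoto_step:
  fixes S T :: "'n::finite set"
  assumes k: "k \<ge> 0" and a: "a \<ge> 0" and T: "T \<subseteq> S" "j \<in> T"
  shows "rint (\<lambda>x. eS T S a x * wS S k 0 x) = (a + 1 + k * card (S - T)) * rint (\<lambda>x. eS (T - {j}) S a x * wS S k 0 x)"
proof -
  define G where "G = (eS (T - {j}) S a :: real^'n \<Rightarrow> real)"
  define G' where "G' x = G x * (a / x $ j - 1)" for x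
  define Q where "Q l x = (if l \<in> T then 0 else G x)" for l x
  have j: "j \<in> S" using T by auto
  have gG: "good G" unfolding G_def by (rule good_eS[OF a])
  have jG: "x $ j * G x = eS T S a x" for x
    unfolding G_def eS_def prod.remove[OF finite T(2)] by (simp add: mult.assoc)
  have xG': "x $ j * G' x = a * G x - eS T S a x" if "x \<in> Rpos" for x
    unfolding jG[symmetric] G'_def using Rpos_nth[OF that, of j] by (simp add: field_simps)
  have "good (\<lambda>x. a * G x - eS T S a x)" by (intro good_diff good_cmult gG good_eS a)
  then have gG': "good (\<lambda>x. x $ j * G' x)"
  proof (rule good_mono)
    show "(\<lambda>x. x $ j * G' x) \<in> borel_measurable borel" unfolding G'_def G_def by measurable
  qed (simp add: xG')
  have "rint (\<lambda>x. (G x + x $ j * G' x + k * (\<Sum>l\<in>S-{j}. Q l x)) * wS S k 0 x) = 0"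
  proof (rule dunkl_ibp[OF k j gG gG'])
    show "((\<lambda>t. G (x + t *\<^sub>R axis j 1)) has_real_derivative G' x) (at 0)" if "x \<in> Rpos" for x
      unfolding G'_def G_def by (rule eS_deriv[OF that j]) simp
    show "good (Q l)" for l unfolding Q_def[abs_def] by (cases "l \<in> T") (simp_all add: good_0 gG)
    fix l and x :: "real^'n" assume l: "l \<in> S - {j}" and x: "x \<in> Rpos" "regular x"
    have p: "(\<Prod>i\<in>S. swap_coord j l x $ i powr a) = (\<Prod>i\<in>S. x $ i powr a)"
      using prod_swap[of j S l "\<lambda>t. t powr a"] j l by simp
    show "Q l x * (x $ j - x $ l) = x $ j * G x - x $ l * G (swap_coord j l x)"
    proof (cases "l \<in> T")
      case True
      have "swap_coord j l x $ j * G (swap_coord j l x) = eS T S a x"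
        unfolding jG eS_def p sx_swap using prod_swap[OF T(2) True, of "\<lambda>t. t" x] by simp
      then show ?thesis using True by (simp add: Q_def jG)
    next
      case False
      have "(\<Prod>i\<in>T-{j}. swap_coord j l x $ i) = (\<Prod>i\<in>T-{j}. x $ i)"
        by (rule prod.cong) (use False in \<open>auto simp: Transposition.transpose_def\<close>)
      then have "G (swap_coord j l x) = G x" unfolding G_def eS_def p sx_swap by simp
      then show ?thesis using False by (simp add: Q_def algebra_simps)
    qed
  qed
  moreover have "(\<Sum>l\<in>S-{j}. Q l x) = card (S - T) * G x" for x
  proof -
    have "(\<Sum>l\<in>S-{j}. Q l x) = (\<Sum>l\<in>S-T. G x)"
      unfolding Q_def by (rule sum.mono_neutral_cong_right) (use T in auto)
    then show ?thesis by simp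
  qed
  ultimately have "rint (\<lambda>x. (G x + x $ j * G' x + k * (card (S - T) * G x)) * wS S k 0 x) = 0" by simp
  also have "rint (\<lambda>x. (G x + x $ j * G' x + k * (card (S - T) * G x)) * wS S k 0 x)
     = rint (\<lambda>x. (a + 1 + k * card (S - T)) * (G x * wS S k 0 x) - eS T S a x * wS S k 0 x)"
  proof (rule rint_cong_regular)
    show "(\<lambda>x. (G x + x $ j * G' x + k * (card (S - T) * G x)) * wS S k 0 x) \<in> borel_measurable borel"
      unfolding G'_def G_def by measurable
    show "(\<lambda>x. (a + 1 + k * card (S - T)) * (G x * wS S k 0 x) - eS T S a x * wS S k 0 x) \<in> borel_measurable borel"
      unfolding G_def by measurable
  qed (simp only: xG', simp add: algebra_simps)
  also have "\<dots> = (a + 1 + k * card (S - T)) * rint (\<lambda>x. G x * wS S k 0 x) - rint (\<lambda>x. eS T S a x * wS S k 0 x)"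
    unfolding G_def by (subst rint_diff) (auto intro!: good_cmult good_eS_wS k a simp: rint_cmult)
  finally show ?thesis by (simp add: G_def)
qed

definition rS :: "nat \<Rightarrow> real \<Rightarrow> real \<Rightarrow> real" where
  "rS n k a = (\<Prod>i<n. a + 1 + k * real i)"

text \<open>Multiplying in the coordinates one at a time leads from \<open>T = {}\<close> to
  \<open>T = S\<close>, where the extra product raises every exponent by one.\<close>

lemma aomoto:
  fixes S :: "'n::finite set"
  assumes k: "k \<ge> 0" and a: "a \<ge> 0"
  shows "cS S k (a + 1) = rS (card S) k a * cS S k a"
proof -
  have I: "rint (\<lambda>x. eS T S a x * wS S k 0 x) = (\<Prod>i\<in>{card S - card T..<card S}. a + 1 + k * real i) * cS S k a" if "T \<subseteq> S" for T
    using finite[of T] that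
  proof (induction T rule: finite_induct)
    case empty
    then show ?case by (simp add: cS_def)
  next
    case (insert j T)
    have cT: "card (insert j T) \<le> card S" "card (insert j T) = Suc (card T)"
      using insert card_mono[of S "insert j T"] by auto
    have cd: "card (S - insert j T) = card S - card (insert j T)"
      using insert by (intro card_Diff_subset) auto
    have "rint (\<lambda>x. eS (insert j T) S a x * wS S k 0 x) = (a + 1 + k * card (S - insert j T)) * rint (\<lambda>x. eS T S a x * wS S k 0 x)"
      using aomoto_step[OF k a insert.prems, of j] insert(2) by simp
    moreover have "{card S - card (insert j T)..<card S} = insert (card S - card (insert j T)) {card S - card T..<card S}"
      using cT by auto
    moreover have "card S - card (insert j T) \<notin> {card S - card T..<card S}" using cT by auto
    ultimately show ?case using insert cd by simp
  qed
  have "cS S k (a + 1) = rint (\<lambda>x. eS S S a x * wS S k 0 x)"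
    unfolding cS_def
  proof (rule rint_cong_regular)
    fix x :: "real^'n" assume "x \<in> Rpos"
    then have "x $ i powr (a + 1) = x $ i * x $ i powr a" for i
      using Rpos_nth[of x i] by (simp add: powr_add)
    then show "eS {} S (a + 1) x * wS S k 0 x = eS S S a x * wS S k 0 x"
      by (simp add: eS_def prod.distrib)
  qed auto
  also have "\<dots> = (\<Prod>i\<in>{card S - card S..<card S}. a + 1 + k * real i) * cS S k a" by (rule I) simp
  finally show ?thesis by (simp add: rS_def atLeast0LessThan)
qed

section \<open>Interpolation in the exponent\<close>

lemma rint_mono:
  assumes "good f" "good g" "\<And>x. x \<in> Rpos \<Longrightarrow> f x \<le> g x"
  shows "rint f \<le> rint g"
  unfolding rint_def by (intro integral_mono good_integrable assms) (auto simp: indicator_def assms(3))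

lemma rS_pos: "k \<ge> 0 \<Longrightarrow> a \<ge> 0 \<Longrightarrow> rS n k a > 0"
proof -
  assume "k \<ge> 0" "a \<ge> 0"
  then have "0 < a + 1 + k * real i" for i using mult_nonneg_nonneg[of k "real i"] by linarith
  then show ?thesis unfolding rS_def by (intro prod_pos) auto
qed

text \<open>Hoelder's inequality between the exponents \<open>a\<close> and \<open>a + 1\<close>,
  obtained from Young's inequality at the scale \<open>r\<close>, the ratio of the two integrals
  given by Aomoto's recursion; at this scale the two terms on the right add up to
  \<open>r powr s\<close> times the integral at \<open>a\<close>.\<close>

lemma cS_log_convex:
  fixes S :: "'n::finite set"
  assumes k: "k \<ge> 0" and a: "a \<ge> 0" and s: "0 \<le> s" "s \<le> 1"
  shows "cS S k (a + s) \<le> rS (card S) k a powr s * cS S k a"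
proof -
  define r where "r = rS (card S) k a"
  have r: "r > 0" unfolding r_def by (rule rS_pos[OF k a])
  have le: "t powr s \<le> s * (r powr s / r) * t + (1 - s) * r powr s" if "t > 0" for t
  proof -
    have "(t / r) powr s * 1 powr (1 - s) \<le> s * (t / r) + (1 - s) * 1"
      by (rule Youngs_inequality_0) (use s that r in auto)
    then have "(t / r) powr s * r powr s \<le> (s * (t / r) + (1 - s)) * r powr s" by (intro mult_right_mono) auto
    moreover have "(t / r) powr s * r powr s = t powr s" using that r by (simp add: powr_mult[symmetric])
    ultimately show ?thesis by (simp add: algebra_simps)
  qed
  have "cS S k (a + s) \<le> rint (\<lambda>x. s * (r powr s / r) * (eS {} S (a + 1) x * wS S k 0 x) + (1 - s) * r powr s * (eS {} S a x * wS S k 0 x))"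
    unfolding cS_def
  proof (rule rint_mono)
    show "good (\<lambda>x. eS {} S (a + s) x * wS S k 0 x)" using a s k by (intro good_eS_wS) auto
    show "good (\<lambda>x. s * (r powr s / r) * (eS {} S (a + 1) x * wS S k 0 x) + (1 - s) * r powr s * (eS {} S a x * wS S k 0 x))"
      using a k by (intro good_add good_cmult good_eS_wS) auto
    fix x :: "real^'n" assume x: "x \<in> Rpos"
    define D where "D = (\<Prod>i\<in>S. x $ i)"
    have D: "D > 0" unfolding D_def using Rpos_nth[OF x] by (intro prod_pos) auto
    have p: "eS {} S (a + b) x = eS {} S a x * D powr b" for b
      unfolding eS_def D_def using Rpos_nth[OF x] by (simp add: powr_add prod.distrib prod_powr_distrib less_imp_le)
    have "0 \<le> eS {} S a x * wS S k 0 x" unfolding eS_def by (intro mult_nonneg_nonneg wS_nonneg prod_nonneg) auto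
    from mult_left_mono[OF le[OF D] this]
    show "eS {} S (a + s) x * wS S k 0 x \<le> s * (r powr s / r) * (eS {} S (a + 1) x * wS S k 0 x) + (1 - s) * r powr s * (eS {} S a x * wS S k 0 x)"
      unfolding p using D by (simp add: algebra_simps)
  qed
  also have "\<dots> = s * (r powr s / r) * cS S k (a + 1) + (1 - s) * r powr s * cS S k a"
  proof -
    have a1: "a + 1 \<ge> 0" using a by simp
    show ?thesis unfolding cS_def rint_add[OF good_cmult[OF good_eS_wS[OF a1 k]] good_cmult[OF good_eS_wS[OF a k]]] rint_cmult ..
  qed
  also have "\<dots> = r powr s * cS S k a"
    unfolding aomoto[OF k a] r_def[symmetric] using r by (simp add: field_simps)
  finally show ?thesis unfolding r_def .
qed

lemma tendsto_shift_ratio: "(\<lambda>N. (real N + b) / (real N + c)) \<longlonglongrightarrow> 1"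
proof -
  have "filterlim (\<lambda>N. c + real N) at_top sequentially"
    by (rule filterlim_tendsto_add_at_top[OF tendsto_const filterlim_real_sequentially])
  then have f: "filterlim (\<lambda>N. c + real N) at_infinity sequentially" by (rule filterlim_at_top_imp_at_infinity)
  have "(\<lambda>N. 1 + (b - c) / (c + real N)) \<longlonglongrightarrow> 1 + 0"
    by (intro tendsto_add tendsto_const tendsto_divide_0[OF tendsto_const f])
  moreover have "\<forall>\<^sub>F N in sequentially. 1 + (b - c) / (c + real N) = (real N + b) / (real N + c)"
  proof -
    have "\<forall>\<^sub>F N in sequentially. c + real N > 0"
      using filterlim_at_top_dense[THEN iffD1, OF \<open>filterlim (\<lambda>N. c + real N) at_top sequentially\<close>] by blast
    then show ?thesis by (rule eventually_mono) (simp add: field_simps)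
  qed
  ultimately show ?thesis using tendsto_cong by fastforce
qed

text \<open>Quotient of the limit formulas \<open>Gamma_series\<close> for the two values, with
  \<open>real N powr s\<close> replaced by the equivalent
  \<open>(real N + b) powr s\<close>.\<close>

lemma Gamma_ratio_limit:
  fixes b s :: real
  assumes b: "b > 0" and s: "s \<ge> 0"
  shows "(\<lambda>N. (real N + b) powr s * pochhammer b N / pochhammer (b + s) N) \<longlonglongrightarrow> Gamma (b + s) / Gamma b"
proof -
  have G0: "Gamma b \<noteq> 0" using Gamma_real_pos[OF b] by simp
  have "(\<lambda>N. (Gamma_series (b + s) N / Gamma_series b N) * ((real N + b) / (real N + 0)) powr s * ((real N + (b + s)) / (real N + b)))
    \<longlonglongrightarrow> (Gamma (b + s) / Gamma b) * 1 powr s * 1"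
    by (intro tendsto_mult tendsto_divide tendsto_powr Gamma_series_LIMSEQ G0 tendsto_shift_ratio tendsto_const) auto
  moreover have "\<forall>\<^sub>F N in sequentially. (Gamma_series (b + s) N / Gamma_series b N) * ((real N + b) / (real N + 0)) powr s * ((real N + (b + s)) / (real N + b))
     = (real N + b) powr s * pochhammer b N / pochhammer (b + s) N"
    using eventually_gt_at_top[of 0]
  proof eventually_elim
    case (elim N)
    have p: "pochhammer b N > 0" "pochhammer (b + s) N > 0" using b s by (auto intro!: pochhammer_pos)
    have e: "exp ((b + s) * ln (real N)) = exp (b * ln (real N)) * real N powr s"
      using elim by (simp add: powr_def exp_add[symmetric] algebra_simps)
    have q: "((real N + b) / (real N + 0)) powr s = (real N + b) powr s / real N powr s"
      using b elim by (simp add: powr_divide)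
    have g1: "Gamma_series (b + s) N = fact N * (exp (b * ln (real N)) * real N powr s) / (pochhammer (b + s) N * (real N + (b + s)))"
      unfolding Gamma_series_def by (simp add: e[symmetric] pochhammer_Suc add_ac)
    have g2: "Gamma_series b N = fact N * exp (b * ln (real N)) / (pochhammer b N * (real N + b))"
      unfolding Gamma_series_def by (simp add: pochhammer_Suc add_ac)
    have alg: "(F * (E * W) / (B * w)) / (F * E / (A * y)) * (X / W) * (w / y) = X * A / B"
      if "F > 0" "E > 0" "W > 0" "B > 0" "w > 0" "A > 0" "y > 0" for F E W B w A y X :: real
      using that by simp
    show ?case unfolding g1 g2 q
      by (rule alg) (use p b s elim in auto)
  qed
  ultimately show ?thesis by (simp add: tendsto_cong)
qed

text \<open>A Bohr-Mollerup argument. The recursion moves the exponent to \<open>N + s\<close>;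
  log-convexity starting at \<open>N\<close> bounds the integral there from above, and starting at
  \<open>N + s\<close> and reaching \<open>N + 1\<close> it bounds it from below. The bounds agree
  as \<open>N\<close> tends to infinity.\<close>

lemma cS_unit_interval:
  fixes S :: "'n::finite set"
  assumes k: "k \<ge> 0" and s: "0 \<le> s" "s \<le> 1"
  shows "cS S k s = cS S k 0 * (\<Prod>j<card S. Gamma (s + (1 + k * real j)) / Gamma (1 + k * real j))"
proof -
  define n where "n = card S"
  define b where "b j = 1 + k * real j" for j :: nat
  have b: "b j > 0" for j using k mult_nonneg_nonneg[of k "real j"] by (simp add: b_def add_pos_nonneg)
  have rSb: "rS n k a = (\<Prod>j<n. a + b j)" for a by (simp add: rS_def b_def add.assoc)
  have shift: "cS S k (real N + u) = (\<Prod>j<n. pochhammer (b j + u) N) * cS S k u" if u: "u \<ge> 0" for u N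
  proof (induction N)
    case (Suc N)
    have "cS S k (real (Suc N) + u) = rS n k (real N + u) * cS S k (real N + u)"
      using aomoto[OF k, of "real N + u" S] u by (simp add: n_def add_ac)
    also have "\<dots> = (\<Prod>j<n. pochhammer (b j + u) N * (b j + u + real N)) * cS S k u"
      unfolding Suc rSb by (simp add: prod.distrib add_ac mult_ac)
    finally show ?case by (simp add: pochhammer_Suc)
  qed simp
  \<comment> \<open>\<open>U\<close> is the upper bound divided by \<open>cS S k 0\<close>, and
    \<open>V\<close> is the ratio of the lower to the upper bound.\<close>
  define U where "U N = (\<Prod>j<n. (real N + b j) powr s * pochhammer (b j) N / pochhammer (b j + s) N)" for N
  define V where "V N = (\<Prod>j<n. ((real N + b j) / (real N + (b j + s))) powr (1 - s))" for N
  define g where "g = (\<Prod>j<n. Gamma (b j + s) / Gamma (b j))"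
  have limU: "U \<longlonglongrightarrow> g" unfolding U_def[abs_def] g_def
    by (intro tendsto_prod Gamma_ratio_limit b s)
  have limV: "V \<longlonglongrightarrow> 1"
  proof -
    have "V \<longlonglongrightarrow> (\<Prod>j<n. 1 powr (1 - s))" unfolding V_def[abs_def]
      by (intro tendsto_prod tendsto_powr tendsto_shift_ratio tendsto_const) auto
    then show ?thesis by simp
  qed
  define P where "P N = (\<Prod>j<n. pochhammer (b j + s) N)" for N
  define P0 where "P0 N = (\<Prod>j<n. pochhammer (b j) N)" for N
  have Ppos: "P N > 0" for N unfolding P_def using b s by (intro prod_pos) (auto intro!: pochhammer_pos add_pos_nonneg)
  have Nb: "real N + b j > 0" "real N + (b j + s) > 0" for N j using b[of j] s by auto
  have Ueq: "U N * P N = rS n k (real N) powr s * P0 N" for N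
  proof -
    have "U N * P N = (\<Prod>j<n. (real N + b j) powr s * pochhammer (b j) N)"
      unfolding U_def P_def prod.distrib[symmetric]
    proof (rule prod.cong[OF refl])
      fix j
      have "pochhammer (b j + s) N > 0" using b[of j] s by (intro pochhammer_pos) auto
      then show "(real N + b j) powr s * pochhammer (b j) N / pochhammer (b j + s) N * pochhammer (b j + s) N = (real N + b j) powr s * pochhammer (b j) N"
        by simp
    qed
    also have "\<dots> = rS n k (real N) powr s * P0 N"
      unfolding prod.distrib rSb P0_def using Nb(1)[of N] by (simp add: prod_powr_distrib less_imp_le)
    finally show ?thesis .
  qed
  have upper: "cS S k s \<le> cS S k 0 * U N" for N
  proof -
    have "P N * cS S k s \<le> rS n k (real N) powr s * (P0 N * cS S k 0)"
      using cS_log_convex[OF k _ s, of "real N" S] shift[of s N] shift[of 0 N] s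
      by (simp add: n_def[symmetric] P_def P0_def)
    also have "\<dots> = P N * (cS S k 0 * U N)" using Ueq[of N] by (simp add: mult_ac)
    finally show ?thesis using Ppos[of N] by simp
  qed
  have lower: "cS S k 0 * (U N * V N) \<le> cS S k s" for N
  proof -
    have "cS S k ((real N + s) + (1 - s)) \<le> rS n k (real N + s) powr (1 - s) * cS S k (real N + s)"
      using cS_log_convex[OF k, of "real N + s" "1 - s" S] s by (simp add: n_def)
    moreover have "cS S k ((real N + s) + (1 - s)) = rS n k (real N) * (P0 N * cS S k 0)"
      using aomoto[OF k, of "real N" S] shift[of 0 N] by (simp add: n_def[symmetric] P0_def)
    moreover have "cS S k (real N + s) = P N * cS S k s" using shift[of s N] s by (simp add: P_def)
    ultimately have le: "rS n k (real N) * (P0 N * cS S k 0) \<le> rS n k (real N + s) powr (1 - s) * (P N * cS S k s)" by simp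
    define R where "R = rS n k (real N)"
    define R' where "R' = rS n k (real N + s)"
    have R: "R > 0" "R' > 0" unfolding R_def R'_def using k s by (auto intro!: rS_pos)
    have V: "V N = (R / R') powr (1 - s)"
      unfolding V_def R_def R'_def rSb prod_dividef[symmetric] using Nb[of N]
      by (subst prod_powr_distrib) (auto simp: add_ac less_imp_le)
    have "R powr s * R powr (1 - s) = R" using R by (simp add: powr_add[symmetric])
    then have "P N * (R' powr (1 - s) * (cS S k 0 * (U N * V N))) = R * (P0 N * cS S k 0)"
    proof -
      assume RR: "R powr s * R powr (1 - s) = R"
      have "R' powr (1 - s) * (R / R') powr (1 - s) = R powr (1 - s)"
        using R by (simp add: powr_divide)
      then have "P N * (R' powr (1 - s) * (cS S k 0 * (U N * V N))) = (U N * P N) * R powr (1 - s) * cS S k 0"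
        unfolding V by (simp only: mult_ac)
      also have "\<dots> = (R powr s * R powr (1 - s)) * (P0 N * cS S k 0)"
        unfolding Ueq R_def by (simp only: mult_ac)
      finally show ?thesis unfolding RR .
    qed
    also have "\<dots> \<le> P N * (R' powr (1 - s) * cS S k s)" using le unfolding R_def R'_def by (simp add: mult_ac)
    finally show ?thesis using Ppos[of N] R by simp
  qed
  have l1: "(\<lambda>N. cS S k 0 * U N) \<longlonglongrightarrow> cS S k 0 * g" by (intro tendsto_intros limU)
  have l2: "(\<lambda>N. cS S k 0 * (U N * V N)) \<longlonglongrightarrow> cS S k 0 * (g * 1)" by (intro tendsto_intros limU limV)
  have "cS S k s \<le> cS S k 0 * g" by (rule LIMSEQ_le_const[OF l1]) (use upper in auto)
  moreover have "cS S k 0 * g \<le> cS S k s" using LIMSEQ_le_const2[OF l2] lower by auto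
  ultimately show ?thesis unfolding g_def b_def n_def by (simp add: add_ac)
qed

text \<open>Induction over the integer part, starting from the fractional part covered by
  \<open>cS_unit_interval\<close>; the factors of Aomoto's recursion are those of
  \<open>Gamma (t + 1) = t * Gamma t\<close>.\<close>

lemma cS_Gamma:
  fixes S :: "'n::finite set"
  assumes k: "k \<ge> 0" and a: "a \<ge> 0"
  shows "cS S k a = cS S k 0 * (\<Prod>j<card S. Gamma (a + (1 + k * real j)) / Gamma (1 + k * real j))"
proof -
  define s where "s = frac a"
  have s: "0 \<le> s" "s \<le> 1" unfolding s_def by (simp_all add: frac_lt_1 less_imp_le)
  have "cS S k (real m + s) = cS S k 0 * (\<Prod>j<card S. Gamma ((real m + s) + (1 + k * real j)) / Gamma (1 + k * real j))" for m
  proof (induction m)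
    case 0
    then show ?case using cS_unit_interval[OF k s] by simp
  next
    case (Suc m)
    have "Gamma ((real (Suc m) + s) + (1 + k * real j)) = (real m + s + 1 + k * real j) * Gamma ((real m + s) + (1 + k * real j))" for j
    proof -
      have "0 < (real m + s) + (1 + k * real j)" using s k by (intro add_nonneg_pos add_pos_nonneg) auto
      then have "(real m + s) + (1 + k * real j) \<notin> \<int>\<^sub>\<le>\<^sub>0" by (auto elim!: nonpos_Ints_cases)
      from Gamma_plus1[OF this] show ?thesis by (simp add: add_ac)
    qed
    then have "(\<Prod>j<card S. Gamma ((real (Suc m) + s) + (1 + k * real j)) / Gamma (1 + k * real j)) =
      rS (card S) k (real m + s) * (\<Prod>j<card S. Gamma ((real m + s) + (1 + k * real j)) / Gamma (1 + k * real j))"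
      unfolding rS_def prod.distrib[symmetric] by (intro prod.cong) auto
    moreover have "cS S k (real (Suc m) + s) = rS (card S) k (real m + s) * cS S k (real m + s)"
      using aomoto[OF k, of "real m + s" S] s by (simp add: add_ac)
    ultimately show ?case unfolding Suc by (simp only: mult.left_commute)
  qed
  moreover have "a = real (nat \<lfloor>a\<rfloor>) + s" using a by (simp add: s_def frac_def)
  ultimately show ?thesis by metis
qed

section \<open>Integrating out the smallest coordinate\<close>

lemma nn_integral_shear1:
  fixes F :: "real^'n \<Rightarrow> ennreal"
  assumes [measurable]: "F \<in> borel_measurable borel" and "i \<noteq> l"
  shows "(\<integral>\<^sup>+x. F (x + x $ i *\<^sub>R axis l 1) \<partial>lborel) = (\<integral>\<^sup>+x. F x \<partial>lborel)"
proof -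
  define b0 :: "real^'n" where "b0 = axis l 1"
  define I where "I = Basis - {b0}"
  define c where "c x = (\<Sum>b\<in>I. x b *\<^sub>R b)" for x :: "real^'n \<Rightarrow> real"
  have b0: "b0 \<in> Basis" by (simp add: b0_def axis_in_Basis_iff)
  have B: "Basis = insert b0 I" "b0 \<notin> I" "finite I" using b0 by (auto simp: I_def)
  interpret product_sigma_finite "\<lambda>_::real^'n. lborel :: real measure" by standard
  have V: "(\<Sum>b\<in>Basis. (x(b0 := y)) b *\<^sub>R b) = y *\<^sub>R b0 + c x" for x y
  proof -
    have "(\<Sum>b\<in>I. (x(b0 := y)) b *\<^sub>R b) = c x" unfolding c_def by (rule sum.cong) (use B in auto)
    then show ?thesis unfolding B(1) using B(2,3) by simp
  qed
  have L: "(\<integral>\<^sup>+x. G x \<partial>lborel) = (\<integral>\<^sup>+x. (\<integral>\<^sup>+y. G (y *\<^sub>R b0 + c x) \<partial>lborel) \<partial>(\<Pi>\<^sub>M b\<in>I. lborel))"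
    if [measurable]: "G \<in> borel_measurable borel" for G :: "real^'n \<Rightarrow> ennreal"
  proof -
    have "(\<integral>\<^sup>+x. G x \<partial>lborel) = (\<integral>\<^sup>+x. G (\<Sum>b\<in>Basis. x b *\<^sub>R b) \<partial>(\<Pi>\<^sub>M b\<in>Basis. lborel))"
      unfolding lborel_def[where 'a="real^'n"] lborel_eq_real[symmetric] by (subst nn_integral_distr) auto
    also have "\<dots> = (\<integral>\<^sup>+x. (\<integral>\<^sup>+y. G (\<Sum>b\<in>Basis. (x(b0 := y)) b *\<^sub>R b) \<partial>lborel) \<partial>(\<Pi>\<^sub>M b\<in>I. lborel))"
      unfolding B(1) by (rule product_nn_integral_insert[OF B(3,2)]) measurable
    finally show ?thesis unfolding V .
  qed
  \<comment> \<open>With \<open>x_l\<close> as the innermost variable the shear is a translation by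
    \<open>x_i\<close>, which does not involve \<open>x_l\<close>.\<close>
  have "(\<integral>\<^sup>+x. F (x + x $ i *\<^sub>R b0) \<partial>lborel) = (\<integral>\<^sup>+x. (\<integral>\<^sup>+y. F ((y *\<^sub>R b0 + c x) + (y *\<^sub>R b0 + c x) $ i *\<^sub>R b0) \<partial>lborel) \<partial>(\<Pi>\<^sub>M b\<in>I. lborel))"
    by (rule L) measurable
  also have "\<dots> = (\<integral>\<^sup>+x. (\<integral>\<^sup>+y. F (y *\<^sub>R b0 + c x) \<partial>lborel) \<partial>(\<Pi>\<^sub>M b\<in>I. lborel))"
  proof (rule nn_integral_cong)
    fix x
    have "(y *\<^sub>R b0 + c x) + (y *\<^sub>R b0 + c x) $ i *\<^sub>R b0 = (c x $ i + 1 * y) *\<^sub>R b0 + c x" for y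
      using assms(2) by (simp add: b0_def axis_def scaleR_add_left)
    moreover have "(\<integral>\<^sup>+y. F (y *\<^sub>R b0 + c x) \<partial>lborel) = ennreal \<bar>1\<bar> * (\<integral>\<^sup>+y. F ((c x $ i + 1 * y) *\<^sub>R b0 + c x) \<partial>lborel)"
      by (rule nn_integral_real_affine[of "\<lambda>y. F (y *\<^sub>R b0 + c x)" 1 "c x $ i"]) auto
    ultimately show "(\<integral>\<^sup>+y. F ((y *\<^sub>R b0 + c x) + (y *\<^sub>R b0 + c x) $ i *\<^sub>R b0) \<partial>lborel) = (\<integral>\<^sup>+y. F (y *\<^sub>R b0 + c x) \<partial>lborel)"
      by (simp only: abs_one ennreal_1 mult_1_left)
  qed
  also have "\<dots> = (\<integral>\<^sup>+x. F x \<partial>lborel)" by (rule L[symmetric]) measurable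
  finally show ?thesis unfolding b0_def .
qed

definition shear :: "'n \<Rightarrow> 'n set \<Rightarrow> real^'n \<Rightarrow> real^'n" where
  "shear i L x = (\<chi> l. if l \<in> L then x $ l + x $ i else x $ l)"

lemma nn_integral_shear:
  fixes F :: "real^'n \<Rightarrow> ennreal"
  assumes "finite L" "i \<notin> L" "F \<in> borel_measurable borel"
  shows "(\<integral>\<^sup>+x. F (shear i L x) \<partial>lborel) = (\<integral>\<^sup>+x. F x \<partial>lborel)"
  using assms
proof (induction L arbitrary: F rule: finite_induct)
  case empty
  have "shear i {} x = x" for x :: "real^'n" by (simp add: shear_def)
  then show ?case by simp
next
  case (insert l L)
  have [measurable]: "F \<in> borel_measurable borel" by fact
  have "shear i (insert l L) x = shear i L x + shear i L x $ i *\<^sub>R axis l 1" for x :: "real^'n"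
    using insert by (auto simp: shear_def vec_eq_iff axis_def)
  then have "(\<integral>\<^sup>+x. F (shear i (insert l L) x) \<partial>lborel) = (\<integral>\<^sup>+x. (\<lambda>y. F (y + y $ i *\<^sub>R axis l 1)) (shear i L x) \<partial>lborel)"
    by simp
  also have "\<dots> = (\<integral>\<^sup>+y. F (y + y $ i *\<^sub>R axis l 1) \<partial>lborel)"
    by (rule insert.IH) (use insert in auto)
  also have "\<dots> = (\<integral>\<^sup>+x. F x \<partial>lborel)" by (rule nn_integral_shear1) (use insert in auto)
  finally show ?case .
qed

lemma rint_eq_nn:
  assumes "f \<in> borel_measurable borel" "\<And>x. x \<in> Rpos \<Longrightarrow> 0 \<le> f x"
  shows "rint f = enn2real (\<integral>\<^sup>+x. ennreal (indicator Rpos x * f x) \<partial>lborel)"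
  unfolding rint_def by (rule integral_eq_nn_integral) (use assms in \<open>auto simp: indicator_def\<close>)

lemma prs_remove:
  assumes "i \<in> S"
  shows "prs S = prs (S - {i}) \<union> (Pair i ` (S - {i}) \<union> (\<lambda>l. (l, i)) ` (S - {i}))"
  using assms by (auto simp: prs_def)

text \<open>The coordinate that is smallest in \<open>S\<close> is integrated out by a translation, under which the weight is invariant.\<close>
lemma cS_remove:
  fixes S :: "'n::finite set"
  assumes k: "k \<ge> 0" and i: "i \<in> S"
  shows "cS S k 0 = cS (S - {i}) k (2 * k)"
proof -
  define n where "n = card S"
  have n: "n > 0" using i by (auto simp: n_def card_gt_0_iff)
  define L where "L = S - {i}"
  define F where "F x = eS {} S 0 x * wS S k 0 x" for x
  \<comment> \<open>Marks the region where \<open>x $ j\<close> is the strict minimum over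
    \<open>S\<close>; a regular point lies in exactly one of these regions.\<close>
  define mi where "mi j x = (if \<forall>l\<in>S-{j}. x $ j < x $ l then 1 else 0 :: real)" for j and x :: "real^'n"
  have [measurable]: "F \<in> borel_measurable borel" unfolding F_def[abs_def] by measurable
  have mim [measurable]: "mi j \<in> borel_measurable borel" for j
    unfolding mi_def[abs_def] by measurable
  have gF: "good F" unfolding F_def[abs_def] using k by (intro good_eS_wS) auto
  have Fpos: "0 \<le> F x" for x unfolding F_def eS_def by (intro mult_nonneg_nonneg wS_nonneg prod_nonneg) auto
  have gmi: "good (\<lambda>x. mi j x * F x)" for j
    by (rule good_mono[OF gF]) (auto simp: mi_def)
  have "rint F = rint (\<lambda>x. \<Sum>j\<in>S. mi j x * F x)"
  proof (rule rint_cong_regular)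
    fix x :: "real^'n" assume x: "regular x"
    have "\<exists>j\<in>S. \<forall>l\<in>S. x $ j \<le> x $ l"
    proof -
      have "Min ((\<lambda>l. x $ l) ` S) \<in> (\<lambda>l. x $ l) ` S" using i by (intro Min_in) auto
      then obtain j where "j \<in> S" "Min ((\<lambda>l. x $ l) ` S) = x $ j" by auto
      then show ?thesis by (intro bexI[of _ j] ballI) (metis Min_le finite finite_imageI imageI)
    qed
    then obtain j where j: "j \<in> S" "\<And>l. l \<in> S \<Longrightarrow> x $ j \<le> x $ l" by auto
    have "mi l x = (if l = j then 1 else 0)" if "l \<in> S" for l
    proof (cases "l = j")
      case True
      have "x $ j < x $ m" if "m \<in> S - {j}" for m
        using j(2)[of m] x that unfolding regular_def by (auto simp: less_le)
      then show ?thesis using True by (simp add: mi_def)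
    next
      case False
      then have "\<not> (\<forall>m\<in>S-{l}. x $ l < x $ m)" using j(1) j(2)[OF that] by (auto intro!: bexI[of _ j])
      then show ?thesis using False unfolding mi_def by (simp only: if_False)
    qed
    then have "(\<Sum>l\<in>S. mi l x * F x) = (\<Sum>l\<in>S. if l = j then F x else 0)" by (intro sum.cong) auto
    then show "F x = (\<Sum>l\<in>S. mi l x * F x)" using j(1) by simp
  qed measurable
  also have "\<dots> = (\<Sum>j\<in>S. rint (\<lambda>x. mi j x * F x))" by (rule rint_sum[OF finite gmi])
  \<comment> \<open>The integrand is symmetric, so swapping \<open>i\<close> and \<open>j\<close>
    exchanges their regions and all of them contribute equally.\<close>
  also have "\<dots> = (\<Sum>j\<in>S. rint (\<lambda>x. mi i x * F x))"
  proof (rule sum.cong[OF refl])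
    fix j assume j: "j \<in> S"
    have "F (swap_coord i j x) = F x" for x
      unfolding F_def eS_def wS_swap[OF i j] using prod_swap[OF i j, of "\<lambda>t. t powr 0" x] by simp
    moreover have "mi i (swap_coord i j x) = mi j x" for x
    proof -
      have "(\<forall>l\<in>S-{i}. x $ j < x $ Transposition.transpose i j l) \<longleftrightarrow> (\<forall>l\<in>S-{j}. x $ j < x $ l)"
      proof -
        have *: "Transposition.transpose i j ` (S - {i}) = S - {j}"
        proof -
          have "Transposition.transpose i j ` S = S" using i j by (intro transpose_image_eq) simp
          then show ?thesis by (simp add: image_set_diff)
        qed
        show ?thesis unfolding *[symmetric] by simp
      qed
      then show ?thesis by (simp add: mi_def)
    qed
    ultimately show "rint (\<lambda>x. mi j x * F x) = rint (\<lambda>x. mi i x * F x)"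
      using rint_swap[of "\<lambda>x. mi i x * F x" i j] by simp
  qed
  also have "\<dots> = real n * rint (\<lambda>x. mi i x * F x)" by (simp add: n_def)
  finally have 1: "cS S k 0 = real n * rint (\<lambda>x. mi i x * F x)" by (simp add: cS_def F_def[abs_def])
  \<comment> \<open>The integrand after replacing \<open>x_l\<close> by \<open>x_l + x_i\<close> for
    \<open>l\<close> in \<open>L\<close>: differences with \<open>x_i\<close> become
    \<open>x_l\<close> and yield the powers \<open>2 * k\<close>, and the exponent now counts
    \<open>x_i\<close> with multiplicity \<open>n\<close>, once in \<open>sx x\<close> and
    \<open>n - 1\<close> times besides.\<close>
  define g where "g x = exp (- (sx x + (real n - 1) * x $ i)) * ((\<Prod>l\<in>L. x $ l powr (2 * k)) * wS L k 0 x)" for x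
  have [measurable]: "g \<in> borel_measurable borel" unfolding g_def[abs_def] by measurable
  have sh: "indicator Rpos (shear i L x) * (mi i (shear i L x) * F (shear i L x)) = indicator Rpos x * g x" for x
  proof (cases "x \<in> Rpos")
    case True
    have iL: "i \<notin> L" by (simp add: L_def)
    have si: "shear i L x $ i = x $ i" by (simp add: shear_def L_def)
    have s1: "shear i L x \<in> Rpos" using True by (auto simp: Rpos_def shear_def intro: add_pos_pos)
    have s2: "mi i (shear i L x) = 1" using Rpos_nth[OF True] unfolding mi_def si by (simp add: shear_def L_def)
    have s3: "sx (shear i L x) = sx x + (real n - 1) * x $ i"
    proof -
      have "sx (shear i L x) = (\<Sum>l\<in>UNIV. x $ l + (if l \<in> L then x $ i else 0))"
        unfolding sx_def by (rule sum.cong) (auto simp: shear_def)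
      also have "\<dots> = sx x + real (card L) * x $ i" by (simp add: sx_def sum.distrib sum.If_cases)
      also have "real (card L) = real n - 1" using i n by (simp add: L_def n_def)
      finally show ?thesis .
    qed
    have s4: "wS S k 0 (shear i L x) = (\<Prod>l\<in>L. x $ l powr (2 * k)) * wS L k 0 x"
    proof -
      let ?y = "shear i L x"
      let ?f = "\<lambda>a. ((?y $ fst a - ?y $ snd a)\<^sup>2 + 0) powr (k/2)"
      have "wS S k 0 ?y = prod ?f (prs L \<union> (Pair i ` L \<union> (\<lambda>l. (l, i)) ` L))"
        unfolding wS_def prs_remove[OF i] L_def ..
      also have "\<dots> = prod ?f (prs L) * (prod ?f (Pair i ` L) * prod ?f ((\<lambda>l. (l, i)) ` L))"
        by (subst prod.union_disjoint; (subst prod.union_disjoint)?) (auto simp: prs_def L_def)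
      also have "prod ?f (prs L) = wS L k 0 x"
        unfolding wS_def by (rule prod.cong) (auto simp: prs_def shear_def)
      also have "prod ?f (Pair i ` L) = (\<Prod>l\<in>L. x $ l powr k)"
      proof (subst prod.reindex)
        show "prod (?f \<circ> Pair i) L = (\<Prod>l\<in>L. x $ l powr k)"
        proof (rule prod.cong[OF refl])
          fix l assume "l \<in> L"
          then have "(?f \<circ> Pair i) l = ((x $ l)\<^sup>2) powr (k/2)" using iL by (simp add: shear_def)
          also have "\<dots> = x $ l powr k" using Rpos_nth[OF True, of l] by (simp add: powr_powr powr_numeral[symmetric] del: powr_numeral)
          finally show "(?f \<circ> Pair i) l = x $ l powr k" .
        qed
      qed (auto simp: inj_on_def)
      also have "prod ?f ((\<lambda>l. (l, i)) ` L) = (\<Prod>l\<in>L. x $ l powr k)"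
      proof (subst prod.reindex)
        show "prod (?f \<circ> (\<lambda>l. (l, i))) L = (\<Prod>l\<in>L. x $ l powr k)"
        proof (rule prod.cong[OF refl])
          fix l assume "l \<in> L"
          then have "(?f \<circ> (\<lambda>l. (l, i))) l = ((x $ l)\<^sup>2) powr (k/2)" using iL by (simp add: shear_def)
          also have "\<dots> = x $ l powr k" using Rpos_nth[OF True, of l] by (simp add: powr_powr powr_numeral[symmetric] del: powr_numeral)
          finally show "(?f \<circ> (\<lambda>l. (l, i))) l = x $ l powr k" .
        qed
      qed (auto simp: inj_on_def)
      also have "(\<Prod>l\<in>L. x $ l powr k) * (\<Prod>l\<in>L. x $ l powr k) = (\<Prod>l\<in>L. x $ l powr (2 * k))"
        unfolding prod.distrib[symmetric] by (simp add: powr_add[symmetric])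
      finally show ?thesis by simp
    qed
    have s5: "eS {} S 0 (shear i L x) = exp (- sx (shear i L x))"
      unfolding eS_def using Rpos_nth[OF s1] by (simp add: less_imp_neq[symmetric])
    show ?thesis using True s1 unfolding F_def s2 s4 s5 s3 g_def by simp
  next
    case False
    have "shear i L x \<notin> Rpos \<or> mi i (shear i L x) = 0"
    proof (rule ccontr)
      assume "\<not> ?thesis"
      then have a: "shear i L x \<in> Rpos" "mi i (shear i L x) \<noteq> 0" by auto
      then have b: "\<forall>l\<in>S-{i}. shear i L x $ i < shear i L x $ l" by (simp add: mi_def split: if_splits)
      have "0 < x $ l" for l
        using Rpos_nth[OF a(1), of l] b by (cases "l \<in> L") (auto simp: shear_def L_def)
      then show False using False by (simp add: Rpos_def)
    qed
    then show ?thesis using False by auto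
  qed
  have gpos: "0 \<le> g x" for x unfolding g_def by (intro mult_nonneg_nonneg wS_nonneg prod_nonneg) auto
  have "rint (\<lambda>x. mi i x * F x) = enn2real (\<integral>\<^sup>+x. ennreal (indicator Rpos x * (mi i x * F x)) \<partial>lborel)"
    by (rule rint_eq_nn) (use Fpos in \<open>auto simp: mi_def\<close>)
  also have "(\<integral>\<^sup>+x. ennreal (indicator Rpos x * (mi i x * F x)) \<partial>lborel) = (\<integral>\<^sup>+x. ennreal (indicator Rpos (shear i L x) * (mi i (shear i L x) * F (shear i L x))) \<partial>lborel)"
    by (rule nn_integral_shear[symmetric]) (auto simp: L_def)
  also have "enn2real \<dots> = rint g" unfolding sh by (rule rint_eq_nn[symmetric]) (use gpos in auto)
  \<comment> \<open>Scaling \<open>x_i\<close> by \<open>1 / n\<close> restores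
    \<open>exp (- sx x)\<close>; the Jacobian cancels the number of regions.\<close>
  also have "rint g = (1 / real n) * rint (\<lambda>x. g (dil i (1 / real n) x))" by (rule rint_dil) (use n in auto)
  also have "rint (\<lambda>x. g (dil i (1 / real n) x)) = cS L k (2 * k)"
    unfolding cS_def
  proof (rule arg_cong[of _ _ rint], rule ext)
    fix x :: "real^'n"
    have d: "dil i (1 / real n) x $ l = x $ l" if "l \<in> L" for l using that by (simp add: dil_def L_def)
    have w: "wS L k 0 (dil i (1 / real n) x) = wS L k 0 x"
      unfolding wS_def by (rule prod.cong) (auto simp: prs_def d)
    have s: "sx (dil i (1 / real n) x) + (real n - 1) * dil i (1 / real n) x $ i = sx x"
      unfolding sx_dil using n by (simp add: dil_def field_simps)
    show "g (dil i (1 / real n) x) = eS {} L (2 * k) x * wS L k 0 x"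
      unfolding g_def w s eS_def using d by simp
  qed
  finally show ?thesis using 1 n by (simp add: L_def)
qed

lemma cS_empty: "cS ({} :: 'n::finite set) k a = 1"
proof -
  have "cS ({} :: 'n set) k a = rint (\<lambda>x::real^'n. exp (- sx x))"
    by (simp add: cS_def eS_def wS_def prs_def)
  also have "\<dots> = enn2real (\<integral>\<^sup>+x. ennreal (indicator Rpos x * exp (- sx x)) \<partial>(lborel :: (real^'n) measure))"
    by (rule rint_eq_nn) auto
  also have "(\<integral>\<^sup>+x. ennreal (indicator Rpos x * exp (- sx x)) \<partial>(lborel :: (real^'n) measure))
    = (\<integral>\<^sup>+x. ennreal (exp (- 1 * sx x)) * indicator Rpos x \<partial>(lborel :: (real^'n) measure))"
    by (rule nn_integral_cong) (simp add: indicator_def)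
  also have "\<dots> = 1" by (subst nn_integral_exp_Rpos) auto
  finally show ?thesis by simp
qed

text \<open>Removing a coordinate expresses the value at \<open>a = 0\<close> through one variable
  fewer at exponent \<open>2 * k\<close>, and \<open>cS_Gamma\<close> supplies the dependence on
  \<open>a\<close>.\<close>

theorem selberg_laguerre:
  fixes S :: "'n::finite set"
  assumes k: "k \<ge> 0" and a: "a \<ge> 0"
  shows "cS S k a = d_const (card S) k * (\<Prod>j<card S. Gamma (a + (1 + k * real j)))"
  using finite[of S] a
proof (induction S arbitrary: a rule: finite_induct)
  case empty
  then show ?case by (simp add: cS_empty d_const_def)
next
  case (insert i S)
  define n where "n = card S"
  have cn: "card (insert i S) = Suc n" using insert by (simp add: n_def)
  have G: "Gamma (1 + k * real j) > 0" for j using k by (intro Gamma_real_pos add_pos_nonneg) auto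
  have "cS (insert i S) k 0 = cS S k (2 * k)" using cS_remove[OF k, of i "insert i S"] insert by simp
  also have "\<dots> = d_const n k * (\<Prod>j<n. Gamma (2 * k + (1 + k * real j)))"
    using insert.IH[of "2 * k"] k by (simp add: n_def)
  \<comment> \<open>Since \<open>2 * k + (1 + k * j) = 1 + k * (j + 2)\<close>, the product is one
    of \<open>n + 2\<close> factors without the first two, \<open>Gamma 1\<close> and
    \<open>Gamma (1 + k)\<close>.\<close>
  also have "(\<Prod>j<n. Gamma (2 * k + (1 + k * real j))) * Gamma (1 + k) * Gamma (1 + k * 0) = (\<Prod>j<Suc (Suc n). Gamma (1 + k * real j))"
    unfolding prod.lessThan_Suc_shift[of _ "Suc n"] prod.lessThan_Suc_shift[of _ n]
    by (simp add: algebra_simps)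
  then have "(\<Prod>j<n. Gamma (2 * k + (1 + k * real j))) = (\<Prod>j<Suc n. Gamma (1 + k * real j)) * (Gamma (1 + real (Suc n) * k) / Gamma (1 + k))"
    using G[of 1] by (simp add: field_simps)
  also have "d_const n k * ((\<Prod>j<Suc n. Gamma (1 + k * real j)) * (Gamma (1 + real (Suc n) * k) / Gamma (1 + k)))
    = d_const (Suc n) k * (\<Prod>j<Suc n. Gamma (1 + k * real j))"
    by (simp add: d_const_def)
  finally have c0: "cS (insert i S) k 0 = d_const (Suc n) k * (\<Prod>j<Suc n. Gamma (1 + k * real j))" .
  have "cS (insert i S) k a = cS (insert i S) k 0 * ((\<Prod>j<Suc n. Gamma (a + (1 + k * real j))) / (\<Prod>j<Suc n. Gamma (1 + k * real j)))"
    using cS_Gamma[OF k insert.prems, of "insert i S"] unfolding cn prod_dividef .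
  moreover have "(\<Prod>j<Suc n. Gamma (1 + k * real j)) \<noteq> 0" using G by (metis (no_types, lifting) less_irrefl prod_zero_iff finite_lessThan)
  ultimately show ?case unfolding c0 cn by simp
qed

subsection \<open>Moments of the Dunkl kernel\<close>

text \<open>On \<open>Rpos\<close> the kernel with real parameter is real, so taking
  \<open>Re\<close> loses nothing there and allows real integrals.\<close>

definition ek :: "real \<Rightarrow> real^'n::{finite,linorder} \<Rightarrow> real^'n::{finite,linorder} \<Rightarrow> real" where
  "ek k z x = Re (dker k (- cvec z) (cvec x))"

definition ek' :: "real \<Rightarrow> real^'n::{finite,linorder} \<Rightarrow> complex^'n::{finite,linorder} \<Rightarrow> real^'n::{finite,linorder} \<Rightarrow> real" where
  "ek' k z v x = Re (pd (dker k (- cvec z)) (cvec x) v)"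

lemma cvec_uminus: "- cvec z = cvec (- z)"
  by (simp add: cvec_def vec_eq_iff)

lemma ek_dker:
  assumes "k \<ge> 0" "x \<in> Rpos"
  shows "dker k (- cvec z) (cvec x) = complex_of_real (ek k z x)" "0 \<le> ek k z x"
  using dker_nonneg[OF assms(1), of x "- z"] Rpos_nth[OF assms(2)] unfolding ek_def cvec_uminus
  by (simp_all add: less_imp_le)

lemma swap_cvec: "swap_coord i j (cvec x) = cvec (swap_coord i j x)"
  by (simp add: cvec_def vec_eq_iff)

lemma ek_measurable: "k \<ge> 0 \<Longrightarrow> ek k z \<in> borel_measurable borel"
  unfolding ek_def[abs_def] by measurable

lemma ek'_measurable:
  assumes "k \<ge> 0" shows "ek' k z v \<in> borel_measurable borel"
proof -
  have "continuous_on UNIV (\<lambda>x. Re (pd (dker k (- cvec z)) (cvec x) v))"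
    by (intro continuous_intros continuous_on_compose2[OF pd_continuous[OF nice_dker[OF assms] open_UNIV] continuous_on_cvec]) auto
  then show ?thesis unfolding ek'_def[abs_def] by (rule borel_measurable_continuous_onI)
qed

lemma Rpos_lower:
  fixes z :: "real^'n"
  assumes "z \<in> Rpos" obtains \<epsilon> where "\<epsilon> > 0" "\<And>i. 2 * \<epsilon> \<le> z $ i"
proof -
  have "cvec z \<in> Dpos" using assms by (simp add: Dpos_def Rpos_def cvec_def)
  then obtain \<epsilon> where "\<epsilon> > 0" "cvec z \<in> Dge (2 * \<epsilon>)" by (rule Dpos_in_Dge)
  then show ?thesis using that[of \<epsilon>] by (auto simp: Dge_def cvec_def less_imp_le)
qed

lemma good_ek:
  fixes z :: "real^'n::{finite,linorder}"
  assumes k: "k \<ge> 0" and z: "z \<in> Rpos" shows "good (ek k z)"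
proof -
  obtain \<epsilon> where e: "\<epsilon> > 0" "\<And>i. 2 * \<epsilon> \<le> z $ i" by (rule Rpos_lower[OF z]) blast
  show ?thesis
  proof (rule goodI[OF ek_measurable[OF k] _ e(1), of 1])
    fix x :: "real^'n::{finite,linorder}" assume x: "x \<in> Rpos"
    have "norm (dker k (- cvec z) (cvec x)) \<le> exp (- \<epsilon> * (\<Sum>i\<in>UNIV. x $ i))"
      by (rule dker_decay_real[OF k e(1)]) (use e(2) Rpos_nth[OF x] in \<open>auto simp: cvec_def less_imp_le\<close>)
    then show "\<bar>ek k z x\<bar> \<le> 1 * exp (- \<epsilon> * sx x)"
      unfolding ek_def sx_def using abs_Re_le_cmod order_trans by auto
  qed simp
qed

text \<open>Cauchy's estimate on a unit disc, using the decay bound at complex points near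
  \<open>x\<close>. The bound \<open>2\<close> on the direction covers both \<open>axis j 1\<close>
  and \<open>axis j 1 - axis l 1\<close>, the direction of the divided differences.\<close>

lemma ek'_bound:
  fixes z :: "real^'n::{finite,linorder}"
  assumes k: "k \<ge> 0" and z: "z \<in> Rpos"
  obtains C \<epsilon> where "C \<ge> 0" "\<epsilon> > 0"
    "\<And>x v. x \<in> Rpos \<Longrightarrow> (\<Sum>i\<in>UNIV. norm (v $ i)) \<le> 2 \<Longrightarrow> \<bar>ek' k z v x\<bar> \<le> C * exp (- \<epsilon> * sx x)"
proof -
  obtain \<epsilon> where e: "\<epsilon> > 0" "\<And>i. 2 * \<epsilon> \<le> z $ i" by (rule Rpos_lower[OF z]) blast
  define M where "M = norm (cvec z)"
  define R where "R = M\<^sup>2 / (2 * \<epsilon>) + \<epsilon>"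
  have R: "R \<ge> \<epsilon>" unfolding R_def using e by simp
  have "\<bar>ek' k z v x\<bar> \<le> exp (4 * R) * exp (- \<epsilon> * sx x)" if x: "x \<in> Rpos" and v: "(\<Sum>i\<in>UNIV. norm (v $ i)) \<le> 2" for x v
  proof -
    have "norm (pd (dker k (- cvec z)) (cvec x) v) \<le> (exp (4 * R) * exp (- \<epsilon> * sx x)) / 1"
    proof (rule pd_bound[OF nice_dker[OF k]])
      fix t :: complex assume t: "norm t \<le> 1"
      let ?y = "cvec x + t *s v"
      have nt: "norm (t * v $ i) \<le> norm (v $ i)" for i
        using mult_right_mono[OF t, of "norm (v $ i)"] by (simp add: norm_mult)
      have "sx x - 2 \<le> sx x - (\<Sum>i\<in>UNIV. norm (v $ i))" using v by simp
      also have "\<dots> = (\<Sum>i\<in>UNIV. x $ i - norm (v $ i))" by (simp add: sx_def sum_subtractf)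
      also have "\<dots> \<le> (\<Sum>i\<in>UNIV. Re (?y $ i))"
      proof (rule sum_mono)
        fix i
        have "- norm (v $ i) \<le> Re (t * v $ i)" using nt[of i] abs_Re_le_cmod[of "t * v $ i"] by linarith
        then show "x $ i - norm (v $ i) \<le> Re (?y $ i)" by (simp add: cvec_def)
      qed
      finally have 1: "sx x - 2 \<le> (\<Sum>i\<in>UNIV. Re (?y $ i))" .
      have "(\<Sum>i\<in>UNIV. norm (?y $ i)) \<le> (\<Sum>i\<in>UNIV. x $ i + norm (v $ i))"
      proof (rule sum_mono)
        fix i
        have "norm (?y $ i) \<le> norm (cvec x $ i) + norm (t * v $ i)" by (simp add: norm_triangle_ineq)
        also have "norm (cvec x $ i) = x $ i" using Rpos_nth[OF x, of i] by (simp add: cvec_def)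
        finally show "norm (?y $ i) \<le> x $ i + norm (v $ i)" using nt[of i] by simp
      qed
      also have "\<dots> \<le> sx x + 2" using v by (simp add: sx_def sum.distrib)
      finally have 2: "(\<Sum>i\<in>UNIV. norm (?y $ i)) \<le> sx x + 2" .
      have "norm (dker k (- cvec z) ?y) \<le> exp (- R * (\<Sum>i\<in>UNIV. Re (?y $ i)) + (R - \<epsilon>) * (\<Sum>i\<in>UNIV. norm (?y $ i)))"
        unfolding R_def by (rule dker_decay[OF k e(1)]) (use e(2) in \<open>auto simp: cvec_def M_def intro: Finite_Cartesian_Product.norm_nth_le[of "cvec z", unfolded cvec_def, simplified]\<close>)
      \<comment> \<open>Moving by \<open>t *s v\<close> changes either sum by at most
        \<open>2\<close>, which costs at most the factor \<open>exp (4 * R)\<close>.\<close>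
      also have "- R * (\<Sum>i\<in>UNIV. Re (?y $ i)) + (R - \<epsilon>) * (\<Sum>i\<in>UNIV. norm (?y $ i)) \<le> - R * (sx x - 2) + (R - \<epsilon>) * (sx x + 2)"
        using mult_left_mono[OF 1, of R] mult_left_mono[OF 2, of "R - \<epsilon>"] R e(1) by linarith
      also have "\<dots> \<le> 4 * R + (- \<epsilon> * sx x)" using e by (simp add: algebra_simps)
      finally show "norm (dker k (- cvec z) ?y) \<le> exp (4 * R) * exp (- \<epsilon> * sx x)" by (simp add: exp_add[symmetric])
    qed auto
    then show ?thesis unfolding ek'_def using abs_Re_le_cmod order_trans by fastforce
  qed
  then show ?thesis using that[of "exp (4 * R)" \<epsilon>] e by auto
qed

lemma ek_deriv:
  fixes x w :: "real^'n::{finite,linorder}"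
  assumes k: "k \<ge> 0"
  shows "((\<lambda>t. ek k z (x + t *\<^sub>R w)) has_real_derivative ek' k z (cvec w) (x + t *\<^sub>R w)) (at t)"
proof -
  let ?f = "dker k (- cvec z)"
  have cv: "cvec (x + s *\<^sub>R w) = cvec x + complex_of_real s *s cvec w" for s
    by (simp add: cvec_def vec_eq_iff)
  have "((\<lambda>s. ?f (cvec x + s *s cvec w)) has_field_derivative pd ?f (cvec x + complex_of_real t *s cvec w) (cvec w)) (at (complex_of_real t))"
    by (rule nice_deriv[OF nice_dker[OF k]]) simp
  then have "((\<lambda>s. ?f (cvec x + s *s cvec w)) \<circ> complex_of_real has_vector_derivative pd ?f (cvec x + complex_of_real t *s cvec w) (cvec w)) (at t)"
    using field_vector_diff_chain_at[OF has_vector_derivative_of_real[OF DERIV_ident]] by fastforce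
  from bounded_linear.has_vector_derivative[OF bounded_linear_Re this]
  show ?thesis unfolding ek_def ek'_def cv o_def has_real_derivative_iff_has_vector_derivative .
qed

lemma cvec_axis: "cvec (axis i 1) = axis i (1::complex)"
  by (simp add: vec_eq_iff cvec_def axis_def)

lemma sum_norm_axis: "(\<Sum>i\<in>UNIV. norm ((axis j 1 :: complex^'n) $ i)) = 1"
proof -
  have "(\<Sum>i\<in>UNIV. norm ((axis j 1 :: complex^'n) $ i)) = (\<Sum>i\<in>UNIV. if i = j then 1 else 0)"
    by (rule sum.cong) (auto simp: axis_def)
  then show ?thesis by simp
qed

lemma good_ek':
  fixes z :: "real^'n::{finite,linorder}"
  assumes k: "k \<ge> 0" and z: "z \<in> Rpos" shows "good (ek' k z (axis j 1))"
proof -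
  obtain C \<epsilon> where C: "C \<ge> 0" "\<epsilon> > 0"
    "\<And>x v. x \<in> Rpos \<Longrightarrow> (\<Sum>i\<in>UNIV. norm (v $ i)) \<le> 2 \<Longrightarrow> \<bar>ek' k z v x\<bar> \<le> C * exp (- \<epsilon> * sx x)"
    by (rule ek'_bound[OF k z]) blast
  show ?thesis by (rule goodI[OF ek'_measurable[OF k] C(1,2)]) (rule C(3), simp_all add: sum_norm_axis)
qed

definition DD :: "real \<Rightarrow> real^'n::{finite,linorder} \<Rightarrow> 'n \<Rightarrow> 'n \<Rightarrow> real^'n::{finite,linorder} \<Rightarrow> real" where
  "DD k z j l x = (ek k z x - ek k z (swap_coord j l x)) / (x $ j - x $ l)"

text \<open>On the segment between \<open>x\<close> and its mirror image \<open>sx\<close> is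
  constant, so the derivative bound is uniform there and the mean value inequality transfers it to
  the quotient. Where \<open>x $ j = x $ l\<close> the quotient is \<open>0\<close> by
  convention.\<close>

lemma good_DD:
  fixes z :: "real^'n::{finite,linorder}"
  assumes k: "k \<ge> 0" and z: "z \<in> Rpos" and jl: "j \<noteq> l" shows "good (DD k z j l)"
proof -
  obtain C \<epsilon> where C: "C \<ge> 0" "\<epsilon> > 0"
    "\<And>x v. x \<in> Rpos \<Longrightarrow> (\<Sum>i\<in>UNIV. norm (v $ i)) \<le> 2 \<Longrightarrow> \<bar>ek' k z v x\<bar> \<le> C * exp (- \<epsilon> * sx x)"
    by (rule ek'_bound[OF k z]) blast
  define w :: "real^'n::{finite,linorder}" where "w = axis j 1 - axis l 1"
  have nw: "(\<Sum>i\<in>UNIV. norm (cvec w $ i)) \<le> 2"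
  proof -
    have "(\<Sum>i\<in>UNIV. norm (cvec w $ i)) \<le> (\<Sum>i\<in>UNIV. norm ((axis j 1 :: (complex,'n) vec) $ i) + norm ((axis l 1 :: (complex,'n) vec) $ i))"
      by (rule sum_mono) (auto simp: cvec_def w_def axis_def)
    then show ?thesis by (simp add: sum.distrib sum_norm_axis)
  qed
  show ?thesis
  proof (rule goodI[OF _ C(1,2)])
    show "DD k z j l \<in> borel_measurable borel"
      unfolding DD_def[abs_def] using ek_measurable[OF k, of z] by measurable
    fix x :: "real^'n::{finite,linorder}" assume x: "x \<in> Rpos"
    show "\<bar>DD k z j l x\<bar> \<le> C * exp (- \<epsilon> * sx x)"
    proof (cases "x $ j = x $ l")
      case True
      then show ?thesis using C(1) by (simp add: DD_def)
    next
      case False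
      define u where "u = swap_coord j l x"
      define \<tau> where "\<tau> = x $ j - x $ l"
      have u: "u \<in> Rpos" using x by (simp add: u_def)
      have xu: "x = u + \<tau> *\<^sub>R w"
        using jl by (auto simp: vec_eq_iff u_def \<tau>_def w_def axis_def Transposition.transpose_def)
      have sw: "sx w = 0" using jl by (simp add: sx_def w_def sum_subtractf axis_def)
      have seg: "u + t *\<^sub>R w \<in> Rpos" "sx (u + t *\<^sub>R w) = sx x" if tt: "t \<in> closed_segment 0 \<tau>" for t
      proof -
        obtain s where s: "0 \<le> s" "s \<le> 1" "t = s *\<^sub>R \<tau>" using tt unfolding closed_segment_def by auto
        have eq: "u + t *\<^sub>R w = (1 - s) *\<^sub>R u + s *\<^sub>R x"
          unfolding xu s(3) by (simp add: algebra_simps)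
        have "0 < (u + t *\<^sub>R w) $ i" for i
        proof -
          have "0 < (1 - s) * u $ i + s * x $ i"
            using s Rpos_nth[OF u, of i] Rpos_nth[OF x, of i]
            by (cases "s = 0") (auto intro!: add_nonneg_pos)
          then show ?thesis unfolding eq by simp
        qed
        then show "u + t *\<^sub>R w \<in> Rpos" by (simp add: Rpos_def)
        have "sx (u + t *\<^sub>R w) = sx u + t * sx w" by (simp add: sx_def sum.distrib sum_distrib_left)
        then show "sx (u + t *\<^sub>R w) = sx x" by (simp add: sw u_def)
      qed
      have "norm (ek k z (u + \<tau> *\<^sub>R w) - ek k z (u + 0 *\<^sub>R w)) \<le> (C * exp (- \<epsilon> * sx x)) * norm (\<tau> - 0)"
      proof (rule field_differentiable_bound[where S="closed_segment 0 \<tau>" and f'="\<lambda>t. ek' k z (cvec w) (u + t *\<^sub>R w)"])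
        fix t assume t: "t \<in> closed_segment 0 \<tau>"
        show "((\<lambda>t. ek k z (u + t *\<^sub>R w)) has_real_derivative ek' k z (cvec w) (u + t *\<^sub>R w)) (at t within closed_segment 0 \<tau>)"
          by (rule has_field_derivative_at_within[OF ek_deriv[OF k]])
        show "norm (ek' k z (cvec w) (u + t *\<^sub>R w)) \<le> C * exp (- \<epsilon> * sx x)"
          using C(3)[OF seg(1)[OF t] nw] seg(2)[OF t] by simp
      qed auto
      then have "\<bar>ek k z x - ek k z u\<bar> \<le> (C * exp (- \<epsilon> * sx x)) * \<bar>\<tau>\<bar>" unfolding xu[symmetric] by simp
      moreover have "\<tau> \<noteq> 0" using False by (simp add: \<tau>_def)
      ultimately show ?thesis unfolding DD_def u_def[symmetric] \<tau>_def[symmetric] by (simp add: divide_le_eq)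
    qed
  qed
qed

text \<open>Real part of the eigenvalue equation in direction \<open>axis j 1\<close>: only pairs
  containing \<open>j\<close> survive, each counted twice.\<close>

lemma ek_dunkl_equation:
  fixes z x :: "real^'n::{finite,linorder}"
  assumes k: "k \<ge> 0" and x: "x \<in> Rpos" "regular x"
  shows "ek' k z (axis j 1) x + k * (\<Sum>l\<in>UNIV-{j}. DD k z j l x) = - z $ j * ek k z x"
proof -
  let ?f = "dker k (- cvec z)"
  have rc: "regular (cvec x)" using x(2) by (simp add: regular_def cvec_def)
  define c where "c a b = DD k z a b x" for a b
  have anti: "c a b = - c b a" for a b
    unfolding c_def DD_def swap_coord_commute[of a b] by (metis minus_diff_eq minus_divide_right)
  have v: "?f (cvec y) = complex_of_real (ek k z y)" if "y \<in> Rpos" for y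
    by (rule ek_dker(1)[OF k that])
  have q: "((axis j 1 :: (complex,'n) vec) $ fst a - axis j 1 $ snd a) * ((?f (cvec x) - ?f (swapp a (cvec x))) / (cvec x $ fst a - cvec x $ snd a))
     = complex_of_real (c (fst a) (snd a) * ((if fst a = j then 1 else 0) - (if snd a = j then 1 else 0)))" for a
    using v[OF x(1)] v[of "swapp a x"] x(1) unfolding swap_cvec c_def DD_def by (simp add: axis_def cvec_def)
  have "Tr k (axis j 1) ?f (cvec x) = cdot (- cvec z) (axis j 1) * ?f (cvec x)"
    by (rule Tr_dker[OF k rc])
  also have "cdot (- cvec z) (axis j 1) = complex_of_real (- z $ j)"
    by (simp add: cdot_def cvec_def axis_def if_distrib cong: if_cong)
  finally have "Re (Tr k (axis j 1) ?f (cvec x)) = - z $ j * ek k z x" unfolding v[OF x(1)] by simp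
  moreover have "Re (Tr k (axis j 1) ?f (cvec x)) = ek' k z (axis j 1) x + (k/2) * (\<Sum>a\<in>UNIV. c (fst a) (snd a) * ((if fst a = j then 1 else 0) - (if snd a = j then 1 else 0)))"
    unfolding Tr_def q ek'_def of_real_sum[symmetric] of_real_mult[symmetric] by simp
  moreover have "(\<Sum>a\<in>UNIV. c (fst a) (snd a) * ((if fst a = j then 1 else 0) - (if snd a = j then 1 else 0))) = 2 * (\<Sum>l\<in>UNIV-{j}. c j l)"
  proof -
    have "(\<Sum>a\<in>UNIV. c (fst a) (snd a) * ((if fst a = j then 1 else 0) - (if snd a = j then 1 else 0))) =
       (\<Sum>a\<in>prs UNIV. c (fst a) (snd a) * ((if fst a = j then 1 else 0) - (if snd a = j then 1 else 0)))"
      by (rule sum.mono_neutral_right) (auto simp: prs_def)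
    also have "\<dots> = 2 * (\<Sum>l\<in>UNIV-{j}. c j l)" by (rule sum_prs_split[OF UNIV_I anti])
    finally show ?thesis .
  qed
  ultimately show ?thesis unfolding c_def by simp
qed

text \<open>The unnormalized density; \<open>wS UNIV k 0\<close> stands for the weight, with which
  it agrees at regular points.\<close>

definition Phi :: "real \<Rightarrow> nat \<Rightarrow> real^'n::{finite,linorder} \<Rightarrow> real^'n::{finite,linorder} \<Rightarrow> real" where
  "Phi k \<nu> z x = ek k z x * dprod x ^ \<nu> * wS UNIV k 0 x"

lemma subexp_1: "subexp (\<lambda>x::real^'n. 1::real)"
  by (rule subexp_const)

lemma subexp_power:
  fixes f :: "real^'n \<Rightarrow> real"
  shows "subexp f \<Longrightarrow> subexp (\<lambda>x. f x ^ m)"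
  by (induction m) (simp_all add: subexp_1 subexp_mult)

lemma subexp_dprod: "subexp (dprod :: real^'n \<Rightarrow> real)"
  unfolding dprod_def[abs_def] by (intro subexp_prod subexp_nth) auto

lemma dprod_measurable [measurable]: "dprod \<in> borel_measurable borel"
  unfolding dprod_def[abs_def] by measurable

lemma dprod_swap: "dprod (swap_coord i j x) = dprod x"
  unfolding dprod_def using prod_swap[of i UNIV j "\<lambda>t. t" x] by simp

lemma good_Phi_mult:
  fixes z :: "real^'n::{finite,linorder}"
  assumes k: "k \<ge> 0" and z: "z \<in> Rpos" and h: "subexp h" "h \<in> borel_measurable borel"
  shows "good (\<lambda>x. h x * Phi k \<nu> z x)"
proof -
  have "good (\<lambda>x. ek k z x * (dprod x ^ \<nu> * wS UNIV k 0 x * h x))"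
    using k h by (intro good_mult_subexp[OF good_ek[OF k z]] subexp_mult subexp_power subexp_dprod subexp_wS) auto
  then show ?thesis unfolding Phi_def by (simp add: mult_ac)
qed

lemma rint_swap_ek:
  fixes z :: "real^'n::{finite,linorder}"
  assumes k: "k \<ge> 0" and m: "h \<in> borel_measurable borel" and h: "\<And>x. h (swap_coord i j x) = h x"
  shows "rint (\<lambda>x. ek k z (swap_coord i j x) * h x * dprod x ^ \<nu> * wS UNIV k 0 x) = rint (\<lambda>x. h x * Phi k \<nu> z x)"
proof -
  have "(\<lambda>x. h x * Phi k \<nu> z x) \<in> borel_measurable borel"
    unfolding Phi_def using ek_measurable[OF k, of z] m by measurable
  from rint_swap[OF this, of i j] show ?thesis
    unfolding Phi_def h dprod_swap wS_swap[OF UNIV_I UNIV_I] by (simp add: mult_ac)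
qed

text \<open>Integration by parts with \<open>G = ek k z x * (x_j ^ p * dprod x ^ \<nu>)\<close>. The
  derivative and the divided differences of the kernel combine to \<open>- z_j * ek k z x\<close> by
  the Dunkl equation. What is left of the reflections is the divided difference \<open>h l\<close>
  of the power \<open>p + 1\<close>, multiplied by the kernel at the swapped point; the other
  factors are symmetric, so a change of variables swaps it back.\<close>

lemma moment_identity:
  fixes z :: "real^'n::{finite,linorder}"
  assumes k: "k \<ge> 0" and z: "z \<in> Rpos"
    and hm: "\<And>l. h l \<in> borel_measurable borel" and hs: "\<And>l. subexp (h l)"
    and hsw: "\<And>l x. h l (swap_coord j l x) = h l x"
    and heq: "\<And>l x. h l x * (x $ j - x $ l) = x $ j ^ (p + 1) - x $ l ^ (p + 1)"
  shows "z $ j * rint (\<lambda>x. x $ j ^ (p + 1) * Phi k \<nu> z x)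
    = real (p + 1 + \<nu>) * rint (\<lambda>x. x $ j ^ p * Phi k \<nu> z x) + k * (\<Sum>l\<in>UNIV-{j}. rint (\<lambda>x. h l x * Phi k \<nu> z x))"
proof -
  let ?w = "wS UNIV k 0 :: real^'n::{finite,linorder} \<Rightarrow> real"
  define D where "D x = dprod x ^ \<nu>" for x :: "real^'n::{finite,linorder}"
  have sD: "subexp D" unfolding D_def[abs_def] by (intro subexp_power subexp_dprod)
  have Dm [measurable]: "D \<in> borel_measurable borel" unfolding D_def[abs_def] by measurable
  have Dsw: "D (swap_coord a b x) = D x" for a b x unfolding D_def dprod_swap ..
  note em [measurable] = ek_measurable[OF k, of z]
  note em' [measurable] = ek'_measurable[OF k, of z]
  note hm [measurable]
  define G where "G x = ek k z x * (x $ j ^ p * D x)" for x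
  define G' where "G' x = ek' k z (axis j 1) x * (x $ j ^ p * D x) + ek k z x * (real (p + \<nu>) * (x $ j ^ p * D x) / x $ j)" for x
  \<comment> \<open>Leibniz rule for the divided difference of \<open>x_j * G\<close>: one term
    differences the kernel, the other the power.\<close>
  define Q where "Q l x = DD k z j l x * (x $ j ^ (p + 1) * D x) + ek k z (swap_coord j l x) * (h l x * D x)" for l x
  have ge: "good (ek k z)" by (rule good_ek[OF k z])
  have gG: "good G" unfolding G_def[abs_def]
    by (intro good_mult_subexp ge subexp_mult subexp_power subexp_nth sD) auto
  have g1: "good (\<lambda>x. ek' k z (axis j 1) x * (x $ j ^ (p + 1) * D x))"
    by (intro good_mult_subexp good_ek' k z subexp_mult subexp_power subexp_nth sD) auto
  have xG': "x $ j * G' x = ek' k z (axis j 1) x * (x $ j ^ (p + 1) * D x) + real (p + \<nu>) * G x" if "x \<in> Rpos" for x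
    unfolding G'_def G_def using Rpos_nth[OF that, of j] by (simp add: field_simps)
  have gG': "good (\<lambda>x. x $ j * G' x)"
    by (rule good_mono[OF good_add[OF g1 good_cmult[OF gG, of "real (p + \<nu>)"]]]) (simp_all add: xG', simp add: G'_def)
  have DDm: "DD k z j l \<in> borel_measurable borel" for l unfolding DD_def[abs_def] by measurable
  have gQ: "good (Q l)" if "l \<in> UNIV - {j}" for l
    unfolding Q_def[abs_def]
  proof (rule good_add)
    show "good (\<lambda>x. DD k z j l x * (x $ j ^ (p + 1) * D x))"
      using that by (intro good_mult_subexp good_DD k z subexp_mult subexp_power subexp_nth sD) auto
    show "good (\<lambda>x. ek k z (swap_coord j l x) * (h l x * D x))"
      by (intro good_mult_subexp good_swap[OF ge] subexp_mult hs sD) auto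
  qed
  have "rint (\<lambda>x. (G x + x $ j * G' x + k * (\<Sum>l\<in>UNIV-{j}. Q l x)) * ?w x) = 0"
  proof (rule dunkl_ibp[OF k UNIV_I gG gG' _ gQ])
    fix x :: "real^'n::{finite,linorder}" assume x: "x \<in> Rpos"
    define r where "r = (\<Prod>i\<in>UNIV-{j}. x $ i)"
    have xj: "x $ j > 0" by (rule Rpos_nth[OF x])
    have dp: "dprod (x + t *\<^sub>R axis j 1) = (x $ j + t) * r" for t
    proof -
      have "(\<Prod>i\<in>UNIV-{j}. (x + t *\<^sub>R axis j 1) $ i) = r" unfolding r_def by (rule prod.cong) (auto simp: axis_def)
      then show ?thesis unfolding dprod_def prod.remove[OF finite UNIV_I[of j]] by (simp add: axis_def)
    qed
    have m: "(x + t *\<^sub>R axis j 1) $ j ^ p * D (x + t *\<^sub>R axis j 1) = r ^ \<nu> * (x $ j + t) ^ (p + \<nu>)" for t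
      unfolding D_def dp by (simp add: axis_def power_add power_mult_distrib mult_ac)
    have "((\<lambda>t. r ^ \<nu> * (x $ j + t) ^ (p + \<nu>)) has_real_derivative r ^ \<nu> * (real (p + \<nu>) * (x $ j) ^ (p + \<nu> - 1))) (at 0)"
      by (auto intro!: derivative_eq_intros)
    moreover have "r ^ \<nu> * (real (p + \<nu>) * (x $ j) ^ (p + \<nu> - 1)) = real (p + \<nu>) * (x $ j ^ p * D x) / x $ j"
    proof (cases "p + \<nu> = 0")
      case False
      then obtain q where q: "p + \<nu> = Suc q" using not0_implies_Suc by blast
      have "x $ j ^ (p + \<nu>) = x $ j * x $ j ^ (p + \<nu> - 1)" unfolding q by simp
      then show ?thesis using m[of 0] xj by simp
    qed simp
    ultimately have d: "((\<lambda>t. (x + t *\<^sub>R axis j 1) $ j ^ p * D (x + t *\<^sub>R axis j 1)) has_real_derivative real (p + \<nu>) * (x $ j ^ p * D x) / x $ j) (at 0)"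
      unfolding m by simp
    have e: "((\<lambda>t. ek k z (x + t *\<^sub>R axis j 1)) has_real_derivative ek' k z (axis j 1) x) (at 0)"
      using ek_deriv[OF k, of z x "axis j 1" 0] by (simp add: cvec_axis)
    from DERIV_mult[OF e d]
    show "((\<lambda>t. G (x + t *\<^sub>R axis j 1)) has_real_derivative G' x) (at 0)"
      unfolding G_def G'_def by (simp add: mult_ac)
  next
    fix l and x :: "real^'n::{finite,linorder}" assume l: "l \<in> UNIV - {j}" and x: "x \<in> Rpos" "regular x"
    have ne: "x $ j - x $ l \<noteq> 0" using l x(2) by (auto simp: regular_def)
    have "Q l x * (x $ j - x $ l) = (DD k z j l x * (x $ j - x $ l)) * (x $ j ^ (p + 1) * D x) + ek k z (swap_coord j l x) * ((h l x * (x $ j - x $ l)) * D x)"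
      unfolding Q_def by (simp only: distrib_right distrib_left mult_ac)
    also have "DD k z j l x * (x $ j - x $ l) = ek k z x - ek k z (swap_coord j l x)" unfolding DD_def using ne by simp
    also have "(ek k z x - ek k z (swap_coord j l x)) * (x $ j ^ (p + 1) * D x) + ek k z (swap_coord j l x) * ((h l x * (x $ j - x $ l)) * D x)
      = x $ j * G x - x $ l * G (swap_coord j l x)"
      unfolding heq G_def Dsw by (simp add: algebra_simps)
    finally show "Q l x * (x $ j - x $ l) = x $ j * G x - x $ l * G (swap_coord j l x)" .
  qed
  also have "rint (\<lambda>x. (G x + x $ j * G' x + k * (\<Sum>l\<in>UNIV-{j}. Q l x)) * ?w x) =
    rint (\<lambda>x. (real (p + 1 + \<nu>) * (x $ j ^ p * Phi k \<nu> z x) - z $ j * (x $ j ^ (p + 1) * Phi k \<nu> z x))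
      + k * (\<Sum>l\<in>UNIV-{j}. ek k z (swap_coord j l x) * h l x * dprod x ^ \<nu> * ?w x))"
  proof (rule rint_cong_regular)
    fix x :: "real^'n::{finite,linorder}" assume x: "x \<in> Rpos" "regular x"
    let ?A = "x $ j ^ (p + 1) * D x"
    have "k * (\<Sum>l\<in>UNIV-{j}. Q l x) = (k * (\<Sum>l\<in>UNIV-{j}. DD k z j l x)) * ?A + k * (\<Sum>l\<in>UNIV-{j}. ek k z (swap_coord j l x) * (h l x * D x))"
      unfolding Q_def by (simp add: sum.distrib sum_distrib_right distrib_left mult.assoc)
    also have "k * (\<Sum>l\<in>UNIV-{j}. DD k z j l x) = - z $ j * ek k z x - ek' k z (axis j 1) x"
      using ek_dunkl_equation[OF k x, of z j] by simp
    finally have s: "k * (\<Sum>l\<in>UNIV-{j}. Q l x) = (- z $ j * ek k z x - ek' k z (axis j 1) x) * ?A + k * (\<Sum>l\<in>UNIV-{j}. ek k z (swap_coord j l x) * (h l x * D x))" .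
    have t: "(\<Sum>l\<in>UNIV-{j}. ek k z (swap_coord j l x) * h l x * dprod x ^ \<nu> * ?w x) = (\<Sum>l\<in>UNIV-{j}. ek k z (swap_coord j l x) * (h l x * D x)) * ?w x"
      unfolding D_def sum_distrib_right by (simp add: mult_ac)
    show "(G x + x $ j * G' x + k * (\<Sum>l\<in>UNIV-{j}. Q l x)) * ?w x = (real (p + 1 + \<nu>) * (x $ j ^ p * Phi k \<nu> z x) - z $ j * (x $ j ^ (p + 1) * Phi k \<nu> z x))
      + k * (\<Sum>l\<in>UNIV-{j}. ek k z (swap_coord j l x) * h l x * dprod x ^ \<nu> * ?w x)"
      by (subst t, subst s, subst xG'[OF x(1)]) (simp add: G_def Phi_def D_def[symmetric] algebra_simps)
  next
    show "(\<lambda>x. (G x + x $ j * G' x + k * (\<Sum>l\<in>UNIV-{j}. Q l x)) * ?w x) \<in> borel_measurable borel"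
      unfolding G_def G'_def Q_def using DDm by measurable
    show "(\<lambda>x. (real (p + 1 + \<nu>) * (x $ j ^ p * Phi k \<nu> z x) - z $ j * (x $ j ^ (p + 1) * Phi k \<nu> z x))
      + k * (\<Sum>l\<in>UNIV-{j}. ek k z (swap_coord j l x) * h l x * dprod x ^ \<nu> * ?w x)) \<in> borel_measurable borel"
      unfolding Phi_def by measurable
  qed
  also have "\<dots> = (real (p + 1 + \<nu>) * rint (\<lambda>x. x $ j ^ p * Phi k \<nu> z x) - z $ j * rint (\<lambda>x. x $ j ^ (p + 1) * Phi k \<nu> z x))
      + k * (\<Sum>l\<in>UNIV-{j}. rint (\<lambda>x. h l x * Phi k \<nu> z x))"
  proof -
    have ga: "good (\<lambda>x. x $ j ^ m * Phi k \<nu> z x)" for m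
      by (rule good_Phi_mult[OF k z subexp_power[OF subexp_nth]]) measurable
    have gb: "good (\<lambda>x. ek k z (swap_coord j l x) * h l x * dprod x ^ \<nu> * ?w x)" for l
      using k by (intro good_mult_subexp good_swap[OF ge] hs subexp_power subexp_dprod subexp_wS) auto
    have gs: "good (\<lambda>x. \<Sum>l\<in>UNIV-{j}. ek k z (swap_coord j l x) * h l x * dprod x ^ \<nu> * ?w x)" by (rule good_sum[OF _ gb]) simp
    show ?thesis
      unfolding rint_add[OF good_diff[OF good_cmult[OF ga] good_cmult[OF ga]] good_cmult[OF gs]]
        rint_diff[OF good_cmult[OF ga] good_cmult[OF ga]] rint_cmult rint_sum[OF finite gb] rint_swap_ek[OF k hm hsw] ..
  qed
  finally show ?thesis by simp
qed

text \<open>The case \<open>p = 0\<close>, where \<open>h l = 1\<close>: the other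
  \<open>CARD('n) - 1\<close> coordinates add \<open>k\<close> each, which gives
  \<open>mu0\<close>.\<close>

lemma first_moment:
  fixes z :: "real^'n::{finite,linorder}"
  assumes k: "k \<ge> 0" and z: "z \<in> Rpos"
  shows "z $ j * rint (\<lambda>x. x $ j * Phi k \<nu> z x) = (real \<nu> + mu0 k TYPE('n) + 1) * rint (Phi k \<nu> z)"
proof -
  have "z $ j * rint (\<lambda>x. x $ j ^ (0 + 1) * Phi k \<nu> z x)
    = real (0 + 1 + \<nu>) * rint (\<lambda>x. x $ j ^ 0 * Phi k \<nu> z x) + k * (\<Sum>l\<in>UNIV-{j}. rint (\<lambda>x. 1 * Phi k \<nu> z x))"
    by (rule moment_identity[OF k z]) (auto intro: subexp_1)
  moreover have "real (card (UNIV - {j})) = real CARD('n) - 1"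
    by (simp add: card_Diff_singleton of_nat_diff Suc_leI card_gt_0_iff)
  ultimately show ?thesis by (simp add: mu0_def algebra_simps)
qed

text \<open>The case \<open>p = 1\<close>, where the divided difference of the square is
  \<open>x_j + x_l\<close>.\<close>

lemma second_moment:
  fixes z :: "real^'n::{finite,linorder}"
  assumes k: "k \<ge> 0" and z: "z \<in> Rpos"
  shows "z $ j * rint (\<lambda>x. (x $ j)\<^sup>2 * Phi k \<nu> z x) = (real \<nu> + 2) * rint (\<lambda>x. x $ j * Phi k \<nu> z x)
    + k * (\<Sum>l\<in>UNIV-{j}. rint (\<lambda>x. x $ j * Phi k \<nu> z x) + rint (\<lambda>x. x $ l * Phi k \<nu> z x))"
proof -
  have "z $ j * rint (\<lambda>x. x $ j ^ (1 + 1) * Phi k \<nu> z x)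
    = real (1 + 1 + \<nu>) * rint (\<lambda>x. x $ j ^ 1 * Phi k \<nu> z x) + k * (\<Sum>l\<in>UNIV-{j}. rint (\<lambda>x. (x $ j + x $ l) * Phi k \<nu> z x))"
  proof (rule moment_identity[OF k z])
    show "subexp (\<lambda>x::real^'n::{finite,linorder}. x $ j + x $ l)" for l
    proof (rule subexp_mono[OF subexp_mult[OF subexp_const[of 2] subexp_powr[of 1]]])
      show "norm (x $ j + x $ l) \<le> norm (2 * (1 + sx x) powr 1)" if "x \<in> Rpos" for x :: "real^'n::{finite,linorder}"
        using nth_le_sx[OF that, of j] nth_le_sx[OF that, of l] Rpos_nth[OF that, of j] Rpos_nth[OF that, of l] by simp
    qed simp
    show "(x $ j + x $ l) * (x $ j - x $ l) = x $ j ^ (1 + 1) - x $ l ^ (1 + 1)" for l and x :: "real^'n::{finite,linorder}"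
      by (simp add: algebra_simps power2_eq_square)
  qed auto
  moreover have "rint (\<lambda>x. (x $ j + x $ l) * Phi k \<nu> z x) = rint (\<lambda>x. x $ j * Phi k \<nu> z x) + rint (\<lambda>x. x $ l * Phi k \<nu> z x)" for l
    unfolding distrib_right by (rule rint_add) (auto intro!: good_Phi_mult k z subexp_nth)
  ultimately show ?thesis by (simp add: numeral_2_eq_2 add.commute[of 2])
qed

subsection \<open>Normalization\<close>

lemma weight_wS:
  fixes x :: "real^'n::{finite,linorder}"
  assumes "regular x"
  shows "weight k x = wS UNIV k 0 x"
proof -
  let ?A = "{(i::'n,j). i < j}" and ?B = "{(i::'n,j). j < i}"
  let ?f = "\<lambda>a. ((x $ fst a - x $ snd a)\<^sup>2 + 0) powr (k/2)"
  have f: "?f a = \<bar>x $ fst a - x $ snd a\<bar> powr k" if "fst a \<noteq> snd a" for a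
  proof -
    have "(x $ fst a - x $ snd a)\<^sup>2 + 0 = \<bar>x $ fst a - x $ snd a\<bar> powr 2" using that assms by (simp add: regular_def)
    then show ?thesis by (simp only: powr_powr) simp
  qed
  have "prs (UNIV :: 'n set) = ?A \<union> ?B" by (auto simp: prs_def)
  then have "wS UNIV k 0 x = prod ?f (?A \<union> ?B)" unfolding wS_def by simp
  also have "\<dots> = prod ?f ?A * prod ?f ?B" by (rule prod.union_disjoint) auto
  also have "prod ?f ?B = prod ?f ?A"
    by (rule prod.reindex_bij_witness[where i="\<lambda>(i,j). (j,i)" and j="\<lambda>(i,j). (j,i)"]) (auto simp: power2_commute)
  also have "prod ?f ?A * prod ?f ?A = (\<Prod>a\<in>?A. rpow0 (x $ fst a - x $ snd a) (2 * k))"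
    unfolding prod.distrib[symmetric]
  proof (rule prod.cong[OF refl])
    fix a assume "a \<in> ?A"
    then have ne: "fst a \<noteq> snd a" by auto
    then have "x $ fst a - x $ snd a \<noteq> 0" using assms by (simp add: regular_def)
    then show "?f a * ?f a = rpow0 (x $ fst a - x $ snd a) (2 * k)"
      unfolding f[OF ne] rpow0_def by (simp add: powr_add[symmetric])
  qed
  finally show ?thesis unfolding weight_def by (simp add: case_prod_unfold)
qed

lemma LW_borel:
  assumes "k \<ge> 0" "g \<in> borel_measurable borel"
  shows "LW k g z \<in> borel_measurable borel"
proof -
  have "LW k g z = (\<lambda>x. indicator Rpos x *\<^sub>R (g x * dker k (- z) (cvec x) * complex_of_real (weight k x)))"
    by (simp add: LW_def fun_eq_iff dker_neg_symmetric[OF assms(1), of z])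
  then show ?thesis using assms by simp
qed

lemma LW_real:
  assumes k: "k \<ge> 0" and x: "regular x"
  shows "LW k g (cvec z) x = indicator Rpos x *\<^sub>R (complex_of_real (ek k z x * wS UNIV k 0 x) * g x)"
proof (cases "x \<in> Rpos")
  case True
  then show ?thesis
    by (simp add: LW_def dker_neg_symmetric[OF k, of "cvec x"] ek_dker(1)[OF k True] weight_wS[OF x])
qed (simp add: LW_def)

lemma laplace_real:
  fixes g :: "real^'n::{finite,linorder} \<Rightarrow> real"
  assumes k: "k \<ge> 0" and g [measurable]: "g \<in> borel_measurable borel"
  shows "dunkl_laplace k (\<lambda>x. complex_of_real (g x)) (cvec z) = complex_of_real (rint (\<lambda>x. g x * ek k z x * wS UNIV k 0 x))"
proof -
  note [measurable] = ek_measurable[OF k, of z] LW_borel[OF k]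
  have "dunkl_laplace k (\<lambda>x. complex_of_real (g x)) (cvec z) = (\<integral>x. LW k (\<lambda>x. complex_of_real (g x)) (cvec z) x \<partial>lborel)"
    unfolding dunkl_laplace_LW[OF k] by (rule integral_completion) measurable
  also have "\<dots> = (\<integral>x. complex_of_real (indicator Rpos x * (g x * ek k z x * wS UNIV k 0 x)) \<partial>lborel)"
  proof (rule integral_cong_AE)
    show "AE x in lborel. LW k (\<lambda>x. complex_of_real (g x)) (cvec z) x = complex_of_real (indicator Rpos x * (g x * ek k z x * wS UNIV k 0 x))"
      using AE_regular by eventually_elim (simp add: LW_real[OF k] scaleR_conv_of_real)
  qed measurable
  also have "\<dots> = complex_of_real (rint (\<lambda>x. g x * ek k z x * wS UNIV k 0 x))"
    unfolding rint_def by (rule integral_complex_of_real)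
  finally show ?thesis .
qed

definition FD :: "real \<Rightarrow> nat \<Rightarrow> complex^'n::{finite,linorder} \<Rightarrow> complex" where
  "FD k \<nu> = dunkl_laplace k (\<lambda>x. complex_of_real (dprod x ^ \<nu>))"

lemma FD_assms:
  "set_borel_measurable lebesgue Rpos (\<lambda>x::real^'n. complex_of_real (dprod x ^ \<nu>))"
  "subexp (\<lambda>x::real^'n. complex_of_real (dprod x ^ \<nu>))"
proof -
  show "set_borel_measurable lebesgue Rpos (\<lambda>x::real^'n. complex_of_real (dprod x ^ \<nu>))"
    unfolding set_borel_measurable_def by (rule lebesgue_measurableI) measurable
  show "subexp (\<lambda>x::real^'n. complex_of_real (dprod x ^ \<nu>))"
    by (intro subexp_of_real subexp_power subexp_dprod)
qed

lemma FD_swap: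
  fixes z :: "complex^'n::{finite,linorder}"
  assumes k: "k \<ge> 0"
  shows "FD k \<nu> (swap_coord i j z) = FD k \<nu> z"
proof -
  let ?g = "\<lambda>x::real^'n::{finite,linorder}. complex_of_real (dprod x ^ \<nu>)"
  have gm [measurable]: "?g \<in> borel_measurable borel" by measurable
  note [measurable] = LW_borel[OF k gm]
  have I: "FD k \<nu> y = (\<integral>x. LW k ?g y x \<partial>lborel)" for y
    unfolding FD_def dunkl_laplace_LW[OF k] by (rule integral_completion) measurable
  have "FD k \<nu> (swap_coord i j z) = (\<integral>x. LW k ?g (swap_coord i j z) x \<partial>distr lborel borel (swap_coord i j))"
    unfolding I lborel_swap ..
  also have "\<dots> = (\<integral>x. LW k ?g (swap_coord i j z) (swap_coord i j x) \<partial>lborel)"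
    by (rule integral_distr) measurable
  also have "\<dots> = (\<integral>x. LW k ?g z x \<partial>lborel)"
  proof (rule integral_cong_AE)
    show "AE x in lborel. LW k ?g (swap_coord i j z) (swap_coord i j x) = LW k ?g z x"
      using AE_regular
    proof eventually_elim
      case (elim x)
      have "- cvec (swap_coord i j x) = swap_coord i j (- cvec x)" by (simp add: vec_eq_iff cvec_def)
      then have "dker k (- cvec (swap_coord i j x)) (swap_coord i j z) = dker k (- cvec x) z"
        by (simp only: dker_swap[OF k])
      moreover have "weight k (swap_coord i j x) = weight k x"
        using weight_wS[OF elim, of k] weight_wS[OF regular_swap[OF elim], of k i j] wS_swap[OF UNIV_I UNIV_I, of k 0 i j x] by simp
      ultimately show ?case unfolding LW_def by (simp add: dprod_swap indicator_def)
    qed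
  qed measurable
  finally show ?thesis unfolding I .
qed

text \<open>\<open>FD\<close> is symmetric by \<open>FD_swap\<close>, so its reflection quotients
  vanish and \<open>Tr\<close> reduces to the directional derivative; continuity removes the
  regularity assumption. The derivative is thus a combination of first moments.\<close>

lemma pd_FD:
  fixes z :: "complex^'n::{finite,linorder}"
  assumes k: "k \<ge> 0" and z: "z \<in> Dpos"
  shows "pd (FD k \<nu>) z (cvec \<zeta>) = dunkl_laplace k (\<lambda>x. - complex_of_real (\<zeta> \<bullet> x) * complex_of_real (dprod x ^ \<nu>)) z"
proof (rule continuous_eq_on_regular[OF open_Dpos _ _ _ z])
  have n: "nice Dpos (FD k \<nu> :: complex^'n::{finite,linorder} \<Rightarrow> complex)" unfolding FD_def by (rule laplace_nice[OF k FD_assms])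
  show "continuous_on Dpos (\<lambda>z::complex^'n::{finite,linorder}. pd (FD k \<nu>) z (cvec \<zeta>))" by (rule pd_continuous[OF n open_Dpos])
  have m: "set_borel_measurable lebesgue Rpos (\<lambda>x. - complex_of_real (\<zeta> \<bullet> x) * complex_of_real (dprod x ^ \<nu>))"
    by (rule set_borel_measurable_mult_cont[OF FD_assms(1)]) measurable
  have "subexp (\<lambda>x::real^'n::{finite,linorder}. \<zeta> \<bullet> x)"
  proof (rule subexp_mono[OF subexp_mult[OF subexp_const[of "\<Sum>i\<in>UNIV. \<bar>\<zeta> $ i\<bar>"] subexp_powr[of 1]]])
    fix x :: "real^'n::{finite,linorder}" assume x: "x \<in> Rpos"
    have "\<bar>\<zeta> \<bullet> x\<bar> \<le> (\<Sum>i\<in>UNIV. \<bar>\<zeta> $ i\<bar> * (1 + sx x))"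
      unfolding inner_vec_def
    proof (rule order_trans[OF sum_abs], rule sum_mono)
      fix i
      have "\<bar>x $ i\<bar> \<le> 1 + sx x" using nth_le_sx[OF x, of i] Rpos_nth[OF x, of i] by simp
      then show "\<bar>\<zeta> $ i \<bullet> x $ i\<bar> \<le> \<bar>\<zeta> $ i\<bar> * (1 + sx x)" by (simp add: abs_mult mult_left_mono)
    qed
    then show "norm (\<zeta> \<bullet> x) \<le> norm ((\<Sum>i\<in>UNIV. \<bar>\<zeta> $ i\<bar>) * (1 + sx x) powr 1)"
      using sx_nonneg[OF x] by (simp add: sum_distrib_right abs_mult abs_of_nonneg sum_nonneg)
  qed simp
  then have s: "subexp (\<lambda>x. - complex_of_real (\<zeta> \<bullet> x) * complex_of_real (dprod x ^ \<nu>))"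
    by (intro subexp_mult subexp_uminus subexp_of_real FD_assms(2))
  show "continuous_on Dpos (\<lambda>z. dunkl_laplace k (\<lambda>x. - complex_of_real (\<zeta> \<bullet> x) * complex_of_real (dprod x ^ \<nu>)) z)"
    by (rule nice_continuous[OF laplace_nice[OF k m s]])
  fix z :: "complex^'n::{finite,linorder}" assume z: "z \<in> Dpos" "regular z"
  have "Tr k (cvec \<zeta>) (FD k \<nu>) z = pd (FD k \<nu>) z (cvec \<zeta>)" by (simp add: Tr_def FD_swap[OF k])
  then show "pd (FD k \<nu>) z (cvec \<zeta>) = dunkl_laplace k (\<lambda>x. - complex_of_real (\<zeta> \<bullet> x) * complex_of_real (dprod x ^ \<nu>)) z"
    using Tr_laplace[OF k FD_assms z, of \<zeta> \<nu>] by (simp add: FD_def)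
qed

lemma FD_real:
  assumes k: "k \<ge> 0"
  shows "FD k \<nu> (cvec z) = complex_of_real (rint (Phi k \<nu> z))"
proof -
  have "rint (\<lambda>x. dprod x ^ \<nu> * ek k z x * wS UNIV k 0 x) = rint (Phi k \<nu> z)"
    by (rule arg_cong[of _ _ rint]) (simp add: Phi_def[abs_def] fun_eq_iff mult_ac)
  then show ?thesis unfolding FD_def by (simp only: laplace_real[OF k borel_measurable_power[OF dprod_measurable]])
qed

lemma Phi_ones:
  assumes k: "k \<ge> 0"
  shows "rint (Phi k \<nu> (\<chi> i. 1) :: real^'n::{finite,linorder} \<Rightarrow> real) = cS (UNIV :: 'n set) k (real \<nu>)"
  unfolding cS_def
proof (rule rint_cong_regular)
  fix x :: "real^'n::{finite,linorder}" assume x: "x \<in> Rpos"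
  have "cvec (\<chi> i. 1) = (cvx 1 :: complex^'n::{finite,linorder})" by (simp add: vec_eq_iff cvec_def cvx_def)
  then have "ek k (\<chi> i. 1) x = exp (- sx x)" unfolding ek_def sx_def by (simp only: dker_constant[OF k] Re_complex_of_real)
  moreover have "(\<Prod>i\<in>UNIV. x $ i powr real \<nu>) = dprod x ^ \<nu>"
    unfolding dprod_def prod_power_distrib using Rpos_nth[OF x] by (intro prod.cong refl powr_realpow)
  ultimately show "Phi k \<nu> (\<chi> i. 1) x = eS {} UNIV (real \<nu>) x * wS UNIV k 0 x"
    unfolding Phi_def eS_def by (simp add: mult_ac)
next
  show "Phi k \<nu> (\<chi> i. 1) \<in> borel_measurable borel"
    unfolding Phi_def[abs_def] using ek_measurable[OF k, of "\<chi> i. 1"] by measurable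
qed measurable

text \<open>Along the segment from \<open>(1,\<dots>,1)\<close> to \<open>z\<close> the product with \<open>\<Delta>(z)\<^sup>\<mu>\<close> is constant, by the first moments.\<close>
lemma Phi_total:
  fixes z :: "real^'n::{finite,linorder}" and \<nu> :: nat
  assumes k: "k \<ge> 0" and z: "z \<in> Rpos"
  defines "\<mu> \<equiv> real \<nu> + mu0 k TYPE('n) + 1"
  shows "rint (Phi k \<nu> z) * dprod z powr \<mu> = cS (UNIV :: 'n set) k (real \<nu>)"
proof -
  define \<zeta> where "\<zeta> = z - (\<chi> i. 1)"
  define \<gamma> where "\<gamma> s = (\<chi> i. 1) + s *\<^sub>R \<zeta>" for s
  have \<gamma>_nth: "\<gamma> s $ i = 1 + s * \<zeta> $ i" for s i by (simp add: \<gamma>_def)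
  have \<gamma>R: "\<gamma> s \<in> Rpos" if "0 \<le> s" "s \<le> 1" for s
  proof -
    have "0 < 1 + s * (z $ i - 1)" for i
    proof -
      have "1 + s * (z $ i - 1) = (1 - s) + s * z $ i" by (simp add: algebra_simps)
      moreover have "0 < (1 - s) + s * z $ i"
        using that Rpos_nth[OF z, of i] by (cases "s = 0") (auto intro!: add_nonneg_pos)
      ultimately show ?thesis by simp
    qed
    then show ?thesis by (simp add: Rpos_def \<gamma>_nth \<zeta>_def)
  qed
  have cv: "cvec (\<gamma> s) = cvx 1 + complex_of_real s *s cvec \<zeta>" for s
    by (simp add: vec_eq_iff cvec_def cvx_def \<gamma>_nth)
  have n: "nice Dpos (FD k \<nu> :: complex^'n::{finite,linorder} \<Rightarrow> complex)" unfolding FD_def by (rule laplace_nice[OF k FD_assms])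
  define \<phi> where "\<phi> s = Re (FD k \<nu> (cvec (\<gamma> s)))" for s
  have \<phi>Z: "\<phi> s = rint (Phi k \<nu> (\<gamma> s))" for s unfolding \<phi>_def FD_real[OF k] by simp
  define L where "L s = (\<Sum>j\<in>UNIV. \<zeta> $ j / \<gamma> s $ j)" for s
  have d\<phi>: "(\<phi> has_real_derivative - (\<mu> * L s * \<phi> s)) (at s)" if s: "0 \<le> s" "s \<le> 1" for s
  proof -
    have D: "cvec (\<gamma> s) \<in> Dpos" using \<gamma>R[OF s] by (simp add: Dpos_def Rpos_def cvec_def)
    have "((\<lambda>t. FD k \<nu> (cvx 1 + t *s cvec \<zeta>)) has_field_derivative pd (FD k \<nu>) (cvx 1 + complex_of_real s *s cvec \<zeta>) (cvec \<zeta>)) (at (complex_of_real s))"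
      by (rule nice_deriv[OF n]) (use D in \<open>simp only: cv\<close>)
    then have "((\<lambda>t. FD k \<nu> (cvx 1 + t *s cvec \<zeta>)) \<circ> complex_of_real has_vector_derivative pd (FD k \<nu>) (cvx 1 + complex_of_real s *s cvec \<zeta>) (cvec \<zeta>)) (at s)"
      using field_vector_diff_chain_at[OF has_vector_derivative_of_real[OF DERIV_ident]] by fastforce
    from bounded_linear.has_vector_derivative[OF bounded_linear_Re this]
    have "(\<phi> has_real_derivative Re (pd (FD k \<nu>) (cvec (\<gamma> s)) (cvec \<zeta>))) (at s)"
      unfolding \<phi>_def[abs_def] cv o_def has_real_derivative_iff_has_vector_derivative .
    moreover have "Re (pd (FD k \<nu>) (cvec (\<gamma> s)) (cvec \<zeta>)) = - (\<mu> * L s * \<phi> s)"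
    proof -
      have "pd (FD k \<nu>) (cvec (\<gamma> s)) (cvec \<zeta>) = dunkl_laplace k (\<lambda>x. complex_of_real (- (\<zeta> \<bullet> x) * dprod x ^ \<nu>)) (cvec (\<gamma> s))"
        unfolding pd_FD[OF k D] by simp
      also have "\<dots> = complex_of_real (rint (\<lambda>x. (- (\<zeta> \<bullet> x) * dprod x ^ \<nu>) * ek k (\<gamma> s) x * wS UNIV k 0 x))"
        by (rule laplace_real[OF k]) measurable
      also have "(\<lambda>x. (- (\<zeta> \<bullet> x) * dprod x ^ \<nu>) * ek k (\<gamma> s) x * wS UNIV k 0 x) = (\<lambda>x. \<Sum>j\<in>UNIV. (- \<zeta> $ j) * (x $ j * Phi k \<nu> (\<gamma> s) x))"
        by (rule ext) (simp add: Phi_def inner_vec_def sum_distrib_right sum_distrib_left sum_negf mult_ac)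
      also have "rint \<dots> = (\<Sum>j\<in>UNIV. (- \<zeta> $ j) * rint (\<lambda>x. x $ j * Phi k \<nu> (\<gamma> s) x))"
      proof -
        have g: "good (\<lambda>x. (- \<zeta> $ j) * (x $ j * Phi k \<nu> (\<gamma> s) x))" for j
          by (rule good_cmult[OF good_Phi_mult[OF k \<gamma>R[OF s] subexp_nth]]) measurable
        show ?thesis unfolding rint_sum[OF finite g] rint_cmult ..
      qed
      also have "\<dots> = (\<Sum>j\<in>UNIV. (- \<zeta> $ j) * (\<mu> * \<phi> s / \<gamma> s $ j))"
      proof (rule sum.cong[OF refl])
        fix j
        have "rint (\<lambda>x. x $ j * Phi k \<nu> (\<gamma> s) x) = \<mu> * \<phi> s / \<gamma> s $ j"
          using first_moment[OF k \<gamma>R[OF s], of j \<nu>] Rpos_nth[OF \<gamma>R[OF s], of j] unfolding \<phi>Z \<mu>_def by (simp add: field_simps)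
        then show "(- \<zeta> $ j) * rint (\<lambda>x. x $ j * Phi k \<nu> (\<gamma> s) x) = (- \<zeta> $ j) * (\<mu> * \<phi> s / \<gamma> s $ j)" by simp
      qed
      also have "\<dots> = - (\<mu> * L s * \<phi> s)"
        unfolding L_def by (simp add: sum_distrib_left sum_distrib_right sum_negf mult_ac)
      finally show ?thesis by simp
    qed
    ultimately show ?thesis by simp
  qed
  \<comment> \<open>The exponential is \<open>dprod (\<gamma> s) powr \<mu>\<close>; its logarithmic
    derivative \<open>\<mu> * L s\<close> cancels that of \<phi>.\<close>
  define \<psi> where "\<psi> s = \<phi> s * exp (\<mu> * (\<Sum>j\<in>UNIV. ln (1 + s * \<zeta> $ j)))" for s
  have "(\<psi> has_real_derivative 0) (at s)" if s: "0 \<le> s" "s \<le> 1" for s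
  proof -
    have "((\<lambda>s. ln (1 + s * \<zeta> $ j)) has_real_derivative \<zeta> $ j / \<gamma> s $ j) (at s)" for j
      using Rpos_nth[OF \<gamma>R[OF s], of j] unfolding \<gamma>_nth by (auto intro!: derivative_eq_intros)
    then have "((\<lambda>s. \<Sum>j\<in>UNIV. ln (1 + s * \<zeta> $ j)) has_real_derivative L s) (at s)" unfolding L_def by (rule DERIV_sum)
    from DERIV_mult[OF d\<phi>[OF s] DERIV_fun_exp[OF DERIV_cmult[OF this, of \<mu>]]]
    show ?thesis unfolding \<psi>_def[abs_def] by (simp add: algebra_simps)
  qed
  then have "\<psi> 1 = \<psi> 0" using MVT2[of 0 1 \<psi> "\<lambda>_. 0"] by auto
  moreover have "\<psi> 0 = cS (UNIV :: 'n set) k (real \<nu>)"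
    unfolding \<psi>_def \<phi>Z using Phi_ones[OF k, of \<nu>, where 'n='n] by (simp add: \<gamma>_def)
  moreover have "\<psi> 1 = rint (Phi k \<nu> z) * dprod z powr \<mu>"
  proof -
    have z0: "z $ i \<noteq> 0" for i using Rpos_nth[OF z, of i] by simp
    have "\<gamma> 1 = z" by (simp add: \<gamma>_def \<zeta>_def)
    moreover have "(\<Sum>j\<in>UNIV. ln (1 + 1 * \<zeta> $ j)) = ln (dprod z)"
      unfolding dprod_def using z0 by (subst ln_prod) (simp_all add: \<zeta>_def)
    moreover have "dprod z \<noteq> 0" unfolding dprod_def using z0 by simp
    ultimately show ?thesis unfolding \<psi>_def \<phi>Z by (simp add: powr_def)
  qed
  ultimately show ?thesis by simp
qed

lemma Gamma_n_cS:
  assumes k: "k \<ge> 0"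
  shows "Gamma_n CARD('n::finite) k (real \<nu> + mu0 k TYPE('n) + 1) = cS (UNIV :: 'n set) k (real \<nu>)"
    and "Gamma_n CARD('n::finite) k (real \<nu> + mu0 k TYPE('n) + 1) > 0"
proof -
  let ?n = "CARD('n)"
  \<comment> \<open>\<open>\<nu> + mu0 + 1 - k * (j - 1) = \<nu> + 1 + k * (n - j)\<close>, so
    reversing the order of the factors matches the Selberg product.\<close>
  have "(\<Prod>j=1..?n. Gamma (real \<nu> + mu0 k TYPE('n) + 1 - k * (real j - 1))) = (\<Prod>j<?n. Gamma (real \<nu> + (1 + k * real j)))"
  proof (rule prod.reindex_bij_witness[where i="\<lambda>j. ?n - j" and j="\<lambda>j. ?n - j"])
    fix j assume "j \<in> {1..?n}"
    then have r: "real (?n - j) = real ?n - real j" by (simp add: of_nat_diff)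
    show "Gamma (real \<nu> + (1 + k * real (?n - j))) = Gamma (real \<nu> + mu0 k TYPE('n) + 1 - k * (real j - 1))"
      unfolding r mu0_def by (rule arg_cong[of _ _ Gamma]) (simp add: algebra_simps)
  qed auto
  then have e: "Gamma_n ?n k (real \<nu> + mu0 k TYPE('n) + 1) = d_const ?n k * (\<Prod>j<?n. Gamma (real \<nu> + (1 + k * real j)))"
    unfolding Gamma_n_def by simp
  then show "Gamma_n ?n k (real \<nu> + mu0 k TYPE('n) + 1) = cS (UNIV :: 'n set) k (real \<nu>)"
    using selberg_laguerre[OF k, of "real \<nu>" "UNIV :: 'n set"] by simp
  have "0 < d_const ?n k" unfolding d_const_def using k
    by (intro prod_pos ballI divide_pos_pos Gamma_real_pos add_pos_nonneg) auto
  moreover have "0 < (\<Prod>j<?n. Gamma (real \<nu> + (1 + k * real j)))" using k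
    by (intro prod_pos ballI Gamma_real_pos add_nonneg_pos add_pos_nonneg) auto
  ultimately show "Gamma_n ?n k (real \<nu> + mu0 k TYPE('n) + 1) > 0" unfolding e by simp
qed

subsection \<open>Concentration and the inversion formula\<close>

text \<open>Positivity of the density turns a pointwise bound of \<open>f - c\<close> into a bound
  of the integral. As \<open>f\<close> is only Lebesgue measurable, the comparison takes place over
  \<open>lebesgue\<close>, and the Borel majorant is carried over from
  \<open>lborel\<close>.\<close>

lemma laplace_diff_bound:
  fixes f :: "real^'n::{finite,linorder} \<Rightarrow> complex"
  assumes k: "k \<ge> 0" and z: "z \<in> Rpos"
    and f: "set_borel_measurable lebesgue Rpos f" "subexp f"
    and h: "subexp h" "h \<in> borel_measurable borel"
    and le: "\<And>x. x \<in> Rpos \<Longrightarrow> norm (f x - c) \<le> h x"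
  shows "norm (dunkl_laplace k (\<lambda>x. complex_of_real (dprod x ^ \<nu>) * f x) (cvec z) - c * FD k \<nu> (cvec z)) \<le> rint (\<lambda>x. h x * Phi k \<nu> z x)"
proof -
  let ?D = "\<lambda>x::real^'n::{finite,linorder}. complex_of_real (dprod x ^ \<nu>)"
  have zD: "cvec z \<in> Dpos" using z by (simp add: Dpos_def Rpos_def cvec_def)
  have m1: "set_borel_measurable lebesgue Rpos (\<lambda>x. ?D x * f x)"
    by (rule set_borel_measurable_mult_cont[OF f(1)]) measurable
  have s1: "subexp (\<lambda>x. ?D x * f x)" by (rule subexp_mult[OF FD_assms(2) f(2)])
  have I1: "integrable lebesgue (LW k (\<lambda>x. ?D x * f x) (cvec z))" by (rule LW_integrable[OF k m1 s1 zD])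
  have I2: "integrable lebesgue (LW k ?D (cvec z))" by (rule LW_integrable[OF k FD_assms zD])
  have gh: "good (\<lambda>x. h x * Phi k \<nu> z x)" by (rule good_Phi_mult[OF k z h])
  have I3: "integrable lborel (\<lambda>x. indicator Rpos x * (h x * Phi k \<nu> z x))" by (rule good_integrable[OF gh])
  have m3: "(\<lambda>x. indicator Rpos x * (h x * Phi k \<nu> z x)) \<in> borel_measurable lborel" using I3 by (rule borel_measurable_integrable)
  have I3': "integrable lebesgue (\<lambda>x. indicator Rpos x * (h x * Phi k \<nu> z x))"
    using I3 by (simp only: integrable_completion[OF m3])
  have "dunkl_laplace k (\<lambda>x. ?D x * f x) (cvec z) - c * FD k \<nu> (cvec z)
     = (\<integral>x. LW k (\<lambda>x. ?D x * f x) (cvec z) x - c * LW k ?D (cvec z) x \<partial>lebesgue)"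
    unfolding FD_def dunkl_laplace_LW[OF k] using I1 I2 by simp
  also have "norm \<dots> \<le> (\<integral>x. norm (LW k (\<lambda>x. ?D x * f x) (cvec z) x - c * LW k ?D (cvec z) x) \<partial>lebesgue)"
    by (rule integral_norm_bound)
  also have "\<dots> \<le> (\<integral>x. indicator Rpos x * (h x * Phi k \<nu> z x) \<partial>lebesgue)"
  proof (rule integral_mono_AE)
    show "integrable lebesgue (\<lambda>x. norm (LW k (\<lambda>x. ?D x * f x) (cvec z) x - c * LW k ?D (cvec z) x))" using I1 I2 by simp
    show "integrable lebesgue (\<lambda>x. indicator Rpos x * (h x * Phi k \<nu> z x))" by (rule I3')
    have "AE x in lebesgue. regular (x :: real^'n::{finite,linorder})" by (rule AE_completion[OF AE_regular])
    then show "AE x in lebesgue. norm (LW k (\<lambda>x. ?D x * f x) (cvec z) x - c * LW k ?D (cvec z) x) \<le> indicator Rpos x * (h x * Phi k \<nu> z x)"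
    proof eventually_elim
      case (elim x)
      show ?case
      proof (cases "x \<in> Rpos")
        case True
        have D0: "0 \<le> dprod x" unfolding dprod_def using Rpos_nth[OF True] by (intro prod_nonneg) (auto intro: less_imp_le)
        have P: "Phi k \<nu> z x \<ge> 0" unfolding Phi_def
          using ek_dker(2)[OF k True, of z] D0 wS_nonneg[of UNIV k 0 x] by (intro mult_nonneg_nonneg) auto
        have "LW k (\<lambda>x. ?D x * f x) (cvec z) x - c * LW k ?D (cvec z) x = complex_of_real (Phi k \<nu> z x) * (f x - c)"
          unfolding LW_real[OF k elim] Phi_def using True by (simp add: algebra_simps)
        then have "norm (LW k (\<lambda>x. ?D x * f x) (cvec z) x - c * LW k ?D (cvec z) x) = Phi k \<nu> z x * norm (f x - c)"
          using P by (simp add: norm_mult)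
        also have "\<dots> \<le> Phi k \<nu> z x * h x" by (rule mult_left_mono[OF le[OF True] P])
        finally show ?thesis using True by (simp add: mult.commute)
      qed (simp add: LW_def)
    qed
  qed
  also have "\<dots> = rint (\<lambda>x. h x * Phi k \<nu> z x)"
    unfolding rint_def by (rule integral_completion[OF m3])
  finally show ?thesis .
qed

theorem theorem7p1:
  fixes k :: real and f :: "real^('n::{finite,linorder}) \<Rightarrow> complex" and \<xi> :: "real^('n::{finite,linorder})"
  assumes "k \<ge> 0"
    and "set_borel_measurable lebesgue Rpos f"
    and "bounded (f ` Rpos)"
    and "\<xi> \<in> Rpos"
    and "continuous (at \<xi> within Rpos) f"
  shows "(\<lambda>\<nu>::nat.
      complex_of_real ((-1) ^ (CARD('n::{finite,linorder}) * \<nu>)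
        / Gamma_n CARD('n::{finite,linorder}) k (real \<nu> + mu0 k TYPE('n::{finite,linorder}) + 1)
        * dprod (\<chi> i. real \<nu> / \<xi> $ i) powr (real \<nu> + mu0 k TYPE('n::{finite,linorder}) + 1))
      * ((dunkl_Delta k ^^ \<nu>) (dunkl_laplace k f) (cvec (\<chi> i. real \<nu> / \<xi> $ i))))
    \<longlonglongrightarrow> f \<xi>"
proof -
  note k = assms(1) and fm = assms(2) and \<xi> = assms(4)
  have \<xi>i: "\<xi> $ i > 0" for i by (rule Rpos_nth[OF \<xi>])
  obtain M where M: "\<And>x. x \<in> Rpos \<Longrightarrow> norm (f x) \<le> M" using assms(3) unfolding bounded_iff by auto
  have M0: "M \<ge> 0" using M[OF \<xi>] norm_ge_zero order_trans by blast
  have fs: "subexp f" by (rule subexp_bounded[OF M])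
  let ?n = "CARD('n)"
  define \<mu> where "\<mu> \<nu> = real \<nu> + mu0 k TYPE('n) + 1" for \<nu>
  define z where "z \<nu> = (\<chi> i. real \<nu> / \<xi> $ i)" for \<nu>
  \<comment> \<open>Normalizes the density at \<open>z \<nu>\<close> to total mass one; the
    remaining sign in \<open>A\<close> cancels the one produced by
    \<open>dunkl_Delta\<close>.\<close>
  define c where "c \<nu> = dprod (z \<nu>) powr \<mu> \<nu> / Gamma_n ?n k (\<mu> \<nu>)" for \<nu>
  define A where "A \<nu> = complex_of_real ((-1) ^ (?n * \<nu>) / Gamma_n ?n k (\<mu> \<nu>) * dprod (z \<nu>) powr \<mu> \<nu>)
      * ((dunkl_Delta k ^^ \<nu>) (dunkl_laplace k f) (cvec (z \<nu>)))" for \<nu>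
  define \<rho> where "\<rho> \<nu> = \<mu> \<nu> / real \<nu>" for \<nu>
  \<comment> \<open>The mean squared distance from \<xi> under the normalized density, expanded into
    moments; the mean itself is \<open>\<rho> \<nu>\<close> times \<xi>.\<close>
  define V where "V \<nu> = (\<Sum>j\<in>UNIV. (\<xi> $ j / real \<nu>) * ((real \<nu> + 2) * (\<rho> \<nu> * \<xi> $ j) + k * (\<Sum>l\<in>UNIV-{j}. \<rho> \<nu> * \<xi> $ j + \<rho> \<nu> * \<xi> $ l))
      - 2 * \<xi> $ j * (\<rho> \<nu> * \<xi> $ j) + (\<xi> $ j)\<^sup>2)" for \<nu>
  have zR: "z \<nu> \<in> Rpos" if "\<nu> > 0" for \<nu> using that \<xi>i by (simp add: Rpos_def z_def)
  have norm1: "c \<nu> * rint (Phi k \<nu> (z \<nu>)) = 1" and c0: "c \<nu> \<ge> 0" if "\<nu> > 0" for \<nu>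
  proof -
    have G: "Gamma_n ?n k (\<mu> \<nu>) > 0" unfolding \<mu>_def by (rule Gamma_n_cS(2)[OF k])
    have "rint (Phi k \<nu> (z \<nu>)) * dprod (z \<nu>) powr \<mu> \<nu> = Gamma_n ?n k (\<mu> \<nu>)"
      unfolding \<mu>_def Gamma_n_cS(1)[OF k] by (rule Phi_total[OF k zR[OF that]])
    then show "c \<nu> * rint (Phi k \<nu> (z \<nu>)) = 1" unfolding c_def using G by (simp add: mult.commute)
    show "c \<nu> \<ge> 0" unfolding c_def using G by simp
  qed
  have m1: "c \<nu> * rint (\<lambda>x. x $ j * Phi k \<nu> (z \<nu>) x) = \<rho> \<nu> * \<xi> $ j" if "\<nu> > 0" for \<nu> j
  proof -
    have "(real \<nu> / \<xi> $ j) * (c \<nu> * rint (\<lambda>x. x $ j * Phi k \<nu> (z \<nu>) x)) = \<mu> \<nu> * (c \<nu> * rint (Phi k \<nu> (z \<nu>)))"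
      using first_moment[OF k zR[OF that], of j \<nu>] by (simp add: z_def \<mu>_def mult_ac)
    then show ?thesis unfolding norm1[OF that] \<rho>_def using that \<xi>i[of j] by (simp add: field_simps)
  qed
  have m2: "c \<nu> * rint (\<lambda>x. (x $ j)\<^sup>2 * Phi k \<nu> (z \<nu>) x)
      = (\<xi> $ j / real \<nu>) * ((real \<nu> + 2) * (\<rho> \<nu> * \<xi> $ j) + k * (\<Sum>l\<in>UNIV-{j}. \<rho> \<nu> * \<xi> $ j + \<rho> \<nu> * \<xi> $ l))" if "\<nu> > 0" for \<nu> j
  proof -
    have "(real \<nu> / \<xi> $ j) * (c \<nu> * rint (\<lambda>x. (x $ j)\<^sup>2 * Phi k \<nu> (z \<nu>) x)) =
      c \<nu> * (z \<nu> $ j * rint (\<lambda>x. (x $ j)\<^sup>2 * Phi k \<nu> (z \<nu>) x))" by (simp add: z_def mult_ac)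
    also have "\<dots> = (real \<nu> + 2) * (c \<nu> * rint (\<lambda>x. x $ j * Phi k \<nu> (z \<nu>) x))
      + k * (\<Sum>l\<in>UNIV-{j}. c \<nu> * rint (\<lambda>x. x $ j * Phi k \<nu> (z \<nu>) x) + c \<nu> * rint (\<lambda>x. x $ l * Phi k \<nu> (z \<nu>) x))"
      unfolding second_moment[OF k zR[OF that]] by (simp only: distrib_left sum_distrib_left mult.left_commute)
    finally have "(real \<nu> / \<xi> $ j) * (c \<nu> * rint (\<lambda>x. (x $ j)\<^sup>2 * Phi k \<nu> (z \<nu>) x)) =
      (real \<nu> + 2) * (\<rho> \<nu> * \<xi> $ j) + k * (\<Sum>l\<in>UNIV-{j}. \<rho> \<nu> * \<xi> $ j + \<rho> \<nu> * \<xi> $ l)"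
      unfolding m1[OF that] .
    moreover have "a = (\<xi> $ j / real \<nu>) * b" if "(real \<nu> / \<xi> $ j) * a = b" for a b
      using that \<open>\<nu> > 0\<close> \<xi>i[of j] by (auto simp: field_simps)
    ultimately show ?thesis by blast
  qed
  have inv: "(\<lambda>\<nu>. 1 / real \<nu>) \<longlonglongrightarrow> 0" by (rule lim_1_over_n)
  have \<rho>1: "\<rho> \<longlonglongrightarrow> 1"
    using tendsto_shift_ratio[of "mu0 k TYPE('n) + 1" 0] by (simp add: \<rho>_def[abs_def] \<mu>_def add.assoc)
  have r2: "(\<lambda>\<nu>. (real \<nu> + 2) / real \<nu>) \<longlonglongrightarrow> 1" using tendsto_shift_ratio[of 2 0] by simp
  \<comment> \<open>As \<rho> tends to \<open>1\<close>, the main part of each summand tends to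
    \<open>(1 - 2 + 1) * (\<xi> $ j)\<^sup>2\<close>, and the reflection terms carry a factor
    \<open>1 / \<nu>\<close>.\<close>
  have V0: "V \<longlonglongrightarrow> 0"
  proof -
    have eq: "(\<xi> $ j / real \<nu>) * ((real \<nu> + 2) * (\<rho> \<nu> * \<xi> $ j) + k * (\<Sum>l\<in>UNIV-{j}. \<rho> \<nu> * \<xi> $ j + \<rho> \<nu> * \<xi> $ l)) - 2 * \<xi> $ j * (\<rho> \<nu> * \<xi> $ j) + (\<xi> $ j)\<^sup>2
      = (((real \<nu> + 2) / real \<nu>) * \<rho> \<nu> * (\<xi> $ j)\<^sup>2 + (1 / real \<nu>) * (\<xi> $ j * k * (\<Sum>l\<in>UNIV-{j}. \<rho> \<nu> * \<xi> $ j + \<rho> \<nu> * \<xi> $ l)))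
        - 2 * \<rho> \<nu> * (\<xi> $ j)\<^sup>2 + (\<xi> $ j)\<^sup>2" for j \<nu>
      by (simp add: distrib_left power2_eq_square mult_ac add_divide_distrib)
    have "V \<longlonglongrightarrow> (\<Sum>j\<in>UNIV. (1 * 1 * (\<xi> $ j)\<^sup>2 + 0 * (\<xi> $ j * k * (\<Sum>l\<in>UNIV-{j}. 1 * \<xi> $ j + 1 * \<xi> $ l))) - 2 * 1 * (\<xi> $ j)\<^sup>2 + (\<xi> $ j)\<^sup>2)"
      unfolding V_def[abs_def] eq by (intro tendsto_intros \<rho>1 r2 inv)
    then show ?thesis by simp
  qed
  \<comment> \<open>A majorant consisting of a constant and a multiple of the squared distance
    integrates to exactly the total mass and \<open>V\<close>.\<close>
  have key: "norm (A \<nu> - f \<xi>) \<le> \<eta> + C * V \<nu>"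
    if \<nu>: "\<nu> > 0" and \<eta>: "\<eta> \<ge> 0" and C: "C \<ge> 0"
      and le: "\<And>x. x \<in> Rpos \<Longrightarrow> norm (f x - f \<xi>) \<le> \<eta> + C * (\<Sum>j\<in>UNIV. (x $ j - \<xi> $ j)\<^sup>2)" for \<nu> \<eta> C
  proof -
    let ?D = "\<lambda>x::real^'n::{finite,linorder}. complex_of_real (dprod x ^ \<nu>)"
    let ?P = "Phi k \<nu> (z \<nu>)"
    define h where "h x = \<eta> + C * (\<Sum>j\<in>UNIV. (x $ j - \<xi> $ j)\<^sup>2)" for x :: "real^'n::{finite,linorder}"
    have zD: "cvec (z \<nu>) \<in> Dpos" using zR[OF \<nu>] by (simp add: Dpos_def Rpos_def cvec_def)
    have "(dunkl_Delta k ^^ \<nu>) (dunkl_laplace k f) (cvec (z \<nu>)) =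
      dunkl_laplace k (\<lambda>x. ((-1) ^ ?n * complex_of_real (dprod x)) ^ \<nu> * f x) (cvec (z \<nu>))"
      using dunkl_Delta_power_laplace[OF k fm fs, of \<nu>] zD by simp
    also have "\<dots> = (-1) ^ (?n * \<nu>) * dunkl_laplace k (\<lambda>x. ?D x * f x) (cvec (z \<nu>))"
    proof -
      have "LW k (\<lambda>x. ((-1) ^ ?n * complex_of_real (dprod x)) ^ \<nu> * f x) (cvec (z \<nu>)) x = (-1) ^ (?n * \<nu>) * LW k (\<lambda>x. ?D x * f x) (cvec (z \<nu>)) x" for x
        unfolding power_mult by (simp add: LW_def power_mult_distrib mult_ac)
      then have "LW k (\<lambda>x. ((-1) ^ ?n * complex_of_real (dprod x)) ^ \<nu> * f x) (cvec (z \<nu>)) = (\<lambda>x. (-1) ^ (?n * \<nu>) * LW k (\<lambda>x. ?D x * f x) (cvec (z \<nu>)) x)"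
        by (rule ext)
      then show ?thesis unfolding dunkl_laplace_LW[OF k] by (simp only: integral_mult_right_zero)
    qed
    finally have "A \<nu> = complex_of_real ((-1) ^ (?n * \<nu>) * (-1) ^ (?n * \<nu>) * c \<nu>) * dunkl_laplace k (\<lambda>x. ?D x * f x) (cvec (z \<nu>))"
      unfolding A_def c_def by (simp add: mult_ac)
    then have A: "A \<nu> = complex_of_real (c \<nu>) * dunkl_laplace k (\<lambda>x. ?D x * f x) (cvec (z \<nu>))"
      by (simp add: power_add[symmetric])
    have "f \<xi> = complex_of_real (c \<nu>) * (f \<xi> * FD k \<nu> (cvec (z \<nu>)))"
      unfolding FD_real[OF k] using norm1[OF \<nu>] by (metis mult.left_commute mult.right_neutral of_real_1 of_real_mult)
    then have "A \<nu> - f \<xi> = complex_of_real (c \<nu>) * (dunkl_laplace k (\<lambda>x. ?D x * f x) (cvec (z \<nu>)) - f \<xi> * FD k \<nu> (cvec (z \<nu>)))"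
      unfolding A right_diff_distrib by simp
    then have "norm (A \<nu> - f \<xi>) = c \<nu> * norm (dunkl_laplace k (\<lambda>x. ?D x * f x) (cvec (z \<nu>)) - f \<xi> * FD k \<nu> (cvec (z \<nu>)))"
      using c0[OF \<nu>] by (simp add: norm_mult)
    also have "\<dots> \<le> c \<nu> * rint (\<lambda>x. h x * ?P x)"
    proof (rule mult_left_mono[OF laplace_diff_bound[OF k zR[OF \<nu>] fm fs] c0[OF \<nu>]])
      show "norm (f x - f \<xi>) \<le> h x" if "x \<in> Rpos" for x using le[OF that] by (simp add: h_def)
      show "h \<in> borel_measurable borel" unfolding h_def[abs_def] by measurable
      show "subexp h"
      proof (rule subexp_mono[OF subexp_mult[OF subexp_const[of "\<eta> + C * (\<Sum>j\<in>(UNIV::'n set). (1 + \<bar>\<xi> $ j\<bar>)\<^sup>2)"] subexp_powr[of 2]]])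
        fix x :: "real^'n::{finite,linorder}" assume x: "x \<in> Rpos"
        have s: "0 \<le> sx x" by (rule sx_nonneg[OF x])
        have "(x $ j - \<xi> $ j)\<^sup>2 \<le> (1 + \<bar>\<xi> $ j\<bar>)\<^sup>2 * (1 + sx x)\<^sup>2" for j
        proof -
          have "\<bar>x $ j - \<xi> $ j\<bar> \<le> sx x + \<bar>\<xi> $ j\<bar>" using nth_le_sx[OF x, of j] Rpos_nth[OF x, of j] by linarith
          also have "\<dots> \<le> (1 + \<bar>\<xi> $ j\<bar>) * (1 + sx x)" using s by (simp add: algebra_simps)
          finally have "\<bar>x $ j - \<xi> $ j\<bar>\<^sup>2 \<le> ((1 + \<bar>\<xi> $ j\<bar>) * (1 + sx x))\<^sup>2" by (rule power_mono) simp
          then show ?thesis by (simp only: power2_abs power_mult_distrib)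
        qed
        then have "(\<Sum>j\<in>UNIV. (x $ j - \<xi> $ j)\<^sup>2) \<le> (\<Sum>j\<in>UNIV. (1 + \<bar>\<xi> $ j\<bar>)\<^sup>2) * (1 + sx x)\<^sup>2"
          unfolding sum_distrib_right by (rule sum_mono)
        then have "C * (\<Sum>j\<in>UNIV. (x $ j - \<xi> $ j)\<^sup>2) \<le> C * ((\<Sum>j\<in>UNIV. (1 + \<bar>\<xi> $ j\<bar>)\<^sup>2) * (1 + sx x)\<^sup>2)"
          by (rule mult_left_mono[OF _ C])
        moreover have "\<eta> * 1 \<le> \<eta> * (1 + sx x)\<^sup>2" using s by (intro mult_left_mono[OF _ \<eta>]) simp
        ultimately have "h x \<le> (\<eta> + C * (\<Sum>j\<in>UNIV. (1 + \<bar>\<xi> $ j\<bar>)\<^sup>2)) * (1 + sx x)\<^sup>2"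
          unfolding h_def by (simp add: distrib_right)
        moreover have "0 \<le> h x" unfolding h_def using \<eta> C by (intro add_nonneg_nonneg mult_nonneg_nonneg sum_nonneg) auto
        moreover have "(1 + sx x) powr 2 = (1 + sx x)\<^sup>2" using s by simp
        ultimately show "norm (h x) \<le> norm ((\<eta> + C * (\<Sum>j\<in>UNIV. (1 + \<bar>\<xi> $ j\<bar>)\<^sup>2)) * (1 + sx x) powr 2)"
          by (simp only: real_norm_def abs_of_nonneg)
      qed simp
    qed
    also have "(\<lambda>x. h x * ?P x) = (\<lambda>x. \<eta> * ?P x + C * (\<Sum>j\<in>UNIV. ((x $ j)\<^sup>2 * ?P x - (2 * \<xi> $ j) * (x $ j * ?P x)) + (\<xi> $ j)\<^sup>2 * ?P x))"
    proof (rule ext)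
      fix x
      have "(a - b)\<^sup>2 * p = (a\<^sup>2 * p - (2 * b) * (a * p)) + b\<^sup>2 * p" for a b p :: real by (simp add: power2_eq_square algebra_simps)
      then show "h x * ?P x = \<eta> * ?P x + C * (\<Sum>j\<in>UNIV. ((x $ j)\<^sup>2 * ?P x - (2 * \<xi> $ j) * (x $ j * ?P x)) + (\<xi> $ j)\<^sup>2 * ?P x)"
        unfolding h_def by (simp only: distrib_right mult.assoc[of C] sum_distrib_right)
    qed
    also have "c \<nu> * rint \<dots> = \<eta> * (c \<nu> * rint ?P) + C * (\<Sum>j\<in>UNIV. (c \<nu> * rint (\<lambda>x. (x $ j)\<^sup>2 * ?P x) - (2 * \<xi> $ j) * (c \<nu> * rint (\<lambda>x. x $ j * ?P x))) + (\<xi> $ j)\<^sup>2 * (c \<nu> * rint ?P))"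
    proof -
      have gP: "good ?P" using good_Phi_mult[OF k zR[OF \<nu>] subexp_1, of \<nu>] by simp
      have g1: "good (\<lambda>x. x $ j * ?P x)" for j by (rule good_Phi_mult[OF k zR[OF \<nu>] subexp_nth]) measurable
      have g2: "good (\<lambda>x. (x $ j)\<^sup>2 * ?P x)" for j by (rule good_Phi_mult[OF k zR[OF \<nu>] subexp_power[OF subexp_nth]]) measurable
      note gd = good_diff[OF g2 good_cmult[OF g1]]
      note ga = good_add[OF gd good_cmult[OF gP]]
      show ?thesis
        unfolding rint_add[OF good_cmult[OF gP] good_cmult[OF good_sum[OF finite ga]]] rint_cmult rint_sum[OF finite ga]
          rint_add[OF gd good_cmult[OF gP]] rint_diff[OF g2 good_cmult[OF g1]]
        by (simp only: distrib_left right_diff_distrib sum_distrib_left mult.left_commute[of "c \<nu>"])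
    qed
    also have "\<dots> = \<eta> + C * V \<nu>" unfolding norm1[OF \<nu>] m1[OF \<nu>] m2[OF \<nu>] V_def by simp
    finally show ?thesis .
  qed
  have "A \<longlonglongrightarrow> f \<xi>"
  proof (rule LIMSEQ_I)
    fix e :: real assume e: "e > 0"
    obtain \<delta> where \<delta>: "\<delta> > 0" "\<And>x. x \<in> Rpos \<Longrightarrow> dist x \<xi> < \<delta> \<Longrightarrow> dist (f x) (f \<xi>) < e / 2"
      using assms(5) e unfolding continuous_within_eps_delta by (meson half_gt_zero)
    \<comment> \<open>Chebyshev's argument: at distance at least \<delta> from \<xi> the crude bound
      \<open>2 * M\<close> is at most \<open>C\<close> times the squared distance.\<close>
    define C where "C = 2 * M / \<delta>\<^sup>2"
    have C: "C \<ge> 0" using M0 \<delta> by (simp add: C_def)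
    have le: "norm (f x - f \<xi>) \<le> e / 2 + C * (\<Sum>j\<in>UNIV. (x $ j - \<xi> $ j)\<^sup>2)" if x: "x \<in> Rpos" for x
    proof -
      have S: "(\<Sum>j\<in>UNIV. (x $ j - \<xi> $ j)\<^sup>2) = (dist x \<xi>)\<^sup>2"
        unfolding dist_norm power2_norm_eq_inner inner_vec_def by (simp add: power2_eq_square)
      show ?thesis
      proof (cases "dist x \<xi> < \<delta>")
        case True
        have "0 \<le> C * (dist x \<xi>)\<^sup>2" using C by simp
        then show ?thesis using \<delta>(2)[OF x True] unfolding S dist_norm by linarith
      next
        case False
        then have "\<delta>\<^sup>2 \<le> (dist x \<xi>)\<^sup>2" using \<delta>(1) by (intro power_mono) auto
        then have "C * \<delta>\<^sup>2 \<le> C * (dist x \<xi>)\<^sup>2" by (rule mult_left_mono[OF _ C])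
        moreover have "C * \<delta>\<^sup>2 = 2 * M" using \<delta>(1) by (simp add: C_def)
        moreover have "norm (f x - f \<xi>) \<le> 2 * M" using norm_triangle_ineq4[of "f x" "f \<xi>"] M[OF x] M[OF \<xi>] by linarith
        ultimately show ?thesis unfolding S using e by linarith
      qed
    qed
    have "(\<lambda>\<nu>. C * V \<nu>) \<longlonglongrightarrow> C * 0" by (intro tendsto_intros V0)
    then have "\<forall>\<^sub>F \<nu> in sequentially. C * V \<nu> < e / 2" using e by (intro order_tendstoD(2)) auto
    then obtain N where N: "\<And>\<nu>. \<nu> \<ge> N \<Longrightarrow> C * V \<nu> < e / 2" by (auto simp: eventually_sequentially)
    show "\<exists>no. \<forall>\<nu>\<ge>no. norm (A \<nu> - f \<xi>) < e"
    \<comment> \<open>The index \<open>\<nu> = 0\<close> is excluded because \<open>z 0\<close> is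
      the zero vector, outside \<open>Rpos\<close>.\<close>
    proof (intro exI[of _ "max N 1"] allI impI)
      fix \<nu> assume "max N 1 \<le> \<nu>"
      then have "\<nu> > 0" "\<nu> \<ge> N" by auto
      then show "norm (A \<nu> - f \<xi>) < e" using key[OF \<open>\<nu> > 0\<close> _ C le] N[OF \<open>\<nu> \<ge> N\<close>] e by simp
    qed
  qed
  then show ?thesis unfolding A_def[abs_def] z_def \<mu>_def .
qed

end
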